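(* Let $k$ be a field of characteristic different from $2$, $d\in k$, and let $C\subset\mathbb{P}^3$ be the curve $X_0^2-dX_2^2=X_1X_3$, $X_1^2-X_3^2=4X_0X_2$, assumed nonsingular, regarded as an elliptic curve with identity $(1:1:0:1)$. Writing $(X_0:\dots:X_3)$, $(Y_0:\dots:Y_3)$ for the coordinates of the two summands, the space of addition laws of bidegree $(2,2)$ on $C$ is spanned by $$\begin{aligned}\mathfrak{s}_0=(&-(X_1^2Y_3^2-X_3^2Y_1^2)/4,\ X_0X_3Y_1Y_2-X_1X_2Y_0Y_3,\ X_0^2Y_2^2-X_2^2Y_0^2,\ X_0X_1Y_2Y_3-X_2X_3Y_0Y_1),\\ \mathfrak{s}_1=(&X_0X_1Y_0Y_3+dX_2X_3Y_1Y_2,\ 4dX_0X_2Y_2^2+X_1^2Y_1Y_3,\ X_0X_3Y_2Y_3+X_1X_2Y_0Y_1,\ X_1X_3Y_3^2-4dX_2^2Y_0Y_2),\\ \mathfrak{s}_2=(&X_0^2Y_0^2-d^2X_2^2Y_2^2,\ X_0X_1Y_0Y_1-dX_2X_3Y_2Y_3,\ (X_1^2Y_1^2-X_3^2Y_3^2)/4,\ X_0X_3Y_0Y_3-dX_1X_2Y_1Y_2),\\ \mathfrak{s}_3=(&X_0X_3Y_0Y_1+dX_1X_2Y_2Y_3,\ X_1X_3Y_1^2+4dX_2^2Y_0Y_2,\ X_0X_1Y_1Y_2+X_2X_3Y_0Y_3,\ -4dX_0X_2Y_2^2+X_3^2Y_1Y_3).\end{aligned}$$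
   Context: An addition law of bidegree $(2,2)$ is a $4$-tuple of polynomials in $(X_0,\dots,X_3),(Y_0,\dots,Y_3)$, bihomogeneous of bidegree $(2,2)$, considered modulo the bihomogeneous ideal of $C\times C$ and not all zero modulo it, such that evaluation at $(P,Q)$ gives projective coordinates of $P+Q$ whenever not all components vanish; together with $0$ these form a $k$-vector space. *)

theory Defs
  imports
    "HOL-Algebra.Algebraic_Closure_Type"
    "HOL-Library.Poly_Mapping"
    "HOL-Library.Numeral_Type"
    "HOL-Library.Function_Algebras"
    "HOL-Library.Extended_Nat"
begin

section \<open>Multivariate polynomials\<close>

type_synonym ('v, 'a) mpoly = "('v \<Rightarrow>\<^sub>0 nat) \<Rightarrow>\<^sub>0 'a"

definition Const :: "'a::comm_ring_1 \<Rightarrow> ('v, 'a) mpoly" where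
  "Const c = Poly_Mapping.single 0 c"

definition Var :: "'v \<Rightarrow> ('v, 'a::comm_ring_1) mpoly" where
  "Var v = Poly_Mapping.single (Poly_Mapping.single v 1) 1"

definition mp_eval :: "('v \<Rightarrow> 'a::comm_ring_1) \<Rightarrow> ('v, 'a) mpoly \<Rightarrow> 'a" where
  "mp_eval x p = (\<Sum>m\<in>Poly_Mapping.keys p. Poly_Mapping.lookup p m *
     (\<Prod>v\<in>Poly_Mapping.keys m. x v ^ Poly_Mapping.lookup m v))"

definition mp_deriv :: "'v \<Rightarrow> ('v, 'a::comm_ring_1) mpoly \<Rightarrow> ('v, 'a) mpoly" where
  "mp_deriv v p = (\<Sum>m\<in>Poly_Mapping.keys p.
     Poly_Mapping.single (m - Poly_Mapping.single v 1)
       (of_nat (Poly_Mapping.lookup m v) * Poly_Mapping.lookup p m))"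

definition homogeneous :: "nat \<Rightarrow> ('v::finite, 'a::comm_ring_1) mpoly \<Rightarrow> bool" where
  "homogeneous n p \<longleftrightarrow>
     (\<forall>m\<in>Poly_Mapping.keys p. (\<Sum>v\<in>UNIV. Poly_Mapping.lookup m v) = n)"

definition bihomogeneous ::
    "nat \<Rightarrow> nat \<Rightarrow> ('v::finite + 'w::finite, 'a::comm_ring_1) mpoly \<Rightarrow> bool" where
  "bihomogeneous a b p \<longleftrightarrow>
     (\<forall>m\<in>Poly_Mapping.keys p. (\<Sum>v\<in>UNIV. Poly_Mapping.lookup m (Inl v)) = a \<and>
                              (\<Sum>w\<in>UNIV. Poly_Mapping.lookup m (Inr w)) = b)"

lemma module_mult: "Modules.module ((*) :: 'a::comm_ring_1 \<Rightarrow> 'a \<Rightarrow> 'a)"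
  by unfold_locales (simp_all add: algebra_simps)

text \<open>Powers of an ideal: the ideal generated by all products of \<open>n\<close> elements.\<close>

definition ideal_power :: "'a::comm_ring_1 set \<Rightarrow> nat \<Rightarrow> 'a set" where
  "ideal_power I n = Modules.module.span (*) {\<Prod>i<n. g i | g. \<forall>i<n. g i \<in> I}"


section \<open>The curve\<close>

text \<open>Coordinates are indexed by the four-element type \<open>4\<close>, with elements \<open>0, 1, 2, 3\<close>. A point of
  projective 3-space is given by a nonzero coordinate vector, up to proportionality.\<close>

definition quad :: "'b \<Rightarrow> 'b \<Rightarrow> 'b \<Rightarrow> 'b \<Rightarrow> 4 \<Rightarrow> 'b" where
  "quad a b c e i = (if i = 0 then a else if i = 1 then b else if i = 2 then c else e)"

definition proj_eq :: "(4 \<Rightarrow> 'a::field) \<Rightarrow> (4 \<Rightarrow> 'a) \<Rightarrow> bool" where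
  "proj_eq P Q \<longleftrightarrow> (\<exists>c. c \<noteq> 0 \<and> Q = (\<lambda>i. c * P i))"

definition quadric1 :: "'a::comm_ring_1 \<Rightarrow> (4, 'a) mpoly" where
  "quadric1 d = Var 0 ^ 2 - Const d * Var 2 ^ 2 - Var 1 * Var 3"

definition quadric2 :: "(4, 'a::comm_ring_1) mpoly" where
  "quadric2 = Var 1 ^ 2 - Var 3 ^ 2 - 4 * Var 0 * Var 2"

text \<open>All representatives of the points of the curve. Here and below up to the group law, the type
  \<open>'a\<close> will be instantiated with the algebraic closure of the base field.\<close>

definition curve :: "'a::field \<Rightarrow> (4 \<Rightarrow> 'a) set" where
  "curve d = {P. P \<noteq> (\<lambda>_. 0) \<and> mp_eval P (quadric1 d) = 0 \<and> mp_eval P quadric2 = 0}"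

text \<open>Jacobian criterion: the two gradients are linearly independent at every point.\<close>

definition nonsingular :: "'a::field \<Rightarrow> bool" where
  "nonsingular d \<longleftrightarrow> (\<forall>P\<in>curve d. \<forall>a b.
     (\<forall>i. a * mp_eval P (mp_deriv i (quadric1 d)) + b * mp_eval P (mp_deriv i quadric2) = 0)
       \<longrightarrow> a = 0 \<and> b = 0)"

definition identity_point :: "4 \<Rightarrow> 'a::field" where
  "identity_point = quad 1 1 0 1"


section \<open>Divisors and the group law\<close>

definition curve_ideal :: "'a::field \<Rightarrow> (4, 'a) mpoly set" where
  "curve_ideal d = {f. \<forall>P\<in>curve d. mp_eval P f = 0}"

text \<open>The homogeneous ideal of a point consists of the polynomials that vanish on the line
  spanned by its coordinate vector.\<close>

definition point_ideal :: "(4 \<Rightarrow> 'a::field) \<Rightarrow> (4, 'a) mpoly set" where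
  "point_ideal P = {f. \<forall>c. mp_eval (\<lambda>i. c * P i) f = 0}"

text \<open>A form \<open>F\<close> vanishes to order at least \<open>n\<close> at \<open>P\<close> on the curve iff its local equation
  \<open>F / L ^ deg F\<close>, for a linear form \<open>L\<close> with \<open>L(P) \<noteq> 0\<close>, lies in the \<open>n\<close>-th power of the maximal
  ideal of the local ring of the curve at \<open>P\<close>. Clearing the denominator \<open>H\<close> gives the
  following condition.\<close>

definition vanishes_to_order :: "'a::field \<Rightarrow> (4 \<Rightarrow> 'a) \<Rightarrow> nat \<Rightarrow> (4, 'a) mpoly \<Rightarrow> bool" where
  "vanishes_to_order d P n F \<longleftrightarrow>
     (\<exists>k H. homogeneous k H \<and> mp_eval P H \<noteq> 0 \<and>
        (\<exists>A\<in>curve_ideal d. \<exists>B\<in>ideal_power (point_ideal P) n. H * F = A + B))"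

definition ord_at :: "'a::field \<Rightarrow> (4 \<Rightarrow> 'a) \<Rightarrow> (4, 'a) mpoly \<Rightarrow> enat" where
  "ord_at d P F = (SUP n\<in>{n. vanishes_to_order d P n F}. enat n)"

text \<open>Linear equivalence of the divisors \<open>(P) + (Q)\<close> and \<open>(R) + (S)\<close>: they differ by the divisor of
  the rational function \<open>F / G\<close>.\<close>

definition lin_equiv2 ::
    "'a::field \<Rightarrow> (4 \<Rightarrow> 'a) \<Rightarrow> (4 \<Rightarrow> 'a) \<Rightarrow> (4 \<Rightarrow> 'a) \<Rightarrow> (4 \<Rightarrow> 'a) \<Rightarrow> bool" where
  "lin_equiv2 d P Q R S \<longleftrightarrow>
     (\<exists>n F G. homogeneous n F \<and> homogeneous n G \<and> F \<notin> curve_ideal d \<and> G \<notin> curve_ideal d \<and>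
        (\<forall>Z\<in>curve d. ord_at d Z F + of_bool (proj_eq Z R) + of_bool (proj_eq Z S) =
                      ord_at d Z G + of_bool (proj_eq Z P) + of_bool (proj_eq Z Q)))"

text \<open>The group law of an elliptic curve with identity \<open>O\<close>: \<open>P + Q\<close> is the point \<open>R\<close> such that
  \<open>(P) + (Q)\<close> is linearly equivalent to \<open>(R) + (O)\<close>.\<close>

definition is_sum :: "'a::field \<Rightarrow> (4 \<Rightarrow> 'a) \<Rightarrow> (4 \<Rightarrow> 'a) \<Rightarrow> (4 \<Rightarrow> 'a) \<Rightarrow> bool" where
  "is_sum d P Q R \<longleftrightarrow> P \<in> curve d \<and> Q \<in> curve d \<and> R \<in> curve d \<and>
     lin_equiv2 d P Q R identity_point"


section \<open>Addition laws\<close>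

text \<open>The coordinate ring of the product of two projective 3-spaces over the base field.\<close>

type_synonym 'a bipoly = "(4 + 4, 'a) mpoly"

abbreviation xv :: "4 \<Rightarrow> 'a::comm_ring_1 bipoly" where "xv i \<equiv> Var (Inl i)"
abbreviation yv :: "4 \<Rightarrow> 'a::comm_ring_1 bipoly" where "yv i \<equiv> Var (Inr i)"

definition bi_eval ::
    "(4 \<Rightarrow> 'a alg_closure) \<Rightarrow> (4 \<Rightarrow> 'a alg_closure) \<Rightarrow> 'a::field bipoly \<Rightarrow> 'a alg_closure" where
  "bi_eval P Q f = mp_eval (case_sum P Q) (Poly_Mapping.map to_ac f)"

text \<open>The polynomials over the base field vanishing at all representatives of all geometric points
  of the product of the curve with itself. As the algebraic closure is infinite, this is the ideal
  generated by the bihomogeneous polynomials vanishing on the product.\<close>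

definition product_ideal :: "'a::field \<Rightarrow> 'a bipoly set" where
  "product_ideal d = {f. \<forall>P\<in>curve (to_ac d). \<forall>Q\<in>curve (to_ac d). bi_eval P Q f = 0}"

definition is_addition_law22 :: "'a::field \<Rightarrow> (4 \<Rightarrow> 'a bipoly) \<Rightarrow> bool" where
  "is_addition_law22 d s \<longleftrightarrow>
     (\<forall>j. bihomogeneous 2 2 (s j)) \<and>
     (\<exists>j. s j \<notin> product_ideal d) \<and>
     (\<forall>P\<in>curve (to_ac d). \<forall>Q\<in>curve (to_ac d).
        (\<exists>j. bi_eval P Q (s j) \<noteq> 0) \<longrightarrow> is_sum (to_ac d) P Q (\<lambda>j. bi_eval P Q (s j)))"

definition law_class :: "'a::field \<Rightarrow> (4 \<Rightarrow> 'a bipoly) \<Rightarrow> (4 \<Rightarrow> 'a bipoly) set" where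
  "law_class d s = {t. \<forall>j. bihomogeneous 2 2 (t j) \<and> t j - s j \<in> product_ideal d}"

definition addition_law_space22 :: "'a::field \<Rightarrow> (4 \<Rightarrow> 'a bipoly) set set" where
  "addition_law_space22 d = law_class d ` ({s. is_addition_law22 d s} \<union> {\<lambda>_. 0})"

definition tuple_scale :: "'a::field \<Rightarrow> (4 \<Rightarrow> 'a bipoly) \<Rightarrow> 4 \<Rightarrow> 'a bipoly" where
  "tuple_scale c s = (\<lambda>j. Const c * s j)"

lemma Const_add: "Const (a + b) = Const a + Const b"
  by (simp add: Const_def single_add)

lemma Const_mult: "Const (a * b) = Const a * Const b"
  by (simp add: Const_def mult_single)

lemma Const_1: "Const 1 = 1"
  by (simp add: Const_def)

lemma vector_space_tuple_scale: "vector_space tuple_scale"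
  by unfold_locales
    (simp_all add: tuple_scale_def fun_eq_iff Const_add Const_mult Const_1 algebra_simps)

definition law0 :: "4 \<Rightarrow> 'a::field bipoly" where
  "law0 = quad
     (- (Const (1/4) * (xv 1 ^ 2 * yv 3 ^ 2 - xv 3 ^ 2 * yv 1 ^ 2)))
     (xv 0 * xv 3 * yv 1 * yv 2 - xv 1 * xv 2 * yv 0 * yv 3)
     (xv 0 ^ 2 * yv 2 ^ 2 - xv 2 ^ 2 * yv 0 ^ 2)
     (xv 0 * xv 1 * yv 2 * yv 3 - xv 2 * xv 3 * yv 0 * yv 1)"

definition law1 :: "'a::field \<Rightarrow> 4 \<Rightarrow> 'a bipoly" where
  "law1 d = quad
     (xv 0 * xv 1 * yv 0 * yv 3 + Const d * xv 2 * xv 3 * yv 1 * yv 2)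
     (4 * Const d * xv 0 * xv 2 * yv 2 ^ 2 + xv 1 ^ 2 * yv 1 * yv 3)
     (xv 0 * xv 3 * yv 2 * yv 3 + xv 1 * xv 2 * yv 0 * yv 1)
     (xv 1 * xv 3 * yv 3 ^ 2 - 4 * Const d * xv 2 ^ 2 * yv 0 * yv 2)"

definition law2 :: "'a::field \<Rightarrow> 4 \<Rightarrow> 'a bipoly" where
  "law2 d = quad
     (xv 0 ^ 2 * yv 0 ^ 2 - Const d ^ 2 * xv 2 ^ 2 * yv 2 ^ 2)
     (xv 0 * xv 1 * yv 0 * yv 1 - Const d * xv 2 * xv 3 * yv 2 * yv 3)
     (Const (1/4) * (xv 1 ^ 2 * yv 1 ^ 2 - xv 3 ^ 2 * yv 3 ^ 2))
     (xv 0 * xv 3 * yv 0 * yv 3 - Const d * xv 1 * xv 2 * yv 1 * yv 2)"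

definition law3 :: "'a::field \<Rightarrow> 4 \<Rightarrow> 'a bipoly" where
  "law3 d = quad
     (xv 0 * xv 3 * yv 0 * yv 1 + Const d * xv 1 * xv 2 * yv 2 * yv 3)
     (xv 1 * xv 3 * yv 1 ^ 2 + 4 * Const d * xv 2 ^ 2 * yv 0 * yv 2)
     (xv 0 * xv 1 * yv 1 * yv 2 + xv 2 * xv 3 * yv 0 * yv 3)
     (- (4 * Const d * xv 0 * xv 2 * yv 2 ^ 2) + xv 3 ^ 2 * yv 1 * yv 3)"

end

theory Submission
  imports Defs "HOL-Computational_Algebra.Formal_Power_Series" "HOL-Computational_Algebra.Polynomial"
begin

text \<open>Nonsingularity means \<open>d \<noteq> 0, 1\<close>. The curve is a twisted Edwards curve in a product of two
  lines, embedded by the Segre map. On each of the two lines there are two expressions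
  for the coordinate of \<open>P + Q\<close>, and the four laws are combinations of their Segre products. That these
  expressions compute the sum is seen from the plane section through \<open>P\<close>, \<open>Q\<close>, \<open>- (P + Q)\<close> and the
  point of order two, whose orders of vanishing are computed on formal arcs.

  Conversely, a rational function with at most one pole, and that one simple, is constant. Hence sums
  are unique, and all addition laws are proportional at every pair of points. Let \<open>T\<close> be translation
  by a point of order four. For \<open>j = 1, 2, 3\<close> the values of \<open>\<ss>\<^sub>j\<close> at \<open>(P, T\<^sup>k P)\<close> are those of
  \<open>\<ss>\<^sub>2\<close>, which never vanish, times the \<open>k\<close>-th power of \<open>\<i>\<close>, \<open>1\<close> or \<open>- \<i>\<close>; the first law \<open>\<ss>\<^sub>0\<close>
  vanishes exactly at the pairs \<open>(P, T\<^sup>k P)\<close>, and simply there. Subtracting a combination of the last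
  three laws from an arbitrary law, one can make it vanish for \<open>k = 0, 1, 2\<close>; its quotient by \<open>\<ss>\<^sub>0\<close>
  then has at most one simple pole in each variable and is constant. The coefficients lie in
  the base field because they can be read off from the law with the first argument the identity.\<close>

section \<open>Evaluation of polynomials in algebras\<close>

text \<open>The group law is given by linear equivalence, with orders defined through powers of
  point ideals, so no formula can be tested by substitution alone. Hence orders are first made
  computable: each point gets a formal arc along which the order of a form is the order of a power
  series. One direction is substitution, the other a Taylor expansion with denominators cleared. In
  place of Riemann-Roch stands the fact that forms on the curve have unique expressions in
  \<open>1\<close>, \<open>m\<close>, \<open>n\<close>, \<open>m n\<close> over the binary forms in
  \<open>u\<close>, \<open>v\<close>. A quotient regular along all arcs is rationalised by the norm
  of its denominator, which is then divided out one linear factor at a time. The addition formulas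
  are chords and tangents in disguise: projection from the point of order two maps the curve to the
  plane cubic \<open>a^2 (z - x) = (x + z) (d x^2 - z^2)\<close> and turns planes through that point
  into lines. Three laws have to correct an arbitrary law on four graphs of translations. The graph
  left over costs exactly the one simple pole that the criterion for constancy tolerates.\<close>

locale coeff_hom =
  fixes h :: "'a::comm_ring_1 \<Rightarrow> 'b::comm_ring_1"
  assumes hom_one: "h 1 = 1"
    and hom_add: "h (a + b) = h a + h b"
    and hom_mult: "h (a * b) = h a * h b"
begin

lemma hom_zero: "h 0 = 0"
  using hom_add[of 0 0] by simp

lemma hom_uminus: "h (- a) = - h a"
  using hom_add[of a "- a"] by (simp add: hom_zero eq_neg_iff_add_eq_0 add.commute)

lemma hom_diff: "h (a - b) = h a - h b"
  using hom_add[of a "- b"] by (simp add: hom_uminus)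

lemma hom_power: "h (a ^ n) = h a ^ n"
  by (induction n) (simp_all add: hom_one hom_mult)

lemma hom_numeral: "h (numeral n) = numeral n"
proof -
  have "h (of_nat k) = of_nat k" for k
    by (induction k) (simp_all add: hom_zero hom_add hom_one)
  from this[of "numeral n"] show ?thesis by simp
qed

end

definition mon_eval :: "('v::finite \<Rightarrow> 'b::comm_ring_1) \<Rightarrow> ('v \<Rightarrow>\<^sub>0 nat) \<Rightarrow> 'b" where
  "mon_eval x m = (\<Prod>v\<in>UNIV. x v ^ Poly_Mapping.lookup m v)"

text \<open>One evaluation serves four purposes through the choice of \<open>h\<close>: values over
  the same ring (\<open>id\<close>), geometric values of polynomials over the base field
  (\<open>to_ac\<close>), substitution of polynomials (\<open>Const\<close>) and evaluation along
  formal arcs (\<open>fps_const\<close>).\<close>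

definition ev :: "('a::comm_ring_1 \<Rightarrow> 'b::comm_ring_1) \<Rightarrow> ('v::finite \<Rightarrow> 'b) \<Rightarrow> ('v, 'a) mpoly \<Rightarrow> 'b"
  where "ev h x p = (\<Sum>m\<in>Poly_Mapping.keys p. h (Poly_Mapping.lookup p m) * mon_eval x m)"

lemma mon_eval_0 [simp]: "mon_eval x 0 = 1"
  by (simp add: mon_eval_def)

lemma mon_eval_add: "mon_eval x (m + n) = mon_eval x m * mon_eval x n"
  by (simp add: mon_eval_def lookup_add power_add prod.distrib)

lemma mon_eval_single: "mon_eval x (Poly_Mapping.single v k) = x v ^ k"
proof -
  have "mon_eval x (Poly_Mapping.single v k) = (\<Prod>w\<in>{v}. x w ^ Poly_Mapping.lookup (Poly_Mapping.single v k) w)"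
    unfolding mon_eval_def by (rule prod.mono_neutral_right) (auto simp: lookup_single_not_eq)
  thus ?thesis by simp
qed

lemma mpoly_sum_single:
  "p = (\<Sum>m\<in>Poly_Mapping.keys p. Poly_Mapping.single m (Poly_Mapping.lookup p m))"
  by (rule poly_mapping_eqI) (auto simp: lookup_sum lookup_single when_def not_in_keys_iff_lookup_eq_zero)

lemma mp_eval_conv_ev: "mp_eval x p = ev id x p"
proof -
  have "(\<Prod>v\<in>Poly_Mapping.keys m. x v ^ Poly_Mapping.lookup m v) = mon_eval x m" for m
    unfolding mon_eval_def
    by (rule prod.mono_neutral_left) (auto simp: not_in_keys_iff_lookup_eq_zero)
  thus ?thesis by (simp add: mp_eval_def ev_def)
qed

lemma bi_eval_conv_ev: "bi_eval P Q f = ev to_ac (case_sum P Q) f"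
proof -
  have k: "Poly_Mapping.keys (Poly_Mapping.map to_ac f) = Poly_Mapping.keys f"
    by (auto simp: in_keys_iff map.rep_eq when_def)
  show ?thesis unfolding bi_eval_def mp_eval_conv_ev ev_def k
    by (rule sum.cong) (auto simp: map.rep_eq in_keys_iff)
qed

context coeff_hom
begin

lemma ev_superset:
  assumes "finite A" "Poly_Mapping.keys p \<subseteq> A"
  shows "ev h x p = (\<Sum>m\<in>A. h (Poly_Mapping.lookup p m) * mon_eval x m)"
  unfolding ev_def using assms
  by (intro sum.mono_neutral_left) (auto simp: not_in_keys_iff_lookup_eq_zero hom_zero)

lemma ev_0 [simp]: "ev h x 0 = 0"
  by (simp add: ev_def)

lemma ev_add: "ev h x (p + q) = ev h x p + ev h x q"
proof -
  let ?A = "Poly_Mapping.keys p \<union> Poly_Mapping.keys q"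
  have "ev h x (p + q) = (\<Sum>m\<in>?A. h (Poly_Mapping.lookup (p + q) m) * mon_eval x m)"
    by (rule ev_superset) (use keys_add[of p q] in auto)
  also have "\<dots> = (\<Sum>m\<in>?A. h (Poly_Mapping.lookup p m) * mon_eval x m)
      + (\<Sum>m\<in>?A. h (Poly_Mapping.lookup q m) * mon_eval x m)"
    by (simp add: lookup_add hom_add algebra_simps sum.distrib)
  also have "\<dots> = ev h x p + ev h x q"
    by (simp add: ev_superset[of ?A p] ev_superset[of ?A q])
  finally show ?thesis .
qed

lemma ev_sum: "ev h x (\<Sum>i\<in>A. f i) = (\<Sum>i\<in>A. ev h x (f i))"
  by (induction A rule: infinite_finite_induct) (simp_all add: ev_add)

lemma ev_single: "ev h x (Poly_Mapping.single m c) = h c * mon_eval x m"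
  by (cases "c = 0") (simp_all add: ev_def hom_zero)

lemma ev_mult: "ev h x (p * q) = ev h x p * ev h x q"
proof -
  let ?s = "\<lambda>p m. Poly_Mapping.single m (Poly_Mapping.lookup p m)"
  have "ev h x (p * q) = ev h x ((\<Sum>m\<in>Poly_Mapping.keys p. ?s p m) * (\<Sum>n\<in>Poly_Mapping.keys q. ?s q n))"
    by (simp flip: mpoly_sum_single)
  also have "\<dots> = (\<Sum>m\<in>Poly_Mapping.keys p. \<Sum>n\<in>Poly_Mapping.keys q.
      ev h x (?s p m) * ev h x (?s q n))"
    by (simp add: sum_product ev_sum mult_single ev_single hom_mult mon_eval_add mult_ac)
  also have "\<dots> = ev h x p * ev h x q"
    by (simp add: sum_product ev_single ev_def[of h x p] ev_def[of h x q])
  finally show ?thesis .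
qed

lemma ev_Const [simp]: "ev h x (Const c) = h c"
  by (simp add: Const_def ev_single)

lemma ev_Var [simp]: "ev h x (Var v) = x v"
  by (simp add: Var_def ev_single hom_one mon_eval_single)

lemma ev_1 [simp]: "ev h x 1 = 1"
  by (simp add: hom_one flip: Const_1)

lemma coeff_hom_ev: "coeff_hom (ev h x)"
  by unfold_locales (simp_all add: ev_add ev_mult)

lemmas ev_uminus = coeff_hom.hom_uminus[OF coeff_hom_ev]
lemmas ev_diff = coeff_hom.hom_diff[OF coeff_hom_ev]
lemmas ev_power = coeff_hom.hom_power[OF coeff_hom_ev]
lemmas ev_numeral = coeff_hom.hom_numeral[OF coeff_hom_ev]

lemmas ev_simps = ev_add ev_mult ev_uminus ev_diff ev_power ev_numeral

end

lemma coeff_hom_id: "coeff_hom id"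
  by unfold_locales auto

lemma coeff_hom_to_ac: "coeff_hom to_ac"
  by unfold_locales auto

lemma coeff_hom_Const: "coeff_hom Const"
  by unfold_locales (simp_all add: Const_1 Const_add Const_mult)

lemma coeff_hom_fps_const: "coeff_hom fps_const"
  by unfold_locales simp_all

interpretation ev_id: coeff_hom id by (rule coeff_hom_id)
interpretation ev_ac: coeff_hom to_ac by (rule coeff_hom_to_ac)
interpretation ev_C: coeff_hom Const by (rule coeff_hom_Const)
interpretation ev_fps: coeff_hom fps_const by (rule coeff_hom_fps_const)

lemma Const_0 [simp]: "Const 0 = 0"
  by (simp add: Const_def)

lemma mp_eval_simps [simp]:
  "mp_eval x 0 = 0" "mp_eval x 1 = 1" "mp_eval x (p + q) = mp_eval x p + mp_eval x q"
  "mp_eval x (p * q) = mp_eval x p * mp_eval x q" "mp_eval x (p - q) = mp_eval x p - mp_eval x q"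
  "mp_eval x (- p) = - mp_eval x p" "mp_eval x (p ^ n) = mp_eval x p ^ n"
  "mp_eval x (numeral k) = numeral k" "mp_eval x (Const c) = c" "mp_eval x (Var v) = x v"
  for x :: "'v::finite \<Rightarrow> 'a::comm_ring_1"
  by (simp_all add: mp_eval_conv_ev ev_id.ev_simps)

lemma mp_eval_sum: "mp_eval x (\<Sum>i\<in>A. f i) = (\<Sum>i\<in>A. mp_eval x (f i))"
  for x :: "'v::finite \<Rightarrow> 'a::comm_ring_1"
  by (simp add: mp_eval_conv_ev ev_id.ev_sum)

lemma bi_eval_simps [simp]:
  "bi_eval P Q 0 = 0" "bi_eval P Q 1 = 1" "bi_eval P Q (p + q) = bi_eval P Q p + bi_eval P Q q"
  "bi_eval P Q (p * q) = bi_eval P Q p * bi_eval P Q q"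
  "bi_eval P Q (p - q) = bi_eval P Q p - bi_eval P Q q"
  "bi_eval P Q (- p) = - bi_eval P Q p" "bi_eval P Q (p ^ n) = bi_eval P Q p ^ n"
  "bi_eval P Q (numeral k) = numeral k" "bi_eval P Q (Const c) = to_ac c"
  "bi_eval P Q (xv i) = P i" "bi_eval P Q (yv i) = Q i"
  by (simp_all add: bi_eval_conv_ev ev_ac.ev_simps)

section \<open>Homogeneous polynomials\<close>

definition mdeg :: "('v::finite \<Rightarrow>\<^sub>0 nat) \<Rightarrow> nat" where
  "mdeg m = (\<Sum>v\<in>UNIV. Poly_Mapping.lookup m v)"

lemma homogeneous_mdeg: "homogeneous n p \<longleftrightarrow> (\<forall>m\<in>Poly_Mapping.keys p. mdeg m = n)"
  by (simp add: homogeneous_def mdeg_def)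

lemma mdeg_add: "mdeg (m + n) = mdeg m + mdeg n"
  by (simp add: mdeg_def lookup_add sum.distrib)

lemma mdeg_0 [simp]: "mdeg 0 = 0"
  by (simp add: mdeg_def)

lemma mdeg_single: "mdeg (Poly_Mapping.single v k) = k"
proof -
  have "mdeg (Poly_Mapping.single v k) = (\<Sum>w\<in>{v}. Poly_Mapping.lookup (Poly_Mapping.single v k) w)"
    unfolding mdeg_def by (rule sum.mono_neutral_right) (auto simp: lookup_single_not_eq)
  thus ?thesis by simp
qed

lemma homogeneous_0 [simp]: "homogeneous n 0"
  by (simp add: homogeneous_mdeg)

lemma homogeneous_add: "homogeneous n p \<Longrightarrow> homogeneous n q \<Longrightarrow> homogeneous n (p + q)"
  unfolding homogeneous_mdeg using keys_add[of p q] by blast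

lemma homogeneous_uminus: "homogeneous n p \<Longrightarrow> homogeneous n (- p)"
  by (simp add: homogeneous_mdeg in_keys_iff)

lemma homogeneous_diff: "homogeneous n p \<Longrightarrow> homogeneous n q \<Longrightarrow> homogeneous n (p - q)"
  using homogeneous_add[of n p "- q"] homogeneous_uminus[of n q] by simp

lemma homogeneous_sum: "(\<And>i. i \<in> A \<Longrightarrow> homogeneous n (f i)) \<Longrightarrow> homogeneous n (\<Sum>i\<in>A. f i)"
  by (induction A rule: infinite_finite_induct) (auto intro: homogeneous_add)

lemma homogeneous_mult: "homogeneous m p \<Longrightarrow> homogeneous n q \<Longrightarrow> homogeneous (m + n) (p * q)"
  unfolding homogeneous_mdeg using keys_mult[of p q] by (fastforce simp: mdeg_add)

lemma homogeneous_single: "mdeg m = n \<Longrightarrow> homogeneous n (Poly_Mapping.single m c)"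
  by (cases "c = 0") (simp_all add: homogeneous_mdeg)

lemma homogeneous_Const: "homogeneous 0 (Const c)"
  by (simp add: Const_def homogeneous_single)

lemma homogeneous_1: "homogeneous 0 1"
  using homogeneous_Const[of 1] by (simp add: Const_1)

lemma homogeneous_Var: "homogeneous 1 (Var v)"
  by (simp add: Var_def homogeneous_single mdeg_single)

lemma homogeneous_Const_mult: "homogeneous n p \<Longrightarrow> homogeneous n (Const c * p)"
  using homogeneous_mult[OF homogeneous_Const] by fastforce

lemma homogeneous_power: "homogeneous n p \<Longrightarrow> homogeneous (k * n) (p ^ k)"
  by (induction k) (auto intro: homogeneous_mult homogeneous_1)

lemma homogeneous_prod:
  "(\<And>i. i \<in> A \<Longrightarrow> homogeneous (n i) (f i)) \<Longrightarrow> homogeneous (sum n A) (\<Prod>i\<in>A. f i)"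
  by (induction A rule: infinite_finite_induct) (auto intro: homogeneous_mult homogeneous_1)

lemma mdeg_Suc_ex:
  assumes "mdeg m = Suc n"
  obtains v m' where "m = Poly_Mapping.single v 1 + m'" "mdeg m' = n"
proof -
  have "\<exists>v. Poly_Mapping.lookup m v \<noteq> 0"
    using assms by (metis mdeg_def sum.neutral nat.distinct(1))
  then obtain v where v: "Poly_Mapping.lookup m v \<noteq> 0" ..
  have m: "m = Poly_Mapping.single v 1 + (m - Poly_Mapping.single v 1)"
    by (rule poly_mapping_eqI) (use v in \<open>auto simp: lookup_add lookup_minus lookup_single when_def\<close>)
  with assms have "mdeg (m - Poly_Mapping.single v 1) = n"
    by (metis mdeg_add mdeg_single plus_1_eq_Suc Suc_inject)
  with m that show ?thesis by blast
qed

lemma single_Var_mult: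
  "Poly_Mapping.single (Poly_Mapping.single v 1 + m) c = Var v * Poly_Mapping.single m c"
  by (simp add: Var_def mult_single)

lemma mdeg_eq_0: "mdeg m = 0 \<Longrightarrow> m = 0"
  by (rule poly_mapping_eqI) (simp add: mdeg_def)

text \<open>The degree grows by one variable at a time, so a construction on forms has to be given
  only for constants, for one more factor \<open>Var v\<close>, and for sums. Normal forms and
  Taylor expansions on the curve are built this way.\<close>

lemma homogeneous_induct [consumes 1, case_names Const Var add]:
  fixes F :: "('v::finite, 'a::comm_ring_1) mpoly"
  assumes F: "homogeneous n F"
    and C: "\<And>c. P 0 (Const c)"
    and V: "\<And>n v G. homogeneous n G \<Longrightarrow> P n G \<Longrightarrow> P (Suc n) (Var v * G)"
    and A: "\<And>n F G. homogeneous n F \<Longrightarrow> homogeneous n G \<Longrightarrow> P n F \<Longrightarrow> P n G \<Longrightarrow> P n (F + G)"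
  shows "P n F"
proof -
  have s: "P n (Poly_Mapping.single m c)" if "mdeg m = n" for n m c
    using that
  proof (induction n arbitrary: m)
    case 0
    with C show ?case by (auto dest!: mdeg_eq_0 simp: Const_def)
  next
    case (Suc n)
    then obtain v m' where m: "m = Poly_Mapping.single v 1 + m'" "mdeg m' = n"
      by (blast elim: mdeg_Suc_ex)
    show ?case unfolding m single_Var_mult
      by (intro V homogeneous_single Suc.IH m)
  qed
  have z: "P n 0"
  proof (induction n)
    case 0 show ?case using C[of 0] by simp
  next
    case (Suc n) show ?case using V[OF homogeneous_0 Suc] by simp
  qed
  have "P n (\<Sum>m\<in>A. Poly_Mapping.single m (Poly_Mapping.lookup F m))"
    if "A \<subseteq> Poly_Mapping.keys F" for A
    using finite_subset[OF that finite_keys] that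
  proof (induction A rule: finite_induct)
    case empty thus ?case using z by simp
  next
    case (insert m B)
    hence "mdeg m = n" using F by (auto simp: homogeneous_mdeg)
    moreover have "homogeneous n (\<Sum>m\<in>B. Poly_Mapping.single m (Poly_Mapping.lookup F m))"
      using insert.prems F by (intro homogeneous_sum homogeneous_single) (auto simp: homogeneous_mdeg)
    ultimately show ?case using insert by (auto intro!: A s homogeneous_single)
  qed
  from this[of "Poly_Mapping.keys F"] show ?thesis by (simp flip: mpoly_sum_single)
qed

lemma mpoly_induct [case_names Const Var add]:
  fixes F :: "('v::finite, 'a::comm_ring_1) mpoly"
  assumes C: "\<And>c. P (Const c)" and V: "\<And>v G. P G \<Longrightarrow> P (Var v * G)"
    and A: "\<And>F G. P F \<Longrightarrow> P G \<Longrightarrow> P (F + G)"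
  shows "P F"
proof -
  have s: "P (Poly_Mapping.single m c)" for m c
    by (rule homogeneous_induct[OF homogeneous_single[OF refl], of "\<lambda>n. P"]) (auto intro: C V A)
  have "P (\<Sum>m\<in>A. Poly_Mapping.single m (Poly_Mapping.lookup F m))" if "finite A" for A
    using that by (induction A rule: finite_induct) (use C[of 0] in \<open>auto intro: A s\<close>)
  from this[of "Poly_Mapping.keys F"] show ?thesis by (simp flip: mpoly_sum_single)
qed

lemma (in coeff_hom) ev_homogeneous_scale:
  assumes "homogeneous n F"
  shows "ev h (\<lambda>i. c * x i) F = c ^ n * ev h x F"
  using assms by (induction rule: homogeneous_induct) (simp_all add: ev_simps algebra_simps)

lemma mp_eval_homogeneous_scale:
  "homogeneous n F \<Longrightarrow> mp_eval (\<lambda>i. c * x i) F = c ^ n * mp_eval x F"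
  by (simp add: mp_eval_conv_ev ev_id.ev_homogeneous_scale)

lemma ev_ev:
  assumes g: "coeff_hom g" and h: "coeff_hom h"
  shows "ev h x (ev g y f) = ev (\<lambda>c. ev h x (g c)) (\<lambda>i. ev h x (y i)) f"
proof -
  interpret g: coeff_hom g by fact
  interpret h: coeff_hom h by fact
  interpret c: coeff_hom "\<lambda>c. ev h x (g c)"
    by unfold_locales (simp_all add: g.hom_one g.hom_add g.hom_mult h.ev_simps)
  show ?thesis
    by (induction f rule: mpoly_induct) (simp_all add: g.ev_simps h.ev_simps c.ev_simps)
qed

text \<open>Bidegree turns into degree. With \<open>p, q\<close> equal to \<open>0, 1\<close> or
  \<open>1, 0\<close> one argument of a law is frozen; with \<open>1, 1\<close> both arguments move
  along a graph.\<close>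

lemma homogeneous_subst:
  fixes f :: "('v::finite + 'w::finite, 'a::comm_ring_1) mpoly"
  assumes "coeff_hom g" and f: "bihomogeneous a b f" and g: "\<And>c. homogeneous 0 (g c)"
    and l: "\<And>i. homogeneous p (y (Inl i))" and r: "\<And>j. homogeneous q (y (Inr j))"
  shows "homogeneous (a * p + b * q) (ev g y f)"
  unfolding ev_def
proof (rule homogeneous_sum)
  fix m assume m: "m \<in> Poly_Mapping.keys f"
  let ?l = "Poly_Mapping.lookup m"
  have U: "(UNIV :: ('v + 'w) set) = Inl ` UNIV \<union> Inr ` UNIV"
    by (auto simp: UNIV_sum)
  have "mon_eval y m = (\<Prod>i\<in>UNIV. y (Inl i) ^ ?l (Inl i)) * (\<Prod>j\<in>UNIV. y (Inr j) ^ ?l (Inr j))"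
    unfolding mon_eval_def U
    by (subst prod.union_disjoint) (auto simp: prod.reindex)
  moreover have "homogeneous (\<Sum>i\<in>UNIV. ?l (Inl i) * p) (\<Prod>i\<in>UNIV. y (Inl i) ^ ?l (Inl i))"
    by (intro homogeneous_prod homogeneous_power l)
  moreover have "homogeneous (\<Sum>i\<in>UNIV. ?l (Inr i) * q) (\<Prod>i\<in>UNIV. y (Inr i) ^ ?l (Inr i))"
    by (intro homogeneous_prod homogeneous_power r)
  moreover have "(\<Sum>i\<in>UNIV. ?l (Inl i) * p) = a * p" "(\<Sum>i\<in>UNIV. ?l (Inr i) * q) = b * q"
    using f m by (auto simp: bihomogeneous_def simp flip: sum_distrib_right)
  ultimately have "homogeneous (a * p + b * q) (mon_eval y m)"
    using homogeneous_mult by simp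
  with homogeneous_mult[OF g this] show "homogeneous (a * p + b * q) (g (Poly_Mapping.lookup f m) * mon_eval y m)"
    by simp
qed

text \<open>\<open>curve_ideal\<close> contains inhomogeneous polynomials, which also occur as
  witnesses in \<open>vanishes_to_order\<close>. Normal forms exist only degree by degree, so such
  polynomials are split into components.\<close>

definition hcomp :: "nat \<Rightarrow> ('v::finite, 'a::comm_ring_1) mpoly \<Rightarrow> ('v, 'a) mpoly" where
  "hcomp k p = (\<Sum>m\<in>{m \<in> Poly_Mapping.keys p. mdeg m = k}.
     Poly_Mapping.single m (Poly_Mapping.lookup p m))"

lemma homogeneous_hcomp: "homogeneous k (hcomp k p)"
  unfolding hcomp_def by (auto intro!: homogeneous_sum homogeneous_single)

lemma sum_hcomp: obtains N where "p = (\<Sum>k\<le>N. hcomp k p)"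
proof -
  let ?N = "Max (insert 0 (mdeg ` Poly_Mapping.keys p))"
  let ?s = "\<lambda>m. Poly_Mapping.single m (Poly_Mapping.lookup p m)"
  have "(\<Sum>k\<le>?N. hcomp k p) = (\<Sum>m\<in>Poly_Mapping.keys p. ?s m)"
    unfolding hcomp_def
    by (subst sum.group[of "Poly_Mapping.keys p" "{..?N}" mdeg ?s]) auto
  with that[of ?N] show ?thesis by (simp flip: mpoly_sum_single)
qed

section \<open>The affine cone over the curve\<close>

lemma distinct4 [simp]:
  "(0::4) \<noteq> 1" "(0::4) \<noteq> 2" "(0::4) \<noteq> 3" "(1::4) \<noteq> 0" "(1::4) \<noteq> 2" "(1::4) \<noteq> 3"
  "(2::4) \<noteq> 0" "(2::4) \<noteq> 1" "(2::4) \<noteq> 3" "(3::4) \<noteq> 0" "(3::4) \<noteq> 1" "(3::4) \<noteq> 2"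
  by simp_all

lemma UNIV_4: "(UNIV :: 4 set) = {0, 1, 2, 3}"
  by (rule sym, rule card_subset_eq) auto

lemma all_4: "(\<forall>i::4. P i) \<longleftrightarrow> P 0 \<and> P 1 \<and> P 2 \<and> P 3"
  using UNIV_4 by (metis UNIV_I insertE singletonD)

lemma eq_4_iff: "(f :: 4 \<Rightarrow> 'a) = g \<longleftrightarrow> f 0 = g 0 \<and> f 1 = g 1 \<and> f 2 = g 2 \<and> f 3 = g 3"
  by (simp add: fun_eq_iff all_4)

lemma quad_simps [simp]:
  "quad a b c e 0 = a" "quad a b c e 1 = b" "quad a b c e 2 = c" "quad a b c e 3 = e"
  by (simp_all add: quad_def)

text \<open>The equations are stated over any commutative ring and without excluding the origin, so
  that they also describe arcs with power series coordinates.\<close>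

definition cone :: "'b::comm_ring_1 \<Rightarrow> (4 \<Rightarrow> 'b) \<Rightarrow> bool" where
  "cone D x \<longleftrightarrow> x 0 ^ 2 - D * x 2 ^ 2 = x 1 * x 3 \<and> x 1 ^ 2 - x 3 ^ 2 = 4 * x 0 * x 2"

lemma curve_iff: "P \<in> curve d \<longleftrightarrow> P \<noteq> (\<lambda>_. 0) \<and> cone d P"
  by (simp add: curve_def cone_def quadric1_def quadric2_def)

abbreviation fe :: "('v::finite \<Rightarrow> 'a fps) \<Rightarrow> ('v, 'a::field) mpoly \<Rightarrow> 'a fps" where
  "fe \<equiv> ev fps_const"

lemma fe_simps [simp]:
  "fe x 0 = 0" "fe x 1 = 1" "fe x (p + q) = fe x p + fe x q" "fe x (p * q) = fe x p * fe x q"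
  "fe x (p - q) = fe x p - fe x q" "fe x (- p) = - fe x p" "fe x (p ^ n) = fe x p ^ n"
  "fe x (numeral k) = numeral k" "fe x (Const c) = fps_const c" "fe x (Var v) = x v"
  by (simp_all add: ev_fps.ev_simps)

lemma fe_nth_0: "fe x F $ 0 = mp_eval (\<lambda>i. x i $ 0) F"
  by (induction F rule: mpoly_induct) simp_all

lemma fe_const: "fe (\<lambda>i. fps_const (P i)) F = fps_const (mp_eval P F)"
  by (induction F rule: mpoly_induct) simp_all

lemma fps_const_eq_iff: "fps_const a = fps_const b \<longleftrightarrow> a = b"
  by (metis fps_nth_fps_const)

lemma cone_const_iff: "cone (fps_const d) (\<lambda>i. fps_const (P i)) \<longleftrightarrow> cone d P"
  for d :: "'a::field"
proof -
  have 4: "(4 :: 'a fps) = fps_const 4" by (rule numeral_fps_const)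
  show ?thesis unfolding cone_def 4 fps_const_power fps_const_mult fps_const_sub fps_const_eq_iff ..
qed

lemma cone_nth_0: "cone (fps_const d) x \<Longrightarrow> cone d (\<lambda>i. x i $ 0)"
  for d :: "'a::field"
proof -
  assume "cone (fps_const d) x"
  hence "(x 0 ^ 2 - fps_const d * x 2 ^ 2) $ 0 = (x 1 * x 3) $ 0"
    "(x 1 ^ 2 - x 3 ^ 2) $ 0 = (4 * x 0 * x 2) $ 0" by (simp_all add: cone_def)
  thus ?thesis by (simp add: cone_def power2_eq_square)
qed

lemma infinite_alg_closed: "infinite (UNIV :: 'a::alg_closed_field set)"
proof
  assume fin: "finite (UNIV :: 'a set)"
  \<comment> \<open>If the field were finite, this polynomial would take the value one everywhere
    although its degree is positive.\<close>
  define p :: "'a poly" where "p = (\<Prod>a\<in>UNIV. [:- a, 1:]) + 1"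
  have dg: "degree (\<Prod>a\<in>(UNIV::'a set). [:- a, 1:]) = card (UNIV :: 'a set)"
    by (subst degree_prod_eq_sum_degree) auto
  have "card (UNIV :: 'a set) > 0"
    using fin by (simp add: card_gt_0_iff)
  with dg have "degree p > 0"
    unfolding p_def by (subst degree_add_eq_left) auto
  then obtain x where "poly p x = 0"
    using alg_closed_imp_poly_has_root by blast
  moreover have "poly (\<Prod>a\<in>(UNIV::'a set). [:- a, 1:]) x = 0"
    using fin by (auto simp: poly_prod prod_zero_iff)
  ultimately show False by (simp add: p_def)
qed

lemma sqrt_exists: "\<exists>y. y ^ 2 = (x :: 'a::alg_closed_field)"
  using nth_root_exists[of 2 x] by auto

text \<open>Comparing coefficients of degree \<open>n\<close> in \<open>g^2 = f\<close> gives
  \<open>2 r g_n\<close> plus a convolution of earlier coefficients. Solving for \<open>g_n\<close>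
  only divides by \<open>2 r\<close>, so this works in every characteristic other than two.\<close>

fun sqrt_coeff :: "(nat \<Rightarrow> 'a::field) \<Rightarrow> 'a \<Rightarrow> nat \<Rightarrow> 'a" where
  "sqrt_coeff f r n = (if n = 0 then r
     else (f n - (\<Sum>i=1..<n. sqrt_coeff f r i * sqrt_coeff f r (n - i))) / (2 * r))"

declare sqrt_coeff.simps [simp del]

lemma fps_sqrt_exists:
  fixes f :: "'a::field fps"
  assumes r: "r ^ 2 = f $ 0" "r \<noteq> 0" and two: "(2::'a) \<noteq> 0"
  obtains g where "g ^ 2 = f" "g $ 0 = r"
proof
  define c where "c = sqrt_coeff (fps_nth f) r"
  have c0: "c 0 = r" by (simp add: c_def sqrt_coeff.simps)
  show "Abs_fps c $ 0 = r" by (simp add: c0)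
  show "Abs_fps c ^ 2 = f"
  proof (rule fps_ext)
    fix n
    show "(Abs_fps c ^ 2) $ n = f $ n"
    proof (cases n)
      case 0 with r c0 show ?thesis by (simp add: power2_eq_square)
    next
      case (Suc k)
      have "(Abs_fps c ^ 2) $ n = (\<Sum>i=0..n. c i * c (n - i))"
        by (simp add: power2_eq_square fps_mult_nth)
      also have "{0..n} = insert 0 (insert n {1..<n})" using Suc by auto
      also have "(\<Sum>i\<in>insert 0 (insert n {1..<n}). c i * c (n - i))
          = 2 * r * c n + (\<Sum>i=1..<n. c i * c (n - i))"
        using Suc by (simp add: c0)
      also have "2 * r * c n = f $ n - (\<Sum>i=1..<n. c i * c (n - i))"
        unfolding c_def by (subst sqrt_coeff.simps) (use Suc r two in simp)
      finally show ?thesis by simp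
    qed
  qed
qed

section \<open>Binary forms\<close>

text \<open>The bound is an integer because the parts of a normal form of degree \<open>k\<close>
  have degrees down to \<open>k - 2\<close>. A negative bound leaves only the zero
  polynomial.\<close>

definition dbound :: "int \<Rightarrow> 'a::zero poly \<Rightarrow> bool" where
  "dbound k p \<longleftrightarrow> p = 0 \<or> int (degree p) \<le> k"

text \<open>The binary form of degree \<open>k\<close> with dehomogenisation \<open>p\<close>; it is zero if \<open>k\<close> is negative and
  \<open>dbound k p\<close>.\<close>

definition bform :: "('a::comm_ring_1 \<Rightarrow> 'b::comm_ring_1) \<Rightarrow> int \<Rightarrow> 'a poly \<Rightarrow> 'b \<Rightarrow> 'b \<Rightarrow> 'b" where
  "bform h k p U V = (\<Sum>i\<le>nat k. h (coeff p i) * U ^ i * V ^ (nat k - i))"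

lemma dbound_0 [simp]: "dbound k 0"
  by (simp add: dbound_def)

lemma dbound_coeff: "dbound k p \<Longrightarrow> int i > k \<Longrightarrow> coeff p i = 0"
  by (auto simp: dbound_def intro: coeff_eq_0)

lemma dbound_mono: "dbound k p \<Longrightarrow> k \<le> l \<Longrightarrow> dbound l p"
  by (auto simp: dbound_def)

lemma dbound_add: "dbound k p \<Longrightarrow> dbound k q \<Longrightarrow> dbound k (p + q)"
  using degree_add_le_max[of p q] by (auto simp: dbound_def)

lemma dbound_uminus: "dbound k p \<Longrightarrow> dbound k (- p)"
  by (auto simp: dbound_def)

lemma dbound_diff: "dbound k p \<Longrightarrow> dbound k q \<Longrightarrow> dbound k (p - q)"
  for p :: "'a::ab_group_add poly"
  using dbound_add[of k p "- q"] dbound_uminus[of k q] by simp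

lemma dbound_mult: "dbound k p \<Longrightarrow> dbound l q \<Longrightarrow> dbound (k + l) (p * q)"
  for p :: "'a::comm_semiring_0 poly"
  using degree_mult_le[of p q] by (auto simp: dbound_def)

lemma dbound_smult: "dbound k p \<Longrightarrow> dbound k (smult c p)"
  for p :: "'a::comm_semiring_0 poly"
  using degree_smult_le[of c p] by (auto simp: dbound_def)

lemma dbound_pCons_0: "dbound k p \<Longrightarrow> dbound (k + 1) (pCons 0 p)"
  by (auto simp: dbound_def)

lemma dbound_pConsD: "dbound k (pCons a p) \<Longrightarrow> dbound (k - 1) p"
  by (auto simp: dbound_def degree_pCons_eq split: if_splits)

context coeff_hom
begin

lemma bform_0 [simp]: "bform h k 0 U V = 0"
  by (simp add: bform_def hom_zero)

lemma bform_add: "bform h k (p + q) U V = bform h k p U V + bform h k q U V"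
  by (simp add: bform_def hom_add algebra_simps sum.distrib)

lemma bform_uminus: "bform h k (- p) U V = - bform h k p U V"
  by (simp add: bform_def hom_uminus sum_negf)

lemma bform_diff: "bform h k (p - q) U V = bform h k p U V - bform h k q U V"
  using bform_add[of k p "- q"] by (simp add: bform_uminus)

lemma bform_smult: "bform h k (smult c p) U V = h c * bform h k p U V"
  by (simp add: bform_def hom_mult sum_distrib_left mult_ac)

lemma bform_pCons_0:
  assumes "dbound k p"
  shows "bform h (k + 1) (pCons 0 p) U V = U * bform h k p U V"
proof (cases "p = 0")
  case False
  with assms have k: "k \<ge> 0" by (auto simp: dbound_def)
  hence n: "nat (k + 1) = Suc (nat k)" by simp
  show ?thesis unfolding bform_def n sum.atMost_Suc_shift
    by (simp add: hom_zero sum_distrib_left mult_ac)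
qed simp

lemma bform_Suc:
  assumes "dbound k p"
  shows "bform h (k + 1) p U V = V * bform h k p U V"
proof (cases "p = 0")
  case False
  with assms have k: "k \<ge> 0" by (auto simp: dbound_def)
  hence n: "nat (k + 1) = Suc (nat k)" by simp
  have "coeff p (Suc (nat k)) = 0" by (rule dbound_coeff[OF assms]) (use k in simp)
  moreover have "(\<Sum>i\<le>nat k. h (coeff p i) * U ^ i * V ^ (Suc (nat k) - i))
      = (\<Sum>i\<le>nat k. V * (h (coeff p i) * U ^ i * V ^ (nat k - i)))"
    by (rule sum.cong) (auto simp: Suc_diff_le mult_ac)
  ultimately show ?thesis unfolding bform_def n by (simp add: hom_zero sum_distrib_left)
qed simp

lemma bform_add_nat:
  assumes "dbound k p"
  shows "bform h (k + int j) p U V = V ^ j * bform h k p U V"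
proof (induction j)
  case (Suc j)
  have "bform h (k + int j + 1) p U V = V * bform h (k + int j) p U V"
    by (rule bform_Suc) (rule dbound_mono[OF assms], simp)
  with Suc show ?case by (simp add: add_ac mult_ac)
qed simp

lemma bform_mult:
  assumes "dbound j p" "dbound k q"
  shows "bform h (j + k) (p * q) U V = bform h j p U V * bform h k q U V"
  using assms(1)
proof (induction p arbitrary: j)
  case (pCons a p)
  have j: "j \<ge> 0" using pCons.prems pCons.hyps by (auto simp: dbound_def)
  have p: "dbound (j - 1) p" using pCons.prems by (rule dbound_pConsD)
  have "pCons a p * q = smult a q + pCons 0 (p * q)" by simp
  moreover have "bform h (j + k) (smult a q) U V = h a * (V ^ nat j * bform h k q U V)"
    using bform_add_nat[OF assms(2), of "nat j" U V] j by (simp add: bform_smult add_ac)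
  moreover have "bform h (j + k) (pCons 0 (p * q)) U V = U * (bform h (j - 1) p U V * bform h k q U V)"
    using bform_pCons_0[OF dbound_mult[OF p assms(2)], of U V] pCons.IH[OF p] by (simp add: algebra_simps)
  moreover have "bform h j (pCons a p) U V = h a * V ^ nat j + U * bform h (j - 1) p U V"
  proof -
    have "pCons a p = [:a:] + pCons 0 p" by simp
    moreover have "bform h j [:a:] U V = h a * V ^ nat j"
      using bform_add_nat[of 0 "[:a:]" "nat j" U V] j by (simp add: dbound_def bform_def[of h 0] mult_ac)
    ultimately show ?thesis using bform_pCons_0[OF p, of U V] by (simp only: bform_add) simp
  qed
  ultimately show ?case by (simp add: bform_add algebra_simps)
qed simp

end

lemma bform_id_1: "dbound k p \<Longrightarrow> bform id k p x 1 = poly p x"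
proof (cases "p = 0")
  case False
  assume "dbound k p"
  with False have "degree p \<le> nat k" by (auto simp: dbound_def)
  hence "(\<Sum>i\<le>degree p. coeff p i * x ^ i) = (\<Sum>i\<le>nat k. coeff p i * x ^ i)"
    by (intro sum.mono_neutral_left) (auto simp: coeff_eq_0)
  thus ?thesis by (simp add: bform_def poly_altdef)
qed (simp add: bform_def)

section \<open>Normal forms on the curve\<close>

text \<open>Over an algebraically closed field the pencil of quadrics through the curve can be
  diagonalised. In such coordinates \<open>u, v, m, n\<close> the curve is given by two equations
  expressing \<open>m\<^sup>2\<close> and \<open>n\<^sup>2\<close> by \<open>u\<^sup>2\<close> and \<open>v\<^sup>2\<close>.\<close>

definition frame :: "'a::field \<Rightarrow> 'a \<Rightarrow> 'a \<Rightarrow> 'a \<Rightarrow> 'a \<Rightarrow> (4, 'a) mpoly \<Rightarrow> (4, 'a) mpoly \<Rightarrow>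
    (4, 'a) mpoly \<Rightarrow> (4, 'a) mpoly \<Rightarrow> bool" where
  "frame d \<alpha> \<beta> \<gamma> \<delta> u v m n \<longleftrightarrow>
     \<alpha> \<noteq> 0 \<and> \<beta> \<noteq> 0 \<and> \<gamma> \<noteq> 0 \<and> \<delta> \<noteq> 0 \<and> \<alpha> * \<delta> \<noteq> \<beta> * \<gamma> \<and>
     homogeneous 1 u \<and> homogeneous 1 v \<and> homogeneous 1 m \<and> homogeneous 1 n \<and>
     (\<forall>i. \<exists>a b c e. Var i = Const a * u + Const b * v + Const c * m + Const e * n) \<and>
     (\<forall>x. cone (fps_const d) x \<longrightarrow>
        fe x m ^ 2 = fps_const \<alpha> * fe x u ^ 2 + fps_const \<beta> * fe x v ^ 2 \<and>
        fe x n ^ 2 = fps_const \<gamma> * fe x u ^ 2 + fps_const \<delta> * fe x v ^ 2) \<and>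
     (\<forall>U V M N. M ^ 2 = fps_const \<alpha> * U ^ 2 + fps_const \<beta> * V ^ 2 \<longrightarrow>
        N ^ 2 = fps_const \<gamma> * U ^ 2 + fps_const \<delta> * V ^ 2 \<longrightarrow>
        (\<exists>x. cone (fps_const d) x \<and> fe x u = U \<and> fe x v = V \<and> fe x m = M \<and> fe x n = N))"

text \<open>With \<open>u, v = A + k B, A - k B\<close> one has
  \<open>2 (A^2 - D B^2) = u^2 + v^2\<close> and \<open>4 A B = l (u^2 - v^2)\<close>; the pair
  \<open>m, n = C + i E, C - i E\<close> diagonalises \<open>C E\<close> and
  \<open>C^2 - E^2\<close> in the same way. The two quadrics then prescribe \<open>m^2 - n^2\<close>
  and \<open>m^2 + n^2\<close>.\<close>

lemma frame_equations:
  fixes A B C E D k l i :: "'b::comm_ring_1"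
  assumes K: "k ^ 2 = - D" "i ^ 2 = - 1" "k * l = 1"
    and q: "A ^ 2 - D * B ^ 2 = C * E" "C ^ 2 - E ^ 2 = 4 * A * B"
  shows "(C + i * E) ^ 2 = (l + i) * (A + k * B) ^ 2 + (i - l) * (A - k * B) ^ 2"
    "(C - i * E) ^ 2 = (l - i) * (A + k * B) ^ 2 + (- i - l) * (A - k * B) ^ 2"
proof -
  have r: "C ^ 2 + i ^ 2 * E ^ 2 = 4 * (k * l) * (A * B)" "A ^ 2 + k ^ 2 * B ^ 2 = C * E"
    using q by (simp_all add: K)
  have "(C + i * E) ^ 2 = (C ^ 2 + i ^ 2 * E ^ 2) + 2 * i * (C * E)"
    "(C - i * E) ^ 2 = (C ^ 2 + i ^ 2 * E ^ 2) - 2 * i * (C * E)"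
    "(l + i) * (A + k * B) ^ 2 + (i - l) * (A - k * B) ^ 2
      = 4 * (k * l) * (A * B) + 2 * i * (A ^ 2 + k ^ 2 * B ^ 2)"
    "(l - i) * (A + k * B) ^ 2 + (- i - l) * (A - k * B) ^ 2
      = 4 * (k * l) * (A * B) - 2 * i * (A ^ 2 + k ^ 2 * B ^ 2)"
    by (simp_all add: power2_eq_square algebra_simps)
  thus "(C + i * E) ^ 2 = (l + i) * (A + k * B) ^ 2 + (i - l) * (A - k * B) ^ 2"
    "(C - i * E) ^ 2 = (l - i) * (A + k * B) ^ 2 + (- i - l) * (A - k * B) ^ 2"
    by (simp_all only: r)
qed

lemma frame_equations_inverse:
  fixes U V M N D h k l i :: "'b::comm_ring_1"
  assumes K: "k ^ 2 = - D" "i ^ 2 = - 1" "k * l = 1" "2 * h = 1"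
    and q: "M ^ 2 = (l + i) * U ^ 2 + (i - l) * V ^ 2" "N ^ 2 = (l - i) * U ^ 2 + (- i - l) * V ^ 2"
  defines "A \<equiv> h * (U + V)" and "B \<equiv> h * l * (U - V)" and "C \<equiv> h * (M + N)" and "E \<equiv> - h * i * (M - N)"
  shows "A ^ 2 - D * B ^ 2 = C * E" "C ^ 2 - E ^ 2 = 4 * A * B"
    "A + k * B = U" "A - k * B = V" "C + i * E = M" "C - i * E = N"
proof -
  have r: "M ^ 2 - N ^ 2 = 2 * i * (U ^ 2 + V ^ 2)" "M ^ 2 + N ^ 2 = 2 * l * (U ^ 2 - V ^ 2)"
    unfolding q by (simp_all add: algebra_simps)
  have D: "D = - (k ^ 2)" by (simp add: K)
  have "A ^ 2 - D * B ^ 2 = h ^ 2 * ((U + V) ^ 2 + (k * l) ^ 2 * (U - V) ^ 2)"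
    unfolding A_def B_def D by (simp add: power2_eq_square algebra_simps)
  also have "\<dots> = - (h ^ 2 * 2 * i ^ 2 * (U ^ 2 + V ^ 2))"
    unfolding K by (simp add: power2_eq_square algebra_simps)
  also have "\<dots> = - (h ^ 2 * i * (M ^ 2 - N ^ 2))"
    unfolding r by (simp add: power2_eq_square algebra_simps)
  also have "\<dots> = C * E"
    unfolding C_def E_def by (simp add: power2_eq_square algebra_simps)
  finally show "A ^ 2 - D * B ^ 2 = C * E" .
  have "C ^ 2 - E ^ 2 = h ^ 2 * ((M + N) ^ 2 - i ^ 2 * (M - N) ^ 2)"
    unfolding C_def E_def by (simp add: power2_eq_square algebra_simps)
  also have "\<dots> = h ^ 2 * 2 * (M ^ 2 + N ^ 2)"
    unfolding K by (simp add: power2_eq_square algebra_simps)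
  also have "\<dots> = 4 * A * B"
    unfolding r A_def B_def by (simp add: power2_eq_square algebra_simps)
  finally show "C ^ 2 - E ^ 2 = 4 * A * B" .
  have f: "A + k * B = h * (U + V) + h * (k * l) * (U - V)" "A - k * B = h * (U + V) - h * (k * l) * (U - V)"
    "C + i * E = h * (M + N) - h * i ^ 2 * (M - N)" "C - i * E = h * (M + N) + h * i ^ 2 * (M - N)"
    unfolding A_def B_def C_def E_def by (simp_all add: power2_eq_square algebra_simps)
  have g: "h * (U + V) + h * 1 * (U - V) = (2 * h) * U" "h * (U + V) - h * 1 * (U - V) = (2 * h) * V"
    "h * (M + N) - h * - 1 * (M - N) = (2 * h) * M" "h * (M + N) + h * - 1 * (M - N) = (2 * h) * N"
    by (simp_all add: algebra_simps)
  show "A + k * B = U" "A - k * B = V" "C + i * E = M" "C - i * E = N"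
    unfolding f K g by simp_all
qed

lemma frame_exists:
  fixes d :: "'a::alg_closed_field"
  assumes two: "(2::'a) \<noteq> 0" and d0: "d \<noteq> 0" and d1: "d \<noteq> 1"
  obtains \<alpha> \<beta> \<gamma> \<delta> u v m n where "frame d \<alpha> \<beta> \<gamma> \<delta> u v m n"
proof -
  obtain k i :: 'a where k: "k ^ 2 = - d" and i: "i ^ 2 = - 1"
    using sqrt_exists by metis
  define l where "l = inverse k"
  have k0: "k \<noteq> 0" using k d0 by auto
  have i0: "i \<noteq> 0" using i by auto
  have kl: "k * l = 1" using k0 by (simp add: l_def)
  have "l ^ 2 * d = - ((k * l) ^ 2)" by (simp add: power_mult_distrib k)
  hence l2: "l ^ 2 * d = - 1" by (simp add: kl)
  \<comment> \<open>Since \<open>l^2 d = -1\<close>, the value \<open>l^2 = -1\<close> would mean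
    \<open>d = 1\<close>. As \<open>(l + i) (l - i) = l^2 + 1\<close>, this keeps all four
    coefficients of the frame nonzero.\<close>
  have "l ^ 2 + 1 \<noteq> 0"
  proof
    assume "l ^ 2 + 1 = 0"
    hence "l ^ 2 = - 1" by (simp add: eq_neg_iff_add_eq_0)
    with l2 d1 show False by simp
  qed
  moreover have "(l + i) * (l - i) = l ^ 2 + 1"
  proof -
    have "(l + i) * (l - i) = l ^ 2 - i ^ 2" by (simp add: algebra_simps power2_eq_square)
    thus ?thesis by (simp add: i)
  qed
  ultimately have "(l + i) * (l - i) \<noteq> 0" by (rule ssubst[rotated])
  hence nz: "l + i \<noteq> 0" "i - l \<noteq> 0" "l - i \<noteq> 0" "- i - l \<noteq> 0"
    by (auto simp: algebra_simps add_eq_0_iff)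
  have "(i - l) * (l - i) - (l + i) * (- i - l) = 2 * 2 * (i * l)"
    by (simp add: algebra_simps)
  moreover have "2 * 2 * (i * l) \<noteq> 0"
    using two i0 kl by (intro no_zero_divisors) auto
  ultimately have dt: "(l + i) * (- i - l) \<noteq> (i - l) * (l - i)"
    by (metis diff_self)
  define u v m n :: "(4, 'a) mpoly" where uvmn: "u = Var 0 + Const k * Var 2" "v = Var 0 - Const k * Var 2"
    "m = Var 1 + Const i * Var 3" "n = Var 1 - Const i * Var 3"
  define h where "h = inverse (2::'a)"
  have h: "2 * h = 1" using two by (simp add: h_def)
  let ?c = "fps_const :: 'a \<Rightarrow> 'a fps"
  have K: "?c k ^ 2 = - ?c d" "?c i ^ 2 = - 1" "?c k * ?c l = 1" "2 * ?c h = 1"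
    by (simp_all add: fps_const_power k i kl numeral_fps_const h)
  have "frame d (l + i) (i - l) (l - i) (- i - l) u v m n"
    unfolding frame_def
  proof (intro conjI allI impI)
    show "homogeneous 1 u" "homogeneous 1 v" "homogeneous 1 m" "homogeneous 1 n"
      unfolding uvmn by (intro homogeneous_add homogeneous_diff homogeneous_Const_mult homogeneous_Var)+
  next
    have "h * 2 = 1" "l * k = 1" "i * i = - 1"
      using h kl i by (simp_all add: mult.commute power2_eq_square)
    hence "Const (h * 2) = (1 :: (4, 'a) mpoly)" "Const (l * k) = (1 :: (4, 'a) mpoly)"
      "Const (i * i) = (- 1 :: (4, 'a) mpoly)"
      by (simp_all only: ev_C.hom_uminus Const_1)
    hence e: "Const h * 2 = (1 :: (4, 'a) mpoly)" "Const l * Const k = (1 :: (4, 'a) mpoly)"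
      "Const i * Const i = (- 1 :: (4, 'a) mpoly)"
      by (simp_all only: Const_mult ev_C.hom_numeral)
    have "Var 0 = Const h * u + Const h * v + Const 0 * m + Const 0 * n"
      "Var 1 = Const 0 * u + Const 0 * v + Const h * m + Const h * n"
      "Var 2 = Const (h * l) * u + Const (- h * l) * v + Const 0 * m + Const 0 * n"
      "Var 3 = Const 0 * u + Const 0 * v + Const (- h * i) * m + Const (h * i) * n"
    proof -
      have "Const h * u + Const h * v = (Const h * 2) * Var 0"
        "Const h * m + Const h * n = (Const h * 2) * Var 1"
        "Const h * Const l * u + - (Const h * Const l) * v = (Const h * 2) * (Const l * Const k) * Var 2"
        "- (Const h * Const i) * m + Const h * Const i * n = - ((Const h * 2) * (Const i * Const i) * Var 3)"
        unfolding uvmn by (simp_all add: algebra_simps)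
      thus "Var 0 = Const h * u + Const h * v + Const 0 * m + Const 0 * n"
        "Var 1 = Const 0 * u + Const 0 * v + Const h * m + Const h * n"
        "Var 2 = Const (h * l) * u + Const (- h * l) * v + Const 0 * m + Const 0 * n"
        "Var 3 = Const 0 * u + Const 0 * v + Const (- h * i) * m + Const (h * i) * n"
        using e by (simp_all add: Const_mult ev_C.hom_uminus)
    qed
    thus "\<exists>a b c e. Var j = Const a * u + Const b * v + Const c * m + Const e * n" for j
      by (cases "j = 0 \<or> j = 1 \<or> j = 2 \<or> j = 3") (use UNIV_4 in \<open>blast+\<close>)
  next
    fix x assume "cone (?c d) x"
    hence q: "x 0 ^ 2 - ?c d * x 2 ^ 2 = x 1 * x 3" "x 1 ^ 2 - x 3 ^ 2 = 4 * x 0 * x 2"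
      by (simp_all add: cone_def)
    show "fe x m ^ 2 = ?c (l + i) * fe x u ^ 2 + ?c (i - l) * fe x v ^ 2"
      "fe x n ^ 2 = ?c (l - i) * fe x u ^ 2 + ?c (- i - l) * fe x v ^ 2"
      unfolding uvmn fe_simps fps_const_add[symmetric] fps_const_sub[symmetric] fps_const_neg[symmetric]
      by (rule frame_equations[OF K(1-3) q])+
  next
    fix U V M N
    assume MN: "M ^ 2 = ?c (l + i) * U ^ 2 + ?c (i - l) * V ^ 2"
      "N ^ 2 = ?c (l - i) * U ^ 2 + ?c (- i - l) * V ^ 2"
    define x where "x = quad (?c h * (U + V)) (?c h * (M + N)) (?c h * ?c l * (U - V)) (- ?c h * ?c i * (M - N))"
    note e = frame_equations_inverse[OF K MN[folded fps_const_add fps_const_sub fps_const_neg]]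
    have 1: "cone (?c d) x"
      unfolding x_def cone_def quad_simps using e(1,2) by blast
    have 2: "fe x u = U" "fe x v = V" "fe x m = M" "fe x n = N"
      unfolding uvmn fe_simps x_def quad_simps by (rule e)+
    from 1 2 show "\<exists>x. cone (?c d) x \<and> fe x u = U \<and> fe x v = V \<and> fe x m = M \<and> fe x n = N"
      by blast
  qed (use nz dt in auto)
  thus ?thesis by (rule that)
qed

lemma frame_swap: "frame d \<alpha> \<beta> \<gamma> \<delta> u v m n \<Longrightarrow> frame d \<beta> \<alpha> \<delta> \<gamma> v u m n"
  unfolding frame_def by (auto simp: ac_simps) (metis add.commute)+

lemma linear_system_2:
  fixes a b c e D :: "'b::comm_ring_1"
  assumes "D * (a * e - b * c) = 1"
  shows "x = D * e * y + - D * b * z \<and> w = - D * c * y + D * a * z \<longleftrightarrow> y = a * x + b * w \<and> z = c * x + e * w"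
proof -
  have "a * (D * e * y + - D * b * z) + b * (- D * c * y + D * a * z) = D * (a * e - b * c) * y"
    "c * (D * e * y + - D * b * z) + e * (- D * c * y + D * a * z) = D * (a * e - b * c) * z"
    "D * e * (a * x + b * w) + - D * b * (c * x + e * w) = D * (a * e - b * c) * x"
    "- D * c * (a * x + b * w) + D * a * (c * x + e * w) = D * (a * e - b * c) * w"
    by (simp_all add: algebra_simps)
  with assms show ?thesis by auto
qed

text \<open>Cramer's rule solves the two equations for \<open>u^2\<close> and \<open>v^2\<close>, so
  the pairs \<open>u, v\<close> and \<open>m, n\<close> can change places and either of them can
  serve as projection to a line.\<close>

lemma frame_flip:
  fixes d :: "'a::field"
  assumes f: "frame d \<alpha> \<beta> \<gamma> \<delta> u v m n"
  defines "D \<equiv> inverse (\<alpha> * \<delta> - \<beta> * \<gamma>)"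
  shows "frame d (D * \<delta>) (- D * \<beta>) (- D * \<gamma>) (D * \<alpha>) m n u v"
proof -
  let ?c = "fps_const :: 'a \<Rightarrow> 'a fps"
  have nz: "\<alpha> \<noteq> 0" "\<beta> \<noteq> 0" "\<gamma> \<noteq> 0" "\<delta> \<noteq> 0" "D \<noteq> 0" and D: "D * (\<alpha> * \<delta> - \<beta> * \<gamma>) = 1"
    using f by (auto simp: frame_def D_def)
  have D': "?c D * (?c \<alpha> * ?c \<delta> - ?c \<beta> * ?c \<gamma>) = 1"
    using D by simp
  have inv: "U ^ 2 = ?c (D * \<delta>) * M ^ 2 + ?c (- D * \<beta>) * N ^ 2 \<and>
        V ^ 2 = ?c (- D * \<gamma>) * M ^ 2 + ?c (D * \<alpha>) * N ^ 2 \<longleftrightarrow>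
      M ^ 2 = ?c \<alpha> * U ^ 2 + ?c \<beta> * V ^ 2 \<and> N ^ 2 = ?c \<gamma> * U ^ 2 + ?c \<delta> * V ^ 2" for U V M N
    unfolding fps_const_mult[symmetric] fps_const_neg[symmetric] by (rule linear_system_2[OF D'])
  have dt: "(D * \<delta>) * (D * \<alpha>) \<noteq> (- D * \<beta>) * (- D * \<gamma>)"
  proof
    assume "(D * \<delta>) * (D * \<alpha>) = (- D * \<beta>) * (- D * \<gamma>)"
    moreover have "D * (D * (\<alpha> * \<delta> - \<beta> * \<gamma>)) = (D * \<delta>) * (D * \<alpha>) - (- D * \<beta>) * (- D * \<gamma>)"
      by (simp add: algebra_simps)
    ultimately have "D * (D * (\<alpha> * \<delta> - \<beta> * \<gamma>)) = 0" by simp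
    with D nz show False by simp
  qed
  have v: "\<exists>a b c e. Var i = Const a * m + Const b * n + Const c * u + Const e * v" for i
  proof -
    from f obtain a b c e where "Var i = Const a * u + Const b * v + Const c * m + Const e * n"
      unfolding frame_def by blast
    hence "Var i = Const c * m + Const e * n + Const a * u + Const b * v" by simp
    thus ?thesis by blast
  qed
  show ?thesis unfolding frame_def
  proof (intro conjI allI impI v dt)
    fix x assume "cone (?c d) x"
    with f inv show "fe x u ^ 2 = ?c (D * \<delta>) * fe x m ^ 2 + ?c (- D * \<beta>) * fe x n ^ 2"
      "fe x v ^ 2 = ?c (- D * \<gamma>) * fe x m ^ 2 + ?c (D * \<alpha>) * fe x n ^ 2"
      unfolding frame_def by blast+
  next
    fix M N U V
    assume "U ^ 2 = ?c (D * \<delta>) * M ^ 2 + ?c (- D * \<beta>) * N ^ 2"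
      "V ^ 2 = ?c (- D * \<gamma>) * M ^ 2 + ?c (D * \<alpha>) * N ^ 2"
    with inv have "M ^ 2 = ?c \<alpha> * U ^ 2 + ?c \<beta> * V ^ 2 \<and> N ^ 2 = ?c \<gamma> * U ^ 2 + ?c \<delta> * V ^ 2"
      by blast
    with f show "\<exists>x. cone (?c d) x \<and> fe x m = M \<and> fe x n = N \<and> fe x u = U \<and> fe x v = V"
      unfolding frame_def by blast
  qed (use f nz in \<open>auto simp: frame_def\<close>)
qed

lemma frame_relation:
  assumes f: "frame d \<alpha> \<beta> \<gamma> \<delta> u v m n" and P: "cone d P"
  shows "mp_eval P m ^ 2 = \<alpha> * mp_eval P u ^ 2 + \<beta> * mp_eval P v ^ 2"
    "mp_eval P n ^ 2 = \<gamma> * mp_eval P u ^ 2 + \<delta> * mp_eval P v ^ 2"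
proof -
  from P have "cone (fps_const d) (\<lambda>i. fps_const (P i))" by (simp add: cone_const_iff)
  with f have "fps_const (mp_eval P m) ^ 2 = fps_const \<alpha> * fps_const (mp_eval P u) ^ 2 + fps_const \<beta> * fps_const (mp_eval P v) ^ 2"
    "fps_const (mp_eval P n) ^ 2 = fps_const \<gamma> * fps_const (mp_eval P u) ^ 2 + fps_const \<delta> * fps_const (mp_eval P v) ^ 2"
    unfolding frame_def fe_const[symmetric] by blast+
  thus "mp_eval P m ^ 2 = \<alpha> * mp_eval P u ^ 2 + \<beta> * mp_eval P v ^ 2"
    "mp_eval P n ^ 2 = \<gamma> * mp_eval P u ^ 2 + \<delta> * mp_eval P v ^ 2"
    unfolding fps_const_power fps_const_mult fps_const_add fps_const_eq_iff .
qed

lemma frame_eq_0: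
  assumes f: "frame d \<alpha> \<beta> \<gamma> \<delta> u v m n"
    and "mp_eval P u = 0" "mp_eval P v = 0" "mp_eval P m = 0" "mp_eval P n = 0"
  shows "P = (\<lambda>_. 0)"
proof
  fix i
  from f obtain a b c e where "Var i = Const a * u + Const b * v + Const c * m + Const e * n"
    unfolding frame_def by blast
  from arg_cong[OF this, of "mp_eval P"] show "P i = 0" using assms by simp
qed

lemma frame_point:
  assumes f: "frame d \<alpha> \<beta> \<gamma> \<delta> u v m n"
    and r: "m1 ^ 2 = \<alpha> * u1 ^ 2 + \<beta> * v1 ^ 2" "n1 ^ 2 = \<gamma> * u1 ^ 2 + \<delta> * v1 ^ 2"
    and nz: "\<not> (u1 = 0 \<and> v1 = 0)"
  obtains P where "P \<in> curve d" "mp_eval P u = u1" "mp_eval P v = v1" "mp_eval P m = m1" "mp_eval P n = n1"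
proof -
  let ?c = "fps_const"
  have "?c m1 ^ 2 = ?c \<alpha> * ?c u1 ^ 2 + ?c \<beta> * ?c v1 ^ 2" "?c n1 ^ 2 = ?c \<gamma> * ?c u1 ^ 2 + ?c \<delta> * ?c v1 ^ 2"
    unfolding fps_const_power fps_const_mult fps_const_add fps_const_eq_iff by (rule r)+
  with f obtain x where x: "cone (?c d) x" "fe x u = ?c u1" "fe x v = ?c v1" "fe x m = ?c m1" "fe x n = ?c n1"
    unfolding frame_def by blast
  let ?P = "\<lambda>i. x i $ 0"
  have e: "mp_eval ?P u = u1" "mp_eval ?P v = v1" "mp_eval ?P m = m1" "mp_eval ?P n = n1"
    using x(2-) by (simp_all flip: fe_nth_0)
  moreover have "cone d ?P" using x(1) by (rule cone_nth_0)
  moreover have "?P \<noteq> (\<lambda>_. 0)"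
  proof
    assume z: "?P = (\<lambda>_. 0)"
    have "mp_eval (\<lambda>i. 0 * ?P i) G = 0" if "homogeneous 1 G" for G
      using mp_eval_homogeneous_scale[OF that, of 0 ?P] by simp
    hence "mp_eval ?P u = 0" "mp_eval ?P v = 0" using f z by (auto simp: frame_def)
    with e nz show False by simp
  qed
  ultimately show ?thesis using that by (simp add: curve_iff)
qed

text \<open>At most one of the four coordinates vanishes at a point: two of the squares determine
  the other two, with nonzero coefficients and determinant, so two zeros would force all four.
  Swapping and flipping makes \<open>u\<close> the one that may vanish. The projection to
  \<open>(u : v)\<close> is then unramified at \<open>P\<close>.\<close>

lemma frame_at:
  fixes d :: "'a::alg_closed_field"
  assumes two: "(2::'a) \<noteq> 0" and d0: "d \<noteq> 0" and d1: "d \<noteq> 1" and P: "P \<in> curve d"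
  obtains \<alpha> \<beta> \<gamma> \<delta> u v m n where "frame d \<alpha> \<beta> \<gamma> \<delta> u v m n"
    "mp_eval P v \<noteq> 0" "mp_eval P m \<noteq> 0" "mp_eval P n \<noteq> 0"
proof -
  obtain \<alpha> \<beta> \<gamma> \<delta> u v m n where f: "frame d \<alpha> \<beta> \<gamma> \<delta> u v m n"
    using frame_exists[OF two d0 d1] by blast
  let ?e = "mp_eval P"
  from P have P': "cone d P" "P \<noteq> (\<lambda>_. 0)" by (simp_all add: curve_iff)
  note r = frame_relation[OF f P'(1)]
  have z: "\<not> (?e u = 0 \<and> ?e v = 0 \<and> ?e m = 0 \<and> ?e n = 0)"
    using frame_eq_0[OF f] P'(2) by blast
  have nz: "\<alpha> \<noteq> 0" "\<beta> \<noteq> 0" "\<gamma> \<noteq> 0" "\<delta> \<noteq> 0" "\<alpha> * \<delta> - \<beta> * \<gamma> \<noteq> 0"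
    using f by (auto simp: frame_def)
  show ?thesis
  proof (cases "?e m \<noteq> 0 \<and> ?e n \<noteq> 0")
    case True
    with r have "?e u \<noteq> 0 \<or> ?e v \<noteq> 0" by auto
    with True that[OF f] that[OF frame_swap[OF f]] show ?thesis by auto
  next
    case False
    have uv: "?e u \<noteq> 0 \<and> ?e v \<noteq> 0"
    proof (rule ccontr)
      assume "\<not> (?e u \<noteq> 0 \<and> ?e v \<noteq> 0)"
      with r False nz z show False by auto
    qed
    have "\<not> (?e m = 0 \<and> ?e n = 0)"
    proof
      assume "?e m = 0 \<and> ?e n = 0"
      with r have "\<alpha> * ?e u ^ 2 + \<beta> * ?e v ^ 2 = 0" "\<gamma> * ?e u ^ 2 + \<delta> * ?e v ^ 2 = 0" by auto
      moreover have "(\<alpha> * \<delta> - \<beta> * \<gamma>) * ?e v ^ 2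
          = \<alpha> * (\<gamma> * ?e u ^ 2 + \<delta> * ?e v ^ 2) - \<gamma> * (\<alpha> * ?e u ^ 2 + \<beta> * ?e v ^ 2)"
        by (simp add: algebra_simps)
      ultimately have "(\<alpha> * \<delta> - \<beta> * \<gamma>) * ?e v ^ 2 = 0" by simp
      with uv nz show False by simp
    qed
    with uv that[OF frame_flip[OF f]] that[OF frame_swap[OF frame_flip[OF f]]] show ?thesis by auto
  qed
qed

section \<open>Normal forms over the binary forms in u and v\<close>

definition qform :: "('a::comm_ring_1 \<Rightarrow> 'b::comm_ring_1) \<Rightarrow> int \<Rightarrow> 'a poly \<Rightarrow> 'a poly \<Rightarrow> 'a poly \<Rightarrow>
    'a poly \<Rightarrow> 'b \<Rightarrow> 'b \<Rightarrow> 'b \<Rightarrow> 'b \<Rightarrow> 'b" where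
  "qform h k a b c e U V M N = bform h k a U V + bform h (k - 1) b U V * M
     + bform h (k - 1) c U V * N + bform h (k - 2) e U V * M * N"

definition qbound :: "int \<Rightarrow> 'a::comm_ring_1 poly \<Rightarrow> 'a poly \<Rightarrow> 'a poly \<Rightarrow> 'a poly \<Rightarrow> bool" where
  "qbound k a b c e \<longleftrightarrow> dbound k a \<and> dbound (k - 1) b \<and> dbound (k - 1) c \<and> dbound (k - 2) e"

definition qpoly :: "'a::comm_ring_1 \<Rightarrow> 'a \<Rightarrow> 'a poly" where
  "qpoly \<alpha> \<beta> = [:\<beta>, 0, \<alpha>:]"

lemma dbound_qpoly: "dbound 2 (qpoly \<alpha> \<beta>)"
  by (simp add: qpoly_def dbound_def)

lemma poly_qpoly: "poly (qpoly \<alpha> \<beta>) x = \<alpha> * x ^ 2 + \<beta>"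
  by (simp add: qpoly_def power2_eq_square algebra_simps)

lemma (in coeff_hom) bform_qpoly: "bform h 2 (qpoly \<alpha> \<beta>) U V = h \<alpha> * U ^ 2 + h \<beta> * V ^ 2"
proof -
  have "{..nat 2} = {0, 1, 2::nat}" by auto
  thus ?thesis by (simp add: bform_def qpoly_def coeff_pCons hom_zero numeral_2_eq_2)
qed

lemma bform_nth_0: "bform fps_const k p U V $ 0 = bform id k p (U $ 0) (V $ 0)"
  by (simp add: bform_def fps_sum_nth fps_power_zeroth)

lemma qform_nth_0:
  "qform fps_const k a b c e U V M N $ 0 = qform id k a b c e (U $ 0) (V $ 0) (M $ 0) (N $ 0)"
  by (simp add: qform_def bform_nth_0)

text \<open>The identity is demanded at all power series points of the cone. Constant series give
  values at points and nonconstant ones give series along arcs, so one statement serves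
  both.\<close>

definition normal_form :: "'a::field \<Rightarrow> (4, 'a) mpoly \<Rightarrow> (4, 'a) mpoly \<Rightarrow> (4, 'a) mpoly \<Rightarrow>
    (4, 'a) mpoly \<Rightarrow> int \<Rightarrow> (4, 'a) mpoly \<Rightarrow> 'a poly \<Rightarrow> 'a poly \<Rightarrow> 'a poly \<Rightarrow> 'a poly \<Rightarrow> bool" where
  "normal_form d u v m n k F a b c e \<longleftrightarrow> qbound k a b c e \<and>
     (\<forall>x. cone (fps_const d) x \<longrightarrow>
        fe x F = qform fps_const k a b c e (fe x u) (fe x v) (fe x m) (fe x n))"

lemma normal_form_add:
  "normal_form d u v m n k F a b c e \<Longrightarrow> normal_form d u v m n k G a' b' c' e' \<Longrightarrow>
   normal_form d u v m n k (F + G) (a + a') (b + b') (c + c') (e + e')"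
  by (simp add: normal_form_def qbound_def dbound_add qform_def ev_fps.bform_add algebra_simps)

lemma normal_form_Const_mult:
  "normal_form d u v m n k F a b c e \<Longrightarrow>
   normal_form d u v m n k (Const s * F) (smult s a) (smult s b) (smult s c) (smult s e)"
  by (simp add: normal_form_def qbound_def dbound_smult qform_def ev_fps.bform_smult algebra_simps)

lemma normal_form_mult_u:
  assumes "normal_form d u v m n k F a b c e"
  shows "normal_form d u v m n (k + 1) (u * F) (pCons 0 a) (pCons 0 b) (pCons 0 c) (pCons 0 e)"
proof -
  have q: "dbound k a" "dbound (k - 1) b" "dbound (k - 1) c" "dbound (k - 2) e"
    using assms by (simp_all add: normal_form_def qbound_def)
  note dbound_pCons_0[OF q(1)] dbound_pCons_0[OF q(2)] dbound_pCons_0[OF q(3)] dbound_pCons_0[OF q(4)]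
  moreover note ev_fps.bform_pCons_0[OF q(1)] ev_fps.bform_pCons_0[OF q(2)]
    ev_fps.bform_pCons_0[OF q(3)] ev_fps.bform_pCons_0[OF q(4)]
  moreover have "k - 2 + 1 = k - 1" by simp
  ultimately show ?thesis using assms
    by (simp add: normal_form_def qbound_def qform_def algebra_simps)
qed

lemma normal_form_mult_v:
  assumes "normal_form d u v m n k F a b c e"
  shows "normal_form d u v m n (k + 1) (v * F) a b c e"
proof -
  have q: "dbound k a" "dbound (k - 1) b" "dbound (k - 1) c" "dbound (k - 2) e"
    using assms by (simp_all add: normal_form_def qbound_def)
  have "dbound (k + 1) a" "dbound k b" "dbound k c" "dbound (k - 1) e"
    using q by (auto elim: dbound_mono)
  moreover note ev_fps.bform_Suc[OF q(1)] ev_fps.bform_Suc[OF q(2)]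
    ev_fps.bform_Suc[OF q(3)] ev_fps.bform_Suc[OF q(4)]
  moreover have "k - 2 + 1 = k - 1" by simp
  ultimately show ?thesis using assms
    by (simp add: normal_form_def qbound_def qform_def algebra_simps)
qed

text \<open>Multiplication by \<open>m\<close> permutes the basis \<open>1\<close>,
  \<open>m\<close>, \<open>n\<close>, \<open>m n\<close> up to the factor \<open>m^2\<close>, which
  on the curve is the binary form with dehomogenisation
  \<open>qpoly \<alpha> \<beta>\<close>.\<close>

lemma normal_form_mult_m:
  assumes f: "frame d \<alpha> \<beta> \<gamma> \<delta> u v m n" and F: "normal_form d u v m n k F a b c e"
  shows "normal_form d u v m n (k + 1) (m * F) (qpoly \<alpha> \<beta> * b) a (qpoly \<alpha> \<beta> * e) c"
proof -
  have q: "dbound k a" "dbound (k - 1) b" "dbound (k - 1) c" "dbound (k - 2) e"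
    using F by (simp_all add: normal_form_def qbound_def)
  have "dbound (k + 1) (qpoly \<alpha> \<beta> * b)" "dbound k (qpoly \<alpha> \<beta> * e)"
    using dbound_mult[OF dbound_qpoly q(2)] dbound_mult[OF dbound_qpoly q(4)]
    by (auto simp: algebra_simps)
  moreover have "bform fps_const (k + 1) (qpoly \<alpha> \<beta> * b) (fe x u) (fe x v)
        = fe x m ^ 2 * bform fps_const (k - 1) b (fe x u) (fe x v)"
      "bform fps_const k (qpoly \<alpha> \<beta> * e) (fe x u) (fe x v)
        = fe x m ^ 2 * bform fps_const (k - 2) e (fe x u) (fe x v)" if "cone (fps_const d) x" for x
  proof -
    have mm: "fe x m ^ 2 = bform fps_const 2 (qpoly \<alpha> \<beta>) (fe x u) (fe x v)"
      using f that by (simp add: frame_def ev_fps.bform_qpoly)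
    have "2 + (k - 1) = k + 1" "2 + (k - 2) = k" by simp_all
    thus "bform fps_const (k + 1) (qpoly \<alpha> \<beta> * b) (fe x u) (fe x v)
        = fe x m ^ 2 * bform fps_const (k - 1) b (fe x u) (fe x v)"
      "bform fps_const k (qpoly \<alpha> \<beta> * e) (fe x u) (fe x v)
        = fe x m ^ 2 * bform fps_const (k - 2) e (fe x u) (fe x v)"
      using ev_fps.bform_mult[OF dbound_qpoly q(2), where U="fe x u" and V="fe x v"]
        ev_fps.bform_mult[OF dbound_qpoly q(4), where U="fe x u" and V="fe x v"]
      unfolding mm by metis+
  qed
  moreover have "dbound (k - 1) c" by fact
  ultimately show ?thesis using F
    by (simp add: normal_form_def qbound_def qform_def algebra_simps power2_eq_square)
qed

lemma frame_swap_mn: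
  assumes f: "frame d \<alpha> \<beta> \<gamma> \<delta> u v m n"
  shows "frame d \<gamma> \<delta> \<alpha> \<beta> u v n m"
proof -
  have "\<exists>a b c e. Var i = Const a * u + Const b * v + Const c * n + Const e * m" for i
  proof -
    from f obtain a b c e where "Var i = Const a * u + Const b * v + Const c * m + Const e * n"
      unfolding frame_def by blast
    hence "Var i = Const a * u + Const b * v + Const e * n + Const c * m" by simp
    thus ?thesis by blast
  qed
  moreover have "\<gamma> * \<beta> \<noteq> \<delta> * \<alpha>" using f by (auto simp: frame_def mult.commute)
  ultimately show ?thesis using f unfolding frame_def by blast
qed

lemma normal_form_swap_mn: "normal_form d u v m n k F a b c e \<longleftrightarrow> normal_form d u v n m k F a c b e"
  by (auto simp: normal_form_def qbound_def qform_def algebra_simps)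

lemma normal_form_exists:
  assumes f: "frame d \<alpha> \<beta> \<gamma> \<delta> u v m n" and F: "homogeneous k F"
  obtains a b c e where "normal_form d u v m n (int k) F a b c e"
proof -
  have "\<exists>a b c e. normal_form d u v m n (int k) F a b c e"
    using F
  proof (induction rule: homogeneous_induct)
    case (Const s)
    have "normal_form d u v m n (int 0) (Const s) [:s:] 0 0 0"
      by (simp add: normal_form_def qbound_def qform_def dbound_def bform_def)
    thus ?case by blast
  next
    case (Var k i G)
    then obtain a b c e where G: "normal_form d u v m n (int k) G a b c e" by blast
    obtain p q r s where i: "Var i = Const p * u + Const q * v + Const r * m + Const s * n"
      using f unfolding frame_def by blast
    have "Var i * G = Const p * (u * G) + Const q * (v * G) + Const r * (m * G) + Const s * (n * G)"
      unfolding i by (simp add: algebra_simps)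
    moreover note nfs = normal_form_mult_u[OF G] normal_form_mult_v[OF G] normal_form_mult_m[OF f G]
      normal_form_mult_m[OF frame_swap_mn[OF f] G[unfolded normal_form_swap_mn[of d u v m]],
        unfolded normal_form_swap_mn[of d u v n]]
    ultimately show ?case
      using normal_form_add[OF normal_form_add[OF normal_form_add[OF normal_form_Const_mult[OF nfs(1), of p]
            normal_form_Const_mult[OF nfs(2), of q]] normal_form_Const_mult[OF nfs(3), of r]]
            normal_form_Const_mult[OF nfs(4), of s]]
      by (auto simp: add.commute)
  next
    case (add k F G)
    thus ?case by (blast intro: normal_form_add)
  qed
  thus ?thesis using that by blast
qed

lemma normal_form_mp_eval:
  assumes "normal_form d u v m n k F a b c e" "cone d P"
  shows "mp_eval P F = qform id k a b c e (mp_eval P u) (mp_eval P v) (mp_eval P m) (mp_eval P n)"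
proof -
  have "cone (fps_const d) (\<lambda>i. fps_const (P i))" using assms by (simp add: cone_const_iff)
  with assms(1) have "fe (\<lambda>i. fps_const (P i)) F $ 0 = qform fps_const k a b c e
      (fe (\<lambda>i. fps_const (P i)) u) (fe (\<lambda>i. fps_const (P i)) v)
      (fe (\<lambda>i. fps_const (P i)) m) (fe (\<lambda>i. fps_const (P i)) n) $ 0"
    by (simp add: normal_form_def)
  thus ?thesis by (simp add: qform_nth_0 fe_nth_0)
qed

lemma poly_0_if_infinite_roots:
  fixes p :: "'a::idom poly"
  assumes "finite S" "infinite (UNIV :: 'a set)" "\<And>x. x \<notin> S \<Longrightarrow> poly p x = 0"
  shows "p = 0"
proof (rule ccontr)
  assume "p \<noteq> 0"
  hence "finite {x. poly p x = 0}" by (rule poly_roots_finite)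
  hence "finite (S \<union> {x. poly p x = 0})" using assms(1) by simp
  moreover have "S \<union> {x. poly p x = 0} = UNIV" using assms(3) by blast
  ultimately show False using assms(2) by simp
qed

text \<open>The four equations are the values at the points over one value of \<open>u / v\<close>,
  which differ by the signs of \<open>M\<close> and \<open>N\<close>. Their sign matrix is the
  character table of the Klein four-group, invertible when two is.\<close>

lemma four_signs:
  fixes a b c e M N :: "'a::idom"
  assumes two: "(2::'a) \<noteq> 0"
    and "a + b * M + c * N + e * M * N = 0" "a - b * M + c * N - e * M * N = 0"
      "a + b * M - c * N - e * M * N = 0" "a - b * M - c * N + e * M * N = 0"
  shows "a = 0" "b * M = 0" "c * N = 0" "e * M * N = 0"
proof -
  have "2 * (2 * a) = (a + b * M + c * N + e * M * N) + (a - b * M + c * N - e * M * N) + (a + b * M - c * N - e * M * N) + (a - b * M - c * N + e * M * N)"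
    "2 * (2 * (b * M)) = (a + b * M + c * N + e * M * N) - (a - b * M + c * N - e * M * N) + (a + b * M - c * N - e * M * N) - (a - b * M - c * N + e * M * N)"
    "2 * (2 * (c * N)) = (a + b * M + c * N + e * M * N) + (a - b * M + c * N - e * M * N) - (a + b * M - c * N - e * M * N) - (a - b * M - c * N + e * M * N)"
    "2 * (2 * (e * M * N)) = (a + b * M + c * N + e * M * N) - (a - b * M + c * N - e * M * N) - (a + b * M - c * N - e * M * N) + (a - b * M - c * N + e * M * N)"
    by (simp_all add: algebra_simps)
  hence "2 * (2 * a) = 0" "2 * (2 * (b * M)) = 0" "2 * (2 * (c * N)) = 0" "2 * (2 * (e * M * N)) = 0"
    unfolding assms(2-) by simp_all
  with two show "a = 0" "b * M = 0" "c * N = 0" "e * M * N = 0"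
    by (metis mult_eq_0_iff)+
qed

lemma qpoly_nonzero: "\<alpha> \<noteq> 0 \<Longrightarrow> qpoly \<alpha> \<beta> \<noteq> 0"
  by (simp add: qpoly_def)

text \<open>Outside finitely many \<open>x\<close> the fibre of \<open>u / v\<close> over
  \<open>x\<close> has four points, and the sign argument kills the values of \<open>a\<close>,
  \<open>b\<close>, \<open>c\<close>, \<open>e\<close> at \<open>x\<close>. Polynomials with so many
  roots over an infinite field are zero.\<close>

lemma normal_form_vanish:
  fixes d :: "'a::alg_closed_field"
  assumes two: "(2::'a) \<noteq> 0" and f: "frame d \<alpha> \<beta> \<gamma> \<delta> u v m n"
    and F: "F \<in> curve_ideal d" and nf: "normal_form d u v m n k F a b c e"
  shows "a = 0" "b = 0" "c = 0" "e = 0"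
proof -
  let ?A = "qpoly \<alpha> \<beta>" and ?B = "qpoly \<gamma> \<delta>"
  let ?S = "{x. poly ?A x = 0} \<union> {x. poly ?B x = 0}"
  have fin: "finite ?S" using f by (auto simp: frame_def intro!: poly_roots_finite qpoly_nonzero)
  have q: "dbound k a" "dbound (k - 1) b" "dbound (k - 1) c" "dbound (k - 2) e"
    using nf by (simp_all add: normal_form_def qbound_def)
  have *: "poly a x = 0 \<and> poly b x = 0 \<and> poly c x = 0 \<and> poly e x = 0" if x: "x \<notin> ?S" for x
  proof -
    obtain M N where MN: "M ^ 2 = poly ?A x" "N ^ 2 = poly ?B x" using sqrt_exists by metis
    with x have nz: "M \<noteq> 0" "N \<noteq> 0" by auto
    have v: "poly a x + poly b x * M' + poly c x * N' + poly e x * M' * N' = 0"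
      if "M' ^ 2 = M ^ 2" "N' ^ 2 = N ^ 2" for M' N'
    proof -
      have "M' ^ 2 = \<alpha> * x ^ 2 + \<beta> * 1 ^ 2" "N' ^ 2 = \<gamma> * x ^ 2 + \<delta> * 1 ^ 2"
        using that MN by (simp_all add: poly_qpoly)
      from frame_point[OF f this] obtain P where P: "P \<in> curve d" "mp_eval P u = x" "mp_eval P v = 1"
        "mp_eval P m = M'" "mp_eval P n = N'" by auto
      have "cone d P" using P by (simp add: curve_iff)
      moreover have "mp_eval P F = 0" using P F by (simp add: curve_ideal_def)
      ultimately show ?thesis using normal_form_mp_eval[OF nf, of P] P q
        by (simp add: qform_def bform_id_1)
    qed
    have "poly a x + poly b x * M + poly c x * N + poly e x * M * N = 0"
      "poly a x - poly b x * M + poly c x * N - poly e x * M * N = 0"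
      "poly a x + poly b x * M - poly c x * N - poly e x * M * N = 0"
      "poly a x - poly b x * M - poly c x * N + poly e x * M * N = 0"
      using v[of M N] v[of "- M" N] v[of M "- N"] v[of "- M" "- N"] by simp_all
    from four_signs[OF two this] nz show ?thesis by simp
  qed
  show "a = 0" "b = 0" "c = 0" "e = 0"
    using * by (auto intro!: poly_0_if_infinite_roots[OF fin infinite_alg_closed])
qed

lemma curve_ideal_if_normal_form_0:
  assumes nf: "normal_form d u v m n k F 0 0 0 0"
  shows "F \<in> curve_ideal d"
  using normal_form_mp_eval[OF nf] by (simp add: curve_ideal_def curve_iff qform_def bform_def)

text \<open>Vanishing at the points of the curve makes the normal form zero, and a zero normal form
  vanishes at every power series point. This takes the place of a Nullstellensatz.\<close>

lemma fe_curve_ideal_homogeneous: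
  fixes d :: "'a::alg_closed_field"
  assumes two: "(2::'a) \<noteq> 0" and d: "d \<noteq> 0" "d \<noteq> 1"
    and F: "F \<in> curve_ideal d" "homogeneous k F" and x: "cone (fps_const d) x"
  shows "fe x F = 0"
proof -
  obtain \<alpha> \<beta> \<gamma> \<delta> u v m n where f: "frame d \<alpha> \<beta> \<gamma> \<delta> u v m n"
    using frame_exists[OF two d] by blast
  obtain a b c e where nf: "normal_form d u v m n (int k) F a b c e"
    using normal_form_exists[OF f F(2)] .
  from normal_form_vanish[OF two f F(1) nf] nf x show ?thesis
    by (simp add: normal_form_def qform_def bform_def)
qed

lemma curve_scale: "P \<in> curve d \<Longrightarrow> c \<noteq> 0 \<Longrightarrow> (\<lambda>i. c * P i) \<in> curve d"
proof -
  assume P: "P \<in> curve d" and c: "c \<noteq> 0"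
  have "c ^ 2 * (P 0 ^ 2 - d * P 2 ^ 2) = c ^ 2 * (P 1 * P 3)" "c ^ 2 * (P 1 ^ 2 - P 3 ^ 2) = c ^ 2 * (4 * P 0 * P 2)"
    using P by (simp_all add: curve_iff cone_def)
  hence "cone d (\<lambda>i. c * P i)" by (simp add: cone_def algebra_simps power2_eq_square)
  with P c show ?thesis by (auto simp: curve_iff fun_eq_iff)
qed

text \<open>The curve consists of all representatives, so \<open>F\<close> vanishes at
  \<open>c P\<close> for every \<open>c \<noteq> 0\<close>. As a polynomial in \<open>c\<close> this
  value has the values of the components at \<open>P\<close> as coefficients.\<close>

lemma hcomp_curve_ideal:
  fixes d :: "'a::alg_closed_field"
  assumes F: "F \<in> curve_ideal d"
  shows "hcomp k F \<in> curve_ideal d"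
  unfolding curve_ideal_def
proof safe
  fix P assume P: "P \<in> curve d"
  obtain N where N: "F = (\<Sum>k\<le>N. hcomp k F)" by (rule sum_hcomp)
  define p where "p = (\<Sum>k\<le>N. monom (mp_eval P (hcomp k F)) k)"
  have "poly p c = 0" if "c \<notin> {0}" for c
  proof -
    have "mp_eval (\<lambda>i. c * P i) F = 0" using F curve_scale[OF P, of c] that by (simp add: curve_ideal_def)
    also have "mp_eval (\<lambda>i. c * P i) F = (\<Sum>k\<le>N. c ^ k * mp_eval P (hcomp k F))"
      by (subst N) (simp add: mp_eval_sum mp_eval_homogeneous_scale[OF homogeneous_hcomp])
    finally show ?thesis by (simp add: p_def poly_sum poly_monom mult.commute)
  qed
  hence "p = 0" using poly_0_if_infinite_roots[of "{0}" p] infinite_alg_closed by blast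
  hence "coeff p k = 0" by simp
  hence *: "k \<le> N \<Longrightarrow> mp_eval P (hcomp k F) = 0" by (simp add: p_def coeff_sum)
  show "mp_eval P (hcomp k F) = 0"
  proof (cases "k \<le> N")
    case False
    have "{m \<in> Poly_Mapping.keys F. mdeg m = k} = {}"
    proof safe
      fix m assume m: "m \<in> Poly_Mapping.keys F" "k = mdeg m"
      from m(1) have "m \<in> Poly_Mapping.keys (\<Sum>k\<le>N. hcomp k F)" using N by simp
      then obtain j where "j \<le> N" "m \<in> Poly_Mapping.keys (hcomp j F)"
        using keys_sum[of "\<lambda>k. hcomp k F" "{..N}"] by auto
      with homogeneous_hcomp[of j F] m False show "m \<in> {}" by (auto simp: homogeneous_mdeg)
    qed
    hence "hcomp k F = 0" unfolding hcomp_def by (simp only: sum.empty)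
    thus ?thesis by simp
  qed (use * in simp)
qed

lemma fe_curve_ideal:
  fixes d :: "'a::alg_closed_field"
  assumes two: "(2::'a) \<noteq> 0" and d: "d \<noteq> 0" "d \<noteq> 1"
    and F: "F \<in> curve_ideal d" and x: "cone (fps_const d) x"
  shows "fe x F = 0"
proof -
  obtain N where N: "F = (\<Sum>k\<le>N. hcomp k F)" by (rule sum_hcomp)
  show ?thesis
    by (subst N) (simp add: ev_fps.ev_sum
        fe_curve_ideal_homogeneous[OF two d hcomp_curve_ideal[OF F] homogeneous_hcomp x])
qed

section \<open>Norms of normal forms\<close>

lemma square_eq_times_square:
  fixes p q w :: "'a::field poly"
  assumes w: "Polynomial.order r w = 1" "w \<noteq> 0" and e: "p ^ 2 = w * q ^ 2"
  shows "p = 0" "q = 0"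
proof -
  have "q = 0"
  proof (rule ccontr)
    assume q: "q \<noteq> 0"
    with w e have p: "p \<noteq> 0" by auto
    have "Polynomial.order r (p ^ 2) = 2 * Polynomial.order r p" using p by (simp add: power2_eq_square order_mult)
    moreover have "Polynomial.order r (w * q ^ 2) = 1 + 2 * Polynomial.order r q" using q w
      by (simp add: power2_eq_square order_mult)
    ultimately have "2 * Polynomial.order r p = 1 + 2 * Polynomial.order r q" using e by simp
    thus False by presburger
  qed
  with e show "p = 0" "q = 0" by simp_all
qed

lemma order_qpoly:
  fixes \<alpha> :: "'a::field"
  assumes two: "(2::'a) \<noteq> 0" and "\<alpha> \<noteq> 0" "\<beta> \<noteq> 0" and r: "poly (qpoly \<alpha> \<beta>) r = 0"
  shows "Polynomial.order r (qpoly \<alpha> \<beta>) = 1"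
proof -
  have b: "\<beta> = - (\<alpha> * r ^ 2)" using r by (simp add: poly_qpoly eq_neg_iff_add_eq_0 add.commute)
  have r0: "r \<noteq> 0" using b \<open>\<beta> \<noteq> 0\<close> by auto
  have e: "qpoly \<alpha> \<beta> = [:- r, 1:] * [:\<alpha> * r, \<alpha>:]"
    by (simp add: qpoly_def b power2_eq_square algebra_simps)
  have "poly [:\<alpha> * r, \<alpha>:] r = 2 * (\<alpha> * r)" by (simp add: algebra_simps)
  hence "Polynomial.order r [:\<alpha> * r, \<alpha>:] = 0" using two r0 assms(2) by (intro order_0I) simp
  moreover have "Polynomial.order r [:- r, 1:] = 1" using order_power_n_n[of r 1] by simp
  moreover have "qpoly \<alpha> \<beta> \<noteq> 0" using assms(2) by (rule qpoly_nonzero)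
  ultimately show ?thesis unfolding e by (subst order_mult) auto
qed

lemma qpoly_root_exists:
  fixes \<alpha> :: "'a::alg_closed_field"
  assumes "\<alpha> \<noteq> 0"
  obtains r where "poly (qpoly \<alpha> \<beta>) r = 0"
proof -
  obtain r where "r ^ 2 = - \<beta> / \<alpha>" using sqrt_exists by blast
  with that[of r] assms show ?thesis by (simp add: poly_qpoly)
qed

text \<open>The elements \<open>1, m, n, m n\<close> are linearly independent over the rational functions in \<open>u / v\<close>:
  a vanishing norm of \<open>a + b m + c n + e m n\<close> makes one of the quadratic polynomials
  \<open>A\<close>, \<open>B\<close>, \<open>A B\<close> a square.\<close>

lemma norm_eq_0:
  fixes a b c e :: "'a::alg_closed_field poly"
  assumes two: "(2::'a) \<noteq> 0"
    and nz: "\<alpha> \<noteq> 0" "\<beta> \<noteq> 0" "\<gamma> \<noteq> 0" "\<delta> \<noteq> 0" "\<alpha> * \<delta> \<noteq> \<beta> * \<gamma>"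
  defines "A \<equiv> qpoly \<alpha> \<beta>" and "B \<equiv> qpoly \<gamma> \<delta>"
  assumes z: "(a ^ 2 + A * b ^ 2 - B * (c ^ 2 + A * e ^ 2)) ^ 2 - A * (2 * (a * b - B * c * e)) ^ 2 = 0"
  shows "a = 0" "b = 0" "c = 0" "e = 0"
proof -
  have two': "(2 :: 'a poly) \<noteq> 0"
    using two by (simp add: numeral_poly)
  obtain r where r: "poly A r = 0" unfolding A_def by (rule qpoly_root_exists[OF nz(1)])
  obtain s where s: "poly B s = 0" unfolding B_def by (rule qpoly_root_exists[OF nz(3)])
  have A: "Polynomial.order r A = 1" "A \<noteq> 0" unfolding A_def
    using order_qpoly[OF two nz(1,2) r[unfolded A_def]] qpoly_nonzero[OF nz(1)] .
  have B: "Polynomial.order s B = 1" "B \<noteq> 0" unfolding B_def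
    using order_qpoly[OF two nz(3,4) s[unfolded B_def]] qpoly_nonzero[OF nz(3)] .
  have "poly B r \<noteq> 0"
  proof
    assume "poly B r = 0"
    with r have "\<alpha> * r ^ 2 + \<beta> = 0" "\<gamma> * r ^ 2 + \<delta> = 0" by (simp_all add: A_def B_def poly_qpoly)
    moreover have "\<alpha> * \<delta> - \<beta> * \<gamma> = \<alpha> * (\<gamma> * r ^ 2 + \<delta>) - \<gamma> * (\<alpha> * r ^ 2 + \<beta>)" by (simp add: algebra_simps)
    ultimately show False using nz by simp
  qed
  hence "Polynomial.order r B = 0" by (rule order_0I)
  hence AB: "Polynomial.order r (A * B) = 1" "A * B \<noteq> 0" using A B by (simp_all add: order_mult)
  \<comment> \<open>Multiplying \<open>a + b m + c n + e m n\<close> by its conjugate under the sign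
    change of \<open>n\<close> gives \<open>X + m Y\<close>, where \<open>X\<close> and
    \<open>Y\<close> are the two expressions squared here. As \<open>A\<close> has a simple root,
    \<open>X^2 = A Y^2\<close> forces both to vanish by the parity of orders.\<close>
  have "(a ^ 2 + A * b ^ 2 - B * (c ^ 2 + A * e ^ 2)) ^ 2 = A * (2 * (a * b - B * c * e)) ^ 2"
    using z by simp
  note XY = square_eq_times_square[OF A this]
  have X: "a ^ 2 + A * b ^ 2 = B * (c ^ 2 + A * e ^ 2)" using XY(1) by simp
  have Y: "a * b = B * c * e" using XY(2) two' by simp
  \<comment> \<open>The vanishing of \<open>X\<close> and \<open>Y\<close> makes
    \<open>a^2 - A b^2\<close> and \<open>B (c^2 - A e^2)\<close> agree up to sign, because their
    squares agree. Either sign would exhibit \<open>B\<close> or \<open>A B\<close> as a quotient of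
    squares unless everything is zero.\<close>
  have "(a ^ 2 - A * b ^ 2) ^ 2 = (a ^ 2 + A * b ^ 2) ^ 2 - 4 * A * (a * b) ^ 2"
    by (simp add: power2_eq_square algebra_simps)
  also have "\<dots> = (B * (c ^ 2 - A * e ^ 2)) ^ 2"
    unfolding X Y by (simp add: power2_eq_square algebra_simps)
  finally have "a ^ 2 - A * b ^ 2 = B * (c ^ 2 - A * e ^ 2) \<or> a ^ 2 - A * b ^ 2 = - (B * (c ^ 2 - A * e ^ 2))"
    by (simp add: power2_eq_iff)
  hence "a = 0 \<and> b = 0 \<and> c = 0 \<and> e = 0"
  proof
    assume m: "a ^ 2 - A * b ^ 2 = B * (c ^ 2 - A * e ^ 2)"
    have "2 * a ^ 2 = (a ^ 2 + A * b ^ 2) + (a ^ 2 - A * b ^ 2)"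
      "2 * (A * b ^ 2) = (a ^ 2 + A * b ^ 2) - (a ^ 2 - A * b ^ 2)" by simp_all
    hence "2 * a ^ 2 = 2 * (B * c ^ 2)" "2 * (A * b ^ 2) = 2 * (A * (B * e ^ 2))"
      unfolding X m by (simp_all add: algebra_simps)
    hence "a ^ 2 = B * c ^ 2" "b ^ 2 = B * e ^ 2" using two' A by simp_all
    from square_eq_times_square[OF B this(1)] square_eq_times_square[OF B this(2)]
    show ?thesis by simp
  next
    assume m: "a ^ 2 - A * b ^ 2 = - (B * (c ^ 2 - A * e ^ 2))"
    have "2 * a ^ 2 = (a ^ 2 + A * b ^ 2) + (a ^ 2 - A * b ^ 2)"
      "2 * (A * b ^ 2) = (a ^ 2 + A * b ^ 2) - (a ^ 2 - A * b ^ 2)" by simp_all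
    hence "2 * a ^ 2 = 2 * ((A * B) * e ^ 2)" "2 * (A * b ^ 2) = 2 * (B * c ^ 2)"
      unfolding X m by (simp_all add: algebra_simps)
    hence a: "a ^ 2 = (A * B) * e ^ 2" and "A * b ^ 2 = B * c ^ 2"
      using two' by simp_all
    from arg_cong[OF this(2), of "\<lambda>t. A * t"] have b: "(A * b) ^ 2 = (A * B) * c ^ 2"
      by (simp add: power2_eq_square mult_ac)
    from square_eq_times_square[OF AB a] square_eq_times_square[OF AB b] A
    show ?thesis by simp
  qed
  thus "a = 0" "b = 0" "c = 0" "e = 0" by simp_all
qed

section \<open>Local parametrisations and orders of vanishing\<close>

text \<open>Along this line the form is a polynomial in the series variable. Putting
  \<open>v0 x - u0\<close> for that variable recovers a power of \<open>v0\<close> times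
  \<open>p(x)\<close>.\<close>

lemma bform_line_eq_0:
  fixes p :: "'a::alg_closed_field poly"
  assumes p: "dbound k p" and v0: "v0 \<noteq> 0"
    and z: "bform fps_const k p (fps_const u0 + fps_X) (fps_const v0) = 0"
  shows "p = 0"
proof (rule ccontr)
  assume p0: "p \<noteq> 0"
  let ?n = "nat k"
  define q where "q = (\<Sum>i\<le>?n. smult (coeff p i * v0 ^ (?n - i)) ([:u0, 1:] ^ i))"
  have X: "fps_of_poly [:u0, 1:] = fps_const u0 + fps_X"
    by (simp add: fps_of_poly_pCons)
  have "fps_of_poly q = bform fps_const k p (fps_const u0 + fps_X) (fps_const v0)"
    unfolding q_def bform_def fps_of_poly_sum
    by (rule sum.cong) (simp_all add: fps_of_poly_smult fps_of_poly_power X fps_const_power mult_ac)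
  hence "fps_of_poly q = fps_of_poly 0" using z by simp
  hence "q = 0" by (simp only: fps_of_poly_eq_iff)
  have "poly p x = 0" for x
  proof -
    have "poly q (v0 * x - u0) = (\<Sum>i\<le>?n. coeff p i * (v0 ^ (?n - i) * v0 ^ i * x ^ i))"
      by (simp add: q_def poly_sum power_mult_distrib mult_ac)
    also have "\<dots> = (\<Sum>i\<le>?n. v0 ^ ?n * (coeff p i * x ^ i))"
      by (rule sum.cong) (simp_all flip: power_add)
    also have "\<dots> = v0 ^ ?n * (\<Sum>i\<le>?n. coeff p i * x ^ i)" by (simp add: sum_distrib_left)
    also have "(\<Sum>i\<le>?n. coeff p i * x ^ i) = (\<Sum>i\<le>degree p. coeff p i * x ^ i)"
      using p p0 by (intro sum.mono_neutral_right) (auto simp: dbound_def coeff_eq_0)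
    also have "\<dots> = poly p x" by (simp add: poly_altdef)
    finally show ?thesis using \<open>q = 0\<close> v0 by simp
  qed
  with p0 poly_0_if_infinite_roots[of "{}" p] infinite_alg_closed show False by blast
qed

lemma bform_mult':
  "dbound j p \<Longrightarrow> dbound l q \<Longrightarrow> r = j + l \<Longrightarrow>
   dbound r (p * q) \<and> bform fps_const r (p * q) U V = bform fps_const j p U V * bform fps_const l q U V"
  for p :: "'a::field poly"
  by (simp add: ev_fps.bform_mult dbound_mult)

definition norm_poly :: "'a::comm_ring_1 poly \<Rightarrow> 'a poly \<Rightarrow> 'a poly \<Rightarrow> 'a poly \<Rightarrow> 'a poly \<Rightarrow> 'a poly \<Rightarrow> 'a poly" where
  "norm_poly A B a b c e = (a ^ 2 + A * b ^ 2 - B * (c ^ 2 + A * e ^ 2)) ^ 2 - A * (2 * (a * b - B * c * e)) ^ 2"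

text \<open>The norm is the product over the four sign changes of \<open>m\<close> and
  \<open>n\<close>. In the proof \<open>S\<close> and \<open>T + T\<close> are the two parts of the
  norm taken halfway, written as products so that the degree bound of every term can be
  followed.\<close>

lemma norm_poly_bform:
  fixes a b c e :: "'a::field poly" and U V M N :: "'a fps"
  assumes bd: "qbound k a b c e"
    and rel: "M ^ 2 = fps_const \<alpha> * U ^ 2 + fps_const \<beta> * V ^ 2" "N ^ 2 = fps_const \<gamma> * U ^ 2 + fps_const \<delta> * V ^ 2"
  shows "dbound (4 * k) (norm_poly (qpoly \<alpha> \<beta>) (qpoly \<gamma> \<delta>) a b c e)"
    and "bform fps_const (4 * k) (norm_poly (qpoly \<alpha> \<beta>) (qpoly \<gamma> \<delta>) a b c e) U V
      = qform fps_const k a b c e U V M N * qform fps_const k a b (- c) (- e) U V M N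
        * (qform fps_const k a (- b) c (- e) U V M N * qform fps_const k a (- b) (- c) e U V M N)"
proof -
  let ?A = "qpoly \<alpha> \<beta>" and ?B = "qpoly \<gamma> \<delta>"
  let ?a = "bform fps_const k a U V" and ?b = "bform fps_const (k - 1) b U V"
    and ?c = "bform fps_const (k - 1) c U V" and ?e = "bform fps_const (k - 2) e U V"
  have q: "dbound k a" "dbound (k - 1) b" "dbound (k - 1) c" "dbound (k - 2) e"
    using bd by (simp_all add: qbound_def)
  have AB: "dbound 2 ?A" "dbound 2 ?B" by (rule dbound_qpoly)+
  have MN: "bform fps_const 2 ?A U V = M ^ 2" "bform fps_const 2 ?B U V = N ^ 2"
    using rel unfolding ev_fps.bform_qpoly by simp_all
  define S where "S = a * a + ?A * (b * b) - (?B * (c * c) + ?B * (?A * (e * e)))"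
  define T where "T = a * b - ?B * (c * e)"
  note bm = bform_mult'[where U="U" and V="V"]
  have r: "2 * k = k + k" "2 * k - 1 = k + (k - 1)"
    "2 * k = 2 + ((k - 1) + (k - 1))" "2 * k = 2 + (2 + ((k - 2) + (k - 2)))"
    "2 * k - 1 = 2 + ((k - 1) + (k - 2))" "4 * k = 2 * k + 2 * k"
    "4 * k = 2 + ((2 * k - 1) + (2 * k - 1))" by simp_all
  note aa = bm[OF q(1) q(1) r(1)] and ab = bm[OF q(1) q(2) r(2)]
    and bb = bm[OF q(2) q(2) refl] and cc = bm[OF q(3) q(3) refl]
    and ee = bm[OF q(4) q(4) refl] and ce = bm[OF q(3) q(4) refl]
  note Abb = bm[OF AB(1) conjunct1[OF bb] r(3)] and Bcc = bm[OF AB(2) conjunct1[OF cc] r(3)]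
    and Aee = bm[OF AB(1) conjunct1[OF ee] refl] and Bce = bm[OF AB(2) conjunct1[OF ce] r(5)]
  note BAee = bm[OF AB(2) conjunct1[OF Aee] r(4)]
  note ev = aa[THEN conjunct2] ab[THEN conjunct2] bb[THEN conjunct2] cc[THEN conjunct2] ee[THEN conjunct2]
    ce[THEN conjunct2] Abb[THEN conjunct2] Bcc[THEN conjunct2] Aee[THEN conjunct2] Bce[THEN conjunct2]
    BAee[THEN conjunct2]
  have S: "dbound (2 * k) S" "bform fps_const (2 * k) S U V
      = ?a * ?a + M ^ 2 * (?b * ?b) - (N ^ 2 * (?c * ?c) + N ^ 2 * (M ^ 2 * (?e * ?e)))"
    unfolding S_def ev_fps.bform_add ev_fps.bform_diff ev MN
    by (intro dbound_diff dbound_add aa[THEN conjunct1] Abb[THEN conjunct1] Bcc[THEN conjunct1]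
        BAee[THEN conjunct1] refl)+
  have T: "dbound (2 * k - 1) T" "bform fps_const (2 * k - 1) T U V
      = ?a * ?b - N ^ 2 * (?c * ?e)"
    unfolding T_def ev_fps.bform_diff ev MN
    by (intro dbound_diff ab[THEN conjunct1] Bce[THEN conjunct1] refl)+
  have YY: "dbound (2 * k - 1) (T + T)" "bform fps_const (2 * k - 1) (T + T) U V
      = 2 * (?a * ?b - N ^ 2 * (?c * ?e))"
    by (intro dbound_add T(1)) (simp only: ev_fps.bform_add T(2) mult_2[where 'a="'a fps"])
  define Z where "Z = S * S - ?A * ((T + T) * (T + T))"
  note s1 = bm[OF S(1) S(1) r(6)] and s2 = bm[OF YY(1) YY(1) refl]
  note s3 = bm[OF AB(1) conjunct1[OF s2] r(7)]
  have Z: "dbound (4 * k) Z"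
    unfolding Z_def by (intro dbound_diff s1[THEN conjunct1] s3[THEN conjunct1])
  let ?X = "bform fps_const (2 * k) S U V" and ?Y = "bform fps_const (2 * k - 1) (T + T) U V"
  have "bform fps_const (4 * k) Z U V = ?X * ?X - M ^ 2 * (?Y * ?Y)"
    unfolding Z_def ev_fps.bform_diff s1[THEN conjunct2] s3[THEN conjunct2] s2[THEN conjunct2] MN ..
  also have "\<dots> = (?X + M * ?Y) * (?X - M * ?Y)" by (simp add: power2_eq_square algebra_simps)
  also have "?X + M * ?Y = qform fps_const k a b c e U V M N * qform fps_const k a b (- c) (- e) U V M N"
    unfolding S(2) YY(2) qform_def by (simp add: ev_fps.bform_uminus power2_eq_square algebra_simps)
  also have "?X - M * ?Y = qform fps_const k a (- b) c (- e) U V M N * qform fps_const k a (- b) (- c) e U V M N"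
    unfolding S(2) YY(2) qform_def by (simp add: ev_fps.bform_uminus power2_eq_square algebra_simps)
  finally have *: "bform fps_const (4 * k) Z U V = qform fps_const k a b c e U V M N * qform fps_const k a b (- c) (- e) U V M N
        * (qform fps_const k a (- b) c (- e) U V M N * qform fps_const k a (- b) (- c) e U V M N)" .
  have "Z = norm_poly ?A ?B a b c e"
    unfolding Z_def S_def T_def norm_poly_def by (simp add: power2_eq_square algebra_simps)
  with Z * show "dbound (4 * k) (norm_poly (qpoly \<alpha> \<beta>) (qpoly \<gamma> \<delta>) a b c e)"
    "bform fps_const (4 * k) (norm_poly (qpoly \<alpha> \<beta>) (qpoly \<gamma> \<delta>) a b c e) U V
      = qform fps_const k a b c e U V M N * qform fps_const k a b (- c) (- e) U V M N
        * (qform fps_const k a (- b) c (- e) U V M N * qform fps_const k a (- b) (- c) e U V M N)"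
    by simp_all
qed

lemma norm_poly_nonzero:
  fixes d :: "'a::alg_closed_field"
  assumes two: "(2::'a) \<noteq> 0" and f: "frame d \<alpha> \<beta> \<gamma> \<delta> u v m n"
    and nf: "normal_form d u v m n k F a b c e" and F: "F \<notin> curve_ideal d"
  shows "norm_poly (qpoly \<alpha> \<beta>) (qpoly \<gamma> \<delta>) a b c e \<noteq> 0"
proof
  assume "norm_poly (qpoly \<alpha> \<beta>) (qpoly \<gamma> \<delta>) a b c e = 0"
  moreover have nz: "\<alpha> \<noteq> 0" "\<beta> \<noteq> 0" "\<gamma> \<noteq> 0" "\<delta> \<noteq> 0" "\<alpha> * \<delta> \<noteq> \<beta> * \<gamma>"
    using f by (auto simp: frame_def)
  ultimately have "a = 0 \<and> b = 0 \<and> c = 0 \<and> e = 0"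
    using norm_eq_0[OF two nz, of a b c e] unfolding norm_poly_def by argo
  with nf curve_ideal_if_normal_form_0 F show False by blast
qed

text \<open>A form that vanishes along the arc has a norm that vanishes along it; but the norm
  involves only \<open>u\<close> and \<open>v\<close>, which run through a line there.\<close>

lemma fe_nonzero_on_line:
  fixes d :: "'a::alg_closed_field"
  assumes two: "(2::'a) \<noteq> 0" and f: "frame d \<alpha> \<beta> \<gamma> \<delta> u v m n"
    and x: "cone (fps_const d) x" "fe x u = fps_const u0 + fps_X" "fe x v = fps_const v0" "v0 \<noteq> 0"
    and F: "homogeneous k F" "F \<notin> curve_ideal d"
  shows "fe x F \<noteq> 0"
proof
  assume z: "fe x F = 0"
  obtain a b c e where nf: "normal_form d u v m n (int k) F a b c e"
    using normal_form_exists[OF f F(1)] .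
  have bd: "qbound (int k) a b c e" using nf by (simp add: normal_form_def)
  have rel: "fe x m ^ 2 = fps_const \<alpha> * fe x u ^ 2 + fps_const \<beta> * fe x v ^ 2"
    "fe x n ^ 2 = fps_const \<gamma> * fe x u ^ 2 + fps_const \<delta> * fe x v ^ 2"
    using f x(1) by (simp_all add: frame_def)
  have "qform fps_const (int k) a b c e (fe x u) (fe x v) (fe x m) (fe x n) = 0"
    using z nf x(1) by (simp add: normal_form_def)
  hence "bform fps_const (4 * int k) (norm_poly (qpoly \<alpha> \<beta>) (qpoly \<gamma> \<delta>) a b c e) (fe x u) (fe x v) = 0"
    unfolding norm_poly_bform(2)[OF bd rel] by simp
  hence "norm_poly (qpoly \<alpha> \<beta>) (qpoly \<gamma> \<delta>) a b c e = 0"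
    using bform_line_eq_0[OF norm_poly_bform(1)[OF bd rel] x(4)] unfolding x by blast
  with norm_poly_nonzero[OF two f nf F(2)] show False by contradiction
qed

text \<open>\<open>u\<close> moves with unit speed and \<open>v\<close> stays fixed. Then
  \<open>m\<close> and \<open>n\<close> are square roots of power series whose constant terms are
  nonzero squares, and the roots are chosen to start at \<open>P\<close>.\<close>

lemma arc_exists:
  fixes d :: "'a::alg_closed_field"
  assumes two: "(2::'a) \<noteq> 0" and f: "frame d \<alpha> \<beta> \<gamma> \<delta> u v m n" and P: "P \<in> curve d"
    and nz: "mp_eval P m \<noteq> 0" "mp_eval P n \<noteq> 0"
  obtains x where "cone (fps_const d) x" "\<And>i. x i $ 0 = P i"
    "fe x u = fps_const (mp_eval P u) + fps_X" "fe x v = fps_const (mp_eval P v)"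
proof -
  let ?U = "fps_const (mp_eval P u) + fps_X" and ?V = "fps_const (mp_eval P v)"
  have "cone d P" using P by (simp add: curve_iff)
  note r = frame_relation[OF f this]
  have "mp_eval P m ^ 2 = (fps_const \<alpha> * ?U ^ 2 + fps_const \<beta> * ?V ^ 2) $ 0"
    "mp_eval P n ^ 2 = (fps_const \<gamma> * ?U ^ 2 + fps_const \<delta> * ?V ^ 2) $ 0"
    by (simp_all add: r fps_power_zeroth)
  with nz two obtain M N where M: "M ^ 2 = fps_const \<alpha> * ?U ^ 2 + fps_const \<beta> * ?V ^ 2" "M $ 0 = mp_eval P m"
    and N: "N ^ 2 = fps_const \<gamma> * ?U ^ 2 + fps_const \<delta> * ?V ^ 2" "N $ 0 = mp_eval P n"
    using fps_sqrt_exists by metis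
  from f M(1) N(1) obtain x where x: "cone (fps_const d) x" "fe x u = ?U" "fe x v = ?V" "fe x m = M" "fe x n = N"
    unfolding frame_def by blast
  have "x i $ 0 = P i" for i
  proof -
    from f obtain a b c e where v: "Var i = Const a * u + Const b * v + Const c * m + Const e * n"
      unfolding frame_def by blast
    from arg_cong[OF v, of "\<lambda>F. fe x F $ 0"] arg_cong[OF v, of "mp_eval P"]
    show ?thesis by (simp add: x M N)
  qed
  with x that show ?thesis by blast
qed

section \<open>Orders of vanishing and divisibility along an arc\<close>

lemma (in coeff_hom) hom_prod: "h (\<Prod>i\<in>A. f i) = (\<Prod>i\<in>A. h (f i))"
  by (induction A rule: infinite_finite_induct) (simp_all add: hom_one hom_mult)

lemma fps_X_dvd_iff: "fps_X dvd f \<longleftrightarrow> f $ 0 = 0" for f :: "'a::field fps"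
proof (cases "f = 0")
  case False
  hence "fps_X dvd f \<longleftrightarrow> 1 \<le> subdegree f" by (simp add: fps_dvd_iff)
  also have "\<dots> \<longleftrightarrow> f $ 0 = 0" using False subdegree_eq_0_iff[of f] by auto
  finally show ?thesis .
qed simp

lemma fps_X_power_dvd_iff: "f \<noteq> 0 \<Longrightarrow> fps_X ^ n dvd f \<longleftrightarrow> n \<le> subdegree f" for f :: "'a::field fps"
  by (simp add: fps_dvd_iff fps_X_power_subdegree)

lemma ideal_power_0: "F \<in> ideal_power I 0"
proof -
  have "1 \<in> module.span (*) {\<Prod>i<(0::nat). g i | g. \<forall>i<(0::nat). g i \<in> I}"
    by (rule module.span_base[OF module_mult]) simp
  from module.span_scale[OF module_mult this, of F] show ?thesis by (simp add: ideal_power_def)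
qed

lemma ideal_power_Suc:
  assumes "U \<in> I" "B \<in> ideal_power I n"
  shows "U * B \<in> ideal_power I (Suc n)"
proof -
  let ?S = "\<lambda>n. {\<Prod>i<n. g i | g. \<forall>i<n. g i \<in> I}"
  let ?V = "{b. U * b \<in> module.span (*) (?S (Suc n))}"
  have "module.subspace (*) ?V"
    unfolding module.subspace_def[OF module_mult]
    by (auto simp: distrib_left mult.left_commute intro: module.span_zero[OF module_mult]
        module.span_add[OF module_mult] module.span_scale[OF module_mult])
  moreover have "?S n \<subseteq> ?V"
  proof safe
    fix g assume g: "\<forall>i<n. g i \<in> I"
    have "U * (\<Prod>i<n. g i) = (\<Prod>i<Suc n. (g(n := U)) i)" by (simp add: mult.commute)
    moreover have "\<forall>i<Suc n. (g(n := U)) i \<in> I" using g assms(1) by (auto simp: less_Suc_eq)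
    ultimately show "U * (\<Prod>i<n. g i) \<in> module.span (*) (?S (Suc n))"
      by (intro module.span_base[OF module_mult]) blast
  qed
  ultimately have "module.span (*) (?S n) \<subseteq> ?V" by (intro module.span_minimal[OF module_mult])
  with assms(2) show ?thesis by (auto simp: ideal_power_def)
qed

lemma fe_ideal_power_dvd:
  assumes x: "\<And>i. x i $ 0 = P i" and B: "B \<in> ideal_power (point_ideal P) n"
  shows "fps_X ^ n dvd fe x B"
proof -
  let ?V = "{b. fps_X ^ n dvd fe x b}"
  have "module.subspace (*) ?V"
    unfolding module.subspace_def[OF module_mult] by auto
  moreover have "{\<Prod>i<n. g i | g. \<forall>i<n. g i \<in> point_ideal P} \<subseteq> ?V"
  proof safe
    fix g assume g: "\<forall>i<n. g i \<in> point_ideal P"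
    have "fps_X dvd fe x (g i)" if "i < n" for i
    proof -
      from g that have "mp_eval (\<lambda>i. 1 * P i) (g i) = 0" unfolding point_ideal_def by blast
      thus ?thesis by (simp add: fps_X_dvd_iff fe_nth_0 x)
    qed
    hence "(\<Prod>i<n. fps_X) dvd (\<Prod>i<n. fe x (g i))" by (intro prod_dvd_prod) auto
    thus "fps_X ^ n dvd fe x (\<Prod>i<n. g i)"
      by (simp add: coeff_hom.hom_prod[OF ev_fps.coeff_hom_ev])
  qed
  ultimately have "module.span (*) {\<Prod>i<n. g i | g. \<forall>i<n. g i \<in> point_ideal P} \<subseteq> ?V"
    by (intro module.span_minimal[OF module_mult])
  with B show ?thesis by (auto simp: ideal_power_def)
qed

text \<open>Along the arc \<open>A\<close> vanishes, \<open>B\<close> is divisible by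
  \<open>fps_X ^ n\<close>, and \<open>H\<close> is a unit because it does not vanish at
  \<open>P\<close>.\<close>

lemma vanishes_to_order_imp_dvd:
  fixes d :: "'a::alg_closed_field"
  assumes two: "(2::'a) \<noteq> 0" and d: "d \<noteq> 0" "d \<noteq> 1"
    and x: "cone (fps_const d) x" "\<And>i. x i $ 0 = P i" and F: "vanishes_to_order d P n F"
  shows "fps_X ^ n dvd fe x F"
proof -
  from F obtain k H A B where H: "homogeneous k H" "mp_eval P H \<noteq> 0" and A: "A \<in> curve_ideal d"
    and B: "B \<in> ideal_power (point_ideal P) n" and e: "H * F = A + B"
    unfolding vanishes_to_order_def by blast
  have "fe x H * fe x F = fe x (A + B)" by (simp flip: e)
  also have "\<dots> = fe x B" using fe_curve_ideal[OF two d A x(1)] by simp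
  finally have "fps_X ^ n dvd fe x H * fe x F" using fe_ideal_power_dvd[OF x(2) B] by simp
  moreover have "fe x H dvd 1" using H(2) by (simp add: fe_nth_0 x(2))
  ultimately show ?thesis by (simp add: dvd_mult_unit_iff')
qed

text \<open>Taylor expansion at \<open>P\<close>, with denominators cleared, when \<open>U\<close> is a uniformiser.\<close>

lemma taylor_on_curve:
  fixes P :: "4 \<Rightarrow> 'a::field"
  assumes H: "homogeneous 2 H" and E: "homogeneous 3 E" and U: "homogeneous 1 U" and v: "homogeneous 1 v"
    and V: "\<And>i. \<exists>G. homogeneous 2 G \<and>
      (\<forall>Q\<in>curve d. mp_eval Q H * Q i = P i * mp_eval Q E + mp_eval Q U * mp_eval Q G)"
    and F: "homogeneous k F"
  shows "\<exists>G. homogeneous (3 * k) G \<and> (\<forall>Q\<in>curve d. mp_eval Q v * mp_eval Q H ^ k * mp_eval Q F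
      = mp_eval P F * mp_eval Q v * mp_eval Q E ^ k + mp_eval Q U * mp_eval Q G)"
  using F
proof (induction rule: homogeneous_induct)
  case (Const c)
  show ?case by (rule exI[of _ 0]) simp
next
  case (Var k i F)
  obtain A where A: "homogeneous 2 A"
    "\<And>Q. Q \<in> curve d \<Longrightarrow> mp_eval Q H * Q i = P i * mp_eval Q E + mp_eval Q U * mp_eval Q A"
    using V by blast
  obtain G where G: "homogeneous (3 * k) G" "\<And>Q. Q \<in> curve d \<Longrightarrow>
      mp_eval Q v * mp_eval Q H ^ k * mp_eval Q F
      = mp_eval P F * mp_eval Q v * mp_eval Q E ^ k + mp_eval Q U * mp_eval Q G"
    using Var.IH by blast
  define B where "B = Const (mp_eval P F) * (A * (v * E ^ k)) + Const (P i) * (E * G) + U * (A * G)"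
  have "homogeneous (2 + (1 + k * 3)) (A * (v * E ^ k))" "homogeneous (3 + 3 * k) (E * G)"
    "homogeneous (1 + (2 + 3 * k)) (U * (A * G))"
    by (intro homogeneous_mult homogeneous_power A G v U E)+
  moreover have "2 + (1 + k * 3) = 3 * Suc k" "3 + 3 * k = 3 * Suc k" "1 + (2 + 3 * k) = 3 * Suc k" by simp_all
  ultimately have "homogeneous (3 * Suc k) B"
    unfolding B_def by (metis homogeneous_add homogeneous_Const_mult)
  moreover have "mp_eval Q v * mp_eval Q H ^ Suc k * mp_eval Q (Var i * F)
      = mp_eval P (Var i * F) * mp_eval Q v * mp_eval Q E ^ Suc k + mp_eval Q U * mp_eval Q B"
    if Q: "Q \<in> curve d" for Q
  proof -
    have "mp_eval Q v * mp_eval Q H ^ Suc k * mp_eval Q (Var i * F)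
        = (mp_eval Q H * Q i) * (mp_eval Q v * mp_eval Q H ^ k * mp_eval Q F)" by simp
    also have "\<dots> = (P i * mp_eval Q E + mp_eval Q U * mp_eval Q A) *
        (mp_eval P F * mp_eval Q v * mp_eval Q E ^ k + mp_eval Q U * mp_eval Q G)"
      unfolding A(2)[OF Q] G(2)[OF Q] ..
    finally show ?thesis by (simp add: B_def algebra_simps)
  qed
  ultimately show ?case by blast
next
  case (add k F G)
  then obtain A B where "homogeneous (3 * k) A" "\<And>Q. Q \<in> curve d \<Longrightarrow>
      mp_eval Q v * mp_eval Q H ^ k * mp_eval Q F
      = mp_eval P F * mp_eval Q v * mp_eval Q E ^ k + mp_eval Q U * mp_eval Q A"
    "homogeneous (3 * k) B" "\<And>Q. Q \<in> curve d \<Longrightarrow>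
      mp_eval Q v * mp_eval Q H ^ k * mp_eval Q G
      = mp_eval P G * mp_eval Q v * mp_eval Q E ^ k + mp_eval Q U * mp_eval Q B"
    by blast
  thus ?case by (intro exI[of _ "A + B"]) (simp add: homogeneous_add algebra_simps)
qed

text \<open>On the curve \<open>v(P) m - m(P) v\<close> times \<open>M\<close> equals
  \<open>\<alpha> U W\<close>: expand the difference of squares and insert the equations for
  \<open>m^2\<close> at both points. The same holds for \<open>n\<close> and \<open>N\<close>. So
  after multiplication by \<open>M N\<close> every coordinate is, modulo \<open>U\<close>, a
  multiple of its value at \<open>P\<close>, without any differentiation. At \<open>P\<close> itself
  \<open>M\<close> has the value \<open>2 v(P) m(P)\<close>.\<close>

lemma uniformiser_expansion:
  assumes f: "frame d \<alpha> \<beta> \<gamma> \<delta> u v m n" and P: "P \<in> curve d"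
  defines "M \<equiv> Const (mp_eval P v) * m + Const (mp_eval P m) * v"
    and "N \<equiv> Const (mp_eval P v) * n + Const (mp_eval P n) * v"
    and "U \<equiv> Const (mp_eval P v) * u - Const (mp_eval P u) * v"
  shows "\<exists>G. homogeneous 2 G \<and> (\<forall>Q\<in>curve d. mp_eval Q (Const (mp_eval P v) * (M * N)) * Q i
      = P i * mp_eval Q (M * N * v) + mp_eval Q U * mp_eval Q G)"
proof -
  have hom: "homogeneous 1 u" "homogeneous 1 v" "homogeneous 1 m" "homogeneous 1 n"
    using f by (auto simp: frame_def)
  have hM: "homogeneous 1 M" "homogeneous 1 N"
    unfolding M_def N_def by (intro homogeneous_add homogeneous_Const_mult hom)+
  from f obtain a b c e where i: "Var i = Const a * u + Const b * v + Const c * m + Const e * n"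
    unfolding frame_def by blast
  define W where "W = Const (mp_eval P v) * u + Const (mp_eval P u) * v"
  define G where "G = Const a * (M * N) + Const (c * \<alpha>) * (W * N) + Const (e * \<gamma>) * (M * W)"
  have hW: "homogeneous 1 W" unfolding W_def by (intro homogeneous_add homogeneous_Const_mult hom)
  have "homogeneous (1 + 1) G" unfolding G_def
    by (intro homogeneous_add homogeneous_Const_mult homogeneous_mult hM hW)
  moreover have "mp_eval Q (Const (mp_eval P v) * (M * N)) * Q i
      = P i * mp_eval Q (M * N * v) + mp_eval Q U * mp_eval Q G" if Q: "Q \<in> curve d" for Q
  proof -
    let ?p = "mp_eval P" and ?q = "mp_eval Q"
    have "cone d P" "cone d Q" using P Q by (simp_all add: curve_iff)
    note rP = frame_relation[OF f this(1)] and rQ = frame_relation[OF f this(2)]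
    have Qi: "Q i = a * ?q u + b * ?q v + c * ?q m + e * ?q n"
      using arg_cong[OF i, of ?q] by simp
    have Pi: "P i = a * ?p u + b * ?p v + c * ?p m + e * ?p n"
      using arg_cong[OF i, of ?p] by simp
    have 1: "(?p v * ?q m - ?p m * ?q v) * ?q M = \<alpha> * (?q U * ?q W)"
    proof -
      have "(?p v * ?q m - ?p m * ?q v) * ?q M = ?p v ^ 2 * ?q m ^ 2 - ?p m ^ 2 * ?q v ^ 2"
        by (simp add: M_def power2_eq_square algebra_simps)
      also have "\<dots> = \<alpha> * (?q U * ?q W)"
        unfolding rP rQ by (simp add: U_def W_def power2_eq_square algebra_simps)
      finally show ?thesis .
    qed
    have 2: "(?p v * ?q n - ?p n * ?q v) * ?q N = \<gamma> * (?q U * ?q W)"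
    proof -
      have "(?p v * ?q n - ?p n * ?q v) * ?q N = ?p v ^ 2 * ?q n ^ 2 - ?p n ^ 2 * ?q v ^ 2"
        by (simp add: N_def power2_eq_square algebra_simps)
      also have "\<dots> = \<gamma> * (?q U * ?q W)"
        unfolding rP rQ by (simp add: U_def W_def power2_eq_square algebra_simps)
      finally show ?thesis .
    qed
    have U: "?q U = ?p v * ?q u - ?p u * ?q v" by (simp add: U_def)
    have "?q (Const (?p v) * (M * N)) * Q i - P i * ?q (M * N * v)
        = a * (?q M * ?q N * ?q U) + c * ((?p v * ?q m - ?p m * ?q v) * ?q M) * ?q N
          + e * ((?p v * ?q n - ?p n * ?q v) * ?q N) * ?q M"
      unfolding Qi Pi U by (simp add: algebra_simps)
    also have "\<dots> = ?q U * ?q G"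
      unfolding 1 2 by (simp add: G_def algebra_simps)
    finally show ?thesis by (simp add: algebra_simps)
  qed
  ultimately show ?thesis by (auto simp: numeral_2_eq_2)
qed

text \<open>A form \<open>F\<close> that vanishes at \<open>P\<close> satisfies
  \<open>K F = U G\<close> on the curve with \<open>K\<close> nonzero at \<open>P\<close>. Along the
  arc \<open>U\<close> is a constant multiple of \<open>fps_X\<close>, so \<open>G\<close> has order
  one less and the induction applies to it.\<close>

lemma dvd_imp_vanishes_to_order:
  fixes d :: "'a::alg_closed_field"
  assumes two: "(2::'a) \<noteq> 0" and d: "d \<noteq> 0" "d \<noteq> 1"
    and f: "frame d \<alpha> \<beta> \<gamma> \<delta> u v m n" and P: "P \<in> curve d"
    and nz: "mp_eval P v \<noteq> 0" "mp_eval P m \<noteq> 0" "mp_eval P n \<noteq> 0"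
    and x: "cone (fps_const d) x" "\<And>i. x i $ 0 = P i"
      "fe x u = fps_const (mp_eval P u) + fps_X" "fe x v = fps_const (mp_eval P v)"
    and F: "homogeneous k F" "fps_X ^ j dvd fe x F"
  shows "vanishes_to_order d P j F"
  using F
proof (induction j arbitrary: k F)
  case 0
  have "0 \<in> curve_ideal d" by (simp add: curve_ideal_def)
  moreover have "1 * F = 0 + F" "mp_eval P 1 \<noteq> 0" by simp_all
  ultimately show ?case unfolding vanishes_to_order_def
    using homogeneous_1 ideal_power_0 by blast
next
  case (Suc j)
  define M where "M = Const (mp_eval P v) * m + Const (mp_eval P m) * v"
  define N where "N = Const (mp_eval P v) * n + Const (mp_eval P n) * v"
  define U where "U = Const (mp_eval P v) * u - Const (mp_eval P u) * v"
  define H where "H = Const (mp_eval P v) * (M * N)"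
  have hom: "homogeneous 1 u" "homogeneous 1 v" "homogeneous 1 m" "homogeneous 1 n"
    using f by (auto simp: frame_def)
  have hM: "homogeneous 1 M" "homogeneous 1 N" "homogeneous 1 U"
    unfolding M_def N_def U_def by (intro homogeneous_add homogeneous_diff homogeneous_Const_mult hom)+
  have "homogeneous (1 + 1) H" "homogeneous (1 + 1 + 1) (M * N * v)" unfolding H_def
    by (intro homogeneous_Const_mult homogeneous_mult hM hom)+
  hence hH: "homogeneous 2 H" "homogeneous 3 (M * N * v)"
    by (simp_all add: numeral_2_eq_2 numeral_3_eq_3)
  have "fps_X dvd fps_X ^ Suc j" by simp
  hence "fps_X dvd fe x F" using Suc.prems(2) dvd_trans by blast
  hence F0: "mp_eval P F = 0" by (simp add: fps_X_dvd_iff fe_nth_0 x(2))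
  obtain G where G: "homogeneous (3 * k) G" "\<And>Q. Q \<in> curve d \<Longrightarrow>
      mp_eval Q v * mp_eval Q H ^ k * mp_eval Q F = mp_eval Q U * mp_eval Q G"
    using taylor_on_curve[OF hH hM(3) hom(2) uniformiser_expansion[OF f P, folded M_def N_def U_def H_def] Suc.prems(1)]
    by (auto simp: F0)
  define K where "K = v * H ^ k"
  have hK: "homogeneous (1 + k * 2) K" unfolding K_def
    by (intro homogeneous_mult homogeneous_power hom hH)
  have K0: "mp_eval P K \<noteq> 0"
  proof -
    have "mp_eval P M = 2 * (mp_eval P v * mp_eval P m)" "mp_eval P N = 2 * (mp_eval P v * mp_eval P n)"
      unfolding M_def N_def mp_eval_simps
      by (simp_all only: mult_2 mult.commute[of "mp_eval P m"] mult.commute[of "mp_eval P n"])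
    hence "mp_eval P M \<noteq> 0" "mp_eval P N \<noteq> 0" using two nz by simp_all
    with nz show ?thesis by (simp add: K_def H_def)
  qed
  have I: "K * F - U * G \<in> curve_ideal d"
    using G(2) by (simp add: curve_ideal_def K_def)
  have "fe x K * fe x F = fe x U * fe x G"
    using fe_curve_ideal[OF two d I x(1)] by simp
  also have "fe x U = fps_const (mp_eval P v) * fps_X"
    unfolding U_def by (simp add: x algebra_simps)
  finally have e: "fe x K * fe x F = fps_X * (fps_const (mp_eval P v) * fe x G)"
    by (simp only: mult_ac)
  have "fps_X ^ Suc j dvd fps_X * (fps_const (mp_eval P v) * fe x G)"
    unfolding e[symmetric] using Suc.prems(2) by (rule dvd_mult)
  hence "fps_X ^ j dvd fps_const (mp_eval P v) * fe x G"
    unfolding power_Suc by (subst (asm) dvd_mult_cancel_left) simp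
  moreover have "fps_const (mp_eval P v) dvd 1" using nz by simp
  ultimately have "fps_X ^ j dvd fe x G" by (simp only: dvd_mult_unit_iff')
  from Suc.IH[OF G(1) this] obtain l L A B where L: "homogeneous l L" "mp_eval P L \<noteq> 0"
    "A \<in> curve_ideal d" "B \<in> ideal_power (point_ideal P) j" "L * G = A + B"
    unfolding vanishes_to_order_def by blast
  have Up: "U \<in> point_ideal P"
  proof -
    have "mp_eval (\<lambda>i. c * P i) U = 0" for c
      using mp_eval_homogeneous_scale[OF hM(3), of c P] by (simp add: U_def)
    thus ?thesis by (simp add: point_ideal_def)
  qed
  have "(L * K) * F = (L * (K * F - U * G) + U * A) + U * B"
  proof -
    have "(L * K) * F = L * (K * F - U * G) + U * (L * G)" by (simp add: algebra_simps)
    thus ?thesis unfolding L(5) by (simp add: algebra_simps)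
  qed
  moreover have "L * (K * F - U * G) + U * A \<in> curve_ideal d"
    using I L(3) by (simp add: curve_ideal_def)
  moreover have "U * B \<in> ideal_power (point_ideal P) (Suc j)" by (rule ideal_power_Suc[OF Up L(4)])
  moreover have "homogeneous (l + (1 + k * 2)) (L * K)" by (rule homogeneous_mult[OF L(1) hK])
  moreover have "mp_eval P (L * K) \<noteq> 0" using L K0 by simp
  ultimately show ?case unfolding vanishes_to_order_def by blast
qed

text \<open>The linear form of order one records that the arc is not stationary; simplicity of zeros
  later rests on it. The last clause turns every order on the curve into a subdegree.\<close>

definition local_param :: "'a::field \<Rightarrow> (4 \<Rightarrow> 'a) \<Rightarrow> (4 \<Rightarrow> 'a fps) \<Rightarrow> bool" where
  "local_param d P x \<longleftrightarrow> cone (fps_const d) x \<and> (\<forall>i. x i $ 0 = P i) \<and>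
     (\<exists>l. homogeneous 1 l \<and> subdegree (fe x l) = 1) \<and>
     (\<forall>k F. homogeneous k F \<longrightarrow> F \<notin> curve_ideal d \<longrightarrow>
        fe x F \<noteq> 0 \<and> ord_at d P F = enat (subdegree (fe x F)))"

lemma local_param_exists:
  fixes d :: "'a::alg_closed_field"
  assumes two: "(2::'a) \<noteq> 0" and d: "d \<noteq> 0" "d \<noteq> 1" and P: "P \<in> curve d"
  obtains x where "local_param d P x"
proof -
  obtain \<alpha> \<beta> \<gamma> \<delta> u v m n where f: "frame d \<alpha> \<beta> \<gamma> \<delta> u v m n"
    and nz: "mp_eval P v \<noteq> 0" "mp_eval P m \<noteq> 0" "mp_eval P n \<noteq> 0"
    using frame_at[OF two d P] .
  obtain x where x: "cone (fps_const d) x" "\<And>i. x i $ 0 = P i"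
    "fe x u = fps_const (mp_eval P u) + fps_X" "fe x v = fps_const (mp_eval P v)"
    by (rule arc_exists[OF two f P nz(2,3)]) (rule that)
  have "ord_at d P F = enat (subdegree (fe x F))" "fe x F \<noteq> 0" if F: "homogeneous k F" "F \<notin> curve_ideal d" for k F
  proof -
    show F0: "fe x F \<noteq> 0" by (rule fe_nonzero_on_line[OF two f x(1,3,4) nz(1) F])
    have "vanishes_to_order d P j F \<longleftrightarrow> j \<le> subdegree (fe x F)" for j
      using vanishes_to_order_imp_dvd[OF two d x(1,2), of j F]
        dvd_imp_vanishes_to_order[OF two d f P nz x F(1), of j] fps_X_power_dvd_iff[OF F0] by blast
    hence "{j. vanishes_to_order d P j F} = {..subdegree (fe x F)}" by auto
    thus "ord_at d P F = enat (subdegree (fe x F))"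
      unfolding ord_at_def by (auto intro!: antisym SUP_least SUP_upper)
  qed
  moreover have "\<exists>l. homogeneous 1 l \<and> subdegree (fe x l) = 1"
  proof (intro exI conjI)
    let ?U = "Const (mp_eval P v) * u - Const (mp_eval P u) * v"
    show "homogeneous 1 ?U" using f unfolding frame_def
      by (auto intro!: homogeneous_diff homogeneous_Const_mult)
    have "fe x ?U = fps_const (mp_eval P v) * fps_X" by (simp add: x algebra_simps)
    thus "subdegree (fe x ?U) = 1" using nz by simp
  qed
  ultimately have "local_param d P x" unfolding local_param_def using x(1,2) by blast
  thus ?thesis by (rule that)
qed

section \<open>Functions with at most one pole\<close>

locale smooth_curve =
  fixes d :: "'a::alg_closed_field"
  assumes two: "(2::'a) \<noteq> 0" and d0: "d \<noteq> 0" and d1: "d \<noteq> 1"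
begin

definition arc :: "(4 \<Rightarrow> 'a) \<Rightarrow> 4 \<Rightarrow> 'a fps" where
  "arc P = (SOME x. local_param d P x)"

lemma local_param_arc: "P \<in> curve d \<Longrightarrow> local_param d P (arc P)"
proof -
  assume "P \<in> curve d"
  then obtain x where "local_param d P x" by (rule local_param_exists[OF two d0 d1])
  thus ?thesis unfolding arc_def by (rule someI[where P = "local_param d P"])
qed

lemma arc_cone: "P \<in> curve d \<Longrightarrow> cone (fps_const d) (arc P)"
  using local_param_arc by (simp add: local_param_def)

lemma arc_nth_0: "P \<in> curve d \<Longrightarrow> arc P i $ 0 = P i"
  using local_param_arc by (simp add: local_param_def)

lemma fe_arc_nth_0: "P \<in> curve d \<Longrightarrow> fe (arc P) F $ 0 = mp_eval P F"
  by (simp add: fe_nth_0 arc_nth_0)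

lemma fe_arc_nonzero: "P \<in> curve d \<Longrightarrow> homogeneous k F \<Longrightarrow> F \<notin> curve_ideal d \<Longrightarrow> fe (arc P) F \<noteq> 0"
  using local_param_arc unfolding local_param_def by blast

lemma ord_at_arc:
  "P \<in> curve d \<Longrightarrow> homogeneous k F \<Longrightarrow> F \<notin> curve_ideal d \<Longrightarrow> ord_at d P F = enat (subdegree (fe (arc P) F))"
  using local_param_arc unfolding local_param_def by blast

lemma fe_arc_eq:
  assumes "P \<in> curve d" "\<And>Q. Q \<in> curve d \<Longrightarrow> mp_eval Q F = mp_eval Q G"
  shows "fe (arc P) F = fe (arc P) G"
proof -
  have "F - G \<in> curve_ideal d" using assms(2) by (simp add: curve_ideal_def)
  from fe_curve_ideal[OF two d0 d1 this arc_cone[OF assms(1)]] show ?thesis by simp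
qed

lemma curve_ideal_if_fe_arc_0:
  assumes "P \<in> curve d" "homogeneous k F" "fe (arc P) F = 0"
  shows "F \<in> curve_ideal d"
  using fe_arc_nonzero assms by blast

lemma identity_point_in_curve: "identity_point \<in> curve d"
proof -
  have "(identity_point :: 4 \<Rightarrow> 'a) \<noteq> (\<lambda>_. 0)"
  proof
    assume "(identity_point :: 4 \<Rightarrow> 'a) = (\<lambda>_. 0)"
    hence "(identity_point :: 4 \<Rightarrow> 'a) 0 = 0" by (rule fun_cong)
    thus False by (simp add: identity_point_def)
  qed
  thus ?thesis by (simp add: curve_iff cone_def identity_point_def)
qed

text \<open>Power series have no zero divisors, and a form that vanishes along a single arc lies in
  the ideal; so irreducibility can be seen at one point.\<close>

lemma curve_ideal_prime:
  assumes "homogeneous k F" "homogeneous l G" "F * G \<in> curve_ideal d"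
  shows "F \<in> curve_ideal d \<or> G \<in> curve_ideal d"
proof -
  have P: "identity_point \<in> curve d" by (rule identity_point_in_curve)
  have "fe (arc identity_point) F * fe (arc identity_point) G = 0"
    using fe_curve_ideal[OF two d0 d1 assms(3) arc_cone[OF P]] by simp
  thus ?thesis using curve_ideal_if_fe_arc_0[OF P] assms(1,2) by auto
qed

end

lemma coeff_0_dbound:
  assumes "dbound k p" "coeff p (nat k) = 0"
  shows "dbound (k - 1) p"
proof (cases "p = 0")
  case False
  with assms(1) have "int (degree p) \<le> k" by (simp add: dbound_def)
  moreover have "degree p \<noteq> nat k" using assms(2) False by (metis leading_coeff_0_iff)
  ultimately show ?thesis by (auto simp: dbound_def)
qed simp

lemma bform_id_0: "bform id k p 1 0 = coeff p (nat k)"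
proof -
  have "bform id k p 1 0 = (\<Sum>i\<in>{nat k}. coeff p i)"
    unfolding bform_def id_apply
    by (rule sum.mono_neutral_cong_right) (auto simp: power_0_left)
  thus ?thesis by simp
qed

lemma linear_factor:
  fixes p :: "'a::field poly"
  assumes "dbound k p" "poly p r = 0"
  obtains q where "p = [:- r, 1:] * q" "dbound (k - 1) q"
proof -
  from assms(2) obtain q where q: "p = [:- r, 1:] * q" by (auto simp: poly_eq_0_iff_dvd)
  have "dbound (k - 1) q"
  proof (cases "q = 0")
    case False
    hence "degree p = Suc (degree q)" unfolding q by (subst degree_mult_eq) auto
    with assms(1) False q show ?thesis by (auto simp: dbound_def)
  qed simp
  with q show ?thesis by (rule that)
qed

section \<open>Division of normal forms by binary forms\<close>

context smooth_curve
begin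

context
  fixes \<alpha> \<beta> \<gamma> \<delta> :: 'a and u v m n :: "(4, 'a) mpoly"
  assumes frame: "frame d \<alpha> \<beta> \<gamma> \<delta> u v m n"
begin

definition quad_at :: "int \<Rightarrow> 'a poly \<Rightarrow> 'a poly \<Rightarrow> 'a poly \<Rightarrow> 'a poly \<Rightarrow> (4 \<Rightarrow> 'a) \<Rightarrow> 'a fps" where
  "quad_at k a b c e P = qform fps_const k a b c e (fe (arc P) u) (fe (arc P) v) (fe (arc P) m) (fe (arc P) n)"

lemma quad_at_nth_0:
  "P \<in> curve d \<Longrightarrow> quad_at k a b c e P $ 0
     = qform id k a b c e (mp_eval P u) (mp_eval P v) (mp_eval P m) (mp_eval P n)"
  by (simp add: quad_at_def qform_nth_0 fe_arc_nth_0)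

lemma frame_hom: "homogeneous 1 u" "homogeneous 1 v" "homogeneous 1 m" "homogeneous 1 n"
  using frame by (auto simp: frame_def)

lemma frame_nz: "\<alpha> \<noteq> 0" "\<beta> \<noteq> 0" "\<gamma> \<noteq> 0" "\<delta> \<noteq> 0" "\<alpha> * \<delta> \<noteq> \<beta> * \<gamma>"
  using frame by (auto simp: frame_def)

lemma frame_points:
  assumes "\<not> (u1 = 0 \<and> v1 = 0)"
  obtains M N where "M ^ 2 = \<alpha> * u1 ^ 2 + \<beta> * v1 ^ 2" "N ^ 2 = \<gamma> * u1 ^ 2 + \<delta> * v1 ^ 2"
    "\<And>s t. s ^ 2 = 1 \<Longrightarrow> t ^ 2 = 1 \<Longrightarrow> \<exists>P\<in>curve d. mp_eval P u = u1 \<and> mp_eval P v = v1 \<and>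
       mp_eval P m = s * M \<and> mp_eval P n = t * N"
proof -
  obtain M N where MN: "M ^ 2 = \<alpha> * u1 ^ 2 + \<beta> * v1 ^ 2" "N ^ 2 = \<gamma> * u1 ^ 2 + \<delta> * v1 ^ 2"
    using sqrt_exists by metis
  have "\<exists>P\<in>curve d. mp_eval P u = u1 \<and> mp_eval P v = v1 \<and> mp_eval P m = s * M \<and> mp_eval P n = t * N"
    if "s ^ 2 = 1" "t ^ 2 = 1" for s t
  proof -
    have "(s * M) ^ 2 = \<alpha> * u1 ^ 2 + \<beta> * v1 ^ 2" "(t * N) ^ 2 = \<gamma> * u1 ^ 2 + \<delta> * v1 ^ 2"
      using that MN by (simp_all add: power_mult_distrib)
    from frame_point[OF frame this assms] show ?thesis by blast
  qed
  with MN that show ?thesis by blast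
qed

lemma linear_form_nonzero:
  assumes P: "P \<in> curve d" and pq: "\<not> (p = 0 \<and> q = 0)"
  shows "fps_const p * fe (arc P) u + fps_const q * fe (arc P) v \<noteq> 0"
proof -
  let ?L = "Const p * u + Const q * v"
  have "homogeneous 1 ?L" by (intro homogeneous_add homogeneous_Const_mult frame_hom)
  moreover have "?L \<notin> curve_ideal d"
  proof
    assume L: "?L \<in> curve_ideal d"
    obtain Q where "Q \<in> curve d" "mp_eval Q u = 1" "mp_eval Q v = 0"
      using frame_points[of 1 0] by (metis one_neq_zero power_one)
    moreover obtain R where "R \<in> curve d" "mp_eval R u = 0" "mp_eval R v = 1"
      using frame_points[of 0 1] by (metis one_neq_zero power_one)
    ultimately have "p = 0" "q = 0" using L by (auto simp: curve_ideal_def)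
    with pq show False by blast
  qed
  ultimately have "fe (arc P) ?L \<noteq> 0" by (rule fe_arc_nonzero[OF P])
  thus ?thesis by simp
qed

text \<open>The fibre \<open>v = 0\<close> is unramified, since \<open>m^2 = \<alpha>\<close> and
  \<open>n^2 = \<gamma>\<close> do not vanish at \<open>u = 1\<close>. Its four points kill the top
  coefficients of all four parts, which is what lowers the formal degree by one.\<close>

lemma divide_by_v:
  assumes q: "qbound k a b c e"
    and dvd: "\<And>P. P \<in> curve d \<Longrightarrow> fe (arc P) v dvd quad_at k a b c e P"
  shows "qbound (k - 1) a b c e" "P \<in> curve d \<Longrightarrow> quad_at k a b c e P = fe (arc P) v * quad_at (k - 1) a b c e P"
proof -
  have q': "dbound k a" "dbound (k - 1) b" "dbound (k - 1) c" "dbound (k - 2) e"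
    using q by (simp_all add: qbound_def)
  obtain M N where MN: "M ^ 2 = \<alpha> * 1 ^ 2 + \<beta> * 0 ^ 2" "N ^ 2 = \<gamma> * 1 ^ 2 + \<delta> * 0 ^ 2"
    and P: "\<And>s t. s ^ 2 = 1 \<Longrightarrow> t ^ 2 = 1 \<Longrightarrow> \<exists>P\<in>curve d. mp_eval P u = 1 \<and> mp_eval P v = 0 \<and>
       mp_eval P m = s * M \<and> mp_eval P n = t * N"
    using frame_points[of 1 0] by auto
  have nz: "M \<noteq> 0" "N \<noteq> 0" using MN frame_nz by auto
  have *: "coeff a (nat k) + coeff b (nat (k - 1)) * (s * M) + coeff c (nat (k - 1)) * (t * N)
      + coeff e (nat (k - 2)) * (s * M) * (t * N) = 0" if st: "s ^ 2 = 1" "t ^ 2 = 1" for s t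
  proof -
    obtain P where P: "P \<in> curve d" "mp_eval P u = 1" "mp_eval P v = 0" "mp_eval P m = s * M" "mp_eval P n = t * N"
      using P[OF st] by blast
    have "fe (arc P) v $ 0 = 0" using P by (simp add: fe_arc_nth_0)
    hence "fps_X dvd fe (arc P) v" by (simp add: fps_X_dvd_iff)
    hence "fps_X dvd quad_at k a b c e P" using dvd[OF P(1)] dvd_trans by blast
    thus ?thesis using P by (simp add: fps_X_dvd_iff quad_at_nth_0 qform_def bform_id_0)
  qed
  have "coeff a (nat k) = 0 \<and> coeff b (nat (k - 1)) * M = 0 \<and> coeff c (nat (k - 1)) * N = 0
      \<and> coeff e (nat (k - 2)) * M * N = 0"
    using four_signs[OF two, of "coeff a (nat k)" "coeff b (nat (k - 1))" M "coeff c (nat (k - 1))" N "coeff e (nat (k - 2))"]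
      *[of 1 1] *[of "- 1" 1] *[of 1 "- 1"] *[of "- 1" "- 1"] by simp
  with nz have z: "coeff a (nat k) = 0" "coeff b (nat (k - 1)) = 0" "coeff c (nat (k - 1)) = 0"
    "coeff e (nat (k - 2)) = 0" by simp_all
  have "k - 2 - 1 = k - 1 - 2" by simp
  with coeff_0_dbound[OF q'(1) z(1)] coeff_0_dbound[OF q'(2) z(2)] coeff_0_dbound[OF q'(3) z(3)]
    coeff_0_dbound[OF q'(4) z(4)]
  show q2: "qbound (k - 1) a b c e" unfolding qbound_def by metis
  have q3: "dbound (k - 1) a" "dbound (k - 2) b" "dbound (k - 2) c" "dbound (k - 3) e"
    using q2 by (simp_all add: qbound_def)
  have s: "k - 1 + 1 = k" "k - 2 + 1 = k - 1" "k - 3 + 1 = k - 2" "k - 1 - 1 = k - 2" "k - 1 - 2 = k - 3" by simp_all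
  show "quad_at k a b c e P = fe (arc P) v * quad_at (k - 1) a b c e P"
    unfolding quad_at_def qform_def s(4,5)
    using ev_fps.bform_Suc[OF q3(1), unfolded s] ev_fps.bform_Suc[OF q3(2), unfolded s]
      ev_fps.bform_Suc[OF q3(3), unfolded s] ev_fps.bform_Suc[OF q3(4), unfolded s]
    by (simp add: algebra_simps)
qed

lemma bform_linear: "bform fps_const 1 [:- r, 1:] U V = U - fps_const r * V"
proof -
  have "{..nat 1} = {0, 1::nat}" by auto
  thus ?thesis by (simp add: bform_def algebra_simps flip: fps_const_neg)
qed

text \<open>Here the fibre has just two points, both with \<open>m = 0\<close>, so values reach only
  \<open>a\<close> and \<open>c\<close>. Once these are divided out, \<open>m h\<close> remains.
  Since \<open>u - r v\<close> is \<open>m^2\<close> up to a unit there, \<open>m\<close> must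
  divide \<open>h\<close>, and the values of \<open>h\<close> give \<open>b\<close> and
  \<open>e\<close>.\<close>

lemma roots_if_dvd_ramified:
  assumes q: "qbound k a b c e" and A: "\<alpha> * r ^ 2 + \<beta> = 0"
    and dvd: "\<And>P. P \<in> curve d \<Longrightarrow> (fe (arc P) u - fps_const r * fe (arc P) v) dvd quad_at k a b c e P"
  shows "poly a r = 0 \<and> poly b r = 0 \<and> poly c r = 0 \<and> poly e r = 0"
proof -
  have q': "dbound k a" "dbound (k - 1) b" "dbound (k - 1) c" "dbound (k - 2) e"
    using q by (simp_all add: qbound_def)
  have r0: "r \<noteq> 0" using A frame_nz by auto
  obtain M N where MN: "M ^ 2 = \<alpha> * r ^ 2 + \<beta> * 1 ^ 2" "N ^ 2 = \<gamma> * r ^ 2 + \<delta> * 1 ^ 2"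
    and P: "\<And>s t. s ^ 2 = 1 \<Longrightarrow> t ^ 2 = 1 \<Longrightarrow> \<exists>P\<in>curve d. mp_eval P u = r \<and> mp_eval P v = 1 \<and>
       mp_eval P m = s * M \<and> mp_eval P n = t * N"
    using frame_points[of r 1] by auto
  have M0: "M = 0" using MN A by simp
  have N0: "N \<noteq> 0"
  proof
    assume "N = 0"
    hence "\<gamma> * r ^ 2 + \<delta> = 0" using MN by simp
    moreover have "\<alpha> * \<delta> - \<beta> * \<gamma> = \<alpha> * (\<gamma> * r ^ 2 + \<delta>) - \<gamma> * (\<alpha> * r ^ 2 + \<beta>)" by (simp add: algebra_simps)
    ultimately show False using frame_nz A by simp
  qed
  have P: "\<exists>P\<in>curve d. mp_eval P u = r \<and> mp_eval P v = 1 \<and> mp_eval P m = 0 \<and> mp_eval P n = t * N"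
    if "t ^ 2 = 1" for t using P[of 1 t] that M0 by simp
  let ?l = "\<lambda>P. fe (arc P) u - fps_const r * fe (arc P) v"
  have "poly a r + poly c r * (t * N) = 0" if t: "t ^ 2 = 1" for t
  proof -
    obtain P where P: "P \<in> curve d" "mp_eval P u = r" "mp_eval P v = 1" "mp_eval P m = 0" "mp_eval P n = t * N"
      using P[OF t] by blast
    have "?l P $ 0 = 0" using P by (simp add: fe_arc_nth_0)
    hence "fps_X dvd ?l P" by (simp add: fps_X_dvd_iff)
    hence "fps_X dvd quad_at k a b c e P" using dvd[OF P(1)] dvd_trans by blast
    thus ?thesis using P q' by (simp add: fps_X_dvd_iff quad_at_nth_0 qform_def bform_id_1)
  qed
  from this[of 1] this[of "- 1"] have ac: "poly a r = 0" "poly c r = 0"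
    using four_signs[OF two, of "poly a r" 0 1 "poly c r" N 0] N0 by simp_all
  obtain a1 where a1: "a = [:- r, 1:] * a1" "dbound (k - 1) a1" by (rule linear_factor[OF q'(1) ac(1)])
  obtain c1 where c1: "c = [:- r, 1:] * c1" "dbound (k - 1 - 1) c1" by (rule linear_factor[OF q'(3) ac(2)])
  have lin: "dbound 1 [:- r, 1:]" by (simp add: dbound_def)
  have "poly b r + poly e r * (t * N) = 0" if t: "t ^ 2 = 1" for t
  proof -
    obtain P where P: "P \<in> curve d" "mp_eval P u = r" "mp_eval P v = 1" "mp_eval P m = 0" "mp_eval P n = t * N"
      using P[OF t] by blast
    let ?u = "fe (arc P) u" and ?v = "fe (arc P) v" and ?m = "fe (arc P) m" and ?n = "fe (arc P) n"
    define h where "h = bform fps_const (k - 1) b ?u ?v + bform fps_const (k - 2) e ?u ?v * ?n"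
    define w where "w = fps_const \<alpha> * (?u + fps_const r * ?v)"
    have s: "1 + (k - 1) = k" "1 + (k - 1 - 1) = k - 1" by simp_all
    have f1: "bform fps_const k ([:- r, 1:] * a1) ?u ?v = ?l P * bform fps_const (k - 1) a1 ?u ?v"
      using ev_fps.bform_mult[OF lin a1(2), of ?u ?v] by (simp only: bform_linear s)
    have f2: "bform fps_const (k - 1) ([:- r, 1:] * c1) ?u ?v = ?l P * bform fps_const (k - 1 - 1) c1 ?u ?v"
      using ev_fps.bform_mult[OF lin c1(2), of ?u ?v] by (simp only: bform_linear s)
    have "quad_at k a b c e P = ?l P * (bform fps_const (k - 1) a1 ?u ?v + bform fps_const (k - 1 - 1) c1 ?u ?v * ?n) + ?m * h"
      unfolding quad_at_def qform_def h_def a1(1) c1(1) f1 f2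
      by (simp only: algebra_simps)
    with dvd[OF P(1)] have "?l P dvd ?m * h" by (metis dvd_add_right_iff dvd_triv_left)
    moreover have mm: "?m * ?m = ?l P * w"
    proof -
      have "\<beta> = - (\<alpha> * r ^ 2)" using A by (simp add: eq_neg_iff_add_eq_0 add.commute)
      hence b: "fps_const \<beta> = - (fps_const \<alpha> * fps_const r ^ 2)" by (simp add: fps_const_power)
      have "?m ^ 2 = fps_const \<alpha> * ?u ^ 2 + fps_const \<beta> * ?v ^ 2"
        using frame arc_cone[OF P(1)] by (simp add: frame_def)
      hence "?m * ?m = fps_const \<alpha> * (?u * ?u) + - (fps_const \<alpha> * (fps_const r * fps_const r)) * (?v * ?v)"
        unfolding b power2_eq_square .
      also have "\<dots> = ?l P * w"
        unfolding w_def by (simp add: algebra_simps del: fps_const_mult fps_const_neg)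
      finally show ?thesis .
    qed
    moreover have w: "w dvd 1"
    proof -
      have "w $ 0 = \<alpha> * r + \<alpha> * r" using P by (simp add: w_def fe_arc_nth_0 distrib_left)
      hence "w $ 0 = 2 * (\<alpha> * r)" by (simp only: mult_2)
      with two frame_nz r0 show ?thesis by simp
    qed
    ultimately have "?m * ?m dvd ?m * h" by (simp add: mult_unit_dvd_iff)
    moreover have "?m \<noteq> 0"
    proof
      assume "?m = 0"
      with mm w have "?l P = 0" by auto
      with linear_form_nonzero[OF P(1), of 1 "- r"] show False by (simp flip: fps_const_neg)
    qed
    ultimately have "?m dvd h" by simp
    moreover have "fps_X dvd ?m" using P by (simp add: fps_X_dvd_iff fe_arc_nth_0)
    ultimately have "fps_X dvd h" using dvd_trans by blast
    thus ?thesis using P q' by (simp add: fps_X_dvd_iff h_def bform_nth_0 fe_arc_nth_0 bform_id_1)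
  qed
  from this[of 1] this[of "- 1"] have "poly b r = 0" "poly e r = 0"
    using four_signs[OF two, of "poly b r" 0 1 "poly e r" N 0] N0 by simp_all
  with ac show ?thesis by simp
qed

lemma roots_if_dvd_unramified:
  assumes q: "qbound k a b c e" and AB: "\<alpha> * r ^ 2 + \<beta> \<noteq> 0" "\<gamma> * r ^ 2 + \<delta> \<noteq> 0"
    and dvd: "\<And>P. P \<in> curve d \<Longrightarrow> (fe (arc P) u - fps_const r * fe (arc P) v) dvd quad_at k a b c e P"
  shows "poly a r = 0 \<and> poly b r = 0 \<and> poly c r = 0 \<and> poly e r = 0"
proof -
  have q': "dbound k a" "dbound (k - 1) b" "dbound (k - 1) c" "dbound (k - 2) e"
    using q by (simp_all add: qbound_def)
  obtain M N where MN: "M ^ 2 = \<alpha> * r ^ 2 + \<beta> * 1 ^ 2" "N ^ 2 = \<gamma> * r ^ 2 + \<delta> * 1 ^ 2"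
    and P: "\<And>s t. s ^ 2 = 1 \<Longrightarrow> t ^ 2 = 1 \<Longrightarrow> \<exists>P\<in>curve d. mp_eval P u = r \<and> mp_eval P v = 1 \<and>
       mp_eval P m = s * M \<and> mp_eval P n = t * N"
    using frame_points[of r 1] by auto
  have nz: "M \<noteq> 0" "N \<noteq> 0" using MN AB by auto
  have *: "poly a r + poly b r * (s * M) + poly c r * (t * N) + poly e r * (s * M) * (t * N) = 0"
    if st: "s ^ 2 = 1" "t ^ 2 = 1" for s t
  proof -
    obtain P where P: "P \<in> curve d" "mp_eval P u = r" "mp_eval P v = 1" "mp_eval P m = s * M" "mp_eval P n = t * N"
      using P[OF st] by blast
    have "(fe (arc P) u - fps_const r * fe (arc P) v) $ 0 = 0" using P by (simp add: fe_arc_nth_0)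
    hence "fps_X dvd (fe (arc P) u - fps_const r * fe (arc P) v)" by (simp add: fps_X_dvd_iff)
    hence "fps_X dvd quad_at k a b c e P" using dvd[OF P(1)] dvd_trans by blast
    thus ?thesis using P q' by (simp add: fps_X_dvd_iff quad_at_nth_0 qform_def bform_id_1)
  qed
  have "poly a r = 0 \<and> poly b r * M = 0 \<and> poly c r * N = 0 \<and> poly e r * M * N = 0"
    using four_signs[OF two, of "poly a r" "poly b r" M "poly c r" N "poly e r"]
      *[of 1 1] *[of "- 1" 1] *[of 1 "- 1"] *[of "- 1" "- 1"] by simp
  with nz show ?thesis by simp
qed

end

lemma quad_at_swap:
  assumes "frame d \<alpha> \<beta> \<gamma> \<delta> u v m n"
  shows "quad_at u v m n k a b c e P = quad_at u v n m k a c b e P"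
  by (simp add: quad_at_def[OF assms] quad_at_def[OF frame_swap_mn[OF assms]] qform_def algebra_simps)

context
  fixes \<alpha> \<beta> \<gamma> \<delta> :: 'a and u v m n :: "(4, 'a) mpoly"
  assumes frame: "frame d \<alpha> \<beta> \<gamma> \<delta> u v m n"
begin

abbreviation "qat \<equiv> quad_at u v m n"

lemma divide_by_linear:
  assumes q: "qbound k a b c e"
    and dvd: "\<And>P. P \<in> curve d \<Longrightarrow> (fe (arc P) u - fps_const r * fe (arc P) v) dvd qat k a b c e P"
  obtains a1 b1 c1 e1 where "a = [:- r, 1:] * a1" "b = [:- r, 1:] * b1" "c = [:- r, 1:] * c1" "e = [:- r, 1:] * e1"
    "qbound (k - 1) a1 b1 c1 e1"
    "\<And>P. qat k a b c e P = (fe (arc P) u - fps_const r * fe (arc P) v) * qat (k - 1) a1 b1 c1 e1 P"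
proof -
  have q': "dbound k a" "dbound (k - 1) b" "dbound (k - 1) c" "dbound (k - 2) e"
    using q by (simp_all add: qbound_def)
  have "poly a r = 0 \<and> poly b r = 0 \<and> poly c r = 0 \<and> poly e r = 0"
  proof (cases "\<alpha> * r ^ 2 + \<beta> = 0")
    case True
    show ?thesis by (rule roots_if_dvd_ramified[OF frame q True dvd])
  next
    case A: False
    show ?thesis
    proof (cases "\<gamma> * r ^ 2 + \<delta> = 0")
      case True
      have "qbound k a c b e" using q by (simp add: qbound_def)
      from roots_if_dvd_ramified[OF frame_swap_mn[OF frame] this True] dvd
      show ?thesis by (simp add: quad_at_swap[OF frame])
    next
      case False
      show ?thesis by (rule roots_if_dvd_unramified[OF frame q A False dvd])
    qed
  qed
  then obtain a1 b1 c1 e1 where f: "a = [:- r, 1:] * a1" "dbound (k - 1) a1" "b = [:- r, 1:] * b1" "dbound (k - 1 - 1) b1"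
    "c = [:- r, 1:] * c1" "dbound (k - 1 - 1) c1" "e = [:- r, 1:] * e1" "dbound (k - 2 - 1) e1"
    using linear_factor[OF q'(1)] linear_factor[OF q'(2)] linear_factor[OF q'(3)] linear_factor[OF q'(4)]
    by metis
  have s: "k - 2 - 1 = k - 1 - 2" "1 + (k - 1) = k" "1 + (k - 1 - 1) = k - 1" "1 + (k - 2 - 1) = k - 2" by simp_all
  have qb: "qbound (k - 1) a1 b1 c1 e1" using f unfolding qbound_def s(1) by blast
  have lin: "dbound 1 [:- r, 1:]" by (simp add: dbound_def)
  have m: "bform fps_const k ([:- r, 1:] * a1) U V = (U - fps_const r * V) * bform fps_const (k - 1) a1 U V"
    "bform fps_const (k - 1) ([:- r, 1:] * b1) U V = (U - fps_const r * V) * bform fps_const (k - 1 - 1) b1 U V"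
    "bform fps_const (k - 1) ([:- r, 1:] * c1) U V = (U - fps_const r * V) * bform fps_const (k - 1 - 1) c1 U V"
    "bform fps_const (k - 2) ([:- r, 1:] * e1) U V = (U - fps_const r * V) * bform fps_const (k - 2 - 1) e1 U V" for U V
    using ev_fps.bform_mult[OF lin f(2), of U V] ev_fps.bform_mult[OF lin f(4), of U V]
      ev_fps.bform_mult[OF lin f(6), of U V] ev_fps.bform_mult[OF lin f(8), of U V]
    by (simp_all only: bform_linear[OF frame] s(2-))
  have "qat k a b c e P = (fe (arc P) u - fps_const r * fe (arc P) v) * qat (k - 1) a1 b1 c1 e1 P" for P
    unfolding quad_at_def[OF frame] qform_def f(1,3,5,7) m s(1) by (simp only: algebra_simps)
  from that[OF f(1,3,5,7) qb this] show ?thesis .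
qed

text \<open>The binary form splits into \<open>D\<close> linear factors. A drop in the degree of its
  dehomogenisation means that \<open>v\<close> is a factor; otherwise a root in the algebraically
  closed field supplies one.\<close>

lemma divide_by_binary_form:
  assumes "qbound k a b c e" "N \<noteq> 0" "dbound (int D) N"
    and "\<And>P. P \<in> curve d \<Longrightarrow> bform fps_const (int D) N (fe (arc P) u) (fe (arc P) v) dvd qat k a b c e P"
  shows "\<exists>a1 b1 c1 e1. qbound (k - int D) a1 b1 c1 e1 \<and> (\<forall>P\<in>curve d.
     qat k a b c e P = bform fps_const (int D) N (fe (arc P) u) (fe (arc P) v) * qat (k - int D) a1 b1 c1 e1 P)"
  using assms
proof (induction D arbitrary: N k a b c e)
  case 0
  then obtain s where s: "N = [:s:]" "s \<noteq> 0" by (auto simp: dbound_def elim!: degree_eq_zeroE)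
  let ?i = "smult (inverse s)"
  have N: "bform fps_const (int 0) N U V = fps_const s" for U V by (simp add: bform_def s)
  have "qbound k (?i a) (?i b) (?i c) (?i e)" using "0.prems"(1) by (simp add: qbound_def dbound_smult)
  moreover have "qat k a b c e P = fps_const s * qat k (?i a) (?i b) (?i c) (?i e) P" for P
  proof -
    have "fps_const s * fps_const (inverse s) = 1" using s by simp
    hence "fps_const s * (fps_const (inverse s) * w) = w" for w by (simp only: mult.assoc[symmetric] mult_1)
    moreover have "qat k (?i a) (?i b) (?i c) (?i e) P = fps_const (inverse s) * qat k a b c e P"
      unfolding quad_at_def[OF frame] qform_def ev_fps.bform_smult by (simp only: distrib_left mult.assoc)
    ultimately show ?thesis by simp
  qed
  ultimately show ?case unfolding N
    by (intro exI[of _ "?i a"] exI[of _ "?i b"] exI[of _ "?i c"] exI[of _ "?i e"]) simp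
next
  case (Suc D)
  show ?case
  proof (cases "degree N = Suc D")
    case False
    hence N: "dbound (int D) N" using Suc.prems(2,3) by (auto simp: dbound_def)
    have e: "bform fps_const (int (Suc D)) N U V = V * bform fps_const (int D) N U V" for U V
      using ev_fps.bform_Suc[OF N] by (simp add: add.commute)
    have vd: "fe (arc P) v dvd qat k a b c e P" if "P \<in> curve d" for P
      using Suc.prems(4)[OF that] unfolding e by (rule dvd_mult_left)
    have dv: "qbound (k - 1) a b c e" "P \<in> curve d \<Longrightarrow> qat k a b c e P = fe (arc P) v * qat (k - 1) a b c e P" for P
      using divide_by_v[OF frame Suc.prems(1)] vd by blast+
    have "bform fps_const (int D) N (fe (arc P) u) (fe (arc P) v) dvd qat (k - 1) a b c e P" if P: "P \<in> curve d" for P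
    proof -
      have "fe (arc P) v \<noteq> 0" using linear_form_nonzero[OF frame P, of 0 1] by simp
      with Suc.prems(4)[OF P] show ?thesis unfolding e dv(2)[OF P] by simp
    qed
    from Suc.IH[OF dv(1) Suc.prems(2) N this] obtain a1 b1 c1 e1 where
      q1: "qbound (k - 1 - int D) a1 b1 c1 e1" and Q1: "\<And>P. P \<in> curve d \<Longrightarrow> qat (k - 1) a b c e P
         = bform fps_const (int D) N (fe (arc P) u) (fe (arc P) v) * qat (k - 1 - int D) a1 b1 c1 e1 P" by blast
    have s: "k - int (Suc D) = k - 1 - int D" by simp
    show ?thesis unfolding e s
    proof (intro exI conjI ballI)
      show "qbound (k - 1 - int D) a1 b1 c1 e1" by (rule q1)
      fix P assume P: "P \<in> curve d"
      show "qat k a b c e P = fe (arc P) v * bform fps_const (int D) N (fe (arc P) u) (fe (arc P) v) * qat (k - 1 - int D) a1 b1 c1 e1 P"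
        unfolding dv(2)[OF P] Q1[OF P] by (simp only: mult.assoc)
    qed
  next
    case True
    then obtain r where "poly N r = 0" using alg_closed_imp_poly_has_root[of N] by auto
    from linear_factor[OF Suc.prems(3) this] obtain N1 where N1: "N = [:- r, 1:] * N1" "dbound (int D) N1"
      by auto
    have N10: "N1 \<noteq> 0" using N1 Suc.prems(2) by auto
    have lin: "dbound 1 [:- r, 1:]" by (simp add: dbound_def)
    have e: "bform fps_const (int (Suc D)) N U V = (U - fps_const r * V) * bform fps_const (int D) N1 U V" for U V
      using ev_fps.bform_mult[OF lin N1(2)] by (simp add: N1(1) bform_linear[OF frame])
    have "(fe (arc P) u - fps_const r * fe (arc P) v) dvd qat k a b c e P" if "P \<in> curve d" for P
      using Suc.prems(4)[OF that] unfolding e by (rule dvd_mult_left)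
    from divide_by_linear[OF Suc.prems(1) this] obtain a1 b1 c1 e1 where q: "qbound (k - 1) a1 b1 c1 e1"
      and Qe: "\<And>P. qat k a b c e P = (fe (arc P) u - fps_const r * fe (arc P) v) * qat (k - 1) a1 b1 c1 e1 P" by metis
    have "bform fps_const (int D) N1 (fe (arc P) u) (fe (arc P) v) dvd qat (k - 1) a1 b1 c1 e1 P" if P: "P \<in> curve d" for P
    proof -
      have "fe (arc P) u - fps_const r * fe (arc P) v \<noteq> 0"
        using linear_form_nonzero[OF frame P, of 1 "- r"] by (simp flip: fps_const_neg)
      with Suc.prems(4)[OF P] show ?thesis unfolding e Qe by simp
    qed
    from Suc.IH[OF q N10 N1(2) this] obtain a2 b2 c2 e2 where
      q2: "qbound (k - 1 - int D) a2 b2 c2 e2" and Q2: "\<And>P. P \<in> curve d \<Longrightarrow> qat (k - 1) a1 b1 c1 e1 P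
         = bform fps_const (int D) N1 (fe (arc P) u) (fe (arc P) v) * qat (k - 1 - int D) a2 b2 c2 e2 P" by blast
    have s: "k - int (Suc D) = k - 1 - int D" by simp
    show ?thesis unfolding e s
    proof (intro exI conjI ballI)
      show "qbound (k - 1 - int D) a2 b2 c2 e2" by (rule q2)
      fix P assume P: "P \<in> curve d"
      show "qat k a b c e P = (fe (arc P) u - fps_const r * fe (arc P) v) *
          bform fps_const (int D) N1 (fe (arc P) u) (fe (arc P) v) * qat (k - 1 - int D) a2 b2 c2 e2 P"
        unfolding Qe Q2[OF P] by (simp only: mult.assoc)
    qed
  qed
qed

end

end

lemma fe_bform: "fe x (bform Const k p u v) = bform fps_const k p (fe x u) (fe x v)"
  by (simp add: bform_def ev_fps.ev_sum)

lemma fe_qform: "fe x (qform Const k a b c e u v m n) = qform fps_const k a b c e (fe x u) (fe x v) (fe x m) (fe x n)"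
  by (simp add: qform_def fe_bform)

lemma homogeneous_bform_mult:
  assumes p: "dbound (int k - int j) p" and h: "homogeneous 1 u" "homogeneous 1 v" "homogeneous j w"
  shows "homogeneous k (bform Const (int k - int j) p u v * w)"
proof (cases "p = 0")
  case False
  with p have jk: "j \<le> k" by (auto simp: dbound_def)
  hence n: "nat (int k - int j) = k - j" by simp
  have "homogeneous (k - j) (bform Const (int k - int j) p u v)"
    unfolding bform_def n
  proof (rule homogeneous_sum)
    fix i assume i: "i \<in> {..k - j}"
    have "homogeneous (0 + i * 1 + (k - j - i) * 1) (Const (coeff p i) * u ^ i * v ^ (k - j - i))"
      by (intro homogeneous_mult homogeneous_Const homogeneous_power h)
    moreover have "0 + i * 1 + (k - j - i) * 1 = k - j" using i by simp
    ultimately show "homogeneous (k - j) (Const (coeff p i) * u ^ i * v ^ (k - j - i))" by (simp only:)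
  qed
  from homogeneous_mult[OF this h(3)] jk show ?thesis by simp
qed (simp add: bform_def)

lemma homogeneous_qform:
  assumes q: "qbound (int k) a b c e"
    and h: "homogeneous 1 u" "homogeneous 1 v" "homogeneous 1 m" "homogeneous 1 n"
  shows "homogeneous k (qform Const (int k) a b c e u v m n)"
proof -
  have q': "dbound (int k - int 0) a" "dbound (int k - int 1) b" "dbound (int k - int 1) c" "dbound (int k - int 2) e"
    using q by (simp_all add: qbound_def)
  have mn: "homogeneous 2 (m * n)" using homogeneous_mult[OF h(3,4)] by (simp add: numeral_2_eq_2)
  from homogeneous_bform_mult[OF q'(1) h(1,2) homogeneous_1] homogeneous_bform_mult[OF q'(2) h(1,2,3)]
    homogeneous_bform_mult[OF q'(3) h(1,2,4)] homogeneous_bform_mult[OF q'(4) h(1,2) mn]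
  show ?thesis unfolding qform_def by (simp add: homogeneous_add mult.assoc)
qed

lemma qbound_signs:
  "qbound k a b c e \<Longrightarrow> qbound k a b (- c) (- e)" "qbound k a b c e \<Longrightarrow> qbound k a (- b) c (- e)"
  "qbound k a b c e \<Longrightarrow> qbound k a (- b) (- c) e"
  by (simp_all add: qbound_def dbound_uminus)

lemma proj_eq_refl [simp]: "proj_eq P P"
  unfolding proj_eq_def by (rule exI[of _ 1]) simp

lemma proj_eq_sym: "proj_eq P Q \<Longrightarrow> proj_eq Q P"
  unfolding proj_eq_def
proof (elim exE conjE)
  fix c assume c: "c \<noteq> 0" "Q = (\<lambda>i. c * P i)"
  thus "\<exists>c. c \<noteq> 0 \<and> P = (\<lambda>i. c * Q i)"
    by (intro exI[of _ "inverse c"]) (simp add: fun_eq_iff)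
qed

lemma proj_eq_trans: "proj_eq P Q \<Longrightarrow> proj_eq Q R \<Longrightarrow> proj_eq P R"
  unfolding proj_eq_def
proof (elim exE conjE)
  fix b c assume "b \<noteq> 0" "Q = (\<lambda>i. b * P i)" "c \<noteq> 0" "R = (\<lambda>i. c * Q i)"
  thus "\<exists>c. c \<noteq> 0 \<and> R = (\<lambda>i. c * P i)"
    by (intro exI[of _ "c * b"]) (simp add: fun_eq_iff)
qed

lemma proj_eq_mp_eval:
  assumes "proj_eq P Q" "homogeneous k F"
  obtains c where "c \<noteq> 0" "mp_eval Q F = c ^ k * mp_eval P F"
  using assms mp_eval_homogeneous_scale[OF assms(2)] unfolding proj_eq_def by metis

section \<open>Rational functions with few poles\<close>

context smooth_curve
begin

text \<open>The product \<open>H\<close> of the three other conjugates of \<open>G\<close>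
  rationalises the denominator: \<open>G H\<close> is the norm, a binary form of degree
  \<open>4 k\<close>, and it divides \<open>F H\<close> along all arcs. The quotient is a normal
  form of degree one.\<close>

lemma linear_quotient:
  assumes f: "frame d \<alpha> \<beta> \<gamma> \<delta> u v m n"
    and F: "homogeneous (Suc k) F" and G: "homogeneous k G" "G \<notin> curve_ideal d"
    and dvd: "\<And>P. P \<in> curve d \<Longrightarrow> fe (arc P) G dvd fe (arc P) F"
  obtains p q r s where "\<And>P. P \<in> curve d \<Longrightarrow>
    fe (arc P) F = fe (arc P) G * fe (arc P) (Const p * u + Const q * v + Const r * m + Const s * n)"
proof -
  obtain a b c e where nf: "normal_form d u v m n (int k) G a b c e"
    using normal_form_exists[OF f G(1)] .
  have qb: "qbound (int k) a b c e" using nf by (simp add: normal_form_def)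
  note h = frame_hom[OF f]
  define N where "N = norm_poly (qpoly \<alpha> \<beta>) (qpoly \<gamma> \<delta>) a b c e"
  have N0: "N \<noteq> 0" unfolding N_def by (rule norm_poly_nonzero[OF two f nf G(2)])
  define H where "H = qform Const (int k) a b (- c) (- e) u v m n *
    (qform Const (int k) a (- b) c (- e) u v m n * qform Const (int k) a (- b) (- c) e u v m n)"
  have hH: "homogeneous (k + (k + k)) H" unfolding H_def
    by (intro homogeneous_mult homogeneous_qform h qbound_signs qb)
  let ?U = "\<lambda>P. fe (arc P) u" and ?V = "\<lambda>P. fe (arc P) v"
  have Nb: "dbound (4 * int k) N" and N: "bform fps_const (4 * int k) N (?U P) (?V P) = fe (arc P) G * fe (arc P) H"
    if P: "P \<in> curve d" for P
  proof -
    have rel: "fe (arc P) m ^ 2 = fps_const \<alpha> * ?U P ^ 2 + fps_const \<beta> * ?V P ^ 2"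
      "fe (arc P) n ^ 2 = fps_const \<gamma> * ?U P ^ 2 + fps_const \<delta> * ?V P ^ 2"
      using f arc_cone[OF P] by (simp_all add: frame_def)
    show "dbound (4 * int k) N" unfolding N_def by (rule norm_poly_bform(1)[OF qb rel])
    have "fe (arc P) G = qform fps_const (int k) a b c e (?U P) (?V P) (fe (arc P) m) (fe (arc P) n)"
      using nf arc_cone[OF P] by (simp add: normal_form_def)
    thus "bform fps_const (4 * int k) N (?U P) (?V P) = fe (arc P) G * fe (arc P) H"
      unfolding N_def norm_poly_bform(2)[OF qb rel] H_def by (simp add: fe_qform mult.assoc)
  qed
  have Nb: "dbound (int (4 * k)) N" using Nb[OF identity_point_in_curve] by simp
  have GH0: "fe (arc P) G * fe (arc P) H \<noteq> 0" if P: "P \<in> curve d" for P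
  proof -
    have "homogeneous (4 * k) (bform Const (int (4 * k)) N u v * 1)"
      using homogeneous_bform_mult[of "4 * k" 0 N u v 1] Nb h homogeneous_1 by simp
    moreover have "bform Const (int (4 * k)) N u v * 1 \<notin> curve_ideal d"
    proof
      assume "bform Const (int (4 * k)) N u v * 1 \<in> curve_ideal d"
      moreover have "normal_form d u v m n (int (4 * k)) (bform Const (int (4 * k)) N u v * 1) N 0 0 0"
        using Nb by (simp add: normal_form_def qbound_def qform_def fe_bform)
      ultimately show False using normal_form_vanish(1)[OF two f] N0 by blast
    qed
    ultimately have "fe (arc P) (bform Const (int (4 * k)) N u v * 1) \<noteq> 0" by (rule fe_arc_nonzero[OF P])
    with N[OF P] show ?thesis by (simp add: fe_bform)
  qed
  define K where "K = F * H"
  have "homogeneous (Suc k + (k + (k + k))) K" unfolding K_def by (rule homogeneous_mult[OF F hH])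
  hence hK: "homogeneous (4 * k + 1) K" by (simp add: numeral_eq_Suc)
  obtain a1 b1 c1 e1 where nK: "normal_form d u v m n (int (4 * k + 1)) K a1 b1 c1 e1"
    using normal_form_exists[OF f hK] .
  have K: "fe (arc P) K = quad_at u v m n (int (4 * k + 1)) a1 b1 c1 e1 P" if "P \<in> curve d" for P
    using nK arc_cone[OF that] by (simp add: normal_form_def quad_at_def[OF f])
  have dv: "bform fps_const (int (4 * k)) N (?U P) (?V P) dvd quad_at u v m n (int (4 * k + 1)) a1 b1 c1 e1 P"
    if P: "P \<in> curve d" for P
  proof -
    have "fe (arc P) G * fe (arc P) H dvd fe (arc P) F * fe (arc P) H"
      using dvd[OF P] by (rule mult_dvd_mono) simp
    with N[OF P] K[OF P] show ?thesis by (simp add: K_def)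
  qed
  have q1: "qbound (int (4 * k + 1)) a1 b1 c1 e1" using nK by (simp add: normal_form_def)
  obtain a2 b2 c2 e2 where q2: "qbound (int (4 * k + 1) - int (4 * k)) a2 b2 c2 e2"
    and Q2: "\<And>P. P \<in> curve d \<Longrightarrow> quad_at u v m n (int (4 * k + 1)) a1 b1 c1 e1 P
      = bform fps_const (int (4 * k)) N (?U P) (?V P) * quad_at u v m n (int (4 * k + 1) - int (4 * k)) a2 b2 c2 e2 P"
    using divide_by_binary_form[OF f q1 N0 Nb dv] by blast
  have one: "int (4 * k + 1) - int (4 * k) = 1" by simp
  \<comment> \<open>The last part has the bound \<open>1 - 2\<close> and therefore vanishes; the
    others are a linear form in \<open>u, v\<close> and two constants.\<close>
  have e2: "e2 = 0" and bd: "dbound 1 a2" "dbound 0 b2" "dbound 0 c2"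
    using q2 unfolding one by (auto simp: qbound_def dbound_def)
  have "fe (arc P) F = fe (arc P) G * fe (arc P) (Const (coeff a2 1) * u + Const (coeff a2 0) * v + Const (coeff b2 0) * m + Const (coeff c2 0) * n)"
    if P: "P \<in> curve d" for P
  proof -
    have s: "{..nat 1} = {0, 1::nat}" by auto
    have "quad_at u v m n 1 a2 b2 c2 e2 P = fe (arc P) (Const (coeff a2 1) * u + Const (coeff a2 0) * v + Const (coeff b2 0) * m + Const (coeff c2 0) * n)"
      unfolding quad_at_def[OF f] qform_def e2 by (simp add: bform_def s)
    with Q2[OF P, unfolded one] have "fe (arc P) K = fe (arc P) G * fe (arc P) H * fe (arc P) (Const (coeff a2 1) * u + Const (coeff a2 0) * v + Const (coeff b2 0) * m + Const (coeff c2 0) * n)"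
      using K[OF P] N[OF P] by simp
    hence "fe (arc P) H * fe (arc P) F = fe (arc P) H * (fe (arc P) G * fe (arc P) (Const (coeff a2 1) * u + Const (coeff a2 0) * v + Const (coeff b2 0) * m + Const (coeff c2 0) * n))"
      unfolding K_def by (simp only: fe_simps(4) mult_ac)
    thus ?thesis using GH0[OF P] by simp
  qed
  thus ?thesis by (rule that)
qed

text \<open>A rational function with at most one pole, and that one simple, is constant. If \<open>L\<close> is the
  linear form in \<open>u, v\<close> through the pole \<open>R\<close>, then \<open>L F / G\<close> is a linear form that vanishes at the other
  three points of the plane section \<open>L = 0\<close>, hence it is a multiple of \<open>L\<close>.\<close>

lemma one_pole:
  assumes F: "homogeneous k F" and G: "homogeneous k G" "G \<notin> curve_ideal d" and R: "R \<in> curve d"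
    and dvd: "\<And>P. P \<in> curve d \<Longrightarrow> fe (arc P) G dvd (if proj_eq P R then fps_X else 1) * fe (arc P) F"
  shows "\<exists>c. \<forall>P\<in>curve d. mp_eval P F = c * mp_eval P G"
proof -
  obtain \<alpha> \<beta> \<gamma> \<delta> u v m n where f: "frame d \<alpha> \<beta> \<gamma> \<delta> u v m n"
    and nz: "mp_eval R v \<noteq> 0" "mp_eval R m \<noteq> 0" "mp_eval R n \<noteq> 0"
    using frame_at[OF two d0 d1 R] .
  note h = frame_hom[OF f]
  define u0 v0 m0 n0 where "u0 = mp_eval R u" and "v0 = mp_eval R v" and "m0 = mp_eval R m" and "n0 = mp_eval R n"
  define L where "L = Const v0 * u - Const u0 * v"
  have hL: "homogeneous 1 L" unfolding L_def by (intro homogeneous_diff homogeneous_Const_mult h)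
  have LR: "mp_eval R L = 0" by (simp add: L_def u0_def v0_def)
  have L0: "fe (arc P) L \<noteq> 0" if "P \<in> curve d" for P
    using linear_form_nonzero[OF f that, of v0 "- u0"] nz(1)
    by (simp add: L_def v0_def flip: fps_const_neg)
  have "fe (arc P) G dvd fe (arc P) (L * F)" if P: "P \<in> curve d" for P
  proof (cases "proj_eq P R")
    case True
    then obtain c where "c \<noteq> 0" "mp_eval R L = c ^ 1 * mp_eval P L" using proj_eq_mp_eval hL by blast
    hence "mp_eval P L = 0" using LR by simp
    hence "fps_X dvd fe (arc P) L" using P by (simp add: fps_X_dvd_iff fe_arc_nth_0)
    hence "fps_X * fe (arc P) F dvd fe (arc P) (L * F)" by (simp add: mult_dvd_mono)
    moreover have "fe (arc P) G dvd fps_X * fe (arc P) F" using dvd[OF P] True by simp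
    ultimately show ?thesis using dvd_trans by blast
  next
    case False
    with dvd[OF P] show ?thesis by simp
  qed
  moreover have "homogeneous (Suc k) (L * F)" using homogeneous_mult[OF hL F] by simp
  ultimately obtain p q r s where M: "\<And>P. P \<in> curve d \<Longrightarrow>
      fe (arc P) (L * F) = fe (arc P) G * fe (arc P) (Const p * u + Const q * v + Const r * m + Const s * n)"
    using linear_quotient[OF f _ G] by blast
  define M' where "M' = Const p * u + Const q * v + Const r * m + Const s * n"
  have "cone d R" using R by (simp add: curve_iff)
  note rel = frame_relation[OF f this, folded u0_def v0_def m0_def n0_def]
  \<comment> \<open>The other three points of the fibre through \<open>R\<close> differ from it by
    signs of \<open>m\<close> and \<open>n\<close>. These are nonzero at \<open>R\<close>, so none
    of the three points is the pole.\<close>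
  have val: "p * u0 + q * v0 + r * (t * m0) + s * (t' * n0) = 0"
    if t: "t ^ 2 = 1" "t' ^ 2 = 1" "\<not> (t = 1 \<and> t' = 1)" for t t'
  proof -
    have "(t * m0) ^ 2 = \<alpha> * u0 ^ 2 + \<beta> * v0 ^ 2" "(t' * n0) ^ 2 = \<gamma> * u0 ^ 2 + \<delta> * v0 ^ 2"
      using t rel by (simp_all add: power_mult_distrib)
    then obtain P where P: "P \<in> curve d" "mp_eval P u = u0" "mp_eval P v = v0" "mp_eval P m = t * m0" "mp_eval P n = t' * n0"
      using frame_point[OF f] nz(1) v0_def by metis
    have "\<not> proj_eq P R"
    proof
      assume pr: "proj_eq P R"
      then obtain c where c: "R = (\<lambda>i. c * P i)" by (auto simp: proj_eq_def)
      have e: "mp_eval R w = c * mp_eval P w" if "homogeneous 1 w" for w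
        unfolding c using mp_eval_homogeneous_scale[OF that, of c P] by simp
      have "c = 1" using e[OF h(2)] P nz(1) by (simp add: v0_def)
      hence "t = 1" "t' = 1" using e[OF h(3)] e[OF h(4)] P nz by (simp_all add: m0_def n0_def)
      with t show False by blast
    qed
    with dvd[OF P(1)] have "fe (arc P) G dvd fe (arc P) F" by simp
    then obtain w where w: "fe (arc P) F = fe (arc P) G * w" by (auto simp: dvd_def)
    have "fe (arc P) G * fe (arc P) M' = fe (arc P) G * (fe (arc P) L * w)"
    proof -
      have "fe (arc P) L * fe (arc P) F = fe (arc P) G * fe (arc P) M'"
        using M[OF P(1), folded M'_def] by (simp only: fe_simps(4))
      thus ?thesis unfolding w by (simp only: mult_ac)
    qed
    hence "fe (arc P) M' = fe (arc P) L * w" using fe_arc_nonzero[OF P(1) G] by simp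
    hence "fe (arc P) M' $ 0 = mp_eval P L * w $ 0" using P(1) by (simp add: fe_arc_nth_0)
    hence "mp_eval P M' = 0" using P by (simp add: fe_arc_nth_0 L_def)
    thus ?thesis using P by (simp add: M'_def)
  qed
  have mns: "(1::'a) \<noteq> - 1" using two by (metis add.right_inverse one_add_one)
  have e1: "p * u0 + q * v0 - r * m0 + s * n0 = 0" and e2: "p * u0 + q * v0 + r * m0 - s * n0 = 0"
    and e3: "p * u0 + q * v0 - r * m0 - s * n0 = 0"
    using val[of "- 1" 1] val[of 1 "- 1"] val[of "- 1" "- 1"] mns by (auto simp: algebra_simps)
  have "2 * (s * n0) = (p * u0 + q * v0 - r * m0 + s * n0) - (p * u0 + q * v0 - r * m0 - s * n0)"
    "2 * (r * m0) = (p * u0 + q * v0 + r * m0 - s * n0) - (p * u0 + q * v0 - r * m0 - s * n0)"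
    by (simp_all add: algebra_simps)
  hence "2 * (s * n0) = 0" "2 * (r * m0) = 0" by (simp_all only: e1 e2 e3 diff_self)
  hence rs: "s = 0" "r = 0" using two nz by (simp_all add: m0_def n0_def)
  with e1 have pq: "p * u0 + q * v0 = 0" by simp
  define c where "c = p / v0"
  have v00: "v0 \<noteq> 0" using nz by (simp add: v0_def)
  have "p = c * v0" "q = - (c * u0)"
    using pq v00 by (simp_all add: c_def field_simps eq_neg_iff_add_eq_0)
  hence proportional: "fe (arc P) M' = fps_const c * fe (arc P) L" for P
    unfolding M'_def L_def rs by (simp add: algebra_simps flip: fps_const_neg fps_const_mult)
  have "mp_eval P F = c * mp_eval P G" if P: "P \<in> curve d" for P
  proof -
    have "fe (arc P) L * fe (arc P) F = fe (arc P) L * (fps_const c * fe (arc P) G)"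
      using M[OF P, folded M'_def] unfolding proportional by (simp add: mult_ac)
    hence "fe (arc P) F = fps_const c * fe (arc P) G" using L0[OF P] by simp
    hence "fe (arc P) F $ 0 = c * fe (arc P) G $ 0" by simp
    thus ?thesis using P by (simp add: fe_arc_nth_0)
  qed
  thus ?thesis by blast
qed

lemma curve_ideal_mult_nonzero:
  "homogeneous k F \<Longrightarrow> homogeneous l G \<Longrightarrow> F \<notin> curve_ideal d \<Longrightarrow> G \<notin> curve_ideal d \<Longrightarrow> F * G \<notin> curve_ideal d"
  using curve_ideal_prime by blast

text \<open>The quotient of the two functions has the divisor \<open>(S) - (R)\<close>. Its only
  possible pole is simple, so it is constant, and comparison of orders at \<open>S\<close>
  identifies the points.\<close>

theorem is_sum_unique:
  assumes s: "is_sum d P Q R" "is_sum d P Q S"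
  shows "proj_eq R S"
proof -
  have R: "R \<in> curve d" and S: "S \<in> curve d" using s by (auto simp: is_sum_def)
  obtain j F G where FG: "homogeneous j F" "homogeneous j G" "F \<notin> curve_ideal d" "G \<notin> curve_ideal d"
    "\<And>Z. Z \<in> curve d \<Longrightarrow> ord_at d Z F + of_bool (proj_eq Z R) + of_bool (proj_eq Z identity_point)
       = ord_at d Z G + of_bool (proj_eq Z P) + of_bool (proj_eq Z Q)"
    using s(1) unfolding is_sum_def lin_equiv2_def by blast
  obtain k F' G' where FG': "homogeneous k F'" "homogeneous k G'" "F' \<notin> curve_ideal d" "G' \<notin> curve_ideal d"
    "\<And>Z. Z \<in> curve d \<Longrightarrow> ord_at d Z F' + of_bool (proj_eq Z S) + of_bool (proj_eq Z identity_point)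
       = ord_at d Z G' + of_bool (proj_eq Z P) + of_bool (proj_eq Z Q)"
    using s(2) unfolding is_sum_def lin_equiv2_def by blast
  let ?s = "\<lambda>Z F. subdegree (fe (arc Z) F)"
  have e: "?s Z (F * G') + of_bool (proj_eq Z R) = ?s Z (G * F') + of_bool (proj_eq Z S)" if Z: "Z \<in> curve d" for Z
  proof -
    have ob: "of_bool b = enat (of_bool b)" for b by (cases b) (simp_all add: one_enat_def zero_enat_def)
    note o = ord_at_arc[OF Z FG(1,3)] ord_at_arc[OF Z FG(2,4)] ord_at_arc[OF Z FG'(1,3)] ord_at_arc[OF Z FG'(2,4)]
    note n = fe_arc_nonzero[OF Z FG(1,3)] fe_arc_nonzero[OF Z FG(2,4)] fe_arc_nonzero[OF Z FG'(1,3)] fe_arc_nonzero[OF Z FG'(2,4)]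
    have "?s Z F + of_bool (proj_eq Z R) + of_bool (proj_eq Z identity_point) = ?s Z G + of_bool (proj_eq Z P) + of_bool (proj_eq Z Q)"
      using FG(5)[OF Z] unfolding o ob plus_enat_simps enat.inject .
    moreover have "?s Z F' + of_bool (proj_eq Z S) + of_bool (proj_eq Z identity_point) = ?s Z G' + of_bool (proj_eq Z P) + of_bool (proj_eq Z Q)"
      using FG'(5)[OF Z] unfolding o ob plus_enat_simps enat.inject .
    moreover have "?s Z (F * G') = ?s Z F + ?s Z G'" "?s Z (G * F') = ?s Z G + ?s Z F'"
      using n by simp_all
    ultimately show ?thesis by linarith
  qed
  have h: "homogeneous (j + k) (F * G')" "homogeneous (j + k) (G * F')"
    using FG FG' by (auto intro: homogeneous_mult)
  have ni: "F * G' \<notin> curve_ideal d" "G * F' \<notin> curve_ideal d"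
    using FG FG' curve_ideal_mult_nonzero by blast+
  have "fe (arc Z) (G * F') dvd (if proj_eq Z R then fps_X else 1) * fe (arc Z) (F * G')" if Z: "Z \<in> curve d" for Z
  proof -
    have n: "fe (arc Z) (G * F') \<noteq> 0" "fe (arc Z) (F * G') \<noteq> 0"
      using fe_arc_nonzero[OF Z h(1) ni(1)] fe_arc_nonzero[OF Z h(2) ni(2)] by simp_all
    have "?s Z (G * F') \<le> subdegree ((if proj_eq Z R then fps_X else 1) * fe (arc Z) (F * G'))"
      using e[OF Z] n by (auto split: if_splits)
    with n show ?thesis by (subst fps_dvd_iff) auto
  qed
  from one_pole[OF h ni(2) R this] obtain c where c: "\<And>Z. Z \<in> curve d \<Longrightarrow> mp_eval Z (F * G') = c * mp_eval Z (G * F')"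
    by blast
  have "fe (arc S) (F * G') = fe (arc S) (Const c * (G * F'))"
    by (rule fe_arc_eq[OF S]) (use c in simp)
  hence eq: "fe (arc S) (F * G') = fps_const c * fe (arc S) (G * F')" by simp
  with fe_arc_nonzero[OF S h(1) ni(1)] have "c \<noteq> 0" by auto
  with eq fe_arc_nonzero[OF S h(2) ni(2)] have "?s S (F * G') = ?s S (G * F')" by simp
  with e[OF S] have "of_bool (proj_eq S R) = (of_bool (proj_eq S S) :: nat)" by simp
  hence "proj_eq S R" by (cases "proj_eq S R") simp_all
  thus ?thesis by (rule proj_eq_sym)
qed

end

section \<open>The curve in a product of two lines\<close>

lemma homogeneous_0_Const:
  assumes "homogeneous 0 F"
  obtains c where "F = Const c"
proof -
  have "n = 0 \<longrightarrow> (\<exists>c. F = Const c)" if "homogeneous n F" for n F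
    using that by (induction rule: homogeneous_induct) (auto simp flip: Const_add)
  with assms that show ?thesis by blast
qed

lemma homogeneous_1_linear:
  assumes "homogeneous 1 F"
  obtains c where "F = (\<Sum>i\<in>UNIV. Const (c i) * Var i)"
proof -
  have "n = 1 \<longrightarrow> (\<exists>c. F = (\<Sum>i\<in>UNIV. Const (c i) * Var i))" if "homogeneous n F" for n and F :: "('a, 'b) mpoly"
    using that
  proof (induction rule: homogeneous_induct)
    case (Var n v G)
    show ?case
    proof
      assume "Suc n = 1"
      with Var(1) have "homogeneous 0 G" by simp
      then obtain s where G: "G = Const s" by (rule homogeneous_0_Const)
      have "(\<Sum>i\<in>UNIV. Const (if i = v then s else 0) * Var i) = (\<Sum>i\<in>{v}. Const s * Var i)"
        by (rule sum.mono_neutral_cong_right) auto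
      thus "\<exists>c. Var v * G = (\<Sum>i\<in>UNIV. Const (c i) * Var i)"
        unfolding G by (intro exI[of _ "\<lambda>i. if i = v then s else 0"]) (simp add: mult.commute)
    qed
  next
    case (add n F G)
    show ?case
    proof
      assume "n = 1"
      with add obtain b c where "F = (\<Sum>i\<in>UNIV. Const (b i) * Var i)" "G = (\<Sum>i\<in>UNIV. Const (c i) * Var i)"
        by blast
      hence "F + G = (\<Sum>i\<in>UNIV. Const (b i + c i) * Var i)"
        by (simp add: Const_add distrib_right sum.distrib)
      thus "\<exists>c. F + G = (\<Sum>i\<in>UNIV. Const (c i) * Var i)" by (rule exI[of _ "\<lambda>i. b i + c i"])
    qed
  qed auto
  with assms that show ?thesis by blast
qed

text \<open>The point with coordinates \<open>((x : z), (\<mu> : \<nu>))\<close> under the Segre embedding. In the affine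
  coordinates \<open>\<xi> = x / z\<close> and \<open>\<eta> = \<mu> / \<nu>\<close> the curve is the twisted Edwards curve
  \<open>\<xi>\<^sup>2 - \<eta>\<^sup>2 = 1 - d \<xi>\<^sup>2 \<eta>\<^sup>2\<close>, and the identity is \<open>(1, 0)\<close>.\<close>

definition seg :: "'b::comm_ring_1 \<Rightarrow> 'b \<Rightarrow> 'b \<Rightarrow> 'b \<Rightarrow> 4 \<Rightarrow> 'b" where
  "seg x z \<mu> \<nu> = quad (z * \<nu>) (z * \<mu> + x * \<nu>) (x * \<mu>) (x * \<nu> - z * \<mu>)"

lemma seg_simps [simp]:
  "seg x z \<mu> \<nu> 0 = z * \<nu>" "seg x z \<mu> \<nu> 1 = z * \<mu> + x * \<nu>" "seg x z \<mu> \<nu> 2 = x * \<mu>" "seg x z \<mu> \<nu> 3 = x * \<nu> - z * \<mu>"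
  by (simp_all add: seg_def)

text \<open>The second quadric is the Segre quadric and holds identically; the first becomes an
  equation of bidegree \<open>(2, 2)\<close> on the product of the two lines.\<close>

lemma cone_seg: "cone D (seg x z \<mu> \<nu>) \<longleftrightarrow> \<nu>\<^sup>2 * (z\<^sup>2 - x\<^sup>2) = \<mu>\<^sup>2 * (D * x\<^sup>2 - z\<^sup>2)"
proof -
  have "(z * \<nu>)\<^sup>2 - D * (x * \<mu>)\<^sup>2 - (z * \<mu> + x * \<nu>) * (x * \<nu> - z * \<mu>)
      = \<nu>\<^sup>2 * (z\<^sup>2 - x\<^sup>2) - \<mu>\<^sup>2 * (D * x\<^sup>2 - z\<^sup>2)"
    by (simp add: power2_eq_square algebra_simps)
  hence "(z * \<nu>)\<^sup>2 - D * (x * \<mu>)\<^sup>2 = (z * \<mu> + x * \<nu>) * (x * \<nu> - z * \<mu>)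
      \<longleftrightarrow> \<nu>\<^sup>2 * (z\<^sup>2 - x\<^sup>2) = \<mu>\<^sup>2 * (D * x\<^sup>2 - z\<^sup>2)"
    by (rule diff_eq_diff_eq)
  moreover have "(z * \<mu> + x * \<nu>)\<^sup>2 - (x * \<nu> - z * \<mu>)\<^sup>2 = 4 * (z * \<nu>) * (x * \<mu>)"
    by (simp add: power2_eq_square algebra_simps)
  ultimately show ?thesis by (simp add: cone_def)
qed

lemma seg_nonzero:
  fixes x z \<mu> \<nu> :: "'b::field"
  assumes "\<not> (x = 0 \<and> z = 0)" "\<not> (\<mu> = 0 \<and> \<nu> = 0)" and two: "(2::'b) \<noteq> 0"
  shows "seg x z \<mu> \<nu> \<noteq> (\<lambda>_. 0)"
proof
  assume s: "seg x z \<mu> \<nu> = (\<lambda>_. 0)"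
  have e: "z * \<nu> = 0" "z * \<mu> + x * \<nu> = 0" "x * \<mu> = 0" "x * \<nu> - z * \<mu> = 0"
    using fun_cong[OF s, of 0] fun_cong[OF s, of 1] fun_cong[OF s, of 2] fun_cong[OF s, of 3] by simp_all
  have "2 * (x * \<nu>) = (z * \<mu> + x * \<nu>) + (x * \<nu> - z * \<mu>)"
    "2 * (z * \<mu>) = (z * \<mu> + x * \<nu>) - (x * \<nu> - z * \<mu>)" by simp_all
  hence "2 * (x * \<nu>) = 0" "2 * (z * \<mu>) = 0" unfolding e by simp_all
  hence "x * \<nu> = 0" "z * \<mu> = 0" using two by simp_all
  with e(1,3) assms show False by auto
qed

text \<open>The relation is the vanishing of the determinant of a two by two matrix of power series.
  One entry is a unit, and the row and the column through it give a factorisation in which neither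
  factor vanishes at the origin.\<close>

lemma seg_factor:
  fixes a b e f :: "'a::field fps"
  assumes r: "b * e = a * f" and nz: "a $ 0 \<noteq> 0 \<or> b $ 0 \<noteq> 0 \<or> e $ 0 \<noteq> 0 \<or> f $ 0 \<noteq> 0"
  obtains x z \<mu> \<nu> where "a = x * \<mu>" "b = z * \<mu>" "e = x * \<nu>" "f = z * \<nu>"
    "x $ 0 \<noteq> 0 \<or> z $ 0 \<noteq> 0" "\<mu> $ 0 \<noteq> 0 \<or> \<nu> $ 0 \<noteq> 0"
proof -
  have inv: "w * (g * inverse g) = w" if "g $ 0 \<noteq> 0" for g w :: "'a fps"
    using that by (simp add: inverse_mult_eq_1 mult.commute[of g])
  have q: "s * inverse g * g = s" "s * inverse g * t = w" if "g $ 0 \<noteq> 0" "s * t = g * w" for g s t w :: "'a fps"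
  proof -
    have "s * inverse g * g = s * (g * inverse g)" "s * inverse g * t = (s * t) * inverse g" by (simp_all only: mult_ac)
    moreover have "(s * t) * inverse g = w * (g * inverse g)" unfolding that(2) by (simp only: mult_ac)
    ultimately show "s * inverse g * g = s" "s * inverse g * t = w" using inv[OF that(1)] by simp_all
  qed
  from nz consider (a) "a $ 0 \<noteq> 0" | (b) "b $ 0 \<noteq> 0" | (e) "e $ 0 \<noteq> 0" | (f) "f $ 0 \<noteq> 0" by blast
  thus ?thesis
  proof cases
    case a
    from a that[of 1 a "b * inverse a" e] q[OF a r] show ?thesis by simp
  next
    case b
    from b that[of "a * inverse b" b 1 f] q[OF b r[symmetric]] show ?thesis by simp
  next
    case e
    have "f * a = e * b" using r by (simp add: mult.commute)
    from e that[of 1 a "f * inverse e" e] q[OF e this] show ?thesis by simp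
  next
    case f
    have "e * b = f * a" using r by (simp add: mult.commute)
    from f that[of "e * inverse f" b 1 f] q[OF f this] show ?thesis by simp
  qed
qed

lemma seg_lift:
  fixes Y :: "4 \<Rightarrow> 'a::field fps"
  assumes two: "(2::'a) \<noteq> 0" and c: "cone D Y" and nz: "\<exists>i. Y i $ 0 \<noteq> 0"
  obtains x z \<mu> \<nu> where "Y = seg x z \<mu> \<nu>" "\<not> (x $ 0 = 0 \<and> z $ 0 = 0)" "\<not> (\<mu> $ 0 = 0 \<and> \<nu> $ 0 = 0)"
proof -
  define h where "h = fps_const (inverse (2::'a))"
  have h: "2 * h = 1" unfolding h_def using two by (simp add: numeral_fps_const)
  have h': "h * w + h * w = w" for w
  proof -
    have "h * w + h * w = (2 * h) * w" by (simp add: algebra_simps)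
    thus ?thesis by (simp only: h mult_1)
  qed
  define a b e f where "a = Y 2" and "b = h * (Y 1 - Y 3)" and "e = h * (Y 1 + Y 3)" and "f = Y 0"
  have Y: "Y 0 = f" "Y 1 = b + e" "Y 2 = a" "Y 3 = e - b"
    using h'[of "Y 1"] h'[of "Y 3"] by (simp_all add: a_def b_def e_def f_def algebra_simps)
  have "4 * (b * e) = 4 * (a * f)"
  proof -
    have "4 * (b * e) = (Y 1)\<^sup>2 - (Y 3)\<^sup>2" unfolding Y by (simp add: power2_eq_square algebra_simps)
    also have "\<dots> = 4 * (a * f)" using c by (simp add: cone_def a_def f_def)
    finally show ?thesis .
  qed
  moreover have "(4 :: 'a fps) \<noteq> 0"
  proof
    assume "(4 :: 'a fps) = 0"
    hence "(2 :: 'a fps) * 2 = 0" by simp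
    hence "(2 :: 'a fps) = 0" by (simp only: mult_eq_0_iff disj_absorb)
    with h show False by simp
  qed
  ultimately have "b * e = a * f" by simp
  moreover have "a $ 0 \<noteq> 0 \<or> b $ 0 \<noteq> 0 \<or> e $ 0 \<noteq> 0 \<or> f $ 0 \<noteq> 0"
  proof (rule ccontr)
    assume "\<not> ?thesis"
    hence "Y 0 $ 0 = 0" "Y 1 $ 0 = 0" "Y 2 $ 0 = 0" "Y 3 $ 0 = 0" unfolding Y by simp_all
    hence "\<forall>i. Y i $ 0 = 0" unfolding all_4 by blast
    with nz show False by blast
  qed
  ultimately obtain x z \<mu> \<nu> where s: "a = x * \<mu>" "b = z * \<mu>" "e = x * \<nu>" "f = z * \<nu>"
    "x $ 0 \<noteq> 0 \<or> z $ 0 \<noteq> 0" "\<mu> $ 0 \<noteq> 0 \<or> \<nu> $ 0 \<noteq> 0" by (rule seg_factor)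
  have "Y = seg x z \<mu> \<nu>" unfolding eq_4_iff seg_simps Y s(1-4) by simp
  with s(5,6) that show ?thesis by blast
qed

context smooth_curve
begin

lemma curve_seg:
  assumes "P \<in> curve d"
  obtains x z \<mu> \<nu> where "P = seg x z \<mu> \<nu>" "\<not> (x = 0 \<and> z = 0)" "\<not> (\<mu> = 0 \<and> \<nu> = 0)"
    "\<nu>\<^sup>2 * (z\<^sup>2 - x\<^sup>2) = \<mu>\<^sup>2 * (d * x\<^sup>2 - z\<^sup>2)"
proof -
  let ?Y = "\<lambda>i. fps_const (P i)"
  have P: "cone d P" "P \<noteq> (\<lambda>_. 0)" using assms by (simp_all add: curve_iff)
  have "cone (fps_const d) ?Y" using P by (simp add: cone_const_iff)
  moreover have "\<exists>i. ?Y i $ 0 \<noteq> 0" using P(2) by auto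
  ultimately obtain x z \<mu> \<nu> where Y: "?Y = seg x z \<mu> \<nu>" and nz: "\<not> (x $ 0 = 0 \<and> z $ 0 = 0)" "\<not> (\<mu> $ 0 = 0 \<and> \<nu> $ 0 = 0)"
    using seg_lift[OF two] by metis
  have "P i = seg x z \<mu> \<nu> i $ 0" for i using fun_cong[OF Y, of i] by (metis fps_nth_fps_const)
  hence e: "P = seg (x $ 0) (z $ 0) (\<mu> $ 0) (\<nu> $ 0)" unfolding eq_4_iff by simp
  with P(1) have "(\<nu> $ 0)\<^sup>2 * ((z $ 0)\<^sup>2 - (x $ 0)\<^sup>2) = (\<mu> $ 0)\<^sup>2 * (d * (x $ 0)\<^sup>2 - (z $ 0)\<^sup>2)"
    by (simp only: cone_seg)
  from that[OF e nz this] show ?thesis .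
qed

lemma seg_in_curve:
  fixes x z \<mu> \<nu> :: 'a
  shows
  "\<not> (x = 0 \<and> z = 0) \<Longrightarrow> \<not> (\<mu> = 0 \<and> \<nu> = 0) \<Longrightarrow> \<nu>\<^sup>2 * (z\<^sup>2 - x\<^sup>2) = \<mu>\<^sup>2 * (d * x\<^sup>2 - z\<^sup>2) \<Longrightarrow> seg x z \<mu> \<nu> \<in> curve d"
  by (simp add: curve_iff cone_seg seg_nonzero two)

lemma proportional_pair:
  fixes x z x' z' :: 'a
  assumes "x * z' = z * x'" "\<not> (x = 0 \<and> z = 0)" "\<not> (x' = 0 \<and> z' = 0)"
  obtains s where "s \<noteq> 0" "x' = s * x" "z' = s * z"
proof (cases "z = 0")
  case True
  with assms have "x \<noteq> 0" "z' = 0" "x' \<noteq> 0" by auto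
  with True that[of "x' / x"] show ?thesis by simp
next
  case False
  have "x' = (z' / z) * x" using assms False by (simp add: field_simps)
  with False assms that[of "z' / z"] show ?thesis by auto
qed

lemma proj_eq_seg:
  fixes x z \<mu> \<nu> x' z' \<mu>' \<nu>' :: 'a
  assumes "\<not> (x = 0 \<and> z = 0)" "\<not> (\<mu> = 0 \<and> \<nu> = 0)" "\<not> (x' = 0 \<and> z' = 0)" "\<not> (\<mu>' = 0 \<and> \<nu>' = 0)"
  shows "proj_eq (seg x z \<mu> \<nu>) (seg x' z' \<mu>' \<nu>') \<longleftrightarrow> x * z' = z * x' \<and> \<mu> * \<nu>' = \<nu> * \<mu>'"
proof
  assume "proj_eq (seg x z \<mu> \<nu>) (seg x' z' \<mu>' \<nu>')"
  then obtain c where c: "c \<noteq> 0" "seg x' z' \<mu>' \<nu>' = (\<lambda>i. c * seg x z \<mu> \<nu> i)" by (auto simp: proj_eq_def)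
  have e: "z' * \<nu>' = c * (z * \<nu>)" "x' * \<mu>' = c * (x * \<mu>)"
    and s: "z' * \<mu>' + x' * \<nu>' = c * (z * \<mu> + x * \<nu>)" "x' * \<nu>' - z' * \<mu>' = c * (x * \<nu> - z * \<mu>)"
    using fun_cong[OF c(2), of 0] fun_cong[OF c(2), of 1] fun_cong[OF c(2), of 2] fun_cong[OF c(2), of 3] by simp_all
  have "2 * (x' * \<nu>') = (z' * \<mu>' + x' * \<nu>') + (x' * \<nu>' - z' * \<mu>')"
    "2 * (z' * \<mu>') = (z' * \<mu>' + x' * \<nu>') - (x' * \<nu>' - z' * \<mu>')" by simp_all
  hence "2 * (x' * \<nu>') = 2 * (c * (x * \<nu>))" "2 * (z' * \<mu>') = 2 * (c * (z * \<mu>))"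
    unfolding s by (simp_all add: algebra_simps)
  hence f: "x' * \<nu>' = c * (x * \<nu>)" "z' * \<mu>' = c * (z * \<mu>)" using two by simp_all
  have "(x * z' - z * x') * \<mu>' = x * (z' * \<mu>') - z * (x' * \<mu>')" "(x * z' - z * x') * \<nu>' = x * (z' * \<nu>') - z * (x' * \<nu>')"
    "(\<mu> * \<nu>' - \<nu> * \<mu>') * x' = \<mu> * (x' * \<nu>') - \<nu> * (x' * \<mu>')" "(\<mu> * \<nu>' - \<nu> * \<mu>') * z' = \<mu> * (z' * \<nu>') - \<nu> * (z' * \<mu>')"
    by (simp_all add: algebra_simps)
  hence "(x * z' - z * x') * \<mu>' = 0" "(x * z' - z * x') * \<nu>' = 0" "(\<mu> * \<nu>' - \<nu> * \<mu>') * x' = 0" "(\<mu> * \<nu>' - \<nu> * \<mu>') * z' = 0"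
    unfolding e f by (simp_all add: algebra_simps)
  with assms show "x * z' = z * x' \<and> \<mu> * \<nu>' = \<nu> * \<mu>'" by auto
next
  assume "x * z' = z * x' \<and> \<mu> * \<nu>' = \<nu> * \<mu>'"
  hence r: "x * z' = z * x'" "\<mu> * \<nu>' = \<nu> * \<mu>'" by simp_all
  obtain s where s: "s \<noteq> 0" "x' = s * x" "z' = s * z" by (rule proportional_pair[OF r(1) assms(1,3)])
  obtain t where t: "t \<noteq> 0" "\<mu>' = t * \<mu>" "\<nu>' = t * \<nu>" by (rule proportional_pair[OF r(2) assms(2,4)])
  show "proj_eq (seg x z \<mu> \<nu>) (seg x' z' \<mu>' \<nu>')"
    unfolding proj_eq_def
    by (rule exI[of _ "s * t"]) (use s t in \<open>simp add: eq_4_iff algebra_simps\<close>)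
qed

section \<open>Arcs in Segre coordinates\<close>

definition arc_coords :: "(4 \<Rightarrow> 'a) \<Rightarrow> 'a fps \<Rightarrow> 'a fps \<Rightarrow> 'a fps \<Rightarrow> 'a fps \<Rightarrow> bool" where
  "arc_coords Z x z \<mu> \<nu> \<longleftrightarrow> arc Z = seg x z \<mu> \<nu> \<and> \<not> (x $ 0 = 0 \<and> z $ 0 = 0) \<and> \<not> (\<mu> $ 0 = 0 \<and> \<nu> $ 0 = 0)
     \<and> Z = seg (x $ 0) (z $ 0) (\<mu> $ 0) (\<nu> $ 0) \<and> \<nu>\<^sup>2 * (z\<^sup>2 - x\<^sup>2) = \<mu>\<^sup>2 * (fps_const d * x\<^sup>2 - z\<^sup>2)
     \<and> (\<nu> $ 0)\<^sup>2 * ((z $ 0)\<^sup>2 - (x $ 0)\<^sup>2) = (\<mu> $ 0)\<^sup>2 * (d * (x $ 0)\<^sup>2 - (z $ 0)\<^sup>2)"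

lemma arc_coords_exist:
  assumes Z: "Z \<in> curve d"
  obtains x z \<mu> \<nu> where "arc_coords Z x z \<mu> \<nu>"
proof -
  have c: "cone (fps_const d) (arc Z)" by (rule arc_cone[OF Z])
  moreover have "\<exists>i. arc Z i $ 0 \<noteq> 0" using Z by (auto simp: arc_nth_0 curve_iff fun_eq_iff)
  ultimately obtain x z \<mu> \<nu> where Y: "arc Z = seg x z \<mu> \<nu>" and nz: "\<not> (x $ 0 = 0 \<and> z $ 0 = 0)" "\<not> (\<mu> $ 0 = 0 \<and> \<nu> $ 0 = 0)"
    using seg_lift[OF two] by metis
  have "Z i = seg x z \<mu> \<nu> i $ 0" for i using fun_cong[OF Y, of i] arc_nth_0[OF Z, of i] by simp
  hence e: "Z = seg (x $ 0) (z $ 0) (\<mu> $ 0) (\<nu> $ 0)" unfolding eq_4_iff by simp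
  have "cone d Z" using Z by (simp add: curve_iff)
  hence "(\<nu> $ 0)\<^sup>2 * ((z $ 0)\<^sup>2 - (x $ 0)\<^sup>2) = (\<mu> $ 0)\<^sup>2 * (d * (x $ 0)\<^sup>2 - (z $ 0)\<^sup>2)"
    using e by (simp only: cone_seg)
  moreover have "\<nu>\<^sup>2 * (z\<^sup>2 - x\<^sup>2) = \<mu>\<^sup>2 * (fps_const d * x\<^sup>2 - z\<^sup>2)" using c unfolding Y cone_seg .
  ultimately show ?thesis using that Y nz e unfolding arc_coords_def by blast
qed

text \<open>The two coordinates cannot both be stationary, since the arc is not.\<close>

lemma pair_mod_square:
  fixes x z :: "'a fps"
  assumes "\<not> (x $ 0 = 0 \<and> z $ 0 = 0)" and "fps_X\<^sup>2 dvd x * fps_const (z $ 0) - z * fps_const (x $ 0)"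
  obtains s where "fps_X\<^sup>2 dvd x - s * fps_const (x $ 0)" "fps_X\<^sup>2 dvd z - s * fps_const (z $ 0)"
proof (cases "z $ 0 = 0")
  case False
  define s where "s = z * fps_const (inverse (z $ 0))"
  have i: "fps_const (inverse (z $ 0)) * fps_const (z $ 0) = 1" using False by simp
  have "x - s * fps_const (x $ 0) = fps_const (inverse (z $ 0)) * (x * fps_const (z $ 0) - z * fps_const (x $ 0))"
  proof -
    have "fps_const (inverse (z $ 0)) * (x * fps_const (z $ 0) - z * fps_const (x $ 0))
        = x * (fps_const (inverse (z $ 0)) * fps_const (z $ 0)) - s * fps_const (x $ 0)"
      unfolding s_def by (simp only: right_diff_distrib mult_ac)
    thus ?thesis by (simp only: i mult_1_right)
  qed
  moreover have "z - s * fps_const (z $ 0) = 0"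
    unfolding s_def mult.assoc i by simp
  ultimately show ?thesis using that[of s] assms(2) by simp
next
  case True
  with assms(1) have x0: "x $ 0 \<noteq> 0" by simp
  define s where "s = x * fps_const (inverse (x $ 0))"
  have i: "fps_const (inverse (x $ 0)) * fps_const (x $ 0) = 1" using x0 by simp
  have "z - s * fps_const (z $ 0) = - (fps_const (inverse (x $ 0)) * (x * fps_const (z $ 0) - z * fps_const (x $ 0)))"
  proof -
    have "- (fps_const (inverse (x $ 0)) * (x * fps_const (z $ 0) - z * fps_const (x $ 0)))
        = z * (fps_const (inverse (x $ 0)) * fps_const (x $ 0)) - s * fps_const (z $ 0)"
      unfolding s_def by (simp only: right_diff_distrib mult_ac minus_diff_eq)
    thus ?thesis by (simp only: i mult_1_right)
  qed
  moreover have "x - s * fps_const (x $ 0) = 0"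
    unfolding s_def mult.assoc i by simp
  ultimately show ?thesis using that[of s] assms(2) by simp
qed

lemma dvd_product_diff:
  fixes t x x' y y' :: "'b::comm_ring_1"
  assumes "t dvd x - x'" "t dvd y - y'"
  shows "t dvd x * y - x' * y'"
proof -
  have "x * y - x' * y' = (x - x') * y + x' * (y - y')" by (simp add: algebra_simps)
  with assms show ?thesis by simp
qed

lemma fps_const_sum: "fps_const (\<Sum>i\<in>A. f i) = (\<Sum>i\<in>A. fps_const (f i :: 'b::comm_ring_1))"
  by (induction A rule: infinite_finite_induct) (simp_all flip: fps_const_add)

text \<open>If both pairs were constant up to a scalar modulo \<open>fps_X^2\<close>, so would be
  the arc, and a linear form of order one would have order at least two.\<close>

lemma arc_not_stationary:
  assumes Z: "Z \<in> curve d" and c: "arc_coords Z x z \<mu> \<nu>"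
  shows "\<not> (fps_X\<^sup>2 dvd x * fps_const (z $ 0) - z * fps_const (x $ 0) \<and>
            fps_X\<^sup>2 dvd \<mu> * fps_const (\<nu> $ 0) - \<nu> * fps_const (\<mu> $ 0))"
proof
  let ?c = fps_const
  assume "fps_X\<^sup>2 dvd x * ?c (z $ 0) - z * ?c (x $ 0) \<and> fps_X\<^sup>2 dvd \<mu> * ?c (\<nu> $ 0) - \<nu> * ?c (\<mu> $ 0)"
  then obtain s t where s: "fps_X\<^sup>2 dvd x - s * ?c (x $ 0)" "fps_X\<^sup>2 dvd z - s * ?c (z $ 0)"
    and t: "fps_X\<^sup>2 dvd \<mu> - t * ?c (\<mu> $ 0)" "fps_X\<^sup>2 dvd \<nu> - t * ?c (\<nu> $ 0)"
    using c pair_mod_square unfolding arc_coords_def by metis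
  have Y: "arc Z = seg x z \<mu> \<nu>" and Z0: "Z = seg (x $ 0) (z $ 0) (\<mu> $ 0) (\<nu> $ 0)"
    using c unfolding arc_coords_def by blast+
  have e: "(s * ?c p) * (t * ?c q) = (s * t) * ?c (p * q)" for p q by (simp add: mult_ac)
  note d4 = dvd_product_diff[OF s(1) t(1), unfolded e] dvd_product_diff[OF s(1) t(2), unfolded e]
    dvd_product_diff[OF s(2) t(1), unfolded e] dvd_product_diff[OF s(2) t(2), unfolded e]
  have "fps_X\<^sup>2 dvd arc Z 0 - (s * t) * ?c (Z 0)" "fps_X\<^sup>2 dvd arc Z 2 - (s * t) * ?c (Z 2)"
    unfolding Y by (subst Z0, simp only: seg_simps d4)+
  moreover have "fps_X\<^sup>2 dvd arc Z 1 - (s * t) * ?c (Z 1)"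
  proof -
    have "arc Z 1 - (s * t) * ?c (Z 1) = (z * \<mu> - (s * t) * ?c (z $ 0 * \<mu> $ 0)) + (x * \<nu> - (s * t) * ?c (x $ 0 * \<nu> $ 0))"
      unfolding Y by (subst Z0) (simp add: algebra_simps flip: fps_const_add)
    thus ?thesis using d4 by simp
  qed
  moreover have "fps_X\<^sup>2 dvd arc Z 3 - (s * t) * ?c (Z 3)"
  proof -
    have "arc Z 3 - (s * t) * ?c (Z 3) = (x * \<nu> - (s * t) * ?c (x $ 0 * \<nu> $ 0)) - (z * \<mu> - (s * t) * ?c (z $ 0 * \<mu> $ 0))"
      unfolding Y by (subst Z0) (simp add: algebra_simps flip: fps_const_sub)
    thus ?thesis using d4 by simp
  qed
  ultimately have "\<forall>i. fps_X\<^sup>2 dvd arc Z i - (s * t) * ?c (Z i)" unfolding all_4 by blast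
  hence dv: "fps_X\<^sup>2 dvd arc Z i - (s * t) * ?c (Z i)" for i by blast
  obtain l where l: "homogeneous 1 l" "subdegree (fe (arc Z) l) = 1"
    using local_param_arc[OF Z] unfolding local_param_def by blast
  obtain k where k: "l = (\<Sum>i\<in>UNIV. Const (k i) * Var i)" using homogeneous_1_linear[OF l(1)] .
  have "fe (arc Z) l $ 0 = 0" using nth_less_subdegree_zero[of 0 "fe (arc Z) l"] l(2) by simp
  hence l0: "(\<Sum>i\<in>UNIV. k i * Z i) = 0" using Z by (simp add: fe_arc_nth_0 k mp_eval_sum)
  have "fe (arc Z) l = (\<Sum>i\<in>UNIV. ?c (k i) * arc Z i)"
    by (simp add: k ev_fps.ev_sum)
  also have "\<dots> = (\<Sum>i\<in>UNIV. ?c (k i) * (arc Z i - (s * t) * ?c (Z i)) + (s * t) * ?c (k i * Z i))"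
    by (rule sum.cong) (simp_all add: algebra_simps)
  also have "\<dots> = (\<Sum>i\<in>UNIV. ?c (k i) * (arc Z i - (s * t) * ?c (Z i))) + (s * t) * (\<Sum>i\<in>UNIV. ?c (k i * Z i))"
    by (simp only: sum.distrib sum_distrib_left)
  also have "(\<Sum>i\<in>UNIV. ?c (k i * Z i)) = 0"
  proof -
    have "(\<Sum>i\<in>UNIV. ?c (k i * Z i)) = ?c (\<Sum>i\<in>UNIV. k i * Z i)" by (rule fps_const_sum[symmetric])
    thus ?thesis unfolding l0 by simp
  qed
  finally have "fe (arc Z) l = (\<Sum>i\<in>UNIV. ?c (k i) * (arc Z i - (s * t) * ?c (Z i)))" by simp
  also have "fps_X\<^sup>2 dvd \<dots>" using dv by (intro dvd_sum) simp
  finally have "fps_X\<^sup>2 dvd fe (arc Z) l" .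
  moreover have "fe (arc Z) l \<noteq> 0" using l(2) by auto
  ultimately show False using l(2) by (simp add: fps_X_power_dvd_iff)
qed

end

section \<open>Divisors of plane sections\<close>

context smooth_curve
begin

text \<open>The local picture of a branch point: \<open>D\<close> is \<open>q^2\<close> up to units,
  and since the two are not both stationary, \<open>q\<close> has order one.\<close>

lemma order_two:
  fixes D w p q r :: "'a fps"
  assumes e: "D * w * p\<^sup>2 = q\<^sup>2 * r" and u: "w $ 0 \<noteq> 0" "p $ 0 \<noteq> 0" "r $ 0 \<noteq> 0" and q0: "q $ 0 = 0"
    and n: "\<not> (fps_X\<^sup>2 dvd D \<and> fps_X\<^sup>2 dvd q)"
  shows "subdegree q = 1" "subdegree D = 2"
proof -
  have w: "w \<noteq> 0" "p \<noteq> 0" "r \<noteq> 0" using u by auto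
  have q: "q \<noteq> 0"
  proof
    assume "q = 0"
    with e w have "D = 0" by simp
    with \<open>q = 0\<close> n show False by simp
  qed
  with e w have D: "D \<noteq> 0" by auto
  have "subdegree (D * w * p\<^sup>2) = subdegree (q\<^sup>2 * r)" by (simp only: e)
  hence s: "subdegree D = 2 * subdegree q" using w q D u by (simp add: power2_eq_square)
  have "subdegree q \<noteq> 0" using q q0 by (simp add: subdegree_eq_0_iff)
  moreover have "\<not> (2 \<le> subdegree D \<and> 2 \<le> subdegree q)"
    using n fps_X_power_dvd_iff[OF D, of 2] fps_X_power_dvd_iff[OF q, of 2] by blast
  ultimately show "subdegree q = 1" "subdegree D = 2" using s by auto
qed

definition cross :: "'a fps \<Rightarrow> 'a fps \<Rightarrow> 'a fps" where
  "cross x z = x * fps_const (z $ 0) - z * fps_const (x $ 0)"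

lemma cross_nth_0: "cross x z $ 0 = 0"
  by (simp add: cross_def mult.commute)

lemma arc_coordsD:
  assumes "arc_coords Z x z \<mu> \<nu>"
  shows "\<not> (x $ 0 = 0 \<and> z $ 0 = 0)" "\<not> (\<mu> $ 0 = 0 \<and> \<nu> $ 0 = 0)" "Z = seg (x $ 0) (z $ 0) (\<mu> $ 0) (\<nu> $ 0)"
    "\<nu>\<^sup>2 * (z\<^sup>2 - x\<^sup>2) = \<mu>\<^sup>2 * (fps_const d * x\<^sup>2 - z\<^sup>2)"
    "(\<nu> $ 0)\<^sup>2 * ((z $ 0)\<^sup>2 - (x $ 0)\<^sup>2) = (\<mu> $ 0)\<^sup>2 * (d * (x $ 0)\<^sup>2 - (z $ 0)\<^sup>2)"
    "arc Z = seg x z \<mu> \<nu>"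
  using assms unfolding arc_coords_def by blast+

lemma not_both_0:
  fixes x z :: 'a
  assumes "\<not> (x = 0 \<and> z = 0)"
  shows "\<not> (z\<^sup>2 - x\<^sup>2 = 0 \<and> d * x\<^sup>2 - z\<^sup>2 = 0)"
proof
  assume a: "z\<^sup>2 - x\<^sup>2 = 0 \<and> d * x\<^sup>2 - z\<^sup>2 = 0"
  have "(d - 1) * x\<^sup>2 = (d * x\<^sup>2 - z\<^sup>2) + (z\<^sup>2 - x\<^sup>2)" by (simp add: algebra_simps)
  hence "(d - 1) * x\<^sup>2 = 0" using a by simp
  hence "x = 0" using d1 by simp
  with a assms show False by simp
qed

text \<open>If \<open>(x : z)\<close> were stationary, the curve equation would make the ratio of
  \<open>\<mu>^2\<close> and \<open>\<nu>^2\<close> constant modulo \<open>fps_X^2\<close>. Where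
  neither \<open>\<mu>\<close> nor \<open>\<nu>\<close> vanishes, \<open>(\<mu> : \<nu>)\<close>
  would then be stationary as well.\<close>

lemma order_unramified:
  assumes Z: "Z \<in> curve d" and c: "arc_coords Z x z \<mu> \<nu>" and nz: "\<mu> $ 0 \<noteq> 0" "\<nu> $ 0 \<noteq> 0"
  shows "subdegree (cross x z) = 1"
proof -
  note D = arc_coordsD[OF c]
  let ?c = fps_const
  define A where "A = (z $ 0)\<^sup>2 - (x $ 0)\<^sup>2"
  define B where "B = d * (x $ 0)\<^sup>2 - (z $ 0)\<^sup>2"
  have AB: "(\<nu> $ 0)\<^sup>2 * A = (\<mu> $ 0)\<^sup>2 * B" using D(5) by (simp only: A_def B_def)
  have A0: "A \<noteq> 0"
  proof
    assume "A = 0"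
    with AB nz have "B = 0" by simp
    with \<open>A = 0\<close> not_both_0[OF D(1)] show False by (simp add: A_def B_def)
  qed
  have "\<not> fps_X\<^sup>2 dvd cross x z"
  proof
    assume d1: "fps_X\<^sup>2 dvd cross x z"
    then obtain s where s: "fps_X\<^sup>2 dvd x - s * ?c (x $ 0)" "fps_X\<^sup>2 dvd z - s * ?c (z $ 0)"
      using pair_mod_square[OF D(1)] unfolding cross_def by metis
    have "fps_X dvd (fps_X\<^sup>2 :: 'a fps)" by (simp add: power2_eq_square)
    with s have "fps_X dvd x - s * ?c (x $ 0)" "fps_X dvd z - s * ?c (z $ 0)" using dvd_trans by blast+
    hence "x $ 0 = s $ 0 * x $ 0" "z $ 0 = s $ 0 * z $ 0" by (simp_all add: fps_X_dvd_iff)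
    hence s0: "s $ 0 = 1" using D(1) by auto
    note xx = dvd_product_diff[OF s(1) s(1)] and zz = dvd_product_diff[OF s(2) s(2)]
    let ?xx = "x * x - s * ?c (x $ 0) * (s * ?c (x $ 0))" and ?zz = "z * z - s * ?c (z $ 0) * (s * ?c (z $ 0))"
    have "s * s * (\<nu>\<^sup>2 * ?c A - \<mu>\<^sup>2 * ?c B)
      = (\<nu>\<^sup>2 * (z\<^sup>2 - x\<^sup>2) - \<mu>\<^sup>2 * (?c d * x\<^sup>2 - z\<^sup>2)) - \<nu>\<^sup>2 * (?zz - ?xx) + \<mu>\<^sup>2 * (?c d * ?xx - ?zz)"
      unfolding A_def B_def fps_const_sub[symmetric] fps_const_mult[symmetric] fps_const_power[symmetric] power2_eq_square
      by (simp add: algebra_simps del: fps_const_mult fps_const_sub fps_const_add)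
    also have "\<dots> = - (\<nu>\<^sup>2 * (?zz - ?xx)) + \<mu>\<^sup>2 * (?c d * ?xx - ?zz)" using D(4) by simp
    also have "fps_X\<^sup>2 dvd \<dots>" by (intro dvd_add dvd_diff dvd_mult xx zz iffD2[OF dvd_minus_iff])
    finally have "fps_X\<^sup>2 dvd s * s * (\<nu>\<^sup>2 * ?c A - \<mu>\<^sup>2 * ?c B)" .
    moreover have "s * s dvd 1" using s0 by simp
    ultimately have "fps_X\<^sup>2 dvd \<nu>\<^sup>2 * ?c A - \<mu>\<^sup>2 * ?c B" by (simp only: dvd_mult_unit_iff')
    define m n a b where "m = ?c (\<mu> $ 0)" and "n = ?c (\<nu> $ 0)" and "a = ?c A" and "b = ?c B"
    have ab: "m\<^sup>2 * b = n\<^sup>2 * a"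
      using AB unfolding m_def n_def a_def b_def fps_const_power fps_const_mult by simp
    have "m\<^sup>2 * (\<nu>\<^sup>2 * a - \<mu>\<^sup>2 * b) = a * (\<nu> * m)\<^sup>2 - \<mu>\<^sup>2 * (m\<^sup>2 * b)"
      by (simp add: power2_eq_square algebra_simps)
    also have "\<dots> = - a * (\<nu> * m + \<mu> * n) * (\<mu> * n - \<nu> * m)"
      unfolding ab by (simp add: power2_eq_square algebra_simps)
    finally have "fps_X\<^sup>2 dvd - a * (\<nu> * m + \<mu> * n) * (\<mu> * n - \<nu> * m)"
      using \<open>fps_X\<^sup>2 dvd \<nu>\<^sup>2 * ?c A - \<mu>\<^sup>2 * ?c B\<close> unfolding a_def b_def by (metis dvd_mult)
    hence "fps_X\<^sup>2 dvd - ?c A * (\<nu> * ?c (\<mu> $ 0) + \<mu> * ?c (\<nu> $ 0)) * (\<mu> * ?c (\<nu> $ 0) - \<nu> * ?c (\<mu> $ 0))"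
      unfolding m_def n_def a_def .
    moreover have "- ?c A * (\<nu> * ?c (\<mu> $ 0) + \<mu> * ?c (\<nu> $ 0)) dvd 1"
    proof -
      have "(- ?c A * (\<nu> * ?c (\<mu> $ 0) + \<mu> * ?c (\<nu> $ 0))) $ 0 = - (A * (2 * (\<mu> $ 0 * \<nu> $ 0)))"
        by (simp add: algebra_simps)
      also have "\<dots> \<noteq> 0" using A0 nz two by simp
      finally show ?thesis by simp
    qed
    ultimately have "fps_X\<^sup>2 dvd \<mu> * ?c (\<nu> $ 0) - \<nu> * ?c (\<mu> $ 0)" by (simp only: dvd_mult_unit_iff')
    with d1 arc_not_stationary[OF Z c] show False unfolding cross_def by blast
  qed
  moreover from this have "cross x z \<noteq> 0" by auto
  moreover have "subdegree (cross x z) \<noteq> 0"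
    using \<open>cross x z \<noteq> 0\<close> cross_nth_0[of x z] by (simp add: subdegree_eq_0_iff)
  ultimately show ?thesis using fps_X_power_dvd_iff[of "cross x z" 2] by simp
qed

text \<open>The curve equation says that \<open>cross x z\<close> is \<open>\<mu>^2\<close> up to
  units: a branch point of the coordinate \<open>(x : z)\<close>, with \<open>\<mu>\<close> as
  uniformiser.\<close>

lemma order_mu_0:
  assumes Z: "Z \<in> curve d" and c: "arc_coords Z x z \<mu> \<nu>" and m0: "\<mu> $ 0 = 0"
  shows "subdegree \<mu> = 1" "subdegree (cross x z) = 2"
proof -
  note D = arc_coordsD[OF c]
  let ?c = fps_const
  let ?x = "x $ 0" and ?z = "z $ 0"
  have n0: "\<nu> $ 0 \<noteq> 0" using D(2) m0 by simp
  hence zx: "?z\<^sup>2 = ?x\<^sup>2" using D(5) m0 by simp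
  hence xz: "?x \<noteq> 0" "?z \<noteq> 0" using D(1) by auto
  define w where "w = x * ?c ?z + z * ?c ?x"
  define r where "r = - (?c (?z\<^sup>2) * (?c d * x\<^sup>2 - z\<^sup>2))"
  have "cross x z * w = x\<^sup>2 * ?c (?z\<^sup>2) - z\<^sup>2 * ?c (?x\<^sup>2)"
    unfolding cross_def w_def fps_const_power[symmetric] by (simp add: power2_eq_square algebra_simps del: fps_const_mult)
  also have "\<dots> = - (?c (?z\<^sup>2) * (z\<^sup>2 - x\<^sup>2))" unfolding zx by (simp add: algebra_simps)
  finally have e0: "cross x z * w = - (?c (?z\<^sup>2) * (z\<^sup>2 - x\<^sup>2))" .
  have "cross x z * w * \<nu>\<^sup>2 = - (?c (?z\<^sup>2) * (\<nu>\<^sup>2 * (z\<^sup>2 - x\<^sup>2)))"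
    unfolding e0 by (simp add: mult_ac)
  also have "\<dots> = \<mu>\<^sup>2 * r" unfolding D(4) r_def by (simp add: mult_ac)
  finally have e: "cross x z * w * \<nu>\<^sup>2 = \<mu>\<^sup>2 * r" .
  have "w $ 0 = 2 * (?x * ?z)" by (simp add: w_def)
  hence w0: "w $ 0 \<noteq> 0" using xz two by simp
  have "d * ?x\<^sup>2 - ?z\<^sup>2 \<noteq> 0" using not_both_0[OF D(1)] zx by simp
  hence r0: "r $ 0 \<noteq> 0" using xz by (simp add: r_def power2_eq_square)
  have "\<not> (fps_X\<^sup>2 dvd cross x z \<and> fps_X\<^sup>2 dvd \<mu>)"
    using arc_not_stationary[OF Z c] m0 unfolding cross_def by auto
  from order_two[OF e w0 n0 r0 m0 this] show "subdegree \<mu> = 1" "subdegree (cross x z) = 2" .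
qed

lemma order_nu_0:
  assumes Z: "Z \<in> curve d" and c: "arc_coords Z x z \<mu> \<nu>" and n0: "\<nu> $ 0 = 0"
  shows "subdegree \<nu> = 1" "subdegree (cross x z) = 2"
proof -
  note D = arc_coordsD[OF c]
  let ?c = fps_const
  let ?x = "x $ 0" and ?z = "z $ 0"
  have m0: "\<mu> $ 0 \<noteq> 0" using D(2) n0 by simp
  hence zx: "?z\<^sup>2 = d * ?x\<^sup>2" using D(5) n0 by simp
  hence xz: "?x \<noteq> 0" "?z \<noteq> 0" using D(1) d0 by auto
  define w where "w = x * ?c ?z + z * ?c ?x"
  define r where "r = ?c (?x\<^sup>2) * (z\<^sup>2 - x\<^sup>2)"
  have "cross x z * w = x\<^sup>2 * ?c (?z\<^sup>2) - z\<^sup>2 * ?c (?x\<^sup>2)"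
    unfolding cross_def w_def fps_const_power[symmetric] by (simp add: power2_eq_square algebra_simps del: fps_const_mult)
  also have "\<dots> = ?c (?x\<^sup>2) * (?c d * x\<^sup>2 - z\<^sup>2)" unfolding zx by (simp add: algebra_simps flip: fps_const_mult)
  finally have "cross x z * w * \<mu>\<^sup>2 = ?c (?x\<^sup>2) * (\<mu>\<^sup>2 * (?c d * x\<^sup>2 - z\<^sup>2))" by (simp only: mult_ac)
  also have "\<dots> = \<nu>\<^sup>2 * r" unfolding D(4)[symmetric] r_def by (simp only: mult_ac)
  finally have e: "cross x z * w * \<mu>\<^sup>2 = \<nu>\<^sup>2 * r" .
  have "w $ 0 = 2 * (?x * ?z)" by (simp add: w_def)
  hence w0: "w $ 0 \<noteq> 0" using xz two by simp
  have "?z\<^sup>2 - ?x\<^sup>2 \<noteq> 0" using not_both_0[OF D(1)] zx by auto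
  hence r0: "r $ 0 \<noteq> 0" using xz by (simp add: r_def power2_eq_square)
  have "\<not> (fps_X\<^sup>2 dvd cross x z \<and> fps_X\<^sup>2 dvd \<nu>)"
  proof
    assume a: "fps_X\<^sup>2 dvd cross x z \<and> fps_X\<^sup>2 dvd \<nu>"
    hence "fps_X\<^sup>2 dvd \<mu> * ?c (\<nu> $ 0) - \<nu> * ?c (\<mu> $ 0)" using n0 by simp
    with a arc_not_stationary[OF Z c] show False unfolding cross_def by blast
  qed
  from order_two[OF e w0 m0 r0 n0 this] show "subdegree \<nu> = 1" "subdegree (cross x z) = 2" .
qed

lemma linear_order:
  assumes Z: "Z \<in> curve d" and c: "arc_coords Z x z \<mu> \<nu>" and ab: "\<not> (a = 0 \<and> b = 0)"
  shows "subdegree (fps_const a * x + fps_const b * z) =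
    (if a * x $ 0 + b * z $ 0 \<noteq> 0 then 0 else if \<mu> $ 0 = 0 \<or> \<nu> $ 0 = 0 then 2 else 1)"
    "fps_const a * x + fps_const b * z \<noteq> 0"
proof -
  note D = arc_coordsD[OF c]
  have cr: "subdegree (cross x z) = (if \<mu> $ 0 = 0 \<or> \<nu> $ 0 = 0 then 2 else 1)"
    using order_mu_0[OF Z c] order_nu_0[OF Z c] order_unramified[OF Z c] by auto
  let ?L = "fps_const a * x + fps_const b * z"
  have L0: "?L $ 0 = a * x $ 0 + b * z $ 0" by simp
  have "subdegree ?L = (if a * x $ 0 + b * z $ 0 \<noteq> 0 then 0 else if \<mu> $ 0 = 0 \<or> \<nu> $ 0 = 0 then 2 else 1) \<and> ?L \<noteq> 0"
  proof (cases "a * x $ 0 + b * z $ 0 = 0")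
    case False
    with L0 have "?L $ 0 \<noteq> 0" by simp
    hence "?L \<noteq> 0" by (metis fps_zero_nth)
    with False L0 show ?thesis by (simp add: subdegree_eq_0)
  next
    case True
    hence "x $ 0 * a + z $ 0 * b = 0" by (simp only: mult.commute)
    hence "z $ 0 * - b = x $ 0 * a" by (simp add: neg_eq_iff_add_eq_0 add.commute)
    moreover have "\<not> (z $ 0 = 0 \<and> x $ 0 = 0)" using D(1) by blast
    moreover have "\<not> (a = 0 \<and> - b = 0)" using ab by simp
    ultimately obtain s where s: "s \<noteq> 0" "a = s * z $ 0" "- b = s * x $ 0" by (rule proportional_pair)
    have b: "b = - (s * x $ 0)" using s(3) by (metis minus_minus)
    have e: "?L = fps_const s * cross x z"
      unfolding cross_def s(2) b fps_const_neg[symmetric] fps_const_mult[symmetric]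
      by (simp add: algebra_simps del: fps_const_mult fps_const_neg)
    have "cross x z \<noteq> 0" using cr by (auto split: if_splits)
    with e s(1) True cr show ?thesis by simp
  qed
  thus "subdegree ?L = (if a * x $ 0 + b * z $ 0 \<noteq> 0 then 0 else if \<mu> $ 0 = 0 \<or> \<nu> $ 0 = 0 then 2 else 1)" "?L \<noteq> 0"
    by blast+
qed

definition on_curve :: "'a \<Rightarrow> 'a \<Rightarrow> 'a \<Rightarrow> 'a \<Rightarrow> bool" where
  "on_curve x z \<mu> \<nu> \<longleftrightarrow> \<not> (x = 0 \<and> z = 0) \<and> \<not> (\<mu> = 0 \<and> \<nu> = 0) \<and> \<nu>\<^sup>2 * (z\<^sup>2 - x\<^sup>2) = \<mu>\<^sup>2 * (d * x\<^sup>2 - z\<^sup>2)"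

definition mult_at :: "(4 \<Rightarrow> 'a) \<Rightarrow> (4 \<Rightarrow> 'a) \<Rightarrow> nat" where
  "mult_at Z P = of_bool (proj_eq Z P)"

text \<open>The affine point \<open>(-1, 0)\<close>. Negation changes the sign of
  \<open>\<mu>\<close> and fixes it.\<close>

definition T2 :: "4 \<Rightarrow> 'a" where "T2 = seg 1 (- 1) 0 1"

lemma identity_point_seg: "identity_point = seg 1 1 0 1"
  by (simp add: eq_4_iff identity_point_def)

lemma proj_eq_arc_coords:
  assumes c: "arc_coords Z x z \<mu> \<nu>" and "\<not> (x' = 0 \<and> z' = 0)" "\<not> (\<mu>' = 0 \<and> \<nu>' = 0)"
  shows "proj_eq Z (seg x' z' \<mu>' \<nu>') \<longleftrightarrow> x $ 0 * z' = z $ 0 * x' \<and> \<mu> $ 0 * \<nu>' = \<nu> $ 0 * \<mu>'"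
  by (subst arc_coordsD(3)[OF c]) (rule proj_eq_seg[OF arc_coordsD(1,2)[OF c] assms(2,3)])

text \<open>The zeros of \<open>\<xi> - \<xi>(P)\<close> are \<open>(P) + (- P)\<close>. At a branch
  point, where \<open>\<mu>\<close> or \<open>\<nu>\<close> vanishes, the two coincide and the order
  is two.\<close>

lemma order_coordinate:
  assumes Z: "Z \<in> curve d" and c: "arc_coords Z x z \<mu> \<nu>" and P: "on_curve xP zP mP nP"
  shows "subdegree (fps_const zP * x + fps_const (- xP) * z) = mult_at Z (seg xP zP mP nP) + mult_at Z (seg xP zP (- mP) nP)"
    "fps_const zP * x + fps_const (- xP) * z \<noteq> 0"
proof -
  note D = arc_coordsD[OF c]
  have P': "\<not> (xP = 0 \<and> zP = 0)" "\<not> (mP = 0 \<and> nP = 0)" "nP\<^sup>2 * (zP\<^sup>2 - xP\<^sup>2) = mP\<^sup>2 * (d * xP\<^sup>2 - zP\<^sup>2)"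
    using P unfolding on_curve_def by blast+
  have nz: "\<not> (zP = 0 \<and> - xP = 0)" "\<not> (- mP = 0 \<and> nP = 0)" using P' by auto
  note lo = linear_order[OF Z c nz(1)]
  show "fps_const zP * x + fps_const (- xP) * z \<noteq> 0" by (rule lo(2))
  have m: "mult_at Z (seg xP zP mP nP) = of_bool (x $ 0 * zP = z $ 0 * xP \<and> \<mu> $ 0 * nP = \<nu> $ 0 * mP)"
    "mult_at Z (seg xP zP (- mP) nP) = of_bool (x $ 0 * zP = z $ 0 * xP \<and> \<mu> $ 0 * nP = \<nu> $ 0 * - mP)"
    unfolding mult_at_def proj_eq_arc_coords[OF c P'(1,2)] proj_eq_arc_coords[OF c P'(1) nz(2)] by (rule refl)+
  show "subdegree (fps_const zP * x + fps_const (- xP) * z) = mult_at Z (seg xP zP mP nP) + mult_at Z (seg xP zP (- mP) nP)"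
  proof (cases "x $ 0 * zP = z $ 0 * xP")
    case False
    hence "zP * x $ 0 + - xP * z $ 0 \<noteq> 0" by (simp add: mult.commute)
    with False show ?thesis unfolding lo(1) m by simp
  next
    case True
    then obtain s where s: "s \<noteq> 0" "xP = s * x $ 0" "zP = s * z $ 0" using proportional_pair[OF True D(1) P'(1)] by metis
    have z: "zP * x $ 0 + - xP * z $ 0 = 0" using True by (simp add: mult.commute)
    define A where "A = (z $ 0)\<^sup>2 - (x $ 0)\<^sup>2"
    define B where "B = d * (x $ 0)\<^sup>2 - (z $ 0)\<^sup>2"
    have AB: "(\<nu> $ 0)\<^sup>2 * A = (\<mu> $ 0)\<^sup>2 * B" using D(5) by (simp only: A_def B_def)
    have "s\<^sup>2 * (nP\<^sup>2 * A) = s\<^sup>2 * (mP\<^sup>2 * B)" using P'(3) unfolding s A_def B_def by (simp add: power2_eq_square algebra_simps)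
    hence AB': "nP\<^sup>2 * A = mP\<^sup>2 * B" using s(1) by simp
    have nAB: "\<not> (A = 0 \<and> B = 0)" using not_both_0[OF D(1)] by (simp add: A_def B_def)
    consider (m) "\<mu> $ 0 = 0" | (n) "\<nu> $ 0 = 0" | (mn) "\<mu> $ 0 \<noteq> 0" "\<nu> $ 0 \<noteq> 0" by blast
    thus ?thesis
    proof cases
      case m
      hence "A = 0" using AB D(2) by simp
      hence "mP = 0" using AB' nAB by simp
      with m True z show ?thesis unfolding lo(1) \<open>mult_at Z (seg xP zP mP nP) = _\<close> \<open>mult_at Z (seg xP zP (- mP) nP) = _\<close>
        by simp
    next
      case n
      hence "B = 0" using AB D(2) by simp
      hence "nP = 0" using AB' nAB by simp
      with n True z show ?thesis unfolding lo(1) m by simp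
    next
      case mn
      have A: "A \<noteq> 0" "B \<noteq> 0" using AB nAB mn by auto
      hence mnP: "mP \<noteq> 0" "nP \<noteq> 0" using AB' P'(2) by auto
      have "A * ((\<mu> $ 0 * nP)\<^sup>2 - (\<nu> $ 0 * mP)\<^sup>2) = (\<mu> $ 0)\<^sup>2 * (nP\<^sup>2 * A) - mP\<^sup>2 * ((\<nu> $ 0)\<^sup>2 * A)"
        by (simp add: power_mult_distrib algebra_simps)
      also have "\<dots> = 0" unfolding AB AB' by (simp add: mult_ac)
      finally have "(\<mu> $ 0 * nP)\<^sup>2 = (\<nu> $ 0 * mP)\<^sup>2" using A by simp
      hence "\<mu> $ 0 * nP = \<nu> $ 0 * mP \<or> \<mu> $ 0 * nP = \<nu> $ 0 * - mP" by (simp add: power2_eq_iff)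
      moreover have "\<nu> $ 0 * mP \<noteq> \<nu> $ 0 * - mP"
      proof
        assume "\<nu> $ 0 * mP = \<nu> $ 0 * - mP"
        hence "\<nu> $ 0 * mP + \<nu> $ 0 * mP = 0" by (simp only: mult_minus_right eq_neg_iff_add_eq_0)
        hence "2 * (\<nu> $ 0 * mP) = 0" by (simp only: mult_2)
        with two mn mnP show False by simp
      qed
      ultimately show ?thesis using mn True z unfolding lo(1) m by auto
    qed
  qed
qed

lemma order_mu:
  assumes Z: "Z \<in> curve d" and c: "arc_coords Z x z \<mu> \<nu>"
  shows "subdegree \<mu> = mult_at Z identity_point + mult_at Z T2" "\<mu> \<noteq> 0"
proof -
  note D = arc_coordsD[OF c]
  have m: "mult_at Z identity_point = of_bool (x $ 0 = z $ 0 \<and> \<mu> $ 0 = 0)"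
    "mult_at Z T2 = of_bool (x $ 0 = - z $ 0 \<and> \<mu> $ 0 = 0)"
    unfolding mult_at_def identity_point_seg T2_def
    using proj_eq_arc_coords[OF c, of 1 1 0 1] proj_eq_arc_coords[OF c, of 1 "- 1" 0 1]
    by (simp_all add: eq_neg_iff_add_eq_0 neg_eq_iff_add_eq_0 add.commute)
  have "subdegree \<mu> = mult_at Z identity_point + mult_at Z T2 \<and> \<mu> \<noteq> 0"
  proof (cases "\<mu> $ 0 = 0")
    case True
    hence "(z $ 0)\<^sup>2 = (x $ 0)\<^sup>2" using D(5) D(2) by simp
    hence "x $ 0 = z $ 0 \<or> x $ 0 = - z $ 0" using power2_eq_iff[of "x $ 0" "z $ 0"] by auto
    moreover have "z $ 0 \<noteq> - z $ 0"
    proof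
      assume e: "z $ 0 = - z $ 0"
      hence "2 * z $ 0 = 0" by (simp add: eq_neg_iff_add_eq_0)
      hence "z $ 0 = 0" using two by simp
      with \<open>(z $ 0)\<^sup>2 = (x $ 0)\<^sup>2\<close> D(1) show False by simp
    qed
    moreover have "subdegree \<mu> = 1" by (rule order_mu_0(1)[OF Z c True])
    moreover from this have "\<mu> \<noteq> 0" by auto
    ultimately show ?thesis unfolding m using True by auto
  next
    case False
    hence "\<mu> \<noteq> 0" by auto
    with False show ?thesis unfolding m by (simp add: subdegree_eq_0)
  qed
  thus "subdegree \<mu> = mult_at Z identity_point + mult_at Z T2" "\<mu> \<noteq> 0" by blast+
qed

end

section \<open>Chords\<close>

lemma chord_cubic:
  fixes D \<alpha> \<beta> \<gamma> x z :: "'b::comm_ring_1"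
  shows "\<gamma>\<^sup>2 * (x + z) * (D * x\<^sup>2 - z\<^sup>2) - (z - x) * (\<alpha> * x + \<beta> * z)\<^sup>2
    = (\<gamma>\<^sup>2 * D + \<alpha>\<^sup>2) * (x * x * x) + (\<gamma>\<^sup>2 * D - \<alpha>\<^sup>2 + 2 * \<alpha> * \<beta>) * (x * x * z)
      + (\<beta>\<^sup>2 - 2 * \<alpha> * \<beta> - \<gamma>\<^sup>2) * (x * z * z) + (- \<gamma>\<^sup>2 - \<beta>\<^sup>2) * (z * z * z)"
  by (simp add: power2_eq_square algebra_simps)

lemma product_cubic:
  fixes k x z :: "'b::comm_ring_1"
  shows "k * ((z1 * x + - x1 * z) * (z2 * x + - x2 * z) * (z3 * x + - x3 * z))
    = (k * z1 * z2 * z3) * (x * x * x) + (- (k * (x1 * z2 * z3 + z1 * x2 * z3 + z1 * z2 * x3))) * (x * x * z)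
      + (k * (z1 * x2 * x3 + x1 * z2 * x3 + x1 * x2 * z3)) * (x * z * z) + (- (k * x1 * x2 * x3)) * (z * z * z)"
  by (simp add: algebra_simps)

text \<open>Orders of different parity are different, so no cancellation occurs with either
  sign.\<close>

lemma subdegree_add_parity:
  fixes f g :: "'b::comm_ring_1 fps"
  assumes "f = 0 \<or> odd (subdegree f + subdegree g)" "g \<noteq> 0"
  shows "subdegree (f + g) = subdegree (g - f)" "f + g \<noteq> 0"
proof -
  have "subdegree (f + g) = subdegree (g - f) \<and> f + g \<noteq> 0"
  proof (cases "f = 0")
    case False
    with assms have "subdegree f \<noteq> subdegree g" by auto
    then consider "subdegree f < subdegree g" | "subdegree g < subdegree f" by linarith
    thus ?thesis
    proof cases
      case 1
      hence "subdegree (f + g) = subdegree f" "subdegree (f - g) = subdegree f"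
        using False subdegree_add_eq1[of f g] subdegree_diff_eq1[of f g] by simp_all
      moreover have "subdegree (g - f) = subdegree (f - g)" using subdegree_uminus[of "f - g"] by simp
      moreover have "f + g \<noteq> 0"
      proof
        assume "f + g = 0"
        hence "f = - g" by (simp add: eq_neg_iff_add_eq_0)
        with 1 show False by simp
      qed
      ultimately show ?thesis by simp
    next
      case 2
      hence "subdegree (f + g) = subdegree g" "subdegree (g - f) = subdegree g"
        using assms(2) subdegree_add_eq1[of g f] subdegree_diff_eq1[of g f] by (simp_all add: add.commute)
      moreover have "f + g \<noteq> 0"
      proof
        assume "f + g = 0"
        hence "f = - g" by (simp add: eq_neg_iff_add_eq_0)
        with 2 show False by simp
      qed
      ultimately show ?thesis by simp
    qed
  qed (use assms in simp)
  thus "subdegree (f + g) = subdegree (g - f)" "f + g \<noteq> 0" by blast+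
qed

context smooth_curve
begin

lemma subdegree_double:
  fixes f :: "'a fps"
  shows "subdegree (2 * f) = subdegree f" "2 * f = 0 \<longleftrightarrow> f = 0"
proof -
  have t: "2 * f = fps_const 2 * f" by (simp add: numeral_fps_const)
  show "2 * f = 0 \<longleftrightarrow> f = 0" unfolding t using two by (metis fps_const_0_eq_0 fps_const_eq_0_iff mult_eq_0_iff)
  show "subdegree (2 * f) = subdegree f" unfolding t using two by (cases "f = 0") simp_all
qed

lemma cubic_coefficients:
  fixes a b c e :: 'a
  assumes "\<And>x z. a * (x * x * x) + b * (x * x * z) + c * (x * z * z) + e * (z * z * z) = 0"
  shows "a = 0" "b = 0" "c = 0" "e = 0"
proof -
  have "poly [:e, c, b, a:] x = 0" for x
    using assms[of x 1] by (simp add: algebra_simps)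
  hence "[:e, c, b, a:] = 0"
    using poly_0_if_infinite_roots[OF finite.emptyI infinite_alg_closed] by blast
  thus "a = 0" "b = 0" "c = 0" "e = 0" by simp_all
qed

lemma lin_equiv2I:
  assumes "homogeneous n F" "homogeneous n G"
    and nz: "\<And>Z. Z \<in> curve d \<Longrightarrow> fe (arc Z) F \<noteq> 0" "\<And>Z. Z \<in> curve d \<Longrightarrow> fe (arc Z) G \<noteq> 0"
    and eq: "\<And>Z. Z \<in> curve d \<Longrightarrow> subdegree (fe (arc Z) F) + mult_at Z R + mult_at Z S
      = subdegree (fe (arc Z) G) + mult_at Z P + mult_at Z Q"
  shows "lin_equiv2 d P Q R S"
proof -
  have n: "F \<notin> curve_ideal d" "G \<notin> curve_ideal d"
    using fe_curve_ideal[OF two d0 d1 _ arc_cone[OF identity_point_in_curve]] nz identity_point_in_curve by blast+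
  have o: "(of_bool b :: enat) = enat (of_bool b)" for b by (cases b) (simp_all add: zero_enat_def one_enat_def)
  have "ord_at d Z F + of_bool (proj_eq Z R) + of_bool (proj_eq Z S) =
      ord_at d Z G + of_bool (proj_eq Z P) + of_bool (proj_eq Z Q)" if Z: "Z \<in> curve d" for Z
    using eq[OF Z] unfolding ord_at_arc[OF Z assms(1) n(1)] ord_at_arc[OF Z assms(2) n(2)] o mult_at_def by simp
  with assms(1,2) n show ?thesis unfolding lin_equiv2_def by blast
qed

text \<open>At \<open>seg x' z' \<mu> \<nu>\<close> this is \<open>2 \<mu> (z x' - x z')\<close>:
  the plane that cuts out the identity, \<open>T2\<close> and the two points with first coordinate
  \<open>(x : z)\<close>.\<close>

definition pair_form :: "'a \<Rightarrow> 'a \<Rightarrow> (4, 'a) mpoly" where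
  "pair_form x z = Const (2 * z) * Var 2 - Const x * (Var 1 - Var 3)"

text \<open>At \<open>seg x z \<mu> \<nu>\<close> this is twice
  \<open>\<mu> (\<alpha> x + \<beta> z) + \<gamma> \<nu> (x + z)\<close>, the general plane through
  \<open>T2\<close>. In the coordinates \<open>(x : z : a)\<close> with
  \<open>a = \<nu> (x + z) / \<mu>\<close> it is the line
  \<open>\<alpha> x + \<beta> z + \<gamma> a = 0\<close>.\<close>

definition line_form :: "'a \<Rightarrow> 'a \<Rightarrow> 'a \<Rightarrow> (4, 'a) mpoly" where
  "line_form \<alpha> \<beta> \<gamma> = Const (2 * \<alpha>) * Var 2 + Const \<beta> * (Var 1 - Var 3) + Const \<gamma> * (2 * Var 0 + Var 1 + Var 3)"

lemma homogeneous_pair_form: "homogeneous 1 (pair_form x z)"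
  unfolding pair_form_def by (intro homogeneous_diff homogeneous_Const_mult homogeneous_Var)

lemma homogeneous_line_form: "homogeneous 1 (line_form \<alpha> \<beta> \<gamma>)"
proof -
  have "(2::(4, 'a) mpoly) * Var 0 = Const 2 * Var 0" by (simp add: Const_add[of 1 1, simplified] Const_1)
  thus ?thesis unfolding line_form_def
    by (simp only:) (intro homogeneous_add homogeneous_diff homogeneous_Const_mult homogeneous_Var)
qed

lemma on_curve_identity: "on_curve 1 1 0 1" and on_curve_T2: "on_curve 1 (- 1) 0 1"
  by (simp_all add: on_curve_def)

lemma seg_uminus_0: "seg x z (- (0::'a)) n = seg x z 0 n"
  by simp

lemma order_pair_form:
  assumes Z: "Z \<in> curve d" and P: "on_curve xP zP mP nP"
  shows "subdegree (fe (arc Z) (pair_form xP zP)) = mult_at Z identity_point + mult_at Z T2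
      + (mult_at Z (seg xP zP mP nP) + mult_at Z (seg xP zP (- mP) nP))"
    "fe (arc Z) (pair_form xP zP) \<noteq> 0"
proof -
  obtain x z \<mu> \<nu> where c: "arc_coords Z x z \<mu> \<nu>" using arc_coords_exist[OF Z] .
  have "fe (arc Z) (pair_form xP zP) = 2 * (\<mu> * (fps_const zP * x + fps_const (- xP) * z))"
    unfolding arc_coordsD(6)[OF c] pair_form_def
    by (simp add: algebra_simps numeral_fps_const flip: fps_const_neg fps_const_mult)
  thus "subdegree (fe (arc Z) (pair_form xP zP)) = mult_at Z identity_point + mult_at Z T2
      + (mult_at Z (seg xP zP mP nP) + mult_at Z (seg xP zP (- mP) nP))"
    "fe (arc Z) (pair_form xP zP) \<noteq> 0"
    using order_mu[OF Z c] order_coordinate[OF Z c P] by (simp_all only: subdegree_double) simp_all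
qed

definition chord :: "'a \<Rightarrow> 'a \<Rightarrow> 'a \<Rightarrow> 'a \<Rightarrow> 'a \<Rightarrow> 'a \<Rightarrow> 'a \<Rightarrow> bool" where
  "chord \<alpha> \<beta> \<gamma> x z \<mu> \<nu> \<longleftrightarrow> on_curve x z \<mu> \<nu> \<and> \<mu> * (\<alpha> * x + \<beta> * z) + \<gamma> * \<nu> * (x + z) = 0"

text \<open>The line form is, up to a factor, \<open>F = f1 + f2\<close> with \<open>f1 = \<mu> (\<alpha> x + \<beta> z)\<close> and
  \<open>f2 = \<gamma> \<nu> (x + z)\<close>. Its conjugate \<open>f2 - f1\<close> under negation has the opposite zeros, and the product of
  the two only involves \<open>x\<close> and \<open>z\<close>. Where \<open>\<mu> \<nu> = 0\<close>, the orders of \<open>f1\<close> and \<open>f2\<close> differ by an odd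
  number, so that both factors have the same order.\<close>

lemma order_line_form:
  assumes Z: "Z \<in> curve d" and g: "\<gamma> \<noteq> 0"
    and P1: "chord \<alpha> \<beta> \<gamma> x1 z1 m1 n1" and P2: "chord \<alpha> \<beta> \<gamma> x2 z2 m2 n2" and P3: "chord \<alpha> \<beta> \<gamma> x3 z3 m3 n3"
    and k: "k \<noteq> 0" and N: "\<And>x z. \<gamma>\<^sup>2 * (x + z) * (d * x\<^sup>2 - z\<^sup>2) - (z - x) * (\<alpha> * x + \<beta> * z)\<^sup>2
      = k * ((z1 * x - x1 * z) * (z2 * x - x2 * z) * (z3 * x - x3 * z))"
  shows "subdegree (fe (arc Z) (line_form \<alpha> \<beta> \<gamma>))
      = mult_at Z (seg x1 z1 m1 n1) + mult_at Z (seg x2 z2 m2 n2) + mult_at Z (seg x3 z3 m3 n3) + mult_at Z T2"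
    "fe (arc Z) (line_form \<alpha> \<beta> \<gamma>) \<noteq> 0"
proof -
  obtain x z \<mu> \<nu> where c: "arc_coords Z x z \<mu> \<nu>" using arc_coords_exist[OF Z] .
  note D = arc_coordsD[OF c]
  let ?c = fps_const
  have P: "on_curve x1 z1 m1 n1" "on_curve x2 z2 m2 n2" "on_curve x3 z3 m3 n3"
    using P1 P2 P3 by (simp_all add: chord_def)
  have l: "m1 * (\<alpha> * x1 + \<beta> * z1) + \<gamma> * n1 * (x1 + z1) = 0" "m2 * (\<alpha> * x2 + \<beta> * z2) + \<gamma> * n2 * (x2 + z2) = 0"
    "m3 * (\<alpha> * x3 + \<beta> * z3) + \<gamma> * n3 * (x3 + z3) = 0"
    using P1 P2 P3 by (simp_all add: chord_def)
  define f1 f2 where "f1 = \<mu> * (?c \<alpha> * x + ?c \<beta> * z)" and "f2 = ?c \<gamma> * (\<nu> * (x + z))"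
  have F: "fe (arc Z) (line_form \<alpha> \<beta> \<gamma>) = 2 * (f1 + f2)"
    unfolding D(6) line_form_def f1_def f2_def
    by (simp add: algebra_simps numeral_fps_const flip: fps_const_neg fps_const_mult)
  define W where "W = (\<lambda>a b. ?c b * x + ?c (- a) * z)"
  \<comment> \<open>The cubic identity is given for scalars only. Its coefficients are compared over
    the infinite field and then carried over to power series.\<close>
  have N': "?c \<gamma> ^ 2 * (x + z) * (?c d * x\<^sup>2 - z\<^sup>2) - (z - x) * (?c \<alpha> * x + ?c \<beta> * z)\<^sup>2
      = ?c k * (W x1 z1 * W x2 z2 * W x3 z3)"
  proof -
    have "(\<gamma>\<^sup>2 * d + \<alpha>\<^sup>2 - k * z1 * z2 * z3) * (x * x * x)
       + (\<gamma>\<^sup>2 * d - \<alpha>\<^sup>2 + 2 * \<alpha> * \<beta> - - (k * (x1 * z2 * z3 + z1 * x2 * z3 + z1 * z2 * x3))) * (x * x * z)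
       + (\<beta>\<^sup>2 - 2 * \<alpha> * \<beta> - \<gamma>\<^sup>2 - k * (z1 * x2 * x3 + x1 * z2 * x3 + x1 * x2 * z3)) * (x * z * z)
       + (- \<gamma>\<^sup>2 - \<beta>\<^sup>2 - - (k * x1 * x2 * x3)) * (z * z * z) = 0" for x z
    proof -
      have d: "a1 * X1 + b1 * X2 + c1 * X3 + e1 * X4 = a2 * X1 + b2 * X2 + c2 * X3 + e2 * X4 \<Longrightarrow>
        (a1 - a2) * X1 + (b1 - b2) * X2 + (c1 - c2) * X3 + (e1 - e2) * X4 = 0"
        for a1 b1 c1 e1 a2 b2 c2 e2 X1 X2 X3 X4 :: 'a
        by (simp add: algebra_simps)
      show ?thesis
        by (rule d, rule trans[OF chord_cubic[symmetric] trans[OF N trans[OF _ product_cubic]]]) simp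
    qed
    note co = cubic_coefficients[OF this]
    have co': "\<gamma>\<^sup>2 * d + \<alpha>\<^sup>2 = k * z1 * z2 * z3"
      "\<gamma>\<^sup>2 * d - \<alpha>\<^sup>2 + 2 * \<alpha> * \<beta> = - (k * (x1 * z2 * z3 + z1 * x2 * z3 + z1 * z2 * x3))"
      "\<beta>\<^sup>2 - 2 * \<alpha> * \<beta> - \<gamma>\<^sup>2 = k * (z1 * x2 * x3 + x1 * z2 * x3 + x1 * x2 * z3)"
      "- \<gamma>\<^sup>2 - \<beta>\<^sup>2 = - (k * x1 * x2 * x3)"
      using co by (simp_all only: right_minus_eq)
    have c2: "(2::'a fps) = ?c 2" by (simp add: numeral_fps_const)
    show ?thesis
      unfolding chord_cubic W_def fps_const_neg[symmetric] product_cubic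
      unfolding c2 fps_const_power fps_const_mult fps_const_add fps_const_sub fps_const_neg co' by (rule refl)
  qed
  \<comment> \<open>\<open>W 1 1\<close> is \<open>x - z\<close>. Up to sign, the product of the two
    conjugates with this factor is \<open>\<mu>^2\<close> times the cubic, by the curve
    equation.\<close>
  have prod: "(f1 + f2) * (f2 - f1) * W 1 1 * ?c (- 1) = \<mu> * \<mu> * (?c k * (W x1 z1 * W x2 z2 * W x3 z3))"
  proof -
    define a b s where "a = ?c \<gamma> ^ 2 * (x + z)" and "b = (?c \<alpha> * x + ?c \<beta> * z)\<^sup>2" and "s = z - x"
    have w: "W 1 1 * ?c (- 1) = s" by (simp add: W_def s_def flip: fps_const_neg)
    have "(f1 + f2) * (f2 - f1) * s = a * (\<nu>\<^sup>2 * (z\<^sup>2 - x\<^sup>2)) - s * (\<mu>\<^sup>2 * b)"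
      by (simp add: f1_def f2_def a_def b_def s_def power2_eq_square algebra_simps)
    also have "\<dots> = \<mu> * \<mu> * (a * (?c d * x\<^sup>2 - z\<^sup>2) - s * b)"
      unfolding D(4) by (simp add: power2_eq_square algebra_simps)
    finally show ?thesis unfolding a_def b_def s_def[symmetric] N'[folded s_def]
      by (simp only: mult.assoc w)
  qed
  define O1 T p1 p2 p3 q1 q2 q3 where "O1 = mult_at Z identity_point" and "T = mult_at Z T2"
    and p_def: "p1 = mult_at Z (seg x1 z1 m1 n1)" "p2 = mult_at Z (seg x2 z2 m2 n2)" "p3 = mult_at Z (seg x3 z3 m3 n3)"
    and q_def: "q1 = mult_at Z (seg x1 z1 (- m1) n1)" "q2 = mult_at Z (seg x2 z2 (- m2) n2)" "q3 = mult_at Z (seg x3 z3 (- m3) n3)"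
  have W: "subdegree (W x1 z1) = p1 + q1" "subdegree (W x2 z2) = p2 + q2" "subdegree (W x3 z3) = p3 + q3"
    "subdegree (W 1 1) = O1 + O1" "W x1 z1 \<noteq> 0" "W x2 z2 \<noteq> 0" "W x3 z3 \<noteq> 0" "W 1 1 \<noteq> 0"
    unfolding W_def p_def q_def O1_def identity_point_seg
    using order_coordinate[OF Z c P(1)] order_coordinate[OF Z c P(2)] order_coordinate[OF Z c P(3)]
      order_coordinate[OF Z c on_curve_identity] by simp_all
  note mu = order_mu[OF Z c, folded O1_def T_def]
  have rhs: "\<mu> * \<mu> * (?c k * (W x1 z1 * W x2 z2 * W x3 z3)) \<noteq> 0" using mu(2) W k by simp
  hence nz: "f1 + f2 \<noteq> 0" "f2 - f1 \<noteq> 0" unfolding prod[symmetric] by auto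
  have "subdegree ((f1 + f2) * (f2 - f1) * W 1 1 * ?c (- 1)) = subdegree (\<mu> * \<mu> * (?c k * (W x1 z1 * W x2 z2 * W x3 z3)))"
    by (simp only: prod)
  moreover have "?c (- 1) \<noteq> (0 :: 'a fps)" by simp
  ultimately have total: "subdegree (f1 + f2) + subdegree (f2 - f1) = 2 * T + (p1 + q1) + (p2 + q2) + (p3 + q3)"
    using nz W mu k by simp
  have P': "\<not> (xx = 0 \<and> zz = 0)" "\<not> (mm = 0 \<and> nn = 0)" "\<not> (- mm = 0 \<and> nn = 0)" if "on_curve xx zz mm nn" for xx zz mm nn
    using that unfolding on_curve_def by auto
  have incident: "(f1 + f2) $ 0 = 0"
    if "on_curve xx zz mm nn" "mm * (\<alpha> * xx + \<beta> * zz) + \<gamma> * nn * (xx + zz) = 0" "mult_at Z (seg xx zz mm nn) \<noteq> 0"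
    for xx zz mm nn
  proof -
    note o = that(1)
    have "x $ 0 * zz = z $ 0 * xx" "\<mu> $ 0 * nn = \<nu> $ 0 * mm"
      using that(3) proj_eq_arc_coords[OF c P'(1,2)[OF that(1)]] by (simp_all add: mult_at_def)
    then obtain s t where s: "s \<noteq> 0" "xx = s * x $ 0" "zz = s * z $ 0" and t: "t \<noteq> 0" "mm = t * \<mu> $ 0" "nn = t * \<nu> $ 0"
      using proportional_pair[OF _ D(1) P'(1)[OF o]] proportional_pair[OF _ D(2) P'(2)[OF o]] by metis
    have "s * t * (f1 + f2) $ 0 = mm * (\<alpha> * xx + \<beta> * zz) + \<gamma> * nn * (xx + zz)"
      unfolding s(2,3) t(2,3) f1_def f2_def by (simp add: algebra_simps)
    with that(2) s(1) t(1) show ?thesis by simp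
  qed
  have incident': "(f2 - f1) $ 0 = 0"
    if "on_curve xx zz mm nn" "mm * (\<alpha> * xx + \<beta> * zz) + \<gamma> * nn * (xx + zz) = 0" "mult_at Z (seg xx zz (- mm) nn) \<noteq> 0"
    for xx zz mm nn
  proof -
    note o = that(1)
    have "x $ 0 * zz = z $ 0 * xx" "\<mu> $ 0 * nn = \<nu> $ 0 * - mm"
      using that(3) proj_eq_arc_coords[OF c P'(1,3)[OF that(1)]] by (simp_all add: mult_at_def)
    then obtain s t where s: "s \<noteq> 0" "xx = s * x $ 0" "zz = s * z $ 0" and t: "t \<noteq> 0" "- mm = t * \<mu> $ 0" "nn = t * \<nu> $ 0"
      using proportional_pair[OF _ D(1) P'(1)[OF o]] proportional_pair[OF _ D(2) P'(3)[OF o]] by metis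
    have m: "mm = - (t * \<mu> $ 0)" using t(2) by (metis minus_minus)
    have "s * t * (f2 - f1) $ 0 = mm * (\<alpha> * xx + \<beta> * zz) + \<gamma> * nn * (xx + zz)"
      unfolding s(2,3) t(3) m f1_def f2_def by (simp add: algebra_simps)
    with that(2) s(1) t(1) show ?thesis by simp
  qed
  \<comment> \<open>\<open>total\<close> only gives the sum of the orders of both conjugates. If
    \<open>\<mu>\<close> or \<open>\<nu>\<close> vanishes at \<open>Z\<close>, then \<open>Z\<close>
    is its own negative and both orders are half of the sum. Otherwise at most one conjugate
    vanishes, since two zeros would give \<open>x = - z\<close> and with it
    \<open>\<mu> = 0\<close>.\<close>
  have "subdegree (f1 + f2) = p1 + p2 + p3 + T"
  proof (cases "\<mu> $ 0 = 0 \<or> \<nu> $ 0 = 0")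
    case True
    have sym: "mult_at Z (seg xx zz mm nn) = mult_at Z (seg xx zz (- mm) nn)" if "on_curve xx zz mm nn" for xx zz mm nn
      unfolding mult_at_def proj_eq_arc_coords[OF c P'(1,2)[OF that]] proj_eq_arc_coords[OF c P'(1,3)[OF that]]
      using True D(2) by auto
    have "subdegree (f1 + f2) = subdegree (f2 - f1)"
    proof (rule subdegree_add_parity(1))
      have lin: "subdegree (?c a * x + ?c b * z) \<in> {0, 2}" "?c a * x + ?c b * z \<noteq> 0" if "\<not> (a = 0 \<and> b = 0)" for a b
        using linear_order[OF Z c that] True by auto
      have xz: "subdegree (x + z) \<in> {0, 2}" "x + z \<noteq> 0" using lin[of 1 1] by simp_all
      have mn: "\<mu> \<noteq> 0" "\<nu> \<noteq> 0" "odd (subdegree \<mu> + subdegree \<nu>)"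
        using True D(2) order_mu_0(1)[OF Z c] order_nu_0(1)[OF Z c] by (auto simp: subdegree_eq_0)
      show "f2 \<noteq> 0" using g mn xz by (simp add: f2_def)
      have s2: "subdegree f2 = subdegree \<nu> + subdegree (x + z)" using g mn xz by (simp add: f2_def)
      show "f1 = 0 \<or> odd (subdegree f1 + subdegree f2)"
      proof (cases "\<alpha> = 0 \<and> \<beta> = 0")
        case False
        have "subdegree f1 = subdegree \<mu> + subdegree (?c \<alpha> * x + ?c \<beta> * z)"
          using lin(2)[OF False] mn by (simp add: f1_def)
        with s2 lin(1)[OF False] xz(1) mn(3) show ?thesis by auto
      qed (simp add: f1_def)
    qed
    with total sym[OF P(1)] sym[OF P(2)] sym[OF P(3)] show ?thesis unfolding p_def q_def by simp
  next
    case False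
    hence T0: "T = 0" using mu by (simp add: subdegree_eq_0)
    have "\<not> ((f1 + f2) $ 0 = 0 \<and> (f2 - f1) $ 0 = 0)"
    proof
      assume a: "(f1 + f2) $ 0 = 0 \<and> (f2 - f1) $ 0 = 0"
      have "2 * f2 $ 0 = (f1 + f2) $ 0 + (f2 - f1) $ 0" by simp
      also have "\<dots> = 0" unfolding conjunct1[OF a] conjunct2[OF a] by simp
      finally have "f2 $ 0 = 0" using two by simp
      hence "x $ 0 = - z $ 0" using g False by (simp add: f2_def eq_neg_iff_add_eq_0)
      with D(5) False not_both_0[OF D(1)] show False by simp
    qed
    then consider "(f1 + f2) $ 0 \<noteq> 0" | "(f2 - f1) $ 0 \<noteq> 0" by blast
    thus ?thesis
    proof cases
      case 1
      hence "p1 = 0" "p2 = 0" "p3 = 0" using incident[OF P(1) l(1)] incident[OF P(2) l(2)] incident[OF P(3) l(3)]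
        unfolding p_def by blast+
      with 1 T0 show ?thesis by (simp add: subdegree_eq_0)
    next
      case 2
      hence "q1 = 0" "q2 = 0" "q3 = 0" using incident'[OF P(1) l(1)] incident'[OF P(2) l(2)] incident'[OF P(3) l(3)]
        unfolding q_def by blast+
      moreover have "subdegree (f2 - f1) = 0" using 2 by (rule subdegree_eq_0)
      ultimately show ?thesis using total T0 by simp
    qed
  qed
  thus "subdegree (fe (arc Z) (line_form \<alpha> \<beta> \<gamma>))
      = mult_at Z (seg x1 z1 m1 n1) + mult_at Z (seg x2 z2 m2 n2) + mult_at Z (seg x3 z3 m3 n3) + mult_at Z T2"
    unfolding F p_def[symmetric] T_def[symmetric] by (simp only: subdegree_double)
  show "fe (arc Z) (line_form \<alpha> \<beta> \<gamma>) \<noteq> 0" using F nz(1) by (simp only: subdegree_double not_False_eq_True)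
qed

section \<open>Sums from plane sections\<close>

lemma on_curve_uminus: "on_curve x z \<mu> \<nu> \<Longrightarrow> on_curve x z (- \<mu>) \<nu>"
  by (simp add: on_curve_def)

lemma on_curve_in_curve: "on_curve x z \<mu> \<nu> \<Longrightarrow> seg x z \<mu> \<nu> \<in> curve d"
  using seg_in_curve unfolding on_curve_def by blast

text \<open>The plane through the first two points, \<open>- P3\<close> and \<open>T2\<close> is
  divided by the plane through the identity, \<open>T2\<close>, \<open>P3\<close> and
  \<open>- P3\<close>. The points \<open>- P3\<close> and \<open>T2\<close> cancel, which is why the
  third incidence carries a negated \<open>m3\<close>.\<close>

lemma is_sum_chord:
  assumes g: "\<gamma> \<noteq> 0"
    and P1: "chord \<alpha> \<beta> \<gamma> x1 z1 m1 n1" and P2: "chord \<alpha> \<beta> \<gamma> x2 z2 m2 n2" and P3: "chord \<alpha> \<beta> \<gamma> x3 z3 (- m3) n3"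
    and k: "k \<noteq> 0" and N: "\<And>x z. \<gamma>\<^sup>2 * (x + z) * (d * x\<^sup>2 - z\<^sup>2) - (z - x) * (\<alpha> * x + \<beta> * z)\<^sup>2
      = k * ((z1 * x - x1 * z) * (z2 * x - x2 * z) * (z3 * x - x3 * z))"
  shows "is_sum d (seg x1 z1 m1 n1) (seg x2 z2 m2 n2) (seg x3 z3 m3 n3)"
proof -
  have o: "on_curve x1 z1 m1 n1" "on_curve x2 z2 m2 n2" "on_curve x3 z3 m3 n3"
    using P1 P2 P3 on_curve_uminus[of x3 z3 "- m3" n3] by (simp_all add: chord_def)
  have "lin_equiv2 d (seg x1 z1 m1 n1) (seg x2 z2 m2 n2) (seg x3 z3 m3 n3) identity_point"
    by (rule lin_equiv2I[OF homogeneous_line_form[of \<alpha> \<beta> \<gamma>] homogeneous_pair_form[of x3 z3]])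
      (simp_all add: order_line_form[OF _ g P1 P2 P3 k N] order_pair_form[OF _ o(3)])
  with o[THEN on_curve_in_curve] show ?thesis by (simp add: is_sum_def)
qed

lemma is_sum_uminus:
  assumes o: "on_curve x z \<mu> \<nu>"
  shows "is_sum d (seg x z \<mu> \<nu>) (seg x z (- \<mu>) \<nu>) identity_point"
proof -
  have "lin_equiv2 d (seg x z \<mu> \<nu>) (seg x z (- \<mu>) \<nu>) identity_point identity_point"
    by (rule lin_equiv2I[OF homogeneous_pair_form[of x z] homogeneous_pair_form[of 1 1]])
      (simp_all only: order_pair_form[OF _ o] order_pair_form[OF _ on_curve_identity] not_False_eq_True seg_uminus_0
        identity_point_seg add_ac)
  with o[THEN on_curve_in_curve] o[THEN on_curve_uminus, THEN on_curve_in_curve] identity_point_in_curve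
  show ?thesis by (simp add: is_sum_def)
qed

lemma proj_eq_cong: "proj_eq P P' \<Longrightarrow> proj_eq Z P \<longleftrightarrow> proj_eq Z P'"
  using proj_eq_trans proj_eq_sym by blast

lemma curve_proj_eq: "P \<in> curve d \<Longrightarrow> proj_eq P P' \<Longrightarrow> P' \<in> curve d"
  unfolding proj_eq_def using curve_scale by blast

lemma is_sum_cong:
  assumes "is_sum d P Q R" "proj_eq P P'" "proj_eq Q Q'" "proj_eq R R'"
  shows "is_sum d P' Q' R'"
  using assms(1) assms(2-4)[THEN curve_proj_eq[rotated]]
  unfolding is_sum_def lin_equiv2_def proj_eq_cong[OF assms(2)] proj_eq_cong[OF assms(3)] proj_eq_cong[OF assms(4)]
  by simp

lemma is_sum_commute: "is_sum d P Q R \<Longrightarrow> is_sum d Q P R"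
  unfolding is_sum_def lin_equiv2_def by (simp only: add_ac)

lemma is_sum_identity:
  assumes "P \<in> curve d"
  shows "is_sum d identity_point P P"
proof -
  have "lin_equiv2 d identity_point P P identity_point"
    by (rule lin_equiv2I[OF homogeneous_1 homogeneous_1]) simp_all
  with assms identity_point_in_curve show ?thesis by (simp add: is_sum_def)
qed

end

section \<open>Addition formulas in affine coordinates\<close>

text \<open>The cofactors come from division by the equations \<open>a1\<^sup>2 = K1\<close> and \<open>a2\<^sup>2 = K2\<close> of the two points.\<close>

lemma third_point_1:
  fixes x1 z1 v1 a1 x2 z2 v2 a2 d :: "'a::field"
  assumes "a1^2 = v1 * (d * x1^2 - z1^2)" "a2^2 = v2 * (d * x2^2 - z2^2)"
    and z: "z1 = x1 + 1" "v1 = 2 * x1 + 1" "z2 = x2 + 1" "v2 = 2 * x2 + 1"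
  shows "((a1^2 + 2*a1*a2 - ((d * x1^2 - z1^2) * (x2 + z2) + v1 * 2 * (d * x1 * x2 - z1 * z2)))*z2 + (((d * x2^2 - z2^2) * (x1 + z1) + v2 * 2 * (d * x1 * x2 - z1 * z2)) - a2^2 - 2*a1*a2)*z1) * (z1*z2*v1*v2+x1*x2*a1*a2) = ((a1^2 + 2*a1*a2 - ((d * x1^2 - z1^2) * (x2 + z2) + v1 * 2 * (d * x1 * x2 - z1 * z2)))*x2 + (((d * x2^2 - z2^2) * (x1 + z1) + v2 * 2 * (d * x1 * x2 - z1 * z2)) - a2^2 - 2*a1*a2)*x1) * (z1*z2*a1*a2+d*x1*x2*v1*v2)"
proof -
  define K1 K2 where K: "K1 = v1 * (d * x1^2 - z1^2)" "K2 = v2 * (d * x2^2 - z2^2)"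
  have "((a1^2 + 2*a1*a2 - ((d * x1^2 - z1^2) * (x2 + z2) + v1 * 2 * (d * x1 * x2 - z1 * z2)))*z2 + (((d * x2^2 - z2^2) * (x1 + z1) + v2 * 2 * (d * x1 * x2 - z1 * z2)) - a2^2 - 2*a1*a2)*z1) * (z1*z2*v1*v2+x1*x2*a1*a2) - ((a1^2 + 2*a1*a2 - ((d * x1^2 - z1^2) * (x2 + z2) + v1 * 2 * (d * x1 * x2 - z1 * z2)))*x2 + (((d * x2^2 - z2^2) * (x1 + z1) + v2 * 2 * (d * x1 * x2 - z1 * z2)) - a2^2 - 2*a1*a2)*x1) * (z1*z2*a1*a2+d*x1*x2*v1*v2) =
      (a1 * a2 * x1 * x2 * z2 - a1 * a2 * x2 * z1 * z2 - 2 * a2^2 * x1 * x2 * z1 + 2 * a2^2 * x1 * x2 * z2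
        + 2 * a2^2 * x1 * z1 * z2 - 2 * a2^2 * x2 * z1 * z2 - d * v1 * v2 * x1 * x2^2 + v1 * v2 * z1 * z2^2) * (a1^2 - K1) +
      (- 2 * K1 * x1 * x2 * z1 + 2 * K1 * x1 * x2 * z2 + 2 * K1 * x1 * z1 * z2 - 2 * K1 * x2 * z1 * z2 - a1 * a2 * x1 * x2 * z1
        + a1 * a2 * x1 * z1 * z2 + d * v1 * v2 * x1^2 * x2 - v1 * v2 * z1^2 * z2) * (a2^2 - K2)"
    unfolding K z by Groebner_Basis.algebra
  thus ?thesis using assms(1,2) by (simp add: K)
qed

lemma third_point_2:
  fixes x1 z1 v1 a1 x2 z2 v2 a2 d :: "'a::field"
  assumes "a1^2 = v1 * (d * x1^2 - z1^2)" "a2^2 = v2 * (d * x2^2 - z2^2)"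
    and z: "z1 = x1 + 1" "v1 = 2 * x1 + 1" "z2 = x2 + 1" "v2 = 2 * x2 + 1"
  shows "((a1^2 + 2*a1*a2 - ((d * x1^2 - z1^2) * (x2 + z2) + v1 * 2 * (d * x1 * x2 - z1 * z2)))*z2 + (((d * x2^2 - z2^2) * (x1 + z1) + v2 * 2 * (d * x1 * x2 - z1 * z2)) - a2^2 - 2*a1*a2)*z1) * (x1*z2*v1*a2-z1*x2*a1*v2) = ((a1^2 + 2*a1*a2 - ((d * x1^2 - z1^2) * (x2 + z2) + v1 * 2 * (d * x1 * x2 - z1 * z2)))*x2 + (((d * x2^2 - z2^2) * (x1 + z1) + v2 * 2 * (d * x1 * x2 - z1 * z2)) - a2^2 - 2*a1*a2)*x1) * (z1*x2*v1*a2-x1*z2*a1*v2)"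
proof -
  define K1 K2 where K: "K1 = v1 * (d * x1^2 - z1^2)" "K2 = v2 * (d * x2^2 - z2^2)"
  have "((a1^2 + 2*a1*a2 - ((d * x1^2 - z1^2) * (x2 + z2) + v1 * 2 * (d * x1 * x2 - z1 * z2)))*z2 + (((d * x2^2 - z2^2) * (x1 + z1) + v2 * 2 * (d * x1 * x2 - z1 * z2)) - a2^2 - 2*a1*a2)*z1) * (x1*z2*v1*a2-z1*x2*a1*v2) - ((a1^2 + 2*a1*a2 - ((d * x1^2 - z1^2) * (x2 + z2) + v1 * 2 * (d * x1 * x2 - z1 * z2)))*x2 + (((d * x2^2 - z2^2) * (x1 + z1) + v2 * 2 * (d * x1 * x2 - z1 * z2)) - a2^2 - 2*a1*a2)*x1) * (z1*x2*v1*a2-x1*z2*a1*v2) =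
      (a1 * v2 * x1 * x2 * z2 - a1 * v2 * x2 * z1 * z2 + a2 * v1 * x1 * z2^2 - a2 * v1 * x2^2 * z1 + 2 * a2 * v2 * x1 * x2 * z2
        - 2 * a2 * v2 * x1^2 * z2 - 2 * a2 * v2 * x2 * z1 * z2 + 2 * a2 * v2 * x2 * z1^2) * (a1^2 - K1) +
      (2 * a1 * v1 * x1 * x2 * z1 - 2 * a1 * v1 * x1 * z1 * z2 + 2 * a1 * v1 * x1 * z2^2 - 2 * a1 * v1 * x2^2 * z1
        - a1 * v2 * x1^2 * z2 + a1 * v2 * x2 * z1^2 + a2 * v1 * x1 * x2 * z1 - a2 * v1 * x1 * z1 * z2) * (a2^2 - K2)"
    unfolding K z by Groebner_Basis.algebra
  thus ?thesis using assms(1,2) by (simp add: K)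
qed

text \<open>In \<open>line_ij\<close> and \<open>on_curve_ij\<close> the digits select one of two
  expressions for \<open>(x : z)\<close> and one for \<open>(\<mu> : \<nu>)\<close>. The line
  identities put the negative of the claimed sum on the chord through the two points.\<close>

lemma line_11:
  fixes x1 z1 v1 a1 x2 z2 v2 a2 d :: "'a::field"
  assumes "a1^2 = v1 * (d * x1^2 - z1^2)" "a2^2 = v2 * (d * x2^2 - z2^2)"
    and z: "z1 = x1 + 1" "v1 = 2 * x1 + 1" "z2 = x2 + 1" "v2 = 2 * x2 + 1"
  shows "(x1*z2*a1*v2+z1*x2*v1*a2) * ((z1*a2-z2*a1)*(z1*z2*v1*v2+x1*x2*a1*a2) + (x2*a1-x1*a2)*(z1*z2*a1*a2+d*x1*x2*v1*v2)) = (x1-x2)*(z1*z2*a1*a2-d*x1*x2*v1*v2) * ((z1*z2*v1*v2+x1*x2*a1*a2) + (z1*z2*a1*a2+d*x1*x2*v1*v2))"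
proof -
  define K1 K2 where K: "K1 = v1 * (d * x1^2 - z1^2)" "K2 = v2 * (d * x2^2 - z2^2)"
  have "(x1*z2*a1*v2+z1*x2*v1*a2) * ((z1*a2-z2*a1)*(z1*z2*v1*v2+x1*x2*a1*a2) + (x2*a1-x1*a2)*(z1*z2*a1*a2+d*x1*x2*v1*v2)) - (x1-x2)*(z1*z2*a1*a2-d*x1*x2*v1*v2) * ((z1*z2*v1*v2+x1*x2*a1*a2) + (z1*z2*a1*a2+d*x1*x2*v1*v2)) =
      (a1 * a2 * v2 * x1 * x2 * z1 * z2^2 - a1 * a2 * v2 * x1^2 * x2 * z2^2 - a2^2 * v1 * x1 * x2^2 * z1 * z2
        + a2^2 * v1 * x2^2 * z1^2 * z2 + a2^2 * v2 * x1^2 * x2 * z1 * z2 - a2^2 * v2 * x1^2 * z1 * z2^2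
        + a2^2 * x1 * x2^2 * z1 * z2 - a2^2 * x1 * z1^2 * z2^2 - a2^2 * x1^2 * x2 * z1 * z2 + a2^2 * x2 * z1^2 * z2^2
        + d * v1 * v2^2 * x1^2 * x2^2 * z2 - v1 * v2^2 * x1 * z1 * z2^3) * (a1^2 - K1) +
      (- K1 * v1 * x1 * x2^2 * z1 * z2 + K1 * v1 * x2^2 * z1^2 * z2 + K1 * v2 * x1^2 * x2 * z1 * z2
        - K1 * v2 * x1^2 * z1 * z2^2 + K1 * x1 * x2^2 * z1 * z2 - K1 * x1 * z1^2 * z2^2 - K1 * x1^2 * x2 * z1 * z2
        + K1 * x2 * z1^2 * z2^2 - a1 * a2 * v1 * x1 * x2 * z1^2 * z2 + a1 * a2 * v1 * x1 * x2^2 * z1^2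
        - d * v1^2 * v2 * x1^2 * x2^2 * z1 + v1^2 * v2 * x2 * z1^3 * z2) * (a2^2 - K2)"
    unfolding K z by Groebner_Basis.algebra
  thus ?thesis using assms(1,2) by (simp add: K)
qed

lemma on_curve_11:
  fixes x1 z1 v1 a1 x2 z2 v2 a2 d :: "'a::field"
  assumes "a1^2 = v1 * (d * x1^2 - z1^2)" "a2^2 = v2 * (d * x2^2 - z2^2)"
    and z: "z1 = x1 + 1" "v1 = 2 * x1 + 1" "z2 = x2 + 1" "v2 = 2 * x2 + 1"
  shows "(z1*z2*a1*a2-d*x1*x2*v1*v2)^2 * ((z1*z2*a1*a2+d*x1*x2*v1*v2)^2 - (z1*z2*v1*v2+x1*x2*a1*a2)^2) = (x1*z2*a1*v2+z1*x2*v1*a2)^2 * (d*(z1*z2*v1*v2+x1*x2*a1*a2)^2 - (z1*z2*a1*a2+d*x1*x2*v1*v2)^2)"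
proof -
  define K1 K2 where K: "K1 = v1 * (d * x1^2 - z1^2)" "K2 = v2 * (d * x2^2 - z2^2)"
  have "(z1*z2*a1*a2-d*x1*x2*v1*v2)^2 * ((z1*z2*a1*a2+d*x1*x2*v1*v2)^2 - (z1*z2*v1*v2+x1*x2*a1*a2)^2) - (x1*z2*a1*v2+z1*x2*v1*a2)^2 * (d*(z1*z2*v1*v2+x1*x2*a1*a2)^2 - (z1*z2*a1*a2+d*x1*x2*v1*v2)^2) =
      (- K1 * a2^2 * d * v2^2 * x1^4 * x2^2 * z2^2 + K1 * a2^2 * v2^2 * x1^2 * z1^2 * z2^4
        - K1 * a2^4 * x1^2 * x2^2 * z1^2 * z2^2 + K1 * a2^4 * z1^4 * z2^4 - a1^2 * a2^2 * d * v2^2 * x1^4 * x2^2 * z2^2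
        + a1^2 * a2^2 * v2^2 * x1^2 * z1^2 * z2^4 - a1^2 * a2^4 * x1^2 * x2^2 * z1^2 * z2^2 + a1^2 * a2^4 * z1^4 * z2^4
        + 4 * a2^2 * d * v1^2 * v2^2 * x1^2 * x2^2 * z1^2 * z2^2 - 2 * a2^2 * d^2 * v1^2 * v2^2 * x1^2 * x2^2 * z1^2 * z2^2
        - a2^2 * d^2 * v1^2 * v2^2 * x1^4 * x2^4 - a2^2 * v1^2 * v2^2 * z1^4 * z2^4 - a2^4 * d * v1^2 * x1^2 * x2^4 * z1^2
        + a2^4 * v1^2 * x2^2 * z1^4 * z2^2 - d * v1^2 * v2^4 * x1^2 * z1^2 * z2^4 + d^2 * v1^2 * v2^4 * x1^4 * x2^2 * z2^2) * (a1^2 - K1) +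
      (- K1 * K2 * d * v1^2 * x1^2 * x2^4 * z1^2 + K1 * K2 * v1^2 * x2^2 * z1^4 * z2^2
        - K1 * a2^2 * d * v1^2 * x1^2 * x2^4 * z1^2 + K1 * a2^2 * v1^2 * x2^2 * z1^4 * z2^2
        + 4 * K1 * d * v1^2 * v2^2 * x1^2 * x2^2 * z1^2 * z2^2 - 2 * K1 * d^2 * v1^2 * v2^2 * x1^2 * x2^2 * z1^2 * z2^2
        - K1 * d^2 * v1^2 * v2^2 * x1^4 * x2^4 - K1 * v1^2 * v2^2 * z1^4 * z2^4 - K1^2 * K2 * x1^2 * x2^2 * z1^2 * z2^2
        + K1^2 * K2 * z1^4 * z2^4 - K1^2 * a2^2 * x1^2 * x2^2 * z1^2 * z2^2 + K1^2 * a2^2 * z1^4 * z2^4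
        - K1^2 * d * v2^2 * x1^4 * x2^2 * z2^2 + K1^2 * v2^2 * x1^2 * z1^2 * z2^4 - d * v1^4 * v2^2 * x2^2 * z1^4 * z2^2
        + d^2 * v1^4 * v2^2 * x1^2 * x2^4 * z1^2) * (a2^2 - K2)"
    unfolding K z by Groebner_Basis.algebra
  thus ?thesis using assms(1,2) by (simp add: K)
qed

lemma line_12:
  fixes x1 z1 v1 a1 x2 z2 v2 a2 d :: "'a::field"
  assumes "a1^2 = v1 * (d * x1^2 - z1^2)" "a2^2 = v2 * (d * x2^2 - z2^2)"
    and z: "z1 = x1 + 1" "v1 = 2 * x1 + 1" "z2 = x2 + 1" "v2 = 2 * x2 + 1"
  shows "(z1*x2*a1*v2+x1*z2*v1*a2) * ((z1*a2-z2*a1)*(z1*z2*v1*v2+x1*x2*a1*a2) + (x2*a1-x1*a2)*(z1*z2*a1*a2+d*x1*x2*v1*v2)) = (x1-x2)*(x1*x2*a1*a2-z1*z2*v1*v2) * ((z1*z2*v1*v2+x1*x2*a1*a2) + (z1*z2*a1*a2+d*x1*x2*v1*v2))"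
proof -
  define K1 K2 where K: "K1 = v1 * (d * x1^2 - z1^2)" "K2 = v2 * (d * x2^2 - z2^2)"
  have "(z1*x2*a1*v2+x1*z2*v1*a2) * ((z1*a2-z2*a1)*(z1*z2*v1*v2+x1*x2*a1*a2) + (x2*a1-x1*a2)*(z1*z2*a1*a2+d*x1*x2*v1*v2)) - (x1-x2)*(x1*x2*a1*a2-z1*z2*v1*v2) * ((z1*z2*v1*v2+x1*x2*a1*a2) + (z1*z2*a1*a2+d*x1*x2*v1*v2)) =
      (- a1 * a2 * v2 * x1 * x2^2 * z1 * z2 + a1 * a2 * v2 * x2^2 * z1^2 * z2 + a2^2 * v1 * x1 * x2 * z1 * z2^2
        - a2^2 * v1 * x1^2 * x2 * z2^2 - a2^2 * v2 * x1 * x2 * z1^2 * z2 + a2^2 * v2 * x1 * x2^2 * z1^2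
        + a2^2 * x1 * x2^2 * z1 * z2 - a2^2 * x1^2 * x2 * z1 * z2 + a2^2 * x1^2 * x2^3 - a2^2 * x1^3 * x2^2
        + d * v1 * v2^2 * x1 * x2^3 * z1 - v1 * v2^2 * x2 * z1^2 * z2^2) * (a1^2 - K1) +
      (K1 * v1 * x1 * x2 * z1 * z2^2 - K1 * v1 * x1^2 * x2 * z2^2 - K1 * v2 * x1 * x2 * z1^2 * z2 + K1 * v2 * x1 * x2^2 * z1^2
        + K1 * x1 * x2^2 * z1 * z2 - K1 * x1^2 * x2 * z1 * z2 + K1 * x1^2 * x2^3 - K1 * x1^3 * x2^2
        + a1 * a2 * v1 * x1^2 * x2 * z1 * z2 - a1 * a2 * v1 * x1^2 * z1 * z2^2 - d * v1^2 * v2 * x1^3 * x2 * z2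
        + v1^2 * v2 * x1 * z1^2 * z2^2) * (a2^2 - K2)"
    unfolding K z by Groebner_Basis.algebra
  thus ?thesis using assms(1,2) by (simp add: K)
qed

lemma on_curve_12:
  fixes x1 z1 v1 a1 x2 z2 v2 a2 d :: "'a::field"
  assumes "a1^2 = v1 * (d * x1^2 - z1^2)" "a2^2 = v2 * (d * x2^2 - z2^2)"
    and z: "z1 = x1 + 1" "v1 = 2 * x1 + 1" "z2 = x2 + 1" "v2 = 2 * x2 + 1"
  shows "(x1*x2*a1*a2-z1*z2*v1*v2)^2 * ((z1*z2*a1*a2+d*x1*x2*v1*v2)^2 - (z1*z2*v1*v2+x1*x2*a1*a2)^2) = (z1*x2*a1*v2+x1*z2*v1*a2)^2 * (d*(z1*z2*v1*v2+x1*x2*a1*a2)^2 - (z1*z2*a1*a2+d*x1*x2*v1*v2)^2)"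
proof -
  define K1 K2 where K: "K1 = v1 * (d * x1^2 - z1^2)" "K2 = v2 * (d * x2^2 - z2^2)"
  have "(x1*x2*a1*a2-z1*z2*v1*v2)^2 * ((z1*z2*a1*a2+d*x1*x2*v1*v2)^2 - (z1*z2*v1*v2+x1*x2*a1*a2)^2) - (z1*x2*a1*v2+x1*z2*v1*a2)^2 * (d*(z1*z2*v1*v2+x1*x2*a1*a2)^2 - (z1*z2*a1*a2+d*x1*x2*v1*v2)^2) =
      (- K1 * a2^2 * d * v2^2 * x1^2 * x2^4 * z1^2 + K1 * a2^2 * v2^2 * x2^2 * z1^4 * z2^2
        + K1 * a2^4 * x1^2 * x2^2 * z1^2 * z2^2 - K1 * a2^4 * x1^4 * x2^4 - a1^2 * a2^2 * d * v2^2 * x1^2 * x2^4 * z1^2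
        + a1^2 * a2^2 * v2^2 * x2^2 * z1^4 * z2^2 + a1^2 * a2^4 * x1^2 * x2^2 * z1^2 * z2^2 - a1^2 * a2^4 * x1^4 * x2^4
        - 4 * a2^2 * d * v1^2 * v2^2 * x1^2 * x2^2 * z1^2 * z2^2 + a2^2 * d^2 * v1^2 * v2^2 * x1^4 * x2^4
        + 2 * a2^2 * v1^2 * v2^2 * x1^2 * x2^2 * z1^2 * z2^2 + a2^2 * v1^2 * v2^2 * z1^4 * z2^4
        - a2^4 * d * v1^2 * x1^4 * x2^2 * z2^2 + a2^4 * v1^2 * x1^2 * z1^2 * z2^4 - d * v1^2 * v2^4 * x2^2 * z1^4 * z2^2
        + d^2 * v1^2 * v2^4 * x1^2 * x2^4 * z1^2) * (a1^2 - K1) +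
      (- K1 * K2 * d * v1^2 * x1^4 * x2^2 * z2^2 + K1 * K2 * v1^2 * x1^2 * z1^2 * z2^4
        - K1 * a2^2 * d * v1^2 * x1^4 * x2^2 * z2^2 + K1 * a2^2 * v1^2 * x1^2 * z1^2 * z2^4
        - 4 * K1 * d * v1^2 * v2^2 * x1^2 * x2^2 * z1^2 * z2^2 + K1 * d^2 * v1^2 * v2^2 * x1^4 * x2^4
        + 2 * K1 * v1^2 * v2^2 * x1^2 * x2^2 * z1^2 * z2^2 + K1 * v1^2 * v2^2 * z1^4 * z2^4
        + K1^2 * K2 * x1^2 * x2^2 * z1^2 * z2^2 - K1^2 * K2 * x1^4 * x2^4 + K1^2 * a2^2 * x1^2 * x2^2 * z1^2 * z2^2
        - K1^2 * a2^2 * x1^4 * x2^4 - K1^2 * d * v2^2 * x1^2 * x2^4 * z1^2 + K1^2 * v2^2 * x2^2 * z1^4 * z2^2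
        - d * v1^4 * v2^2 * x1^2 * z1^2 * z2^4 + d^2 * v1^4 * v2^2 * x1^4 * x2^2 * z2^2) * (a2^2 - K2)"
    unfolding K z by Groebner_Basis.algebra
  thus ?thesis using assms(1,2) by (simp add: K)
qed

lemma line_21:
  fixes x1 z1 v1 a1 x2 z2 v2 a2 d :: "'a::field"
  assumes "a1^2 = v1 * (d * x1^2 - z1^2)" "a2^2 = v2 * (d * x2^2 - z2^2)"
    and z: "z1 = x1 + 1" "v1 = 2 * x1 + 1" "z2 = x2 + 1" "v2 = 2 * x2 + 1"
  shows "(x1*z2*a1*v2+z1*x2*v1*a2) * ((z1*a2-z2*a1)*(x1*z2*v1*a2-z1*x2*a1*v2) + (x2*a1-x1*a2)*(z1*x2*v1*a2-x1*z2*a1*v2)) = (x1-x2)*(z1*z2*a1*a2-d*x1*x2*v1*v2) * ((x1*z2*v1*a2-z1*x2*a1*v2) + (z1*x2*v1*a2-x1*z2*a1*v2))"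
proof -
  define K1 K2 where K: "K1 = v1 * (d * x1^2 - z1^2)" "K2 = v2 * (d * x2^2 - z2^2)"
  have "(x1*z2*a1*v2+z1*x2*v1*a2) * ((z1*a2-z2*a1)*(x1*z2*v1*a2-z1*x2*a1*v2) + (x2*a1-x1*a2)*(z1*x2*v1*a2-x1*z2*a1*v2)) - (x1-x2)*(z1*z2*a1*a2-d*x1*x2*v1*v2) * ((x1*z2*v1*a2-z1*x2*a1*v2) + (z1*x2*v1*a2-x1*z2*a1*v2)) =
      (a1 * v2^2 * x1 * x2 * z1 * z2^2 - a1 * v2^2 * x1^2 * x2 * z2^2 - a2 * v1 * v2 * x1^2 * z2^3
        + a2 * v1 * v2 * x2^2 * z1^2 * z2 - a2 * v2 * x1 * x2 * z1 * z2^2 + a2 * v2 * x1 * x2 * z1^2 * z2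
        + a2 * v2 * x1^2 * z1 * z2^2 - a2 * v2 * x2^2 * z1^2 * z2 - a2 * v2^2 * x1 * x2 * z1^2 * z2 + a2 * v2^2 * x1^3 * z2^2) * (a1^2 - K1) +
      (a1 * v1 * v2 * x1^2 * z1 * z2^2 - a1 * v1 * v2 * x2^2 * z1^3 + a1 * v1 * x1 * x2 * z1 * z2^2
        - a1 * v1 * x1 * x2 * z1^2 * z2 - a1 * v1 * x1^2 * z1 * z2^2 + a1 * v1 * x2^2 * z1^2 * z2
        - a1 * v1^2 * x1 * x2 * z1 * z2^2 + a1 * v1^2 * x2^3 * z1^2 + a2 * v1^2 * x1 * x2 * z1^2 * z2
        - a2 * v1^2 * x1 * x2^2 * z1^2) * (a2^2 - K2)"
    unfolding K z by Groebner_Basis.algebra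
  thus ?thesis using assms(1,2) by (simp add: K)
qed

lemma on_curve_21:
  fixes x1 z1 v1 a1 x2 z2 v2 a2 d :: "'a::field"
  assumes "a1^2 = v1 * (d * x1^2 - z1^2)" "a2^2 = v2 * (d * x2^2 - z2^2)"
    and z: "z1 = x1 + 1" "v1 = 2 * x1 + 1" "z2 = x2 + 1" "v2 = 2 * x2 + 1"
  shows "(z1*z2*a1*a2-d*x1*x2*v1*v2)^2 * ((z1*x2*v1*a2-x1*z2*a1*v2)^2 - (x1*z2*v1*a2-z1*x2*a1*v2)^2) = (x1*z2*a1*v2+z1*x2*v1*a2)^2 * (d*(x1*z2*v1*a2-z1*x2*a1*v2)^2 - (z1*x2*v1*a2-x1*z2*a1*v2)^2)"
proof -
  define K1 K2 where K: "K1 = v1 * (d * x1^2 - z1^2)" "K2 = v2 * (d * x2^2 - z2^2)"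
  have "(z1*z2*a1*a2-d*x1*x2*v1*v2)^2 * ((z1*x2*v1*a2-x1*z2*a1*v2)^2 - (x1*z2*v1*a2-z1*x2*a1*v2)^2) - (x1*z2*a1*v2+z1*x2*v1*a2)^2 * (d*(x1*z2*v1*a2-z1*x2*a1*v2)^2 - (z1*x2*v1*a2-x1*z2*a1*v2)^2) =
      (K1 * a2^2 * v2^2 * x1^2 * z1^2 * z2^4 - K1 * a2^2 * v2^2 * x2^2 * z1^4 * z2^2
        - K1 * d * v2^4 * x1^2 * x2^2 * z1^2 * z2^2 + K1 * v2^4 * x1^4 * z2^4 + a1^2 * a2^2 * v2^2 * x1^2 * z1^2 * z2^4
        - a1^2 * a2^2 * v2^2 * x2^2 * z1^4 * z2^2 - a1^2 * d * v2^4 * x1^2 * x2^2 * z1^2 * z2^2 + a1^2 * v2^4 * x1^4 * z2^4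
        + 4 * a2^2 * d * v1^2 * v2^2 * x1^2 * x2^2 * z1^2 * z2^2 - a2^2 * d * v1^2 * v2^2 * x1^4 * z2^4
        - a2^2 * d * v1^2 * v2^2 * x2^4 * z1^4 - 2 * a2^2 * v1^2 * v2^2 * x1^2 * x2^2 * z1^2 * z2^2
        - a2^4 * v1^2 * x1^2 * z1^2 * z2^4 + a2^4 * v1^2 * x2^2 * z1^4 * z2^2 - d^2 * v1^2 * v2^4 * x1^2 * x2^4 * z1^2
        + d^2 * v1^2 * v2^4 * x1^4 * x2^2 * z2^2) * (a1^2 - K1) +
      (- K1 * K2 * v1^2 * x1^2 * z1^2 * z2^4 + K1 * K2 * v1^2 * x2^2 * z1^4 * z2^2 - K1 * a2^2 * v1^2 * x1^2 * z1^2 * z2^4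
        + K1 * a2^2 * v1^2 * x2^2 * z1^4 * z2^2 + 4 * K1 * d * v1^2 * v2^2 * x1^2 * x2^2 * z1^2 * z2^2
        - K1 * d * v1^2 * v2^2 * x1^4 * z2^4 - K1 * d * v1^2 * v2^2 * x2^4 * z1^4
        - 2 * K1 * v1^2 * v2^2 * x1^2 * x2^2 * z1^2 * z2^2 + K1^2 * v2^2 * x1^2 * z1^2 * z2^4 - K1^2 * v2^2 * x2^2 * z1^4 * z2^2
        - K2 * d * v1^4 * x1^2 * x2^2 * z1^2 * z2^2 + K2 * v1^4 * x2^4 * z1^4 - a2^2 * d * v1^4 * x1^2 * x2^2 * z1^2 * z2^2
        + a2^2 * v1^4 * x2^4 * z1^4 + d^2 * v1^4 * v2^2 * x1^2 * x2^4 * z1^2 - d^2 * v1^4 * v2^2 * x1^4 * x2^2 * z2^2) * (a2^2 - K2)"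
    unfolding K z by Groebner_Basis.algebra
  thus ?thesis using assms(1,2) by (simp add: K)
qed

lemma line_22:
  fixes x1 z1 v1 a1 x2 z2 v2 a2 d :: "'a::field"
  assumes "a1^2 = v1 * (d * x1^2 - z1^2)" "a2^2 = v2 * (d * x2^2 - z2^2)"
    and z: "z1 = x1 + 1" "v1 = 2 * x1 + 1" "z2 = x2 + 1" "v2 = 2 * x2 + 1"
  shows "(z1*x2*a1*v2+x1*z2*v1*a2) * ((z1*a2-z2*a1)*(x1*z2*v1*a2-z1*x2*a1*v2) + (x2*a1-x1*a2)*(z1*x2*v1*a2-x1*z2*a1*v2)) = (x1-x2)*(x1*x2*a1*a2-z1*z2*v1*v2) * ((x1*z2*v1*a2-z1*x2*a1*v2) + (z1*x2*v1*a2-x1*z2*a1*v2))"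
proof -
  define K1 K2 where K: "K1 = v1 * (d * x1^2 - z1^2)" "K2 = v2 * (d * x2^2 - z2^2)"
  have "(z1*x2*a1*v2+x1*z2*v1*a2) * ((z1*a2-z2*a1)*(x1*z2*v1*a2-z1*x2*a1*v2) + (x2*a1-x1*a2)*(z1*x2*v1*a2-x1*z2*a1*v2)) - (x1-x2)*(x1*x2*a1*a2-z1*z2*v1*v2) * ((x1*z2*v1*a2-z1*x2*a1*v2) + (z1*x2*v1*a2-x1*z2*a1*v2)) =
      (- a1 * v2^2 * x1 * x2^2 * z1 * z2 + a1 * v2^2 * x2^2 * z1^2 * z2 - a2 * v1 * v2 * x1^2 * x2 * z2^2
        + a2 * v1 * v2 * x2^3 * z1^2 - a2 * v2 * x1 * x2^3 * z1 + a2 * v2 * x1^2 * x2^2 * z1 - a2 * v2 * x1^2 * x2^2 * z2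
        + a2 * v2 * x1^3 * x2 * z2 + a2 * v2^2 * x1^2 * x2 * z1 * z2 - a2 * v2^2 * x2^2 * z1^3) * (a1^2 - K1) +
      (- a1 * v1 * v2 * x1 * x2^2 * z1^2 + a1 * v1 * v2 * x1^3 * z2^2 + a1 * v1 * x1 * x2^3 * z1 - a1 * v1 * x1^2 * x2^2 * z1
        + a1 * v1 * x1^2 * x2^2 * z2 - a1 * v1 * x1^3 * x2 * z2 + a1 * v1^2 * x1 * x2^2 * z1 * z2 - a1 * v1^2 * x1^2 * z2^3
        - a2 * v1^2 * x1^2 * x2 * z1 * z2 + a2 * v1^2 * x1^2 * z1 * z2^2) * (a2^2 - K2)"
    unfolding K z by Groebner_Basis.algebra
  thus ?thesis using assms(1,2) by (simp add: K)
qed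

lemma on_curve_22:
  fixes x1 z1 v1 a1 x2 z2 v2 a2 d :: "'a::field"
  assumes "a1^2 = v1 * (d * x1^2 - z1^2)" "a2^2 = v2 * (d * x2^2 - z2^2)"
    and z: "z1 = x1 + 1" "v1 = 2 * x1 + 1" "z2 = x2 + 1" "v2 = 2 * x2 + 1"
  shows "(x1*x2*a1*a2-z1*z2*v1*v2)^2 * ((z1*x2*v1*a2-x1*z2*a1*v2)^2 - (x1*z2*v1*a2-z1*x2*a1*v2)^2) = (z1*x2*a1*v2+x1*z2*v1*a2)^2 * (d*(x1*z2*v1*a2-z1*x2*a1*v2)^2 - (z1*x2*v1*a2-x1*z2*a1*v2)^2)"
proof -
  define K1 K2 where K: "K1 = v1 * (d * x1^2 - z1^2)" "K2 = v2 * (d * x2^2 - z2^2)"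
  have "(x1*x2*a1*a2-z1*z2*v1*v2)^2 * ((z1*x2*v1*a2-x1*z2*a1*v2)^2 - (x1*z2*v1*a2-z1*x2*a1*v2)^2) - (z1*x2*a1*v2+x1*z2*v1*a2)^2 * (d*(x1*z2*v1*a2-z1*x2*a1*v2)^2 - (z1*x2*v1*a2-x1*z2*a1*v2)^2) =
      (- K1 * a2^2 * v2^2 * x1^2 * x2^4 * z1^2 + K1 * a2^2 * v2^2 * x1^4 * x2^2 * z2^2 - K1 * d * v2^4 * x2^4 * z1^4
        + K1 * v2^4 * x1^2 * x2^2 * z1^2 * z2^2 - a1^2 * a2^2 * v2^2 * x1^2 * x2^4 * z1^2
        + a1^2 * a2^2 * v2^2 * x1^4 * x2^2 * z2^2 - a1^2 * d * v2^4 * x2^4 * z1^4 + a1^2 * v2^4 * x1^2 * x2^2 * z1^2 * z2^2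
        + 2 * a2^2 * d * v1^2 * v2^2 * x1^2 * x2^2 * z1^2 * z2^2 - 4 * a2^2 * v1^2 * v2^2 * x1^2 * x2^2 * z1^2 * z2^2
        + a2^2 * v1^2 * v2^2 * x1^4 * z2^4 + a2^2 * v1^2 * v2^2 * x2^4 * z1^4 + a2^4 * v1^2 * x1^2 * x2^4 * z1^2
        - a2^4 * v1^2 * x1^4 * x2^2 * z2^2 + v1^2 * v2^4 * x1^2 * z1^2 * z2^4 - v1^2 * v2^4 * x2^2 * z1^4 * z2^2) * (a1^2 - K1) +
      (K1 * K2 * v1^2 * x1^2 * x2^4 * z1^2 - K1 * K2 * v1^2 * x1^4 * x2^2 * z2^2 + K1 * a2^2 * v1^2 * x1^2 * x2^4 * z1^2
        - K1 * a2^2 * v1^2 * x1^4 * x2^2 * z2^2 + 2 * K1 * d * v1^2 * v2^2 * x1^2 * x2^2 * z1^2 * z2^2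
        - 4 * K1 * v1^2 * v2^2 * x1^2 * x2^2 * z1^2 * z2^2 + K1 * v1^2 * v2^2 * x1^4 * z2^4 + K1 * v1^2 * v2^2 * x2^4 * z1^4
        - K1^2 * v2^2 * x1^2 * x2^4 * z1^2 + K1^2 * v2^2 * x1^4 * x2^2 * z2^2 - K2 * d * v1^4 * x1^4 * z2^4
        + K2 * v1^4 * x1^2 * x2^2 * z1^2 * z2^2 - a2^2 * d * v1^4 * x1^4 * z2^4 + a2^2 * v1^4 * x1^2 * x2^2 * z1^2 * z2^2
        - v1^4 * v2^2 * x1^2 * z1^2 * z2^4 + v1^4 * v2^2 * x2^2 * z1^4 * z2^2) * (a2^2 - K2)"
    unfolding K z by Groebner_Basis.algebra
  thus ?thesis using assms(1,2) by (simp add: K)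
qed

section \<open>Existence of addition formulas\<close>

text \<open>The Boolean argument chooses between two expressions for the coordinates \<open>(x : z)\<close> of the sum
  (left) and for \<open>(\<mu> : \<nu>)\<close> (right); they are proportional, but each of them vanishes at some pairs of
  points.\<close>

definition left_pair :: "'a::comm_ring_1 \<Rightarrow> bool \<Rightarrow> 'a \<Rightarrow> 'a \<Rightarrow> 'a \<Rightarrow> 'a \<Rightarrow> 'a \<Rightarrow> 'a \<Rightarrow> 'a \<Rightarrow> 'a \<Rightarrow> 'a \<times> 'a" where
  "left_pair d b x1 z1 m1 n1 x2 z2 m2 n2 =
    (if b then (z1 * z2 * m1 * m2 + x1 * x2 * n1 * n2, z1 * z2 * n1 * n2 + d * x1 * x2 * m1 * m2)
     else (x1 * z2 * m1 * n2 - z1 * x2 * n1 * m2, z1 * x2 * m1 * n2 - x1 * z2 * n1 * m2))"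

definition right_pair :: "'a::comm_ring_1 \<Rightarrow> bool \<Rightarrow> 'a \<Rightarrow> 'a \<Rightarrow> 'a \<Rightarrow> 'a \<Rightarrow> 'a \<Rightarrow> 'a \<Rightarrow> 'a \<Rightarrow> 'a \<Rightarrow> 'a \<times> 'a" where
  "right_pair d b x1 z1 m1 n1 x2 z2 m2 n2 =
    (if b then (x1 * z2 * n1 * m2 + z1 * x2 * m1 * n2, z1 * z2 * n1 * n2 - d * x1 * x2 * m1 * m2)
     else (z1 * x2 * n1 * m2 + x1 * z2 * m1 * n2, x1 * x2 * n1 * n2 - z1 * z2 * m1 * m2))"

lemma left_pair_scale:
  "left_pair d b (s1 * x1) (s1 * z1) (t1 * m1) (t1 * n1) (s2 * x2) (s2 * z2) (t2 * m2) (t2 * n2)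
    = (let (l1, l2) = left_pair d b x1 z1 m1 n1 x2 z2 m2 n2 in (s1 * t1 * s2 * t2 * l1, s1 * t1 * s2 * t2 * l2))"
  by (simp add: left_pair_def algebra_simps)

lemma right_pair_scale:
  "right_pair d b (s1 * x1) (s1 * z1) (t1 * m1) (t1 * n1) (s2 * x2) (s2 * z2) (t2 * m2) (t2 * n2)
    = (let (l1, l2) = right_pair d b x1 z1 m1 n1 x2 z2 m2 n2 in (s1 * t1 * s2 * t2 * l1, s1 * t1 * s2 * t2 * l2))"
  by (simp add: right_pair_def algebra_simps)

lemma left_pair_swap:
  "left_pair d b x2 z2 m2 n2 x1 z1 m1 n1
    = (let (l1, l2) = left_pair d b x1 z1 m1 n1 x2 z2 m2 n2; s = if b then 1 else - 1 in (s * l1, s * l2))"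
  by (simp add: left_pair_def algebra_simps)

lemma right_pair_swap: "right_pair d b x2 z2 m2 n2 x1 z1 m1 n1 = right_pair d b x1 z1 m1 n1 x2 z2 m2 n2"
  by (simp add: right_pair_def algebra_simps)

text \<open>Coordinates scaled such that \<open>z - x = 1\<close> and \<open>\<mu> = v = z + x\<close>, \<open>\<nu> = a\<close>.\<close>

definition affine :: "'a::field \<Rightarrow> 'a \<Rightarrow> 'a \<Rightarrow> 'a \<Rightarrow> 'a \<Rightarrow> bool" where
  "affine d x z v a \<longleftrightarrow> z = x + 1 \<and> v = 2 * x + 1 \<and> v \<noteq> 0 \<and> a\<^sup>2 = v * (d * x\<^sup>2 - z\<^sup>2)"

text \<open>Since \<open>x + z = v\<close> in affine coordinates, the plane is the line
  \<open>\<alpha> x + \<beta> z + \<gamma> a = 0\<close> after division by \<open>v\<close>. Its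
  coefficients are the cross product of \<open>(x1, z1, a1)\<close> and \<open>(x2, z2, a2)\<close>,
  where \<open>x1 z2 - x2 z1\<close> collapses to \<open>x1 - x2\<close> because
  \<open>z - x = 1\<close>.\<close>

lemma chord_through_affine:
  fixes d :: "'a::field"
  assumes P: "affine d x1 z1 v1 a1" and Q: "affine d x2 z2 v2 a2"
    and l: "left_pair d b x1 z1 v1 a1 x2 z2 v2 a2 = (l1, l2)" and k: "right_pair d c x1 z1 v1 a1 x2 z2 v2 a2 = (k1, k2)"
  defines "\<alpha> \<equiv> z1 * a2 - z2 * a1" and "\<beta> \<equiv> x2 * a1 - x1 * a2" and "\<gamma> \<equiv> x1 - x2"
  shows "k1 * (\<alpha> * l1 + \<beta> * l2) = \<gamma> * k2 * (l1 + l2)" "k2\<^sup>2 * (l2\<^sup>2 - l1\<^sup>2) = k1\<^sup>2 * (d * l1\<^sup>2 - l2\<^sup>2)"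
    "(l2 - l1) * (\<gamma> * (\<gamma>\<^sup>2 * (x + z) * (d * x\<^sup>2 - z\<^sup>2) - (z - x) * (\<alpha> * x + \<beta> * z)\<^sup>2))
       = 2 * \<gamma> ^ 3 * (d - 1) * ((z1 * x - x1 * z) * (z2 * x - x2 * z) * (l2 * x - l1 * z))"
    "\<gamma> \<noteq> 0 \<Longrightarrow> 2 * (d - 1) \<noteq> 0 \<Longrightarrow> l1 = l2 \<Longrightarrow> l1 = 0"
proof -
  have e: "a1\<^sup>2 = v1 * (d * x1\<^sup>2 - z1\<^sup>2)" "a2\<^sup>2 = v2 * (d * x2\<^sup>2 - z2\<^sup>2)"
    and z: "z1 = x1 + 1" "v1 = 2 * x1 + 1" "z2 = x2 + 1" "v2 = 2 * x2 + 1"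
    using P Q by (simp_all add: affine_def)
  note h = e z
  show "k1 * (\<alpha> * l1 + \<beta> * l2) = \<gamma> * k2 * (l1 + l2)"
    using l k line_11[OF h] line_12[OF h] line_21[OF h] line_22[OF h] unfolding \<alpha>_def \<beta>_def \<gamma>_def
    by (cases b; cases c) (auto simp: left_pair_def right_pair_def)
  show "k2\<^sup>2 * (l2\<^sup>2 - l1\<^sup>2) = k1\<^sup>2 * (d * l1\<^sup>2 - l2\<^sup>2)"
    using l k on_curve_11[OF h] on_curve_12[OF h] on_curve_21[OF h] on_curve_22[OF h]
    by (cases b; cases c) (auto simp: left_pair_def right_pair_def)
  \<comment> \<open>Written in the linear forms \<open>V1 = z1 x - x1 z\<close> and
    \<open>V2 = z2 x - x2 z\<close>, \<open>\<gamma>\<close> times the cubic loses its pure cubes by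
    the curve equations; \<open>A\<close> and \<open>B\<close> are the coefficients of
    \<open>V1 V2^2\<close> and \<open>V1^2 V2\<close>. Hence \<open>p x + q z = A V2 + B V1\<close>
    is the third linear factor.\<close>
  define A where "A = a1\<^sup>2 + 2 * a1 * a2 - ((d * x1\<^sup>2 - z1\<^sup>2) * (x2 + z2) + v1 * 2 * (d * x1 * x2 - z1 * z2))"
  define B where "B = ((d * x2\<^sup>2 - z2\<^sup>2) * (x1 + z1) + v2 * 2 * (d * x1 * x2 - z1 * z2)) - a2\<^sup>2 - 2 * a1 * a2"
  define p q where "p = A * z2 + B * z1" and "q = - (A * x2 + B * x1)"
  have "p * l1 = (A * x2 + B * x1) * l2"
    using l third_point_1[OF h, folded A_def B_def] third_point_2[OF h, folded A_def B_def]
    unfolding p_def by (cases b) (auto simp: left_pair_def)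
  hence t: "p * l1 = - (q * l2)" unfolding q_def mult_minus_left minus_minus .
  \<comment> \<open>This is the third factor at \<open>(1, 1)\<close>. Its value is nonzero when
    \<open>\<gamma>\<close> and \<open>2 (d - 1)\<close> are, which later excludes
    \<open>l1 = l2\<close> unless both vanish.\<close>
  have s: "p + q = 2 * \<gamma> ^ 3 * (d - 1)"
  proof -
    have "p + q = A + B" unfolding p_def q_def z by (simp add: algebra_simps)
    also have "\<dots> = v1 * (d * x1\<^sup>2 - z1\<^sup>2) - ((d * x1\<^sup>2 - z1\<^sup>2) * (x2 + z2) + v1 * 2 * (d * x1 * x2 - z1 * z2))
        + ((d * x2\<^sup>2 - z2\<^sup>2) * (x1 + z1) + v2 * 2 * (d * x1 * x2 - z1 * z2)) - v2 * (d * x2\<^sup>2 - z2\<^sup>2)"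
      unfolding A_def B_def e by simp
    also have "\<dots> = 2 * \<gamma> ^ 3 * (d - 1)" unfolding \<gamma>_def z by Groebner_Basis.algebra
    finally show ?thesis .
  qed
  define N V1 V2 where "N = \<gamma> * (\<gamma>\<^sup>2 * (x + z) * (d * x\<^sup>2 - z\<^sup>2) - (z - x) * (\<alpha> * x + \<beta> * z)\<^sup>2)"
    and "V1 = z1 * x - x1 * z" and "V2 = z2 * x - x2 * z"
  have "N - V1 * V2 * (A * V2 + B * V1)
      = (v1 * (d * x1\<^sup>2 - z1\<^sup>2) - a1\<^sup>2) * V2 ^ 3 - (v2 * (d * x2\<^sup>2 - z2\<^sup>2) - a2\<^sup>2) * V1 ^ 3"
    unfolding N_def V1_def V2_def A_def B_def \<alpha>_def \<beta>_def \<gamma>_def z by Groebner_Basis.algebra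
  hence N: "N = V1 * V2 * (p * x + q * z)"
    unfolding e p_def q_def V1_def V2_def by (simp add: algebra_simps)
  have "(l2 - l1) * N = V1 * V2 * ((p + q) * (l2 * x - l1 * z))"
  proof -
    have "(l2 - l1) * (p * x + q * z) = (p * l2 * x - p * l1 * x) + (q * l2 * z - q * l1 * z)" by (simp add: algebra_simps)
    also have "\<dots> = (p + q) * (l2 * x - l1 * z) - (p * l1 + q * l2) * x + (p * l1 + q * l2) * z" by (simp add: algebra_simps)
    also have "\<dots> = (p + q) * (l2 * x - l1 * z)" unfolding t by simp
    finally show ?thesis unfolding N by (simp add: mult_ac)
  qed
  thus "(l2 - l1) * (\<gamma> * (\<gamma>\<^sup>2 * (x + z) * (d * x\<^sup>2 - z\<^sup>2) - (z - x) * (\<alpha> * x + \<beta> * z)\<^sup>2))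
       = 2 * \<gamma> ^ 3 * (d - 1) * ((z1 * x - x1 * z) * (z2 * x - x2 * z) * (l2 * x - l1 * z))"
    unfolding s N_def[symmetric] V1_def[symmetric] V2_def[symmetric] by (simp only: mult_ac)
  show "l1 = 0" if "\<gamma> \<noteq> 0" "2 * (d - 1) \<noteq> 0" "l1 = l2"
  proof -
    have "(p + q) * l1 = 0" using t that(3) by (simp add: algebra_simps)
    with s that show ?thesis by simp
  qed
qed

section \<open>Chords, tangents and the two-torsion points\<close>

context smooth_curve
begin

lemma affine_on_curve: "affine d x z v a \<Longrightarrow> on_curve x z v a"
proof -
  assume a: "affine d x z v a"
  have "z\<^sup>2 - x\<^sup>2 = v" using a by (simp add: affine_def power2_eq_square algebra_simps)
  with a show ?thesis by (auto simp: on_curve_def affine_def power2_eq_square)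
qed

text \<open>For \<open>m \<noteq> 0\<close> the equation \<open>z^2 = x^2\<close> would also force
  \<open>d x^2 = z^2\<close>, which is impossible. So \<open>z - x\<close> and \<open>z + x\<close>
  are nonzero and both scalings can be made.\<close>

lemma affine_exists:
  assumes o: "on_curve x z m n" and m: "m \<noteq> 0"
  obtains s t y w v a where "s \<noteq> 0" "t \<noteq> 0" "x = s * y" "z = s * w" "m = t * v" "n = t * a" "affine d y w v a"
proof -
  have o': "\<not> (x = 0 \<and> z = 0)" "n\<^sup>2 * (z\<^sup>2 - x\<^sup>2) = m\<^sup>2 * (d * x\<^sup>2 - z\<^sup>2)" using o by (simp_all add: on_curve_def)
  have zx: "z\<^sup>2 \<noteq> x\<^sup>2" using o' m not_both_0[OF o'(1)] by auto
  define s y where "s = z - x" and "y = x / s"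
  have s: "s \<noteq> 0" using zx by (auto simp: s_def)
  have x1: "x = s * y" using s by (simp add: y_def)
  have "s * (y + 1) = z" by (simp only: distrib_left mult_1_right x1[symmetric]) (simp add: s_def)
  note x = x1 this[symmetric]
  have "z + x \<noteq> 0"
  proof
    assume "z + x = 0"
    moreover have "z\<^sup>2 - x\<^sup>2 = (z - x) * (z + x)" by (simp add: power2_eq_square algebra_simps)
    ultimately show False using zx by simp
  qed
  moreover have zx': "z + x = s * (2 * y + 1)" by (subst x(2), subst x(1)) (simp add: algebra_simps)
  ultimately have v: "2 * y + 1 \<noteq> 0" by auto
  define t where "t = m / (2 * y + 1)"
  have t: "t \<noteq> 0" "m = t * (2 * y + 1)" using m v by (simp_all add: t_def)
  define q where "q = n / t"
  have n: "n = t * q" using t by (simp add: q_def)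
  have zz: "z\<^sup>2 - x\<^sup>2 = s * (s * (2 * y + 1))"
    by (simp only: zx'[symmetric]) (simp add: s_def power2_eq_square algebra_simps)
  have nn: "n\<^sup>2 = t\<^sup>2 * q\<^sup>2" by (simp add: n power_mult_distrib)
  have "t\<^sup>2 * q\<^sup>2 * (s * (s * (2 * y + 1))) = (t * (2 * y + 1))\<^sup>2 * (d * (s * y)\<^sup>2 - (s * (y + 1))\<^sup>2)"
    unfolding nn[symmetric] zz[symmetric] x[symmetric] t(2)[symmetric] by (rule o'(2))
  hence "(t\<^sup>2 * s\<^sup>2 * (2 * y + 1)) * q\<^sup>2 = (t\<^sup>2 * s\<^sup>2 * (2 * y + 1)) * ((2 * y + 1) * (d * y\<^sup>2 - (y + 1)\<^sup>2))"
    by (simp add: power2_eq_square algebra_simps)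
  hence "q\<^sup>2 = (2 * y + 1) * (d * y\<^sup>2 - (y + 1)\<^sup>2)" using t s v by simp
  with v have "affine d y (y + 1) (2 * y + 1) q" by (simp add: affine_def)
  with s t x n that show ?thesis by blast
qed

lemma proj_eq_seg_scale: "s \<noteq> 0 \<Longrightarrow> t \<noteq> 0 \<Longrightarrow> proj_eq (seg x z m n) (seg (s * x) (s * z) (t * m) (t * n :: 'a))"
  unfolding proj_eq_def by (rule exI[of _ "s * t"]) (simp add: eq_4_iff algebra_simps)

lemma is_sum_scale:
  assumes "is_sum d P Q (seg x z m n)" "l1 = s * x" "l2 = s * z" "k1 = t * m" "k2 = t * n"
    "\<not> (l1 = 0 \<and> l2 = 0)" "\<not> (k1 = 0 \<and> k2 = 0)"
  shows "is_sum d P Q (seg l1 l2 k1 k2)"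
proof -
  have "s \<noteq> 0" "t \<noteq> 0" using assms(2-7) by auto
  thus ?thesis unfolding assms(2-5) by (rule is_sum_cong[OF assms(1) proj_eq_refl proj_eq_refl proj_eq_seg_scale])
qed

text \<open>The three cases are those of the plane cubic: a chord through points with distinct
  abscissas, a pair of opposite points, and a tangent.\<close>

lemma is_sum_affine:
  assumes P: "affine d x1 z1 v1 a1" and Q: "affine d x2 z2 v2 a2"
    and l: "left_pair d b x1 z1 v1 a1 x2 z2 v2 a2 = (l1, l2)" and k: "right_pair d c x1 z1 v1 a1 x2 z2 v2 a2 = (k1, k2)"
    and nz: "\<not> (l1 = 0 \<and> l2 = 0)" "\<not> (k1 = 0 \<and> k2 = 0)"
  shows "is_sum d (seg x1 z1 v1 a1) (seg x2 z2 v2 a2) (seg l1 l2 k1 k2)"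
proof -
  have p: "z1 = x1 + 1" "v1 = 2 * x1 + 1" "a1\<^sup>2 = v1 * (d * x1\<^sup>2 - z1\<^sup>2)" "v1 \<noteq> 0"
    and q: "z2 = x2 + 1" "v2 = 2 * x2 + 1" "a2\<^sup>2 = v2 * (d * x2\<^sup>2 - z2\<^sup>2)"
    using P Q unfolding affine_def by blast+
  note oc = affine_on_curve[OF P] affine_on_curve[OF Q]
  note h = chord_through_affine[OF P Q l k]
  have oR: "on_curve l1 l2 (- k1) k2" using nz h(2) by (simp add: on_curve_def)
  \<comment> \<open>A point with \<open>a1 = 0\<close> is its own negative and is counted among the
    opposite pairs, so the tangent always has \<open>\<gamma> \<noteq> 0\<close>.\<close>
  consider "x1 \<noteq> x2" | "x1 = x2" "a2 = - a1" | "x1 = x2" "a2 = a1" "a1 \<noteq> 0"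
  proof (cases "x1 = x2")
    case True
    hence "a2\<^sup>2 = a1\<^sup>2" using p q by simp
    hence "a2 = a1 \<or> a2 = - a1" by (simp only: power2_eq_iff)
    with True that show thesis by (metis minus_zero)
  qed (use that in blast)
  thus ?thesis
  proof cases
    case 1
    define \<alpha> \<beta> \<gamma> where "\<alpha> = z1 * a2 - z2 * a1" and "\<beta> = x2 * a1 - x1 * a2" and "\<gamma> = x1 - x2"
    note h = h[folded \<alpha>_def \<beta>_def \<gamma>_def]
    have g: "\<gamma> \<noteq> 0" using 1 by (simp add: \<gamma>_def)
    have "l1 \<noteq> l2" using h(4) g two d1 nz(1) by auto
    \<comment> \<open>The factorisation in \<open>h(3)\<close> carries the factors
      \<open>\<gamma>\<close> and \<open>l2 - l1\<close>; this constant is what remains when they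
      are cancelled.\<close>
    define \<kappa> where "\<kappa> = 2 * \<gamma>\<^sup>2 * (d - 1) / (l2 - l1)"
    have \<kappa>: "\<kappa> \<noteq> 0" "(l2 - l1) * \<kappa> = 2 * \<gamma>\<^sup>2 * (d - 1)" using g two d1 \<open>l1 \<noteq> l2\<close> by (simp_all add: \<kappa>_def)
    show ?thesis
    proof (rule is_sum_chord[OF g])
      have "\<alpha> * x1 + \<beta> * z1 + \<gamma> * a1 = 0" "\<alpha> * x2 + \<beta> * z2 + \<gamma> * a2 = 0"
        unfolding \<alpha>_def \<beta>_def \<gamma>_def p(1) q(1) by (simp_all add: algebra_simps)
      hence "v1 * (\<alpha> * x1 + \<beta> * z1 + \<gamma> * a1) = 0" "v2 * (\<alpha> * x2 + \<beta> * z2 + \<gamma> * a2) = 0" by simp_all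
      moreover have "x1 + z1 = v1" "x2 + z2 = v2" unfolding p q by simp_all
      ultimately show "chord \<alpha> \<beta> \<gamma> x1 z1 v1 a1" "chord \<alpha> \<beta> \<gamma> x2 z2 v2 a2"
        using oc by (simp_all add: chord_def algebra_simps)
      show "chord \<alpha> \<beta> \<gamma> l1 l2 (- k1) k2" using oR h(1) by (simp add: chord_def)
      show "\<kappa> \<noteq> 0" by (rule \<kappa>(1))
      show "\<gamma>\<^sup>2 * (x + z) * (d * x\<^sup>2 - z\<^sup>2) - (z - x) * (\<alpha> * x + \<beta> * z)\<^sup>2
          = \<kappa> * ((z1 * x - x1 * z) * (z2 * x - x2 * z) * (l2 * x - l1 * z))" (is "?N = \<kappa> * ?W") for x z
      proof -
        have "((l2 - l1) * \<gamma>) * ?N = (l2 - l1) * (\<gamma> * ?N)" by (simp only: mult.assoc)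
        also have "\<dots> = 2 * \<gamma> ^ 3 * (d - 1) * ?W" by (rule h(3))
        also have "\<dots> = \<gamma> * (2 * \<gamma>\<^sup>2 * (d - 1)) * ?W" by (simp only: power3_eq_cube power2_eq_square mult_ac)
        also have "\<dots> = ((l2 - l1) * \<gamma>) * (\<kappa> * ?W)" unfolding \<kappa>(2)[symmetric] by (simp only: mult_ac)
        finally show ?thesis using g \<open>l1 \<noteq> l2\<close> by simp
      qed
    qed
  next
    case 2
    have e: "z2 = z1" "v2 = v1" "x2 = x1" using 2 p q by simp_all
    have zx: "z1\<^sup>2 - x1\<^sup>2 = v1" unfolding p by (simp add: power2_eq_square algebra_simps)
    have "z1\<^sup>2 * v1\<^sup>2 - x1\<^sup>2 * a1\<^sup>2 - (- (z1\<^sup>2 * a1\<^sup>2) + d * x1\<^sup>2 * v1\<^sup>2) = a1\<^sup>2 * (z1\<^sup>2 - x1\<^sup>2) - v1\<^sup>2 * (d * x1\<^sup>2 - z1\<^sup>2)"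
      by (simp add: algebra_simps)
    also have "\<dots> = 0" unfolding zx p(3) by (simp add: power2_eq_square)
    finally have "z1\<^sup>2 * v1\<^sup>2 - x1\<^sup>2 * a1\<^sup>2 = - (z1\<^sup>2 * a1\<^sup>2) + d * x1\<^sup>2 * v1\<^sup>2" by simp
    hence f1: "z1 * z1 * v1 * v1 + x1 * x1 * a1 * - a1 = z1 * z1 * a1 * - a1 + d * x1 * x1 * v1 * v1"
      by (simp add: power2_eq_square mult_ac)
    have f2: "x1 * z1 * v1 * - a1 - z1 * x1 * a1 * v1 = z1 * x1 * v1 * - a1 - x1 * z1 * a1 * v1"
      and f3: "x1 * z1 * a1 * v1 + z1 * x1 * v1 * - a1 = 0" "z1 * x1 * a1 * v1 + x1 * z1 * v1 * - a1 = 0"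
      by (simp_all add: mult_ac)
    have "l1 = l2" using l unfolding e 2(2) left_pair_def f1 f2 by (cases b) auto
    have "k1 = 0" using k unfolding e 2(2) right_pair_def f3 by (cases c) auto
    have "is_sum d (seg x1 z1 v1 a1) (seg x1 z1 v1 (- a1)) identity_point"
      by (rule is_sum_cong[OF is_sum_uminus[OF oc(1)] proj_eq_refl _ proj_eq_refl])
        (use proj_eq_seg_scale[of 1 "- 1" x1 z1 "- v1" a1] in simp)
    thus ?thesis unfolding e 2(2) identity_point_seg
      by (rule is_sum_scale[of _ _ 1 1 0 1 l1 l1 l2 k1 k2 k2]) (use \<open>l1 = l2\<close> \<open>k1 = 0\<close> nz in auto)
  next
    case 3
    have e: "z2 = z1" "v2 = v1" "x2 = x1" using 3 p q by simp_all
    define r where "r = d * x1\<^sup>2 - z1\<^sup>2"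
    have a: "a1\<^sup>2 = v1 * r" using p by (simp add: r_def)
    have dx: "d * x1\<^sup>2 = r + z1\<^sup>2" by (simp add: r_def)
    \<comment> \<open>The tangent line: minus one half of the gradient of
      \<open>a^2 (z - x) - (x + z) (d x^2 - z^2)\<close> at the point.\<close>
    define \<alpha> \<beta> \<gamma> where "\<alpha> = z1 * r + d * x1 * v1" and "\<beta> = - (x1 * r + z1 * v1)" and "\<gamma> = - a1"
    define L1 L2 K1 K2 where L: "L1 = z1\<^sup>2 * v1 + x1\<^sup>2 * r" "L2 = z1\<^sup>2 * r + d * x1\<^sup>2 * v1"
      and K: "K1 = 2 * x1 * z1 * a1" "K2 = z1\<^sup>2 * r - d * x1\<^sup>2 * v1"
    have "a1 * a1 = v1 * r" using a by (simp add: power2_eq_square)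
    \<comment> \<open>At a doubled point the second expression for \<open>(x : z)\<close> vanishes
      identically, so \<open>b\<close> holds. The first one contains the factor \<open>v1\<close>
      because of \<open>a1^2 = v1 r\<close>; \<open>L1\<close> and \<open>L2\<close> are the
      cofactors.\<close>
    have nb: "b" using l nz(1) unfolding e 3(2) by (cases b) (auto simp: left_pair_def mult_ac)
    have l': "l1 = v1 * L1" "l2 = v1 * L2"
      using l nb unfolding e 3(2) L left_pair_def by (auto simp: power2_eq_square algebra_simps \<open>a1 * a1 = v1 * r\<close>)
    have "K2 = x1\<^sup>2 * r - z1\<^sup>2 * v1"
      unfolding K r_def p(1,2) by Groebner_Basis.algebra
    hence g3: "x1 * x1 * a1 * a1 - z1 * z1 * v1 * v1 = v1 * K2"
      using \<open>a1 * a1 = v1 * r\<close> by Groebner_Basis.algebra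
    have g2: "z1 * z1 * a1 * a1 - d * x1 * x1 * v1 * v1 = v1 * K2"
      unfolding K using \<open>a1 * a1 = v1 * r\<close> by Groebner_Basis.algebra
    have g1: "x1 * z1 * a1 * v1 + z1 * x1 * v1 * a1 = v1 * K1" "z1 * x1 * a1 * v1 + x1 * z1 * v1 * a1 = v1 * K1"
      by (simp_all add: K algebra_simps)
    have k': "k1 = v1 * K1" "k2 = v1 * K2"
      using k unfolding e 3(2) right_pair_def g1 g2 g3 by (cases c; simp)+
    show ?thesis unfolding e 3(2)
    proof (rule is_sum_scale[OF is_sum_chord l' k' nz])
      show "\<gamma> \<noteq> 0" "d - 1 \<noteq> 0" using 3 d1 by (simp_all add: \<gamma>_def)
      have "\<alpha> * x1 + \<beta> * z1 = v1 * r" unfolding \<alpha>_def \<beta>_def r_def by (simp add: power2_eq_square algebra_simps)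
      moreover have "x1 + z1 = v1" unfolding p by simp
      moreover have "v1 * (v1 * r) + - a1 * a1 * v1 = 0" using \<open>a1 * a1 = v1 * r\<close> by (simp add: mult_ac)
      ultimately show "chord \<alpha> \<beta> \<gamma> x1 z1 v1 a1" "chord \<alpha> \<beta> \<gamma> x1 z1 v1 a1" using oc by (simp_all only: chord_def \<gamma>_def)
      have "\<not> (L1 = 0 \<and> L2 = 0)" "\<not> (K1 = 0 \<and> K2 = 0)" using nz l' k' by auto
      moreover have "K2\<^sup>2 * (L2\<^sup>2 - L1\<^sup>2) = (2 * x1 * z1)\<^sup>2 * (v1 * r) * (d * L1\<^sup>2 - L2\<^sup>2)"
        unfolding L K r_def p(1,2) by Groebner_Basis.algebra
      moreover have "K1\<^sup>2 = (2 * x1 * z1)\<^sup>2 * (v1 * r)" unfolding K a[symmetric] by (simp add: power_mult_distrib)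
      moreover have "- K1 * (\<alpha> * L1 + \<beta> * L2) + \<gamma> * K2 * (L1 + L2) = 0"
        unfolding L K r_def p(1,2) \<alpha>_def \<beta>_def \<gamma>_def by Groebner_Basis.algebra
      ultimately show "chord \<alpha> \<beta> \<gamma> L1 L2 (- K1) K2" by (simp add: chord_def on_curve_def)
      show "\<gamma>\<^sup>2 * (x + z) * (d * x\<^sup>2 - z\<^sup>2) - (z - x) * (\<alpha> * x + \<beta> * z)\<^sup>2
          = (d - 1) * ((z1 * x - x1 * z) * (z1 * x - x1 * z) * (L2 * x - L1 * z))" for x z
      proof -
        have g: "\<gamma>\<^sup>2 = v1 * r" using a by (simp add: \<gamma>_def)
        show ?thesis unfolding g unfolding L \<alpha>_def \<beta>_def r_def p(1,2) by Groebner_Basis.algebra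
      qed
    qed
  qed
qed

text \<open>Adding \<open>T2\<close> changes the signs of both affine coordinates. The plane chosen
  contains \<open>T2\<close> twice: its cubic is \<open>(x + z) (A x^2 + B z^2)\<close>, and the
  even quadratic factor has opposite roots.\<close>

lemma is_sum_T2:
  assumes o: "on_curve x2 z2 m2 n2" and m: "m2 \<noteq> 0"
  shows "is_sum d (seg 1 (- 1) 0 1) (seg x2 z2 m2 n2) (seg x2 (- z2) (- m2) n2)"
proof -
  have o': "\<not> (x2 = 0 \<and> z2 = 0)" "n2\<^sup>2 * (z2\<^sup>2 - x2\<^sup>2) = m2\<^sup>2 * (d * x2\<^sup>2 - z2\<^sup>2)"
    using o by (simp_all add: on_curve_def)
  define A B where "A = m2\<^sup>2 * d + n2\<^sup>2" and "B = - (m2\<^sup>2 + n2\<^sup>2)"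
  have "A + B = m2\<^sup>2 * (d - 1)" by (simp add: A_def B_def algebra_simps)
  hence "\<not> (A = 0 \<and> B = 0)" using m d1 by auto
  moreover have "z2\<^sup>2 * B = - x2\<^sup>2 * A" using o'(2) by (simp add: A_def B_def algebra_simps)
  moreover have "\<not> (z2\<^sup>2 = 0 \<and> - x2\<^sup>2 = 0)" using o'(1) by auto
  ultimately obtain k where k: "k \<noteq> 0" "A = k * z2\<^sup>2" "B = k * - x2\<^sup>2" using proportional_pair by metis
  show ?thesis
  proof (rule is_sum_chord)
    show "- m2 \<noteq> 0" "k \<noteq> 0" using m k by simp_all
    show "chord n2 n2 (- m2) 1 (- 1) 0 1" using on_curve_T2 by (simp add: chord_def)
    show "chord n2 n2 (- m2) x2 z2 m2 n2" using o by (simp add: chord_def algebra_simps)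
    show "chord n2 n2 (- m2) x2 (- z2) (- (- m2)) n2" using o by (simp add: chord_def on_curve_def algebra_simps)
    show "(- m2)\<^sup>2 * (x + z) * (d * x\<^sup>2 - z\<^sup>2) - (z - x) * (n2 * x + n2 * z)\<^sup>2
        = k * ((- 1 * x - 1 * z) * (z2 * x - x2 * z) * (- z2 * x - x2 * z))" for x z
    proof -
      have "(- m2)\<^sup>2 * (x + z) * (d * x\<^sup>2 - z\<^sup>2) - (z - x) * (n2 * x + n2 * z)\<^sup>2 = (x + z) * (A * x\<^sup>2 + B * z\<^sup>2)"
        by (simp add: A_def B_def power2_eq_square algebra_simps)
      also have "\<dots> = k * ((- 1 * x - 1 * z) * (z2 * x - x2 * z) * (- z2 * x - x2 * z))"
        unfolding k(2,3) by (simp add: power2_eq_square algebra_simps)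
      finally show ?thesis .
    qed
  qed
qed

text \<open>The first point is the identity or \<open>T2\<close>. The hypothesis \<open>c1\<close>
  excludes only \<open>T2\<close> plus the identity, which \<open>is_sum_pairs\<close> obtains by
  exchanging the summands.\<close>

lemma is_sum_pairs_two_torsion:
  assumes P: "on_curve x1 z1 m1 n1" and Q: "on_curve x2 z2 m2 n2" and m1: "m1 = 0" and c1: "x1 = z1 \<or> m2 \<noteq> 0 \<or> x2 \<noteq> z2"
    and l: "left_pair d b x1 z1 m1 n1 x2 z2 m2 n2 = (l1, l2)" and k: "right_pair d c x1 z1 m1 n1 x2 z2 m2 n2 = (k1, k2)"
    and nz: "\<not> (l1 = 0 \<and> l2 = 0)" "\<not> (k1 = 0 \<and> k2 = 0)"
  shows "is_sum d (seg x1 z1 m1 n1) (seg x2 z2 m2 n2) (seg l1 l2 k1 k2)"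
proof -
  have n1: "n1 \<noteq> 0" and x: "\<not> (x1 = 0 \<and> z1 = 0)" and "z1\<^sup>2 = x1\<^sup>2" using P m1 by (auto simp: on_curve_def)
  from this(3) have "z1 = x1 \<or> z1 = - x1" by (simp only: power2_eq_iff)
  moreover have x1: "x1 \<noteq> 0" using x calculation by auto
  ultimately consider "z1 = x1" | "z1 = - x1" "m2 \<noteq> 0" | "z1 = - x1" "m2 = 0" "x2 \<noteq> z2"
  proof -
    have "x1 \<noteq> - x1" using two x1 by (metis add_cancel_right_right add_minus_cancel eq_neg_iff_add_eq_0 mult_2 mult_eq_0_iff)
    with c1 \<open>z1 = x1 \<or> z1 = - x1\<close> that show thesis by metis
  qed
  thus ?thesis
  proof cases
    case 1
    have "proj_eq identity_point (seg x1 z1 m1 n1)"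
      unfolding identity_point_seg 1 m1 using proj_eq_seg_scale[OF x1 n1, of 1 1 0 1] by simp
    from is_sum_cong[OF is_sum_identity[OF on_curve_in_curve[OF Q]] this proj_eq_refl proj_eq_refl]
    show ?thesis
      by (rule is_sum_scale[of _ _ _ _ _ _ l1 "if b then x1 * n1 * n2 else - (x1 * n1 * m2)" l2
            k1 "if c then x1 * n1 * z2 else x1 * n1 * x2" k2])
        (use l k nz in \<open>auto simp: left_pair_def right_pair_def 1 m1 split: if_splits\<close>)
  next
    case 2
    have "proj_eq (seg 1 (- 1) 0 1) (seg x1 z1 m1 n1)"
      unfolding 2(1) m1 using proj_eq_seg_scale[OF x1 n1, of 1 "- 1" 0 1] by simp
    from is_sum_cong[OF is_sum_T2[OF Q 2(2)] this proj_eq_refl proj_eq_refl]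
    show ?thesis
      by (rule is_sum_scale[of _ _ _ _ _ _ l1 "if b then x1 * n1 * n2 else x1 * n1 * m2" l2
            k1 "if c then - (x1 * n1 * z2) else x1 * n1 * x2" k2])
        (use l k nz in \<open>auto simp: left_pair_def right_pair_def 2(1) m1 split: if_splits\<close>)
  next
    case 3
    have n2: "n2 \<noteq> 0" and x2: "\<not> (x2 = 0 \<and> z2 = 0)" and "z2\<^sup>2 = x2\<^sup>2" using Q 3 by (auto simp: on_curve_def)
    from this(3) have "z2 = x2 \<or> z2 = - x2" by (simp only: power2_eq_iff)
    with 3 have z2: "z2 = - x2" by auto
    with x2 have x2: "x2 \<noteq> 0" by auto
    have p: "proj_eq (seg 1 (- 1) 0 1) (seg x1 z1 m1 n1)" "proj_eq (seg 1 (- 1) (- 0) 1) (seg x2 z2 m2 n2)"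
      unfolding 3(1,2) m1 z2 using proj_eq_seg_scale[OF x1 n1, of 1 "- 1" 0 1] proj_eq_seg_scale[OF x2 n2, of 1 "- 1" 0 1]
      by simp_all
    from is_sum_cong[OF is_sum_uminus[OF on_curve_T2] p proj_eq_refl]
    show ?thesis unfolding identity_point_seg
      by (rule is_sum_scale[of _ _ _ _ _ _ l1 l1 l2 k1 k2 k2])
        (use l k nz in \<open>auto simp: left_pair_def right_pair_def 3(1,2) z2 m1 split: if_splits\<close>)
  qed
qed

text \<open>The expressions are homogeneous in each of the four coordinate pairs, so scaled points
  suffice. Scaling to affine form fails only for \<open>\<mu> = 0\<close>, that is, at the identity
  and \<open>T2\<close>.\<close>

theorem is_sum_pairs:
  assumes P: "on_curve x1 z1 m1 n1" and Q: "on_curve x2 z2 m2 n2"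
    and l: "left_pair d b x1 z1 m1 n1 x2 z2 m2 n2 = (l1, l2)" and k: "right_pair d c x1 z1 m1 n1 x2 z2 m2 n2 = (k1, k2)"
    and nz: "\<not> (l1 = 0 \<and> l2 = 0)" "\<not> (k1 = 0 \<and> k2 = 0)"
  shows "is_sum d (seg x1 z1 m1 n1) (seg x2 z2 m2 n2) (seg l1 l2 k1 k2)"
proof (cases "m1 = 0 \<and> (x1 = z1 \<or> m2 \<noteq> 0 \<or> x2 \<noteq> z2)")
  case True
  with is_sum_pairs_two_torsion[OF P Q _ _ l k nz] show ?thesis by blast
next
  case F1: False
  show ?thesis
  proof (cases "m2 = 0")
    case True
    define s where "s = (if b then 1 else - 1 :: 'a)"
    have s: "s \<noteq> 0" by (simp add: s_def)
    have l': "left_pair d b x2 z2 m2 n2 x1 z1 m1 n1 = (s * l1, s * l2)"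
      unfolding left_pair_swap[of d b x2] l by (simp add: s_def)
    have k': "right_pair d c x2 z2 m2 n2 x1 z1 m1 n1 = (k1, k2)" using k by (simp add: right_pair_swap[of d c x2])
    have "x2 = z2 \<or> m1 \<noteq> 0 \<or> x1 \<noteq> z1" using F1 by blast
    from is_sum_pairs_two_torsion[OF Q P True this l' k' _ nz(2)] s nz(1)
    have "is_sum d (seg x1 z1 m1 n1) (seg x2 z2 m2 n2) (seg (s * l1) (s * l2) k1 k2)"
      by (auto intro: is_sum_commute)
    thus ?thesis by (rule is_sum_scale[of _ _ _ _ _ _ l1 s l2 k1 1 k2]) (use nz in \<open>auto simp: s_def\<close>)
  next
    case False
    hence m: "m1 \<noteq> 0" "m2 \<noteq> 0" using F1 by auto
    obtain s1 t1 y1 w1 v1 a1 where 1: "s1 \<noteq> 0" "t1 \<noteq> 0" "x1 = s1 * y1" "z1 = s1 * w1" "m1 = t1 * v1" "n1 = t1 * a1"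
      "affine d y1 w1 v1 a1" using affine_exists[OF P m(1)] .
    obtain s2 t2 y2 w2 v2 a2 where 2: "s2 \<noteq> 0" "t2 \<noteq> 0" "x2 = s2 * y2" "z2 = s2 * w2" "m2 = t2 * v2" "n2 = t2 * a2"
      "affine d y2 w2 v2 a2" using affine_exists[OF Q m(2)] .
    obtain L1 L2 where L: "left_pair d b y1 w1 v1 a1 y2 w2 v2 a2 = (L1, L2)" by fastforce
    obtain K1 K2 where K: "right_pair d c y1 w1 v1 a1 y2 w2 v2 a2 = (K1, K2)" by fastforce
    have e: "l1 = s1 * t1 * s2 * t2 * L1" "l2 = s1 * t1 * s2 * t2 * L2" "k1 = s1 * t1 * s2 * t2 * K1" "k2 = s1 * t1 * s2 * t2 * K2"
      using l k unfolding 1(3-6) 2(3-6) left_pair_scale right_pair_scale L K by simp_all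
    have "\<not> (L1 = 0 \<and> L2 = 0)" "\<not> (K1 = 0 \<and> K2 = 0)" using nz e by auto
    from is_sum_affine[OF 1(7) 2(7) L K this]
    have "is_sum d (seg x1 z1 m1 n1) (seg x2 z2 m2 n2) (seg L1 L2 K1 K2)"
      unfolding 1(3-6) 2(3-6)
      by (rule is_sum_cong[OF _ proj_eq_seg_scale[OF 1(1,2)] proj_eq_seg_scale[OF 2(1,2)] proj_eq_refl])
    thus ?thesis by (rule is_sum_scale[OF _ e nz])
  qed
qed

end

section \<open>The four addition laws\<close>

lemma bihomogeneous_add: "bihomogeneous a b p \<Longrightarrow> bihomogeneous a b q \<Longrightarrow> bihomogeneous a b (p + q)"
  unfolding bihomogeneous_def using keys_add[of p q] by blast

lemma bihomogeneous_uminus: "bihomogeneous a b p \<Longrightarrow> bihomogeneous a b (- p)"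
  by (simp add: bihomogeneous_def in_keys_iff)

lemma bihomogeneous_diff: "bihomogeneous a b p \<Longrightarrow> bihomogeneous a b q \<Longrightarrow> bihomogeneous a b (p - q)"
  using bihomogeneous_add[of a b p "- q"] bihomogeneous_uminus[of a b q] by simp

lemma bihomogeneous_0: "bihomogeneous a b 0"
  by (simp add: bihomogeneous_def)

lemma bihomogeneous_sum: "(\<And>i. i \<in> A \<Longrightarrow> bihomogeneous a b (f i)) \<Longrightarrow> bihomogeneous a b (\<Sum>i\<in>A. f i)"
  by (induction A rule: infinite_finite_induct) (auto intro: bihomogeneous_add bihomogeneous_0)

lemma bihomogeneous_Const_mult:
  assumes "bihomogeneous a b p"
  shows "bihomogeneous a b (Const c * p)"
proof -
  have "Poly_Mapping.keys (Const c * p) \<subseteq> Poly_Mapping.keys p"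
    using keys_mult[of "Const c" p] by (auto simp: Const_def split: if_splits)
  with assms show ?thesis unfolding bihomogeneous_def by blast
qed

lemma bihomogeneous_numeral_mult: "bihomogeneous a b p \<Longrightarrow> bihomogeneous a b (numeral n * p)"
  using bihomogeneous_Const_mult[of a b p "numeral n"] by (simp only: ev_C.hom_numeral)

lemma bihomogeneous_monomial: "bihomogeneous 2 2 (xv i * (xv j * (yv k * (yv l :: 'a::comm_ring_1 bipoly))))"
proof -
  let ?s = "\<lambda>v. Poly_Mapping.single v (1::nat)"
  have e: "xv i * (xv j * (yv k * (yv l :: 'a bipoly))) = Poly_Mapping.single (?s (Inl i) + (?s (Inl j) + (?s (Inr k) + ?s (Inr l)))) 1"
    by (simp add: Var_def mult_single)
  show ?thesis unfolding e bihomogeneous_def by (simp add: lookup_add sum.distrib lookup_single when_def)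
qed

lemmas bihomogeneous_intros = bihomogeneous_monomial bihomogeneous_add bihomogeneous_diff bihomogeneous_uminus
  bihomogeneous_Const_mult bihomogeneous_numeral_mult

definition laws :: "'a::field \<Rightarrow> 4 \<Rightarrow> 4 \<Rightarrow> 'a bipoly" where
  "laws d = quad law0 (law1 d) (law2 d) (law3 d)"

lemma bihomogeneous_laws: "bihomogeneous 2 2 (laws d j i)"
proof -
  have "\<forall>j i. bihomogeneous 2 2 (laws d j i)"
    unfolding all_4 laws_def law0_def law1_def law2_def law3_def quad_simps power2_eq_square mult.assoc
    by (intro conjI bihomogeneous_intros)
  thus ?thesis by blast
qed

definition val :: "'a::field \<Rightarrow> 4 \<Rightarrow> (4 \<Rightarrow> 'a) \<Rightarrow> (4 \<Rightarrow> 'a) \<Rightarrow> 4 \<Rightarrow> 'a" where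
  "val d j P Q i = mp_eval (case_sum P Q) (laws d j i)"

lemma val_0: "val d 0 P Q = quad (- (1 / 4 * ((P 1)\<^sup>2 * (Q 3)\<^sup>2 - (P 3)\<^sup>2 * (Q 1)\<^sup>2))) (P 0 * P 3 * Q 1 * Q 2 - P 1 * P 2 * Q 0 * Q 3)
    ((P 0)\<^sup>2 * (Q 2)\<^sup>2 - (P 2)\<^sup>2 * (Q 0)\<^sup>2) (P 0 * P 1 * Q 2 * Q 3 - P 2 * P 3 * Q 0 * Q 1)"
  and val_1: "val d 1 P Q = quad (P 0 * P 1 * Q 0 * Q 3 + d * P 2 * P 3 * Q 1 * Q 2)
    (4 * d * P 0 * P 2 * (Q 2)\<^sup>2 + (P 1)\<^sup>2 * Q 1 * Q 3) (P 0 * P 3 * Q 2 * Q 3 + P 1 * P 2 * Q 0 * Q 1)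
    (P 1 * P 3 * (Q 3)\<^sup>2 - 4 * d * (P 2)\<^sup>2 * Q 0 * Q 2)"
  and val_2: "val d 2 P Q = quad ((P 0)\<^sup>2 * (Q 0)\<^sup>2 - d\<^sup>2 * (P 2)\<^sup>2 * (Q 2)\<^sup>2) (P 0 * P 1 * Q 0 * Q 1 - d * P 2 * P 3 * Q 2 * Q 3)
    (1 / 4 * ((P 1)\<^sup>2 * (Q 1)\<^sup>2 - (P 3)\<^sup>2 * (Q 3)\<^sup>2)) (P 0 * P 3 * Q 0 * Q 3 - d * P 1 * P 2 * Q 1 * Q 2)"
  and val_3: "val d 3 P Q = quad (P 0 * P 3 * Q 0 * Q 1 + d * P 1 * P 2 * Q 2 * Q 3)
    (P 1 * P 3 * (Q 1)\<^sup>2 + 4 * d * (P 2)\<^sup>2 * Q 0 * Q 2) (P 0 * P 1 * Q 1 * Q 2 + P 2 * P 3 * Q 0 * Q 3)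
    (- (4 * d * P 0 * P 2 * (Q 2)\<^sup>2) + (P 3)\<^sup>2 * Q 1 * Q 3)"
  unfolding eq_4_iff val_def laws_def law0_def law1_def law2_def law3_def quad_simps by simp_all

definition comb :: "'a::field \<Rightarrow> (4 \<Rightarrow> 'a) \<Rightarrow> (4 \<Rightarrow> 'a) \<Rightarrow> (4 \<Rightarrow> 'a) \<Rightarrow> 4 \<Rightarrow> 'a" where
  "comb d c P Q i = (\<Sum>j\<in>UNIV. c j * val d j P Q i)"

lemma comb_4: "comb d c P Q i = c 0 * val d 0 P Q i + (c 1 * val d 1 P Q i + (c 2 * val d 2 P Q i + c 3 * val d 3 P Q i))"
  unfolding comb_def UNIV_4 by simp

context smooth_curve
begin

lemma four: "(4::'a) \<noteq> 0"
proof -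
  have e: "(2::'a) * 2 = 4" by (simp only: numeral_times_numeral semiring_norm iszero_0)
  show ?thesis unfolding e[symmetric] by (rule no_zero_divisors[OF two two])
qed

lemma quarter:
  assumes "4 * e = f"
  shows "1 / 4 * f = (e::'a)"
  unfolding assms[symmetric] times_divide_eq_left mult_1 by (rule nonzero_mult_div_cancel_left[OF four])

text \<open>Laws \<open>0\<close> and \<open>2\<close> come from expressions of the same kind, laws
  \<open>1\<close> and \<open>3\<close> are the sum and the difference of the two mixed products.
  For the latter two this holds only modulo the curve equations, with cofactors concentrated in the
  components \<open>1\<close> and \<open>3\<close>.\<close>

lemma val_seg:
  assumes P: "on_curve x1 z1 m1 n1" and Q: "on_curve x2 z2 m2 n2"
    and L1: "left_pair d True x1 z1 m1 n1 x2 z2 m2 n2 = (a1, b1)" and L2: "left_pair d False x1 z1 m1 n1 x2 z2 m2 n2 = (a2, b2)"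
    and M1: "right_pair d True x1 z1 m1 n1 x2 z2 m2 n2 = (e1, f1)" and M2: "right_pair d False x1 z1 m1 n1 x2 z2 m2 n2 = (e2, f2)"
  shows "val d 0 (seg x1 z1 m1 n1) (seg x2 z2 m2 n2) i = - seg a2 b2 e2 f2 i"
    "val d 1 (seg x1 z1 m1 n1) (seg x2 z2 m2 n2) i = seg a1 b1 e2 f2 i + seg a2 b2 e1 f1 i"
    "val d 2 (seg x1 z1 m1 n1) (seg x2 z2 m2 n2) i = seg a1 b1 e1 f1 i"
    "val d 3 (seg x1 z1 m1 n1) (seg x2 z2 m2 n2) i = seg a1 b1 e2 f2 i - seg a2 b2 e1 f1 i"
    "a1 * b2 = b1 * a2" "e1 * f2 = f1 * e2"
proof -
  have h1: "n1\<^sup>2 * (z1\<^sup>2 - x1\<^sup>2) - m1\<^sup>2 * (d * x1\<^sup>2 - z1\<^sup>2) = 0" (is "?h1 = 0")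
    and h2: "n2\<^sup>2 * (z2\<^sup>2 - x2\<^sup>2) - m2\<^sup>2 * (d * x2\<^sup>2 - z2\<^sup>2) = 0" (is "?h2 = 0")
    using P Q by (simp_all add: on_curve_def)
  have L: "a1 = z1 * z2 * m1 * m2 + x1 * x2 * n1 * n2" "b1 = z1 * z2 * n1 * n2 + d * x1 * x2 * m1 * m2"
    "a2 = x1 * z2 * m1 * n2 - z1 * x2 * n1 * m2" "b2 = z1 * x2 * m1 * n2 - x1 * z2 * n1 * m2"
    and M: "e1 = x1 * z2 * n1 * m2 + z1 * x2 * m1 * n2" "f1 = z1 * z2 * n1 * n2 - d * x1 * x2 * m1 * m2"
    "e2 = z1 * x2 * n1 * m2 + x1 * z2 * m1 * n2" "f2 = x1 * x2 * n1 * n2 - z1 * z2 * m1 * m2"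
    using L1 L2 M1 M2 unfolding left_pair_def right_pair_def if_True if_False prod.inject by blast+
  have "a1 * b2 - b1 * a2 = m2 * n2 * x2 * z2 * ?h1 - m1 * n1 * x1 * z1 * ?h2" unfolding L by Groebner_Basis.algebra
  thus "a1 * b2 = b1 * a2" unfolding h1 h2 by (simp only: mult_zero_right diff_zero right_minus_eq)
  have "e1 * f2 - f1 * e2 = - (m2 * n2 * x2 * z2 * ?h1) - m1 * n1 * x1 * z1 * ?h2" unfolding M by Groebner_Basis.algebra
  thus "e1 * f2 = f1 * e2" unfolding h1 h2 by (simp only: mult_zero_right diff_zero minus_zero right_minus_eq)
  let ?P = "seg x1 z1 m1 n1" and ?Q = "seg x2 z2 m2 n2"
  have "\<forall>i. val d 2 ?P ?Q i = seg a1 b1 e1 f1 i"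
    unfolding all_4 val_2 quad_simps seg_simps L M
    by (intro conjI quarter) Groebner_Basis.algebra+
  thus "val d 2 ?P ?Q i = seg a1 b1 e1 f1 i" by blast
  have "\<forall>i. val d 0 ?P ?Q i = - seg a2 b2 e2 f2 i"
    unfolding all_4 val_0 quad_simps seg_simps L M
    by (intro conjI arg_cong[of _ _ uminus] quarter) Groebner_Basis.algebra+
  thus "val d 0 ?P ?Q i = - seg a2 b2 e2 f2 i" by blast
  have "\<forall>i. val d 1 ?P ?Q i - (seg a1 b1 e2 f2 i + seg a2 b2 e1 f1 i) =
      quad 0 (- 2 * m1 * n1 * x1 * z1) 0 0 i * ?h2 + quad 0 0 0 (2 * m2 * n2 * x2 * z2) i * ?h1"
    unfolding all_4 val_1 quad_simps seg_simps L M
    by (intro conjI) Groebner_Basis.algebra+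
  thus "val d 1 ?P ?Q i = seg a1 b1 e2 f2 i + seg a2 b2 e1 f1 i" unfolding h1 h2 by (simp only: mult_zero_right add_0 right_minus_eq)
  have "\<forall>i. val d 3 ?P ?Q i - (seg a1 b1 e2 f2 i - seg a2 b2 e1 f1 i) =
      quad 0 0 0 (2 * m1 * n1 * x1 * z1) i * ?h2 + quad 0 (- 2 * m2 * n2 * x2 * z2) 0 0 i * ?h1"
    unfolding all_4 val_3 quad_simps seg_simps L M
    by (intro conjI) Groebner_Basis.algebra+
  thus "val d 3 ?P ?Q i = seg a1 b1 e2 f2 i - seg a2 b2 e1 f1 i" unfolding h1 h2 by (simp only: mult_zero_right add_0 right_minus_eq)
qed

text \<open>Both expressions become multiples of one pair, nonzero if either of them is. This turns
  a combination of Segre products into a multiple of a single one.\<close>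

lemma parallel_pair:
  fixes a b a' b' :: 'a
  assumes "a * b' = b * a'"
  obtains s t u v where "a = s * u" "b = s * v" "a' = t * u" "b' = t * v" "(u, v) = (a, b) \<or> (u, v) = (a', b')"
    "(u, v) = (0, 0) \<Longrightarrow> a = 0 \<and> b = 0 \<and> a' = 0 \<and> b' = 0"
proof (cases "a = 0 \<and> b = 0")
  case True
  show ?thesis by (rule that[of 0 a' b' 1]) (use True in auto)
next
  case False
  show ?thesis
  proof (cases "a' = 0 \<and> b' = 0")
    case True
    show ?thesis by (rule that[of 1 a b 0]) (use True in auto)
  next
    case F: False
    from proportional_pair[OF assms False F] obtain s where s: "a' = s * a" "b' = s * b" by metis
    show ?thesis by (rule that[of 1 a b s]) (use s False in simp_all)
  qed
qed

theorem is_sum_comb: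
  assumes P: "P \<in> curve d" and Q: "Q \<in> curve d" and nz: "comb d c P Q \<noteq> (\<lambda>_. 0)"
  shows "is_sum d P Q (comb d c P Q)"
proof -
  obtain x1 z1 m1 n1 where P1: "P = seg x1 z1 m1 n1" "on_curve x1 z1 m1 n1"
    using curve_seg[OF P] unfolding on_curve_def by metis
  obtain x2 z2 m2 n2 where Q1: "Q = seg x2 z2 m2 n2" "on_curve x2 z2 m2 n2"
    using curve_seg[OF Q] unfolding on_curve_def by metis
  obtain a1 b1 where L1: "left_pair d True x1 z1 m1 n1 x2 z2 m2 n2 = (a1, b1)" by fastforce
  obtain a2 b2 where L2: "left_pair d False x1 z1 m1 n1 x2 z2 m2 n2 = (a2, b2)" by fastforce
  obtain e1 f1 where M1: "right_pair d True x1 z1 m1 n1 x2 z2 m2 n2 = (e1, f1)" by fastforce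
  obtain e2 f2 where M2: "right_pair d False x1 z1 m1 n1 x2 z2 m2 n2 = (e2, f2)" by fastforce
  note v = val_seg[OF P1(2) Q1(2) L1 L2 M1 M2]
  obtain s1 s2 u v where l: "a1 = s1 * u" "b1 = s1 * v" "a2 = s2 * u" "b2 = s2 * v" "(u, v) = (a1, b1) \<or> (u, v) = (a2, b2)"
    by (rule parallel_pair[OF v(5)])
  obtain t1 t2 y w where m: "e1 = t1 * y" "f1 = t1 * w" "e2 = t2 * y" "f2 = t2 * w" "(y, w) = (e1, f1) \<or> (y, w) = (e2, f2)"
    by (rule parallel_pair[OF v(6)])
  \<comment> \<open>With all multiples collected, any combination of the laws is \<open>k\<close>
    times one Segre product of valid expressions, so it represents the sum wherever it does not
    vanish.\<close>
  define k where "k = - (c 0 * (s2 * t2)) + c 1 * (s1 * t2 + s2 * t1) + c 2 * (s1 * t1) + c 3 * (s1 * t2 - s2 * t1)"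
  have "\<forall>i. comb d c P Q i = k * seg u v y w i"
    unfolding comb_4 P1(1) Q1(1) v(1-4) unfolding all_4 seg_simps l(1-4) m(1-4) k_def
    by (intro conjI) Groebner_Basis.algebra+
  hence e: "comb d c P Q = (\<lambda>i. k * seg u v y w i)" by blast
  have "k \<noteq> 0" and n: "\<not> (u = 0 \<and> v = 0)" "\<not> (y = 0 \<and> w = 0)"
    using nz unfolding e by (auto simp: fun_eq_iff all_4)
  obtain b where b: "left_pair d b x1 z1 m1 n1 x2 z2 m2 n2 = (u, v)" using l(5) L1 L2 by metis
  obtain b' where b': "right_pair d b' x1 z1 m1 n1 x2 z2 m2 n2 = (y, w)" using m(5) M1 M2 by metis
  have "is_sum d P Q (seg u v y w)" unfolding P1(1) Q1(1) by (rule is_sum_pairs[OF P1(2) Q1(2) b b' n])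
  moreover have "proj_eq (seg u v y w) (comb d c P Q)" unfolding proj_eq_def e using \<open>k \<noteq> 0\<close> by blast
  ultimately show ?thesis using is_sum_cong proj_eq_refl by blast
qed

end

section \<open>Translation by points of order four\<close>

text \<open>If \<open>t\<^sup>4 = 1\<close>, this is a translation by a point of order dividing four.\<close>

definition tw :: "'b::comm_ring_1 \<Rightarrow> (4 \<Rightarrow> 'b) \<Rightarrow> 4 \<Rightarrow> 'b" where
  "tw t P = quad (t * P 0) (P 1) (t ^ 3 * P 2) (t\<^sup>2 * P 3)"

lemma tw_simps [simp]: "tw t P 0 = t * P 0" "tw t P 1 = P 1" "tw t P 2 = t ^ 3 * P 2" "tw t P 3 = t\<^sup>2 * P 3"
  by (simp_all add: tw_def)

lemma tw_1 [simp]: "tw 1 P = P"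
  by (simp add: eq_4_iff)

lemma tw_tw: "tw s (tw t P) = tw (s * t) P"
  by (simp add: eq_4_iff power_mult_distrib)

lemma cone_iff: "cone d P \<longleftrightarrow> (P 0)\<^sup>2 - d * (P 2)\<^sup>2 = P 1 * P 3 \<and> (P 1)\<^sup>2 - (P 3)\<^sup>2 = 4 * P 0 * P 2"
  by (simp add: cone_def)

text \<open>The coordinates carry the weights \<open>1, 0, 3, 2\<close> modulo four. Twisting the
  second argument twists the value of law \<open>j\<close> and multiplies it by
  \<open>t^(3 - j)\<close>; these different exponents separate the laws on the graphs of the
  translations.\<close>

lemma val_tw:
  fixes d :: "'a::field"
  assumes t: "t ^ 4 = 1"
  shows "val d 0 P (tw t Q) = (\<lambda>i. t ^ 3 * tw t (val d 0 P Q) i)"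
    "val d 1 P (tw t Q) = (\<lambda>i. t ^ 2 * tw t (val d 1 P Q) i)"
    "val d 2 P (tw t Q) = (\<lambda>i. t * tw t (val d 2 P Q) i)"
    "val d 3 P (tw t Q) = (\<lambda>i. tw t (val d 3 P Q) i)"
proof -
  have T: "t * (t * (t * t)) = 1" "t * (t * (t * (t * x))) = x" for x
    using t by (simp_all add: power4_eq_xxxx flip: mult.assoc)
  show "val d 0 P (tw t Q) = (\<lambda>i. t ^ 3 * tw t (val d 0 P Q) i)"
    "val d 1 P (tw t Q) = (\<lambda>i. t ^ 2 * tw t (val d 1 P Q) i)"
    "val d 2 P (tw t Q) = (\<lambda>i. t * tw t (val d 2 P Q) i)"
    "val d 3 P (tw t Q) = (\<lambda>i. tw t (val d 3 P Q) i)"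
    unfolding eq_4_iff val_0 val_1 val_2 val_3 tw_simps quad_simps
    by (simp_all add: T algebra_simps power2_eq_square power3_eq_cube del: times_divide_eq_left times_divide_eq_right)
qed

lemma val_diagonal:
  fixes d :: "'a::field"
  assumes two: "(2::'a) \<noteq> 0" and c: "cone d P"
  shows "val d 0 P P = (\<lambda>_. 0)" "val d 1 P P = val d 2 P P" "val d 3 P P = val d 2 P P"
proof -
  have four: "(4::'a) \<noteq> 0" using two by (metis mult_eq_0_iff numeral_times_numeral num_double)
  have q: "1 / 4 * (4 * e) = (e::'a)" for e using four by simp
  have c: "P 1 * P 3 = (P 0)\<^sup>2 - d * (P 2)\<^sup>2" "(P 1)\<^sup>2 = (P 3)\<^sup>2 + 4 * P 0 * P 2"
    using c by (simp_all add: cone_iff algebra_simps)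
  have "(P 1)\<^sup>2 * (P 1)\<^sup>2 - (P 3)\<^sup>2 * (P 3)\<^sup>2 = 4 * (P 0 * P 2 * ((P 1)\<^sup>2 + (P 3)\<^sup>2))"
    unfolding c(2) by Groebner_Basis.algebra
  hence e: "1 / 4 * ((P 1)\<^sup>2 * (P 1)\<^sup>2 - (P 3)\<^sup>2 * (P 3)\<^sup>2) = P 0 * P 2 * ((P 1)\<^sup>2 + (P 3)\<^sup>2)"
    by (simp only: q)
  show "val d 0 P P = (\<lambda>_. 0)" unfolding eq_4_iff val_0 by (simp add: algebra_simps)
  show "val d 1 P P = val d 2 P P" unfolding eq_4_iff val_1 val_2 quad_simps e
    using c by (intro conjI; Groebner_Basis.algebra)
  show "val d 3 P P = val d 2 P P" unfolding eq_4_iff val_3 val_2 quad_simps e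
    using c by (intro conjI; Groebner_Basis.algebra)
qed

context smooth_curve
begin

lemma coordinate_pairs:
  assumes "cone d P" "P \<noteq> (\<lambda>_. 0)"
  shows "\<not> (P 0 = 0 \<and> P 2 = 0)" "\<not> (P 1 = 0 \<and> P 3 = 0)" "\<not> (P 0 * P 2 = 0 \<and> P 1 * P 3 = 0)"
proof -
  have c: "(P 0)\<^sup>2 - d * (P 2)\<^sup>2 = P 1 * P 3" "(P 1)\<^sup>2 - (P 3)\<^sup>2 = 4 * P 0 * P 2"
    using assms(1) by (simp_all add: cone_iff)
  have nz: "\<not> (P 0 = 0 \<and> P 1 = 0 \<and> P 2 = 0 \<and> P 3 = 0)" using assms(2) by (auto simp: eq_4_iff)
  show "\<not> (P 0 = 0 \<and> P 2 = 0)" using c nz d0 by auto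
  show "\<not> (P 1 = 0 \<and> P 3 = 0)" using c nz d0 four by auto
  show "\<not> (P 0 * P 2 = 0 \<and> P 1 * P 3 = 0)" using c nz d0 by auto
qed

lemma val_2_diagonal_nonzero:
  assumes "P \<in> curve d"
  shows "val d 2 P P \<noteq> (\<lambda>_. 0)"
proof
  assume z: "val d 2 P P = (\<lambda>_. 0)"
  have P: "cone d P" "P \<noteq> (\<lambda>_. 0)" using assms by (simp_all add: curve_iff)
  have c: "(P 0)\<^sup>2 - d * (P 2)\<^sup>2 = P 1 * P 3" "(P 1)\<^sup>2 - (P 3)\<^sup>2 = 4 * P 0 * P 2"
    using P by (simp_all add: cone_iff)
  \<comment> \<open>The components combine to the four products of \<open>u\<close> or
    \<open>u'\<close> with \<open>v\<close> or \<open>v'\<close>, so one of the pairs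
    \<open>u, u'\<close> and \<open>v, v'\<close> vanishes. By the curve equations
    \<open>u = P 1 * P 3\<close> and \<open>u' = 4 * P 0 * P 2\<close>.\<close>
  define u u' v v' where uv: "u = (P 0)\<^sup>2 - d * (P 2)\<^sup>2" "u' = (P 1)\<^sup>2 - (P 3)\<^sup>2"
    "v = (P 0)\<^sup>2 + d * (P 2)\<^sup>2" "v' = (P 1)\<^sup>2 + (P 3)\<^sup>2"
  have e: "(P 0)\<^sup>2 * (P 0)\<^sup>2 - d\<^sup>2 * (P 2)\<^sup>2 * (P 2)\<^sup>2 = 0" "P 0 * P 1 * P 0 * P 1 - d * P 2 * P 3 * P 2 * P 3 = 0"
    "(P 1)\<^sup>2 * (P 1)\<^sup>2 - (P 3)\<^sup>2 * (P 3)\<^sup>2 = 0" "P 0 * P 3 * P 0 * P 3 - d * P 1 * P 2 * P 1 * P 2 = 0"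
    using z four unfolding eq_4_iff val_2 quad_simps by simp_all
  have "u * v = 0" "u * v' = 0" "u' * v = 0" "u' * v' = 0"
    unfolding uv using e by Groebner_Basis.algebra+
  then consider "u = 0" "u' = 0" | "v = 0" "v' = 0" by auto
  thus False
  proof cases
    case 1
    hence "P 1 * P 3 = 0" "4 * (P 0 * P 2) = 0" using c by (simp_all add: uv)
    with coordinate_pairs(3)[OF P] four show False by simp
  next
    case 2
    have "4 * (4 * (d * (d - 1) * (P 2 ^ 4))) = 0"
      using 2 c unfolding uv by Groebner_Basis.algebra
    hence "d * (d - 1) * (P 2 ^ 4) = 0" using four by (simp only: mult_eq_0_iff simp_thms)
    hence "P 2 = 0" using d0 d1 by simp
    with 2 have "P 0 = 0" by (simp add: uv)
    with \<open>P 2 = 0\<close> coordinate_pairs(1)[OF P] show False by simp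
  qed
qed

section \<open>Zeros of the first law\<close>

lemma fps_dvd_cancel_left: "u $ 0 \<noteq> 0 \<Longrightarrow> D dvd u * f \<Longrightarrow> D dvd f" for u f D :: "'a fps"
  by (metis fps_is_unit_iff dvd_mult_unit_iff' dvd_mult_unit_iff mult.commute)

lemma pair_multiple_mod:
  fixes a b :: 'a
  assumes "\<not> (a = 0 \<and> b = 0)" "D dvd fps_const a * y - fps_const b * x"
  obtains l where "D dvd x - l * fps_const a" "D dvd y - l * fps_const b"
proof (cases "a = 0")
  case True
  with assms have b: "b \<noteq> 0" by simp
  have i: "fps_const (inverse b) * fps_const b = 1" using b by (simp flip: fps_const_1_eq_1 fps_const_mult)
  have "D dvd fps_const b * x" using assms(2) True by simp
  hence "D dvd x" by (rule fps_dvd_cancel_left[rotated]) (simp add: b)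
  have "y - (y * fps_const (inverse b)) * fps_const b = y * (1 - fps_const (inverse b) * fps_const b)"
    by (simp only: right_diff_distrib mult_1_right mult_1_left mult_ac)
  hence "D dvd y - (y * fps_const (inverse b)) * fps_const b" by (simp only: i diff_self mult_zero_right dvd_0_right)
  moreover have "D dvd x - (y * fps_const (inverse b)) * fps_const a" using \<open>D dvd x\<close> True by simp
  ultimately show ?thesis by (intro that)
next
  case a: False
  have i: "fps_const (inverse a) * fps_const a = 1" using a by (simp flip: fps_const_1_eq_1 fps_const_mult)
  have "D dvd fps_const (inverse a) * (fps_const a * y - fps_const b * x)" using assms(2) by (rule dvd_mult)
  also have "fps_const (inverse a) * (fps_const a * y - fps_const b * x) = (fps_const (inverse a) * fps_const a) * y - (x * fps_const (inverse a)) * fps_const b"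
    by (simp only: algebra_simps)
  finally have *: "D dvd y - (x * fps_const (inverse a)) * fps_const b" unfolding i mult_1_left .
  have "x - (x * fps_const (inverse a)) * fps_const a = x * (1 - fps_const (inverse a) * fps_const a)"
    by (simp only: right_diff_distrib mult_1_right mult_1_left mult_ac)
  hence "D dvd x - (x * fps_const (inverse a)) * fps_const a" by (simp only: i diff_self mult_zero_right dvd_0_right)
  from this * show ?thesis by (rule that)
qed

lemma fps_dvd_diff_mult:
  assumes "D dvd x - x'" "D dvd y - y'"
  shows "D dvd x * y - x' * (y' :: 'a fps)"
proof -
  have "x * y - x' * y' = x * (y - y') + (x - x') * y'" by (simp add: algebra_simps)
  with assms show ?thesis by (metis dvd_add dvd_mult dvd_mult2)
qed

text \<open>A twist by \<open>t\<close> multiplies the ratios \<open>P 2 : P 0\<close> and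
  \<open>P 3 : P 1\<close> by \<open>t^2\<close>, so the hypotheses fix \<open>Y\<close> modulo
  \<open>D\<close> up to one factor for each pair, \<open>l\<close> and \<open>k\<close>. The curve
  equations give \<open>l^2 = e^2 k^2\<close> modulo \<open>D\<close>, and one of
  \<open>l - e k\<close>, \<open>l + e k\<close> is a unit, so the twist is by \<open>e\<close> or
  \<open>- e\<close>. The modulus stays general: \<open>fps_X\<close> locates zeros,
  \<open>fps_X^2\<close> tests whether they are simple.\<close>

lemma near_twist:
  assumes P: "P \<in> curve d" and Y: "cone (fps_const d) Y" "(\<lambda>i. Y i $ 0) \<noteq> (\<lambda>_. 0)" and D: "fps_X dvd (D :: 'a fps)"
    and e: "e ^ 4 = 1"
    and d02: "D dvd fps_const (P 0) * Y 2 - fps_const (e\<^sup>2 * P 2) * Y 0"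
    and d13: "D dvd fps_const (P 1) * Y 3 - fps_const (e\<^sup>2 * P 3) * Y 1"
  shows "\<exists>t l. t ^ 4 = 1 \<and> l $ 0 \<noteq> 0 \<and> (\<forall>i. D dvd Y i - l * fps_const (tw t P i))"
proof -
  let ?c = "fps_const :: 'a \<Rightarrow> 'a fps"
  have Pc: "cone d P" "P \<noteq> (\<lambda>_. 0)" using P by (simp_all add: curve_iff)
  have e0: "e \<noteq> 0" using e by (cases "e = 0") auto
  note np = coordinate_pairs[OF Pc]
  obtain l where l: "D dvd Y 0 - l * ?c (P 0)" "D dvd Y 2 - l * ?c (e\<^sup>2 * P 2)"
    by (rule pair_multiple_mod[OF _ d02]) (use np(1) e0 in auto)
  obtain k where k: "D dvd Y 1 - k * ?c (P 1)" "D dvd Y 3 - k * ?c (e\<^sup>2 * P 3)"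
    by (rule pair_multiple_mod[OF _ d13]) (use np(2) e0 in auto)
  have nth: "x $ 0 = y $ 0" if "D dvd x - y" for x y :: "'a fps"
    using dvd_trans[OF D that] by (simp add: fps_X_dvd_iff)
  note ny = coordinate_pairs[OF cone_nth_0[OF Y(1)] Y(2)]
  have l0: "l $ 0 \<noteq> 0" using nth[OF l(1)] nth[OF l(2)] ny(1) by auto
  have k0: "k $ 0 \<noteq> 0" using nth[OF k(1)] nth[OF k(2)] ny(2) by auto
  define h where "h = l\<^sup>2 - ?c (e\<^sup>2) * k\<^sup>2"
  have c4: "?c (numeral n) = numeral n" for n by simp
  have E: "?c e ^ 4 = 1" using e by (simp add: fps_const_power)
  have cP: "(?c (P 0))\<^sup>2 - ?c d * (?c (P 2))\<^sup>2 = ?c (P 1) * ?c (P 3)"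
    "(?c (P 1))\<^sup>2 - (?c (P 3))\<^sup>2 = 4 * ?c (P 0) * ?c (P 2)"
    using cone_const_iff[THEN iffD2, OF Pc(1)] unfolding cone_iff by blast+
  have cY: "(Y 0)\<^sup>2 - ?c d * (Y 2)\<^sup>2 = Y 1 * Y 3" "(Y 1)\<^sup>2 - (Y 3)\<^sup>2 = 4 * Y 0 * Y 2"
    using Y(1) by (simp_all only: cone_iff)
  have m: "?c (e\<^sup>2 * P i) = (?c e)\<^sup>2 * ?c (P i)" for i by (simp add: power2_eq_square)
  note l = l[unfolded m] and k = k[unfolded m]
  have "D dvd h * (?c (P 1) * ?c (P 3))"
  proof -
    have "D dvd (Y 0 * Y 0 - (l * ?c (P 0)) * (l * ?c (P 0))) - ?c d * (Y 2 * Y 2 - (l * ((?c e)\<^sup>2 * ?c (P 2))) * (l * ((?c e)\<^sup>2 * ?c (P 2))))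
        - (Y 1 * Y 3 - (k * ?c (P 1)) * (k * ((?c e)\<^sup>2 * ?c (P 3))))"
      by (intro dvd_diff dvd_mult fps_dvd_diff_mult l k)
    also have "\<dots> = - (h * (?c (P 1) * ?c (P 3)))"
      using cY cP E unfolding h_def fps_const_power[symmetric] by Groebner_Basis.algebra
    finally show ?thesis by simp
  qed
  moreover have "D dvd ?c (e\<^sup>2) * h * (4 * (?c (P 0) * ?c (P 2)))"
  proof -
    have "D dvd (Y 1 * Y 1 - (k * ?c (P 1)) * (k * ?c (P 1))) - (Y 3 * Y 3 - (k * ((?c e)\<^sup>2 * ?c (P 3))) * (k * ((?c e)\<^sup>2 * ?c (P 3))))
        - 4 * (Y 0 * Y 2 - (l * ?c (P 0)) * (l * ((?c e)\<^sup>2 * ?c (P 2))))"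
      by (intro dvd_diff dvd_mult fps_dvd_diff_mult l k)
    also have "\<dots> = ?c (e\<^sup>2) * h * (4 * (?c (P 0) * ?c (P 2)))"
      using cY cP E unfolding h_def fps_const_power[symmetric] by Groebner_Basis.algebra
    finally show ?thesis .
  qed
  ultimately have "D dvd h"
  proof (cases "P 1 * P 3 = 0")
    case True
    with np(3) have nz: "P 0 * P 2 \<noteq> 0" by simp
    assume "D dvd ?c (e\<^sup>2) * h * (4 * (?c (P 0) * ?c (P 2)))"
    hence "D dvd ?c (e\<^sup>2 * (P 0 * P 2)) * (4 * h)" by (simp add: mult_ac)
    hence "D dvd 4 * h" by (rule fps_dvd_cancel_left[rotated]) (use nz e0 in simp)
    thus ?thesis by (rule fps_dvd_cancel_left[rotated]) (use four in simp)
  next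
    case False
    assume "D dvd h * (?c (P 1) * ?c (P 3))"
    hence "D dvd ?c (P 1 * P 3) * h" by (simp add: mult_ac)
    thus ?thesis by (rule fps_dvd_cancel_left[rotated]) (use False in simp)
  qed
  have *: ?thesis if u: "u\<^sup>2 = e\<^sup>2" "D dvd l - ?c u * k" for u
  proof (intro exI conjI allI)
    show "u ^ 4 = 1" using e u(1) by Groebner_Basis.algebra
    show "k $ 0 \<noteq> 0" by (rule k0)
    have e1: "Y 0 - k * ?c (tw u P 0) = (Y 0 - l * ?c (P 0)) + ?c (P 0) * (l - ?c u * k)"
      by (simp add: algebra_simps flip: fps_const_mult)
    have u2: "?c (u\<^sup>2) = (?c e)\<^sup>2" unfolding u(1) by (simp add: power2_eq_square)
    have e2: "Y 2 - k * ?c (tw u P 2) = (Y 2 - l * ((?c e)\<^sup>2 * ?c (P 2))) + ?c (e\<^sup>2 * P 2) * (l - ?c u * k)"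
    proof -
      have "?c (tw u P 2) = (?c e)\<^sup>2 * (?c u * ?c (P 2))"
        unfolding u2[symmetric] tw_simps by (simp add: power3_eq_cube power2_eq_square mult_ac)
      thus ?thesis unfolding m by (simp only: algebra_simps)
    qed
    have e3: "?c (tw u P 3) = (?c e)\<^sup>2 * ?c (P 3)" unfolding u2[symmetric] tw_simps by simp
    have "D dvd Y 0 - k * ?c (tw u P 0)" "D dvd Y 2 - k * ?c (tw u P 2)"
      unfolding e1 e2 by (intro dvd_add dvd_mult l u(2))+
    moreover have "D dvd Y 1 - k * ?c (tw u P 1)" "D dvd Y 3 - k * ?c (tw u P 3)"
      unfolding e3 using k by simp_all
    ultimately have "\<forall>i. D dvd Y i - k * ?c (tw u P i)" unfolding all_4 by blast
    thus "D dvd Y i - k * ?c (tw u P i)" for i by blast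
  qed
  have f: "h = (l - ?c e * k) * (l + ?c e * k)"
    unfolding h_def by (simp add: power2_eq_square algebra_simps)
  have "(l - ?c e * k) $ 0 + (l + ?c e * k) $ 0 = 2 * l $ 0" by simp
  hence "(l - ?c e * k) $ 0 \<noteq> 0 \<or> (l + ?c e * k) $ 0 \<noteq> 0" using l0 two by (metis add_0 mult_eq_0_iff)
  thus ?thesis
  proof
    assume "(l - ?c e * k) $ 0 \<noteq> 0"
    hence "D dvd l + ?c e * k" using \<open>D dvd h\<close> unfolding f by (rule fps_dvd_cancel_left)
    moreover have "l - ?c (- e) * k = l + ?c e * k" by (simp flip: fps_const_neg)
    ultimately have "D dvd l - ?c (- e) * k" by (simp only:)
    thus ?thesis by (rule *[of "- e", rotated]) simp
  next
    assume "(l + ?c e * k) $ 0 \<noteq> 0"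
    moreover have "D dvd (l + ?c e * k) * (l - ?c e * k)" using \<open>D dvd h\<close> unfolding f by (simp only: mult.commute)
    ultimately have "D dvd l - ?c e * k" by (rule fps_dvd_cancel_left)
    thus ?thesis by (rule *[of e, rotated]) simp
  qed
qed

end

context smooth_curve begin

text \<open>Take \<open>B j\<close> not identically zero. By parallelism \<open>A j / B j\<close> is
  regular wherever some \<open>B i\<close> is nonzero. At a common zero some \<open>B i\<close>
  vanishes simply, so the ratio has at most a simple pole, and none if all \<open>A i\<close> vanish
  too. Thus only \<open>R\<close> can be a pole.\<close>

lemma proportional_forms:
  fixes A B :: "4 \<Rightarrow> (4, 'a) mpoly"
  assumes hA: "\<And>i. homogeneous k (A i)" and hB: "\<And>i. homogeneous k (B i)" and R: "R \<in> curve d"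
    and parallel: "\<And>Z i j. Z \<in> curve d \<Longrightarrow> mp_eval Z (A i) * mp_eval Z (B j) = mp_eval Z (A j) * mp_eval Z (B i)"
    and zeros: "\<And>Z. Z \<in> curve d \<Longrightarrow> (\<forall>j. mp_eval Z (B j) = 0) \<Longrightarrow>
      (\<exists>j. \<not> fps_X\<^sup>2 dvd fe (arc Z) (B j)) \<and> (proj_eq Z R \<or> (\<forall>j. mp_eval Z (A j) = 0))"
  shows "\<exists>c. \<forall>Z\<in>curve d. \<forall>i. mp_eval Z (A i) = c * mp_eval Z (B i)"
proof -
  have mult: "fe (arc Z) (A i) * fe (arc Z) (B j) = fe (arc Z) (A j) * fe (arc Z) (B i)" if "Z \<in> curve d" for Z i j
  proof -
    have "mp_eval Q (A i * B j) = mp_eval Q (A j * B i)" if "Q \<in> curve d" for Q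
      unfolding mp_eval_simps by (rule parallel[OF that])
    from fe_arc_eq[OF that this] show ?thesis by (simp only: fe_simps)
  qed
  have X: "fps_X dvd fe (arc Z) F \<longleftrightarrow> mp_eval Z F = 0" if "Z \<in> curve d" for Z F
    using that by (simp add: fps_X_dvd_iff fe_arc_nth_0)
  have "\<exists>j. B j \<notin> curve_ideal d"
  proof (cases "\<forall>j. mp_eval R (B j) = 0")
    case True
    with zeros[OF R] obtain j where "\<not> fps_X\<^sup>2 dvd fe (arc R) (B j)" by blast
    hence "fe (arc R) (B j) \<noteq> 0" by auto
    hence "B j \<notin> curve_ideal d" using fe_curve_ideal[OF two d0 d1 _ arc_cone[OF R]] by metis
    thus ?thesis by (rule exI)
  next
    case False
    thus ?thesis using R unfolding curve_ideal_def by blast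
  qed
  then obtain j where j: "B j \<notin> curve_ideal d" ..
  have "fe (arc Z) (B j) dvd (if proj_eq Z R then fps_X else 1) * fe (arc Z) (A j)" if Z: "Z \<in> curve d" for Z
  proof (cases "\<forall>i. mp_eval Z (B i) = 0")
    case True
    from zeros[OF Z True] obtain i where i: "\<not> fps_X\<^sup>2 dvd fe (arc Z) (B i)"
      and R': "proj_eq Z R \<or> (\<forall>j. mp_eval Z (A j) = 0)" by blast
    obtain u where u: "fe (arc Z) (B i) = fps_X * u" using X[OF Z, THEN iffD2, OF True[rule_format]] by (rule dvdE)
    have u0: "u $ 0 \<noteq> 0"
    proof
      assume "u $ 0 = 0"
      hence "fps_X dvd u" by (simp add: fps_X_dvd_iff)
      with i show False unfolding u power2_eq_square using mult_dvd_mono[OF dvd_refl] by blast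
    qed
    have m: "fe (arc Z) (A j) * (fps_X * u) = fe (arc Z) (A i) * fe (arc Z) (B j)" using mult[OF Z, of j i] u by simp
    show ?thesis
    proof (cases "proj_eq Z R")
      case True
      have "fe (arc Z) (B j) dvd u * (fps_X * fe (arc Z) (A j))"
        by (rule dvdI[of _ _ "fe (arc Z) (A i)"]) (use m in \<open>simp only: mult_ac\<close>)
      from fps_dvd_cancel_left[OF u0 this] True show ?thesis by simp
    next
      case False
      then obtain w where w: "fe (arc Z) (A i) = fps_X * w" using R' X[OF Z] by (meson dvdE)
      have "fps_X * (u * fe (arc Z) (A j)) = fps_X * (w * fe (arc Z) (B j))" using m unfolding w by (simp only: mult_ac)
      hence "u * fe (arc Z) (A j) = w * fe (arc Z) (B j)" by simp
      hence "fe (arc Z) (B j) dvd u * fe (arc Z) (A j)" by (rule ssubst) (rule dvd_triv_right)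
      from fps_dvd_cancel_left[OF u0 this] False show ?thesis by simp
    qed
  next
    case False
    then obtain i where i: "fe (arc Z) (B i) $ 0 \<noteq> 0" using Z by (auto simp: fe_arc_nth_0)
    have "fe (arc Z) (B j) dvd fe (arc Z) (B i) * fe (arc Z) (A j)"
      by (rule dvdI[of _ _ "fe (arc Z) (A i)"]) (use mult[OF Z, of j i] in \<open>simp only: mult_ac\<close>)
    from fps_dvd_cancel_left[OF i this] show ?thesis by simp
  qed
  from one_pole[OF hA hB j R this] obtain c where c: "\<And>Z. Z \<in> curve d \<Longrightarrow> mp_eval Z (A j) = c * mp_eval Z (B j)" by blast
  have "mp_eval Z (A i) = c * mp_eval Z (B i)" if Z: "Z \<in> curve d" for Z i
  proof -
    \<comment> \<open>The constant is known for the index \<open>j\<close>. Parallelism transfers it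
      to the other indices after multiplication by \<open>B j\<close>, which primality then
      cancels.\<close>
    have "(A i - Const c * B i) * B j \<in> curve_ideal d"
      unfolding curve_ideal_def mem_Collect_eq
    proof
      fix Q assume Q: "Q \<in> curve d"
      have "mp_eval Q ((A i - Const c * B i) * B j) = mp_eval Q (A i) * mp_eval Q (B j) - c * mp_eval Q (B j) * mp_eval Q (B i)"
        unfolding mp_eval_simps by Groebner_Basis.algebra
      also have "\<dots> = 0" unfolding parallel[OF Q, of i j] c[OF Q] by (rule diff_self)
      finally show "mp_eval Q ((A i - Const c * B i) * B j) = 0" .
    qed
    moreover have "homogeneous k (A i - Const c * B i)" by (intro homogeneous_diff homogeneous_Const_mult hA hB)
    ultimately have "A i - Const c * B i \<in> curve_ideal d" using curve_ideal_prime[OF _ hB] j by blast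
    thus ?thesis using Z by (simp add: curve_ideal_def)
  qed
  thus ?thesis by blast
qed

end

section \<open>Restriction of laws to one argument and to graphs of translations\<close>

lemma mp_eval_ev_Const:
  fixes x :: "'w::finite \<Rightarrow> 'a::comm_ring_1"
  shows "mp_eval x (ev Const y f) = mp_eval (\<lambda>i. mp_eval x (y i)) f"
  unfolding mp_eval_conv_ev by (subst ev_ev[OF coeff_hom_Const coeff_hom_id]) (simp only: ev_id.ev_Const)

lemma fe_ev_Const: "fe x (ev Const y f) = fe (\<lambda>i. fe x (y i)) f"
  by (subst ev_ev[OF coeff_hom_Const coeff_hom_fps_const]) simp

definition fix_left :: "(4 \<Rightarrow> 'a::comm_ring_1) \<Rightarrow> 'a bipoly \<Rightarrow> (4, 'a) mpoly" where
  "fix_left P = ev Const (case_sum (\<lambda>i. Const (P i)) Var)"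

definition fix_right :: "(4 \<Rightarrow> 'a::comm_ring_1) \<Rightarrow> 'a bipoly \<Rightarrow> (4, 'a) mpoly" where
  "fix_right Q = ev Const (case_sum Var (\<lambda>i. Const (Q i)))"

definition on_twist :: "'a::comm_ring_1 \<Rightarrow> 'a bipoly \<Rightarrow> (4, 'a) mpoly" where
  "on_twist t = ev Const (case_sum Var (\<lambda>i. Const (tw t (\<lambda>_. 1) i) * Var i))"

lemma case_sum_comp: "(\<lambda>i. f (case_sum a b i)) = case_sum (\<lambda>i. f (a i)) (\<lambda>i. f (b i))"
  by (auto split: sum.split)

lemma tw_times: "tw t (\<lambda>_. 1) i * P i = tw t P i"
proof -
  have "\<forall>i. tw t (\<lambda>_. 1) i * P i = tw t P i" unfolding all_4 by simp
  thus ?thesis by blast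
qed

lemma mp_eval_fix_left: "mp_eval Z (fix_left P f) = mp_eval (case_sum P Z) f"
  unfolding fix_left_def mp_eval_ev_Const case_sum_comp mp_eval_simps ..

lemma mp_eval_fix_right: "mp_eval Z (fix_right P f) = mp_eval (case_sum Z P) f"
  unfolding fix_right_def mp_eval_ev_Const case_sum_comp mp_eval_simps ..

lemma mp_eval_on_twist: "mp_eval Z (on_twist t f) = mp_eval (case_sum Z (tw t Z)) f"
  unfolding on_twist_def mp_eval_ev_Const case_sum_comp mp_eval_simps tw_times ..

lemma homogeneous_fix_left: "bihomogeneous a b f \<Longrightarrow> homogeneous b (fix_left P f)"
  using homogeneous_subst[OF coeff_hom_Const, of a b f 0 "case_sum (\<lambda>i. Const (P i)) Var" 1]
  by (simp add: fix_left_def homogeneous_Const homogeneous_Var[unfolded One_nat_def])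

lemma homogeneous_fix_right: "bihomogeneous a b f \<Longrightarrow> homogeneous a (fix_right P f)"
  using homogeneous_subst[OF coeff_hom_Const, of a b f 1 "case_sum Var (\<lambda>i. Const (P i))" 0]
  by (simp add: fix_right_def homogeneous_Const homogeneous_Var[unfolded One_nat_def])

lemma homogeneous_on_twist: "bihomogeneous a b f \<Longrightarrow> homogeneous (a + b) (on_twist t f)"
  using homogeneous_subst[OF coeff_hom_Const, of a b f 1 "case_sum Var (\<lambda>i. Const (tw t (\<lambda>_. 1) i) * Var i)" 1]
  by (simp add: on_twist_def homogeneous_Const homogeneous_Const_mult homogeneous_Var[unfolded One_nat_def])

lemma val_0_swap: "val d 0 Q P i = - val d 0 P Q i"
proof -
  have "\<forall>i. val d 0 Q P i = - val d 0 P Q i" unfolding all_4 val_0 quad_simps by (simp add: algebra_simps)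
  thus ?thesis by blast
qed

context smooth_curve
begin

lemma linear_form_dvd:
  assumes "homogeneous 1 F" "\<And>i. D dvd Y i - l * fps_const (W i)"
  shows "D dvd fe Y F - l * fps_const (mp_eval W F)"
proof -
  obtain c where F: "F = (\<Sum>i\<in>UNIV. Const (c i) * Var i)" by (rule homogeneous_1_linear[OF assms(1)])
  have "fe Y F - l * fps_const (mp_eval W F) = (\<Sum>i\<in>UNIV. fps_const (c i) * (Y i - l * fps_const (W i)))"
    unfolding F ev_fps.ev_sum mp_eval_sum
    by (simp add: fps_const_sum sum_distrib_left sum_subtractf right_diff_distrib mult_ac flip: fps_const_mult)
  also have "D dvd \<dots>" by (intro dvd_sum dvd_mult assms(2))
  finally show ?thesis .
qed

lemma curve_tw:
  assumes "P \<in> curve d" "t ^ 4 = 1"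
  shows "tw t P \<in> curve d"
proof -
  have "t \<noteq> 0" using assms(2) by (cases "t = 0") auto
  moreover have "cone d (tw t P)"
  proof -
    have c: "(P 0)\<^sup>2 - d * (P 2)\<^sup>2 = P 1 * P 3" "(P 1)\<^sup>2 - (P 3)\<^sup>2 = 4 * P 0 * P 2"
      using assms(1) by (simp_all add: curve_iff cone_iff)
    show ?thesis unfolding cone_iff tw_simps
      using c assms(2) by (intro conjI; Groebner_Basis.algebra)
  qed
  ultimately show ?thesis using assms(1) by (auto simp: curve_iff eq_4_iff)
qed

text \<open>The cases \<open>e^2 = 1\<close> and \<open>e^2 = -1\<close> distinguish the twists with
  \<open>t^2 = 1\<close> from those with \<open>t^2 = -1\<close>. If \<open>p - q\<close>,
  \<open>r - s\<close>, \<open>p + q\<close> and \<open>r + s\<close> all vanished at the origin,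
  too many coordinates would be zero; a unit among them cancels and leaves both congruences of one
  case.\<close>

lemma law0_near_twist:
  assumes P: "P \<in> curve d" and Y: "cone (fps_const d) Y" "(\<lambda>i. Y i $ 0) \<noteq> (\<lambda>_. 0)" and D: "fps_X dvd (D :: 'a fps)"
    and dv: "\<And>i. D dvd fe Y (fix_left P (laws d 0 i))"
  shows "\<exists>t l. t ^ 4 = 1 \<and> l $ 0 \<noteq> 0 \<and> (\<forall>i. D dvd Y i - l * fps_const (tw t P i))"
proof -
  let ?c = "fps_const :: 'a \<Rightarrow> 'a fps"
  \<comment> \<open>The components amount to the products of \<open>p - q\<close>, \<open>r - s\<close> with \<open>p + q\<close>, \<open>r + s\<close>: the first two
    vanish on \<open>P\<close> and \<open>T\<^sup>2 P\<close>, the last two on \<open>T P\<close> and \<open>T\<^sup>3 P\<close>.\<close>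
  define p q r s where pqrs: "p = ?c (P 0) * Y 2" "q = ?c (P 2) * Y 0" "r = ?c (P 1) * Y 3" "s = ?c (P 3) * Y 1"
  have v: "fe Y (fix_left P (laws d 0 i)) = quad (- (?c (1/4) * (r\<^sup>2 - s\<^sup>2))) (p * s - r * q) (p\<^sup>2 - q\<^sup>2) (p * r - q * s) i" for i
  proof -
    have "\<forall>i. fe Y (fix_left P (laws d 0 i)) = quad (- (?c (1/4) * (r\<^sup>2 - s\<^sup>2))) (p * s - r * q) (p\<^sup>2 - q\<^sup>2) (p * r - q * s) i"
      unfolding all_4 fix_left_def fe_ev_Const case_sum_comp laws_def law0_def quad_simps fe_simps ev_fps.ev_Const ev_fps.ev_Var sum.case pqrs
      by (intro conjI; Groebner_Basis.algebra)
    thus ?thesis by blast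
  qed
  have d: "D dvd ?c (1/4) * (r\<^sup>2 - s\<^sup>2)" "D dvd p * s - r * q" "D dvd p\<^sup>2 - q\<^sup>2" "D dvd p * r - q * s"
    using dv[of 0] dv[of 1] dv[of 2] dv[of 3] unfolding v quad_simps by simp_all
  have "D dvd r\<^sup>2 - s\<^sup>2" by (rule fps_dvd_cancel_left[OF _ d(1)]) (use four in simp)
  hence rs: "D dvd (r - s) * (r + s)" by (simp add: power2_eq_square algebra_simps)
  have pq: "D dvd (p - q) * (p + q)" using d(3) by (simp add: power2_eq_square algebra_simps)
  have e: "(p - q) * (r + s) = (p * s - r * q) + (p * r - q * s)" "(r - s) * (p + q) = (p * r - q * s) - (p * s - r * q)"
    by (simp_all add: algebra_simps)
  have m: "D dvd (p - q) * (r + s)" "D dvd (r - s) * (p + q)"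
    unfolding e by (intro dvd_add dvd_diff d)+
  have c: "D dvd b" if "D dvd b * a" "a $ 0 \<noteq> 0" for a b
    by (rule fps_dvd_cancel_left[OF that(2)]) (use that(1) in \<open>unfold mult.commute[of b a]\<close>)
  consider "(p - q) $ 0 \<noteq> 0 \<or> (r - s) $ 0 \<noteq> 0" | "(p + q) $ 0 \<noteq> 0 \<or> (r + s) $ 0 \<noteq> 0"
    | "(p - q) $ 0 = 0" "(r - s) $ 0 = 0" "(p + q) $ 0 = 0" "(r + s) $ 0 = 0" by blast
  thus ?thesis
  proof cases
    case 1
    obtain e :: 'a where e: "e\<^sup>2 = - 1" using sqrt_exists by blast
    have "e ^ 4 = (e\<^sup>2)\<^sup>2" by (simp flip: power_mult)
    hence e4: "e ^ 4 = 1" unfolding e by simp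
    have "D dvd p + q" using 1 fps_dvd_cancel_left[OF _ pq] fps_dvd_cancel_left[OF _ m(2)] by blast
    moreover have "D dvd r + s" using 1 fps_dvd_cancel_left[OF _ rs] fps_dvd_cancel_left[OF _ m(1)] by blast
    moreover have "?c (P 0) * Y 2 - ?c (e\<^sup>2 * P 2) * Y 0 = p + q" "?c (P 1) * Y 3 - ?c (e\<^sup>2 * P 3) * Y 1 = r + s"
      unfolding e pqrs by (simp_all flip: fps_const_neg)
    ultimately show ?thesis using near_twist[OF P Y D e4] by (simp only:)
  next
    case 2
    have "D dvd p - q" using 2 c[OF pq] c[OF m(1)] by blast
    moreover have "D dvd r - s" using 2 c[OF rs] c[OF m(2)] by blast
    moreover have "?c (P 0) * Y 2 - ?c (1\<^sup>2 * P 2) * Y 0 = p - q" "?c (P 1) * Y 3 - ?c (1\<^sup>2 * P 3) * Y 1 = r - s"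
      unfolding pqrs by simp_all
    ultimately show ?thesis using near_twist[OF P Y D power_one] by (simp only:)
  next
    case 3
    have "2 * (p $ 0) = (p + q) $ 0 + (p - q) $ 0" "2 * (q $ 0) = (p + q) $ 0 - (p - q) $ 0"
      "2 * (r $ 0) = (r + s) $ 0 + (r - s) $ 0" "2 * (s $ 0) = (r + s) $ 0 - (r - s) $ 0" by simp_all
    hence z: "P 0 * Y 2 $ 0 = 0" "P 2 * Y 0 $ 0 = 0" "P 1 * Y 3 $ 0 = 0" "P 3 * Y 1 $ 0 = 0"
      unfolding 3 using two by (simp_all add: pqrs)
    have P': "cone d P" "P \<noteq> (\<lambda>_. 0)" using P by (simp_all add: curve_iff)
    show ?thesis using coordinate_pairs[OF P'] coordinate_pairs[OF cone_nth_0[OF Y(1)] Y(2)] z by auto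
  qed
qed

lemma law0_zero:
  assumes P: "P \<in> curve d" and Z: "Z \<in> curve d" and z: "\<And>i. val d 0 P Z i = 0"
  obtains t where "t ^ 4 = 1" "proj_eq (tw t P) Z"
proof -
  have dv: "fps_X dvd fe (arc Z) (fix_left P (laws d 0 i))" for i
    unfolding fps_X_dvd_iff fe_arc_nth_0[OF Z] mp_eval_fix_left using z[of i] by (simp only: val_def)
  have nz: "(\<lambda>i. arc Z i $ 0) \<noteq> (\<lambda>_. 0)" using Z by (simp add: arc_nth_0 curve_iff)
  from law0_near_twist[OF P arc_cone[OF Z] nz dvd_refl dv]
  obtain t l where t: "t ^ 4 = 1" "l $ 0 \<noteq> 0" and e: "\<And>i. fps_X dvd arc Z i - l * fps_const (tw t P i)" by metis
  have "Z i = l $ 0 * tw t P i" for i using e[of i] Z by (simp add: fps_X_dvd_iff arc_nth_0)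
  hence "proj_eq (tw t P) Z" unfolding proj_eq_def using t(2) by blast
  with t(1) show ?thesis by (rule that)
qed

text \<open>A double zero of all components would make the arc at \<open>Z\<close> a multiple of a
  constant twist of \<open>P\<close> modulo \<open>fps_X^2\<close>, hence stationary.\<close>

lemma law0_simple_zero:
  assumes P: "P \<in> curve d" and Z: "Z \<in> curve d"
  shows "\<exists>i. \<not> fps_X\<^sup>2 dvd fe (arc Z) (fix_left P (laws d 0 i))"
proof (rule ccontr)
  assume "\<not> ?thesis"
  hence d: "fps_X\<^sup>2 dvd fe (arc Z) (fix_left P (laws d 0 i))" for i by blast
  have nz: "(\<lambda>i. arc Z i $ 0) \<noteq> (\<lambda>_. 0)" using Z by (simp add: arc_nth_0 curve_iff)
  have "fps_X dvd (fps_X\<^sup>2 :: 'a fps)" by (simp add: power2_eq_square)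
  from law0_near_twist[OF P arc_cone[OF Z] nz this d]
  obtain t l where t: "t ^ 4 = 1" "l $ 0 \<noteq> 0" and e: "\<And>i. fps_X\<^sup>2 dvd arc Z i - l * fps_const (tw t P i)" by metis
  obtain F where F: "homogeneous 1 F" "subdegree (fe (arc Z) F) = 1"
    using local_param_arc[OF Z] unfolding local_param_def by blast
  let ?w = "mp_eval (tw t P) F"
  have D: "fps_X\<^sup>2 dvd fe (arc Z) F - l * fps_const ?w" by (rule linear_form_dvd[OF F(1) e])
  hence "fps_X dvd fe (arc Z) F - l * fps_const ?w" by (rule dvd_trans[rotated]) (simp add: power2_eq_square)
  hence "fe (arc Z) F $ 0 = l $ 0 * ?w" by (simp add: fps_X_dvd_iff)
  moreover have "fe (arc Z) F $ 0 = 0" using F(2) by (metis nth_less_subdegree_zero zero_less_one)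
  ultimately have "?w = 0" using t(2) by simp
  with D have "fps_X\<^sup>2 dvd fe (arc Z) F" by simp
  moreover have "fe (arc Z) F \<noteq> 0" using F(2) by auto
  ultimately show False using fps_X_power_dvd_iff[of "fe (arc Z) F" 2] F(2) by simp
qed

text \<open>For fixed \<open>P\<close> the zeros of law \<open>0\<close> are simple and are twists
  of \<open>P\<close>. The tuple \<open>A\<close> may fail to vanish at one of them,
  \<open>R\<close>, which is then the only possible pole of the quotient.\<close>

lemma law0_multiple:
  assumes P: "P \<in> curve d" and A: "\<And>i. homogeneous 2 (A i)" and R: "R \<in> curve d"
    and parallel: "\<And>Z i j. Z \<in> curve d \<Longrightarrow> mp_eval Z (A i) * val d 0 P Z j = mp_eval Z (A j) * val d 0 P Z i"
    and zeros: "\<And>t i. t ^ 4 = 1 \<Longrightarrow> tw t P \<noteq> R \<Longrightarrow> mp_eval (tw t P) (A i) = 0"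
  shows "\<exists>c. \<forall>Z\<in>curve d. \<forall>i. mp_eval Z (A i) = c * val d 0 P Z i"
proof -
  have v: "mp_eval Z (fix_left P (laws d 0 i)) = val d 0 P Z i" for Z i
    unfolding mp_eval_fix_left val_def ..
  have "(\<exists>j. \<not> fps_X\<^sup>2 dvd fe (arc Z) (fix_left P (laws d 0 j))) \<and> (proj_eq Z R \<or> (\<forall>j. mp_eval Z (A j) = 0))"
    if Z: "Z \<in> curve d" "\<forall>j. mp_eval Z (fix_left P (laws d 0 j)) = 0" for Z
  proof (intro conjI law0_simple_zero[OF P Z(1)])
    obtain t where t: "t ^ 4 = 1" "proj_eq (tw t P) Z"
      by (rule law0_zero[OF P Z(1)]) (use Z(2) in \<open>simp add: v\<close>)
    show "proj_eq Z R \<or> (\<forall>j. mp_eval Z (A j) = 0)"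
    proof (cases "tw t P = R")
      case True
      thus ?thesis using proj_eq_sym[OF t(2)] by simp
    next
      case False
      have "mp_eval Z (A j) = 0" for j
        by (rule proj_eq_mp_eval[OF t(2) A[of j]]) (simp add: zeros[OF t(1) False])
      thus ?thesis by blast
    qed
  qed
  note z = this[unfolded v]
  show ?thesis
  proof (rule proportional_forms[where A = A and B = "\<lambda>i. fix_left P (laws d 0 i)",
        OF A homogeneous_fix_left[OF bihomogeneous_laws] R, unfolded v])
    show "mp_eval Z (A i) * val d 0 P Z j = mp_eval Z (A j) * val d 0 P Z i" if "Z \<in> curve d" for Z i j
      using that by (rule parallel)
    show "(\<exists>j. \<not> fps_X\<^sup>2 dvd fe (arc Z) (fix_left P (laws d 0 j))) \<and> (proj_eq Z R \<or> (\<forall>j. mp_eval Z (A j) = 0))"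
      if "Z \<in> curve d" "\<forall>j. val d 0 P Z j = 0" for Z
      using that by (rule z)
  qed
qed

end

section \<open>Uniqueness of the addition laws\<close>

lemma comb_unit: "comb d (\<lambda>m. of_bool (m = j)) P Q = val d j P Q"
proof
  fix i
  have "comb d (\<lambda>m. of_bool (m = j)) P Q i = (\<Sum>m\<in>{j}. val d m P Q i)"
    unfolding comb_def by (rule sum.mono_neutral_cong_right) auto
  thus "comb d (\<lambda>m. of_bool (m = j)) P Q i = val d j P Q i" by simp
qed

lemma fourth_roots:
  fixes t i :: "'a::field"
  assumes "t ^ 4 = 1" "i\<^sup>2 = - 1"
  shows "t = 1 \<or> t = - 1 \<or> t = i \<or> t = - i"
proof -
  have "(t - 1) * ((t + 1) * ((t - i) * (t + i))) = 0" using assms by Groebner_Basis.algebra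
  thus ?thesis by (auto simp: eq_neg_iff_add_eq_0)
qed

lemma val_0_identity: "val d 0 P identity_point 2 = - (P 2)\<^sup>2"
  unfolding val_0 identity_point_def quad_simps by simp

context smooth_curve
begin

lemma point_outside_plane: obtains P where "P \<in> curve d" "P 2 \<noteq> 0"
proof -
  obtain r where r: "r\<^sup>2 = d" using sqrt_exists by blast
  obtain w where w: "w\<^sup>2 = r" using sqrt_exists by blast
  have "quad (w\<^sup>2) (2 * w) 1 0 \<in> curve d"
    using r w by (auto simp: curve_iff cone_iff eq_4_iff power_mult_distrib)
  thus ?thesis by (rule that) simp
qed

lemma is_sum_parallel:
  assumes P: "P \<in> curve d" and Q: "Q \<in> curve d" and F: "F \<noteq> (\<lambda>_. 0) \<Longrightarrow> is_sum d P Q F"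
  shows "F i * comb d c P Q j = F j * comb d c P Q i"
proof (cases "F = (\<lambda>_. 0) \<or> comb d c P Q = (\<lambda>_. 0)")
  case False
  hence "proj_eq F (comb d c P Q)" using is_sum_unique F is_sum_comb[OF P Q] by blast
  then obtain k where "comb d c P Q = (\<lambda>i. k * F i)" unfolding proj_eq_def by blast
  thus ?thesis by simp
qed auto

text \<open>For a square root \<open>e\<close> of \<open>-1\<close> this prescribes
  \<open>c1 t^2 + c2 t + c3\<close> at \<open>t = 1, -1, e\<close>. By \<open>val_tw\<close> and
  \<open>val_diagonal\<close> that polynomial measures the combination of the last three laws on the
  graph of the twist by \<open>t\<close>.\<close>

lemma interpolation:
  fixes e :: 'a
  obtains c1 c2 c3 where "c1 + c2 + c3 = h" "c1 - c2 + c3 = h'" "- c1 + e * c2 + c3 = h''"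
proof -
  define c2 where "c2 = (h - h') / 2"
  define c3 where "c3 = ((h + h') / 2 + (h'' - e * c2)) / 2"
  define c1 where "c1 = c3 - (h'' - e * c2)"
  have "2 * c2 = h - h'" "2 * c3 = (h + h') / 2 + (h'' - e * c2)" "2 * ((h + h') / 2) = h + h'"
    using two by (simp_all add: c2_def c3_def)
  note e = this
  have m: "c1 + c3 = (h + h') / 2" unfolding c1_def using e(2) by (simp add: algebra_simps)
  have s: "2 * (c1 + c3) = h + h'" unfolding m by (rule e(3))
  have "2 * (c1 + c2 + c3) = 2 * (c1 + c3) + 2 * c2" "2 * (c1 - c2 + c3) = 2 * (c1 + c3) - 2 * c2"
    by (simp_all only: algebra_simps)
  hence "2 * (c1 + c2 + c3) = 2 * h" "2 * (c1 - c2 + c3) = 2 * h'" unfolding s e(1) by simp_all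
  hence "c1 + c2 + c3 = h" "c1 - c2 + c3 = h'" by (simp_all only: mult_left_cancel[OF two])
  moreover have "- c1 + e * c2 + c3 = h''" by (simp add: c1_def)
  ultimately show ?thesis by (rule that)
qed

section \<open>Comparison of an arbitrary law with the four laws\<close>

context
  fixes s :: "4 \<Rightarrow> 'a bipoly"
  assumes bihom: "\<And>i. bihomogeneous 2 2 (s i)"
    and sum: "\<And>P Q. P \<in> curve d \<Longrightarrow> Q \<in> curve d \<Longrightarrow> (\<lambda>i. mp_eval (case_sum P Q) (s i)) \<noteq> (\<lambda>_. 0) \<Longrightarrow>
      is_sum d P Q (\<lambda>i. mp_eval (case_sum P Q) (s i))"
begin

text \<open>Law \<open>2\<close> has no zeros on the graph, so the condition on zeros in
  \<open>proportional_forms\<close> is vacuous and any point can stand for \<open>R\<close>.\<close>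

lemma law_on_twist:
  assumes t: "t ^ 4 = 1"
  shows "\<exists>g. \<forall>P\<in>curve d. \<forall>i. mp_eval (case_sum P (tw t P)) (s i) = g * tw t (val d 2 P P) i"
proof -
  have t0: "t \<noteq> 0" using t by (cases "t = 0") auto
  have v: "mp_eval P (on_twist t (laws d 2 i)) = t * tw t (val d 2 P P) i" for P i
    unfolding mp_eval_on_twist val_def[symmetric] val_tw(3)[OF t] ..
  have nz: "\<not> (\<forall>i. t * tw t (val d 2 P P) i = 0)" if "P \<in> curve d" for P
  proof
    assume "\<forall>i. t * tw t (val d 2 P P) i = 0"
    hence "\<forall>i. val d 2 P P i = 0" using t0 by (simp add: all_4)
    with val_2_diagonal_nonzero[OF that] show False by auto
  qed
  have "\<exists>g. \<forall>P\<in>curve d. \<forall>i. mp_eval P (on_twist t (s i)) = g * mp_eval P (on_twist t (laws d 2 i))"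
  proof (rule proportional_forms[OF homogeneous_on_twist[OF bihom] homogeneous_on_twist[OF bihomogeneous_laws] identity_point_in_curve])
    fix P i j assume P: "P \<in> curve d"
    show "mp_eval P (on_twist t (s i)) * mp_eval P (on_twist t (laws d 2 j)) = mp_eval P (on_twist t (s j)) * mp_eval P (on_twist t (laws d 2 i))"
      using is_sum_parallel[OF P curve_tw[OF P t] sum[OF P curve_tw[OF P t]], of i "\<lambda>m. of_bool (m = 2)" j]
      unfolding comb_unit mp_eval_on_twist val_def .
  next
    fix P assume P: "P \<in> curve d" "\<forall>j. mp_eval P (on_twist t (laws d 2 j)) = 0"
    with nz[OF P(1)] show "(\<exists>j. \<not> fps_X\<^sup>2 dvd fe (arc P) (on_twist t (laws d 2 j))) \<and>
      (proj_eq P identity_point \<or> (\<forall>j. mp_eval P (on_twist t (s j)) = 0))" unfolding v by blast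
  qed
  then obtain g where "\<And>P i. P \<in> curve d \<Longrightarrow> mp_eval P (on_twist t (s i)) = g * (t * tw t (val d 2 P P) i)"
    unfolding v by blast
  hence "\<forall>P\<in>curve d. \<forall>i. mp_eval (case_sum P (tw t P)) (s i) = (g * t) * tw t (val d 2 P P) i"
    unfolding mp_eval_on_twist by (simp add: mult.assoc)
  thus ?thesis by blast
qed

theorem law_eq_comb: "\<exists>c. \<forall>P\<in>curve d. \<forall>Q\<in>curve d. \<forall>i. mp_eval (case_sum P Q) (s i) = comb d c P Q i"
proof -
  obtain \<iota> :: 'a where i2: "\<iota>\<^sup>2 = - 1" using sqrt_exists by blast
  have "\<iota> ^ 4 = (\<iota>\<^sup>2)\<^sup>2" by (simp flip: power_mult)
  hence i4: "\<iota> ^ 4 = 1" unfolding i2 by simp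
  have m4: "(- 1 :: 'a) ^ 4 = 1" by simp
  obtain h where h: "\<And>P i. P \<in> curve d \<Longrightarrow> mp_eval (case_sum P (tw 1 P)) (s i) = h * tw 1 (val d 2 P P) i"
    using law_on_twist[of 1] by auto
  obtain h' where h': "\<And>P i. P \<in> curve d \<Longrightarrow> mp_eval (case_sum P (tw (- 1) P)) (s i) = h' * tw (- 1) (val d 2 P P) i"
    using law_on_twist[OF m4] by blast
  obtain h'' where h'': "\<And>P i. P \<in> curve d \<Longrightarrow> mp_eval (case_sum P (tw \<iota> P)) (s i) = h'' * tw \<iota> (val d 2 P P) i"
    using law_on_twist[OF i4] by blast
  obtain c1 c2 c3 where c: "c1 + c2 + c3 = h" "c1 - c2 + c3 = h'" "- c1 + \<iota> * c2 + c3 = h''"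
    by (rule interpolation)
  define s' where "s' i = s i - (Const c1 * laws d 1 i + (Const c2 * laws d 2 i + Const c3 * laws d 3 i))" for i
  have hs': "bihomogeneous 2 2 (s' i)" for i unfolding s'_def
    by (intro bihomogeneous_diff bihomogeneous_add bihomogeneous_Const_mult bihomogeneous_laws bihom)
  define S where "S P Q i = mp_eval (case_sum P Q) (s' i)" for P Q i
  have S: "S P Q i = mp_eval (case_sum P Q) (s i) - (c1 * val d 1 P Q i + (c2 * val d 2 P Q i + c3 * val d 3 P Q i))" for P Q i
    by (simp add: S_def s'_def val_def)
  have parallel: "S P Q i * val d 0 P Q j = S P Q j * val d 0 P Q i" if P: "P \<in> curve d" and Q: "Q \<in> curve d" for P Q i j
  proof -
    note p = is_sum_parallel[OF P Q, of _ i "\<lambda>m. of_bool (m = 0)" j, unfolded comb_unit]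
    have "val d m P Q i * val d 0 P Q j = val d m P Q j * val d 0 P Q i" for m
      by (rule p[OF is_sum_comb[OF P Q, of "\<lambda>k. of_bool (k = m)", unfolded comb_unit]])
    moreover have "mp_eval (case_sum P Q) (s i) * val d 0 P Q j = mp_eval (case_sum P Q) (s j) * val d 0 P Q i"
      by (rule p[OF sum[OF P Q]])
    ultimately have v: "val d m P Q i * val d 0 P Q j = val d m P Q j * val d 0 P Q i"
      "mp_eval (case_sum P Q) (s i) * val d 0 P Q j = mp_eval (case_sum P Q) (s j) * val d 0 P Q i" for m
      by blast+
    show ?thesis unfolding S left_diff_distrib distrib_right mult.assoc v ..
  qed
  \<comment> \<open>The subtracted combination has the same multiple of law \<open>2\<close> on the
    three graphs used for interpolation; the twist by \<open>- \<iota>\<close> is left as the place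
    of the pole.\<close>
  have on_twist: "S P (tw t P) i = 0" if P: "P \<in> curve d" and t: "t ^ 4 = 1" "t \<noteq> - \<iota>" for P t i
  proof -
    have "cone d P" using P by (simp add: curve_iff)
    note D = val_diagonal[OF two this]
    obtain k where k: "mp_eval (case_sum P (tw t P)) (s i) = k * tw t (val d 2 P P) i" "c1 * t\<^sup>2 + c2 * t + c3 = k"
      using fourth_roots[OF t(1) i2] t(2) h[OF P] h'[OF P] h''[OF P] c i2 by (auto simp: mult.commute)
    have "S P (tw t P) i = (k - (c1 * t\<^sup>2 + c2 * t + c3)) * tw t (val d 2 P P) i"
      unfolding S k(1) val_tw[OF t(1)] D(2,3) by (simp add: algebra_simps)
    thus ?thesis unfolding k(2) by simp
  qed
  have row: "\<exists>c. \<forall>Z\<in>curve d. \<forall>i. S P Z i = c * val d 0 P Z i" if P: "P \<in> curve d" for P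
  proof -
    have "(- \<iota>) ^ 4 = 1" using i4 by simp
    note multiple = law0_multiple[OF P homogeneous_fix_left[OF hs'] curve_tw[OF P this], unfolded mp_eval_fix_left, folded S_def]
    show ?thesis
    proof (rule multiple)
      show "S P Z i * val d 0 P Z j = S P Z j * val d 0 P Z i" if "Z \<in> curve d" for Z i j
        by (rule parallel[OF P that])
      show "S P (tw t P) i = 0" if "t ^ 4 = 1" "tw t P \<noteq> tw (- \<iota>) P" for t i
        by (rule on_twist[OF P that(1)]) (use that(2) in blast)
    qed
  qed
  have O: "identity_point \<in> curve d" by (rule identity_point_in_curve)
  \<comment> \<open>\<open>row\<close> yields a constant that may depend on \<open>P\<close>. Fixing
    the second argument at the identity yields one constant for all \<open>P\<close>. Exchanging
    arguments inverts the twist, so the exceptional one is now \<open>\<iota>\<close>, whose cube is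
    \<open>- \<iota>\<close>.\<close>
  have "\<exists>c. \<forall>P\<in>curve d. \<forall>i. mp_eval P (fix_right identity_point (s' i)) = c * val d 0 identity_point P i"
  proof (rule law0_multiple[OF O homogeneous_fix_right[OF hs'] curve_tw[OF O i4]])
    fix Z i j assume Z: "Z \<in> curve d"
    show "mp_eval Z (fix_right identity_point (s' i)) * val d 0 identity_point Z j
        = mp_eval Z (fix_right identity_point (s' j)) * val d 0 identity_point Z i"
      using parallel[OF Z O, of i j] unfolding mp_eval_fix_right S_def[symmetric] val_0_swap[of d identity_point Z] by simp
  next
    fix t i assume t: "t ^ 4 = 1" "tw t identity_point \<noteq> tw \<iota> identity_point"
    have e: "t ^ 3 * t = 1" using t(1) by (simp add: numeral_eq_Suc mult_ac)
    have "(t ^ 3) ^ 4 = (t ^ 4) ^ 3" by (simp flip: power_mult)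
    hence t3: "(t ^ 3) ^ 4 = 1" unfolding t(1) by simp
    have "t ^ 3 \<noteq> - \<iota>"
    proof
      assume "t ^ 3 = - \<iota>"
      hence "- \<iota> * t = 1" using e by simp
      moreover have "(- \<iota> * t) * \<iota> = - (\<iota>\<^sup>2) * t" by (simp add: power2_eq_square mult_ac)
      ultimately have "t = \<iota>" unfolding i2 by simp
      with t(2) show False by simp
    qed
    from on_twist[OF curve_tw[OF O t(1)] t3 this, of i]
    show "mp_eval (tw t identity_point) (fix_right identity_point (s' i)) = 0"
      unfolding tw_tw e tw_1 mp_eval_fix_right S_def .
  qed
  then obtain c' where c': "\<And>P i. P \<in> curve d \<Longrightarrow> S P identity_point i = c' * val d 0 identity_point P i"
    unfolding mp_eval_fix_right S_def by blast
  define c0 where "c0 = - c'"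
  have col: "S P identity_point i = c0 * val d 0 P identity_point i" if "P \<in> curve d" for P i
    unfolding c'[OF that] val_0_swap[of d identity_point P] c0_def by simp
  have S0: "S P Q i = c0 * val d 0 P Q i" if P: "P \<in> curve d" and Q: "Q \<in> curve d" for P Q i
  proof -
    define F where "F = fix_right Q (s' i - Const c0 * laws d 0 i)"
    have F: "mp_eval Z F = S Z Q i - c0 * val d 0 Z Q i" for Z
      by (simp add: F_def mp_eval_fix_right S_def val_def)
    \<comment> \<open>Law \<open>0\<close> at \<open>Z\<close> and the identity has the component
      \<open>- (Z 2)^2\<close>, so the two constants can be compared off the plane
      \<open>Z 2 = 0\<close>. The factor \<open>Var 2\<close> covers that plane and is removed by
      primality.\<close>
    have "F * Var 2 \<in> curve_ideal d"
      unfolding curve_ideal_def mem_Collect_eq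
    proof
      fix Z assume Z: "Z \<in> curve d"
      show "mp_eval Z (F * Var 2) = 0"
      proof (cases "Z 2 = 0")
        case False
        obtain c where c: "\<And>Y i. Y \<in> curve d \<Longrightarrow> S Z Y i = c * val d 0 Z Y i" using row[OF Z] by blast
        have "c * val d 0 Z identity_point 2 = c0 * val d 0 Z identity_point 2"
          using c[OF O] col[OF Z] by metis
        hence "c = c0" using False by (simp add: val_0_identity)
        thus ?thesis using c[OF Q] by (simp add: F)
      qed simp
    qed
    moreover have "homogeneous 2 F" unfolding F_def
      by (rule homogeneous_fix_right[where b = 2]) (intro bihomogeneous_diff bihomogeneous_Const_mult bihomogeneous_laws hs')
    moreover have "Var 2 \<notin> curve_ideal d"
    proof -
      obtain Z where "Z \<in> curve d" "Z 2 \<noteq> 0" by (rule point_outside_plane)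
      thus ?thesis by (auto simp: curve_ideal_def)
    qed
    ultimately have "F \<in> curve_ideal d" using curve_ideal_prime homogeneous_Var by blast
    hence "mp_eval P F = 0" using P by (simp add: curve_ideal_def)
    thus ?thesis by (simp add: F)
  qed
  have "mp_eval (case_sum P Q) (s i) = comb d (quad c0 c1 c2 c3) P Q i" if "P \<in> curve d" "Q \<in> curve d" for P Q i
    using S0[OF that, of i] unfolding S comb_4 quad_simps by (simp only: diff_eq_eq)
  thus ?thesis by blast
qed

end

end

section \<open>Nonsingularity\<close>

lemma mp_deriv_superset:
  assumes "finite A" "Poly_Mapping.keys p \<subseteq> A"
  shows "mp_deriv v p = (\<Sum>m\<in>A. Poly_Mapping.single (m - Poly_Mapping.single v 1)
    (of_nat (Poly_Mapping.lookup m v) * Poly_Mapping.lookup p m))"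
  unfolding mp_deriv_def using assms
  by (intro sum.mono_neutral_left) (auto simp: not_in_keys_iff_lookup_eq_zero)

lemma mp_deriv_add: "mp_deriv v (p + q) = mp_deriv v p + mp_deriv v q"
proof -
  let ?A = "Poly_Mapping.keys p \<union> Poly_Mapping.keys q"
  have "Poly_Mapping.keys (p + q) \<subseteq> ?A" by (rule keys_add)
  hence "mp_deriv v (p + q) = (\<Sum>m\<in>?A. Poly_Mapping.single (m - Poly_Mapping.single v 1)
    (of_nat (Poly_Mapping.lookup m v) * Poly_Mapping.lookup (p + q) m))"
    by (intro mp_deriv_superset) auto
  also have "\<dots> = mp_deriv v p + mp_deriv v q"
    by (simp add: mp_deriv_superset[of ?A p] mp_deriv_superset[of ?A q] lookup_add distrib_left single_add sum.distrib)
  finally show ?thesis .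
qed

lemma mp_deriv_quadratic:
  "mp_deriv v (Const c * (Var a * Var b)) = Const c * (of_bool (v = a) * Var b + of_bool (v = b) * Var a)"
proof -
  let ?s = "\<lambda>v. Poly_Mapping.single v (1::nat)"
  have m: "Const c * (Var a * Var b) = Poly_Mapping.single (?s a + ?s b) c"
    by (simp add: Const_def Var_def mult_single)
  have d: "mp_deriv v (Const c * (Var a * Var b)) = Poly_Mapping.single (?s a + ?s b - ?s v)
      (of_nat (Poly_Mapping.lookup (?s a + ?s b) v) * c)"
    unfolding m by (subst mp_deriv_superset[of "{?s a + ?s b}"]) (simp_all add: keys_single)
  have V: "Const c * Var w = Poly_Mapping.single (?s w) c" for w
    by (simp add: Const_def Var_def mult_single)
  consider "v = a" "v = b" | "v = a" "v \<noteq> b" | "v \<noteq> a" "v = b" | "v \<noteq> a" "v \<noteq> b" by blast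
  thus ?thesis unfolding d distrib_left
  proof cases
    case 1
    have "Poly_Mapping.single (?s a) (2 * c) = Poly_Mapping.single (?s a) c + Poly_Mapping.single (?s a) c"
      by (simp only: mult_2 single_add)
    with 1 show "Poly_Mapping.single (?s a + ?s b - ?s v) (of_nat (Poly_Mapping.lookup (?s a + ?s b) v) * c)
        = Const c * (of_bool (v = a) * Var b) + Const c * (of_bool (v = b) * Var a)"
      by (simp add: lookup_add V del: mult_2 mult_2_right)
  qed (simp_all add: lookup_add lookup_single_not_eq V)
qed

text \<open>Explicit singular points. For \<open>d = 0\<close> the gradient of the first quadric
  vanishes at \<open>(0 : 0 : 1 : 0)\<close>. For \<open>d = 1\<close> the first quadric plus
  \<open>\<iota> / 2\<close> times the second is
  \<open>(X0 - \<iota> X2)^2 + (\<iota> / 2) (X1 + \<iota> X3)^2\<close>, of rank two, and the point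
  lies on its vertex line.\<close>

lemma nonsingular_imp:
  fixes d :: "'a::alg_closed_field"
  assumes two: "(2::'a) \<noteq> 0" and ns: "nonsingular d"
  shows "d \<noteq> 0" "d \<noteq> 1"
proof -
  have q1: "quadric1 d = Const 1 * (Var 0 * Var 0) + (Const (- d) * (Var 2 * Var 2) + Const (- 1) * (Var 1 * Var 3))"
    by (simp add: quadric1_def power2_eq_square ev_C.hom_uminus Const_1)
  have q2: "quadric2 = Const 1 * (Var 1 * Var 1) + (Const (- 1) * (Var 3 * Var 3) + Const (- 4) * (Var 0 * Var 2 :: (4, 'a) mpoly))"
    by (simp add: quadric2_def power2_eq_square ev_C.hom_uminus ev_C.hom_numeral Const_1 mult.assoc)
  note D = mp_deriv_add mp_deriv_quadratic
  show "d \<noteq> 0"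
  proof
    assume d: "d = 0"
    have P: "quad 0 0 1 0 \<in> curve d" by (simp add: curve_iff cone_iff eq_4_iff d)
    have "\<forall>i. 1 * mp_eval (quad 0 0 1 0) (mp_deriv i (quadric1 d)) + 0 * mp_eval (quad 0 0 1 0) (mp_deriv i quadric2) = 0"
      unfolding all_4 q1 D by (simp add: d)
    from ns[unfolded nonsingular_def, rule_format, OF P this[rule_format]] show False by simp
  qed
  show "d \<noteq> 1"
  proof
    assume d: "d = 1"
    obtain \<iota> :: 'a where i: "\<iota>\<^sup>2 = - 1" using sqrt_exists by blast
    obtain w :: 'a where w: "w\<^sup>2 = 2 * \<iota>" using sqrt_exists by blast
    let ?P = "quad \<iota> w 1 (\<iota> * w)"
    have e: "w * w = 2 * \<iota>" "\<iota> * \<iota> = - 1" using i w by (simp_all add: power2_eq_square)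
    have "w * (\<iota> * w) = - 2" "(\<iota> * w) * (\<iota> * w) = - (2 * \<iota>)"
      using e by Groebner_Basis.algebra+
    hence P: "?P \<in> curve d" using e by (simp add: curve_iff cone_iff eq_4_iff d power2_eq_square)
    obtain h where h: "\<iota> = 2 * h" using two by (metis nonzero_mult_div_cancel_left times_divide_eq_right)
    have G: "mp_eval ?P (mp_deriv i (quadric1 d)) = quad (2 * \<iota>) (- (\<iota> * w)) (- 2) (- w) i"
      "mp_eval ?P (mp_deriv i quadric2) = quad (- 4) (2 * w) (- (4 * \<iota>)) (- (2 * (\<iota> * w))) i" for i
    proof -
      have "\<forall>i. mp_eval ?P (mp_deriv i (quadric1 d)) = quad (2 * \<iota>) (- (\<iota> * w)) (- 2) (- w) i"
        "\<forall>i. mp_eval ?P (mp_deriv i quadric2) = quad (- 4) (2 * w) (- (4 * \<iota>)) (- (2 * (\<iota> * w))) i"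
        unfolding all_4 q1 q2 D by (simp_all add: d)
      thus "mp_eval ?P (mp_deriv i (quadric1 d)) = quad (2 * \<iota>) (- (\<iota> * w)) (- 2) (- w) i"
        "mp_eval ?P (mp_deriv i quadric2) = quad (- 4) (2 * w) (- (4 * \<iota>)) (- (2 * (\<iota> * w))) i" by blast+
    qed
    have "\<forall>i. 1 * mp_eval ?P (mp_deriv i (quadric1 d)) + h * mp_eval ?P (mp_deriv i quadric2) = 0"
      unfolding all_4 G quad_simps using e(2) h by (intro conjI; Groebner_Basis.algebra)
    from ns[unfolded nonsingular_def, rule_format, OF P this[rule_format]] show False by simp
  qed
qed

section \<open>Descent to the base field\<close>

lemma homogeneous_2_quadratic:
  assumes "homogeneous 2 F"
  obtains c where "F = (\<Sum>i\<in>UNIV. \<Sum>j\<in>UNIV. Const (c i j) * (Var i * Var j))"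
proof -
  have "n = 2 \<longrightarrow> (\<exists>c. F = (\<Sum>i\<in>UNIV. \<Sum>j\<in>UNIV. Const (c i j) * (Var i * Var j)))"
    if "homogeneous n F" for n and F :: "('a, 'b) mpoly"
    using that
  proof (induction rule: homogeneous_induct)
    case (Var n v G)
    show ?case
    proof
      assume "Suc n = 2"
      with Var(1) have "homogeneous 1 G" by simp
      then obtain c where G: "G = (\<Sum>j\<in>UNIV. Const (c j) * Var j)" by (rule homogeneous_1_linear)
      have "(\<Sum>i\<in>UNIV. \<Sum>j\<in>UNIV. Const (if i = v then c j else 0) * (Var i * Var j))
          = (\<Sum>i\<in>{v}. \<Sum>j\<in>UNIV. Const (c j) * (Var i * Var j))"
        by (rule sum.mono_neutral_cong_right) auto
      also have "\<dots> = Var v * G" unfolding G by (simp add: sum_distrib_left mult_ac)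
      finally show "\<exists>c. Var v * G = (\<Sum>i\<in>UNIV. \<Sum>j\<in>UNIV. Const (c i j) * (Var i * Var j))"
        by (intro exI[of _ "\<lambda>i j. if i = v then c j else 0"]) (rule sym)
    qed
  next
    case (add n F G)
    show ?case
    proof
      assume "n = 2"
      with add obtain b c where "F = (\<Sum>i\<in>UNIV. \<Sum>j\<in>UNIV. Const (b i j) * (Var i * Var j))"
        "G = (\<Sum>i\<in>UNIV. \<Sum>j\<in>UNIV. Const (c i j) * (Var i * Var j))" by blast
      hence "F + G = (\<Sum>i\<in>UNIV. \<Sum>j\<in>UNIV. Const (b i j + c i j) * (Var i * Var j))"
        by (simp add: Const_add distrib_right sum.distrib)
      thus "\<exists>c. F + G = (\<Sum>i\<in>UNIV. \<Sum>j\<in>UNIV. Const (c i j) * (Var i * Var j))" by (rule exI[of _ "\<lambda>i j. b i j + c i j"])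
    qed
  qed auto
  with assms that show ?thesis by blast
qed

text \<open>The fourth roots of \<open>r\<close> are \<open>w\<close>, \<open>- w\<close>,
  \<open>\<iota> w\<close> and \<open>- \<iota> w\<close>. Signed sums of the four equations isolate
  one coefficient each, up to a factor four.\<close>

lemma cubic_eq_0:
  fixes a b c e r :: "'a::alg_closed_field"
  assumes two: "(2::'a) \<noteq> 0" and r: "r \<noteq> 0" and z: "\<And>t. t ^ 4 = r \<Longrightarrow> a + b * t + c * t\<^sup>2 + e * t ^ 3 = 0"
  shows "b = 0" "c = 0" "e = 0"
proof -
  obtain \<iota> :: 'a where i: "\<iota>\<^sup>2 = - 1" using sqrt_exists by blast
  obtain u where u: "u\<^sup>2 = r" using sqrt_exists by blast
  obtain w where w: "w\<^sup>2 = u" using sqrt_exists by blast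
  have "w ^ 4 = (w\<^sup>2)\<^sup>2" by (simp flip: power_mult)
  hence w4: "w ^ 4 = r" unfolding w u .
  hence w0: "w \<noteq> 0" using r by auto
  have "\<iota> ^ 4 = (\<iota>\<^sup>2)\<^sup>2" by (simp flip: power_mult)
  hence i4: "\<iota> ^ 4 = 1" unfolding i by simp
  have m: "\<iota> * w \<noteq> 0" "\<iota>\<^sup>2 * w\<^sup>2 = - w\<^sup>2" "\<iota> ^ 3 * w ^ 3 = - \<iota> * w ^ 3"
    using w0 i by (auto simp: power3_eq_cube power2_eq_square)
  have z1: "a + b * w + c * w\<^sup>2 + e * w ^ 3 = 0" "a - b * w + c * w\<^sup>2 - e * w ^ 3 = 0"
    "a + b * (\<iota> * w) - c * w\<^sup>2 - e * (\<iota> * w ^ 3) = 0" "a - b * (\<iota> * w) - c * w\<^sup>2 + e * (\<iota> * w ^ 3) = 0"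
    using z[of w] z[of "- w"] z[of "\<iota> * w"] z[of "- (\<iota> * w)"] w4 i4
    by (simp_all add: power_mult_distrib m)
  have "2 * (2 * (c * w\<^sup>2)) = 0" "2 * (2 * (b * w * \<iota>)) = 0" "2 * (2 * (e * w ^ 3 * \<iota>)) = 0"
    using z1 by Groebner_Basis.algebra+
  hence "c * w\<^sup>2 = 0" "b * w * \<iota> = 0" "e * w ^ 3 * \<iota> = 0"
    using two by (simp_all only: mult_eq_0_iff simp_thms)
  with w0 m(1) show "b = 0" "c = 0" "e = 0" by auto
qed

lemma ev_to_ac_fix_left: "ev to_ac Z (fix_left P f) = bi_eval (\<lambda>i. to_ac (P i)) Z f"
  unfolding fix_left_def bi_eval_conv_ev ev_ev[OF coeff_hom_Const coeff_hom_to_ac] case_sum_comp ev_ac.ev_Const ev_ac.ev_Var ..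

lemma bi_eval_laws: "bi_eval P Q (laws d j i) = val (to_ac d) j P Q i"
proof -
  have "\<forall>j i. bi_eval P Q (laws d j i) = val (to_ac d) j P Q i"
    unfolding all_4 val_0 val_1 val_2 val_3 unfolding laws_def law0_def law1_def law2_def law3_def quad_simps by simp
  thus ?thesis by blast
qed

text \<open>At the identity the first components are \<open>Q 0\<close> times the four coordinates
  in another order, so the coefficients of a combination appear as those of a linear form.\<close>

lemma val_identity:
  fixes d :: "'a::field"
  assumes "(Q 1)\<^sup>2 - (Q 3)\<^sup>2 = 4 * Q 0 * Q 2" "(4 :: 'a) \<noteq> 0"
  shows "val d j identity_point Q 0 = Q 0 * quad (Q 2) (Q 3) (Q 0) (Q 1) j"
proof -
  have e: "(Q 3)\<^sup>2 - (Q 1)\<^sup>2 = - (4 * (Q 0 * Q 2))" using assms(1) by (simp add: algebra_simps)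
  have "\<forall>j. val d j identity_point Q 0 = Q 0 * quad (Q 2) (Q 3) (Q 0) (Q 1) j"
    unfolding all_4 val_0 val_1 val_2 val_3 quad_simps identity_point_def using assms(2) e
    by (simp add: power2_eq_square)
  thus ?thesis by blast
qed

text \<open>The slice of \<open>f\<close> at the identity is a quadratic form over the base field,
  but it agrees with \<open>Z 0\<close> times the linear form only on the curve. The twists of the
  identity and points with \<open>Z 3 = 0\<close> give cubic polynomials in a parameter with fixed
  fourth power. Their coefficients express each \<open>c j\<close> by coefficients of the
  slice.\<close>

lemma comb_coefficients_descend:
  fixes d :: "'k::field"
  assumes C: "smooth_curve (to_ac d)" and f: "bihomogeneous 2 2 f"
    and c: "\<And>P Q. P \<in> curve (to_ac d) \<Longrightarrow> Q \<in> curve (to_ac d) \<Longrightarrow> bi_eval P Q f = comb (to_ac d) c P Q 0"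
  shows "c j \<in> range to_ac"
proof -
  interpret smooth_curve "to_ac d" by fact
  obtain a where a: "fix_left identity_point f = (\<Sum>i\<in>UNIV. \<Sum>j\<in>UNIV. Const (a i j) * (Var i * Var j))"
    by (rule homogeneous_2_quadratic[OF homogeneous_fix_left[OF f]])
  define g where "g i j = to_ac (a i j)" for i j
  have O: "(\<lambda>i. to_ac (identity_point i)) = identity_point"
    unfolding eq_4_iff identity_point_def quad_simps by simp
  have q: "(\<Sum>i\<in>UNIV. \<Sum>j\<in>UNIV. g i j * (Z i * Z j)) = Z 0 * (c 0 * Z 2 + (c 1 * Z 3 + (c 2 * Z 0 + c 3 * Z 1)))"
    if Z: "Z \<in> curve (to_ac d)" for Z
  proof -
    have e: "(Z 1)\<^sup>2 - (Z 3)\<^sup>2 = 4 * Z 0 * Z 2" using Z by (simp add: curve_iff cone_iff)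
    have "(\<Sum>i\<in>UNIV. \<Sum>j\<in>UNIV. g i j * (Z i * Z j)) = ev to_ac Z (fix_left identity_point f)"
      unfolding a ev_ac.ev_sum by (simp add: g_def ev_ac.ev_mult)
    also have "\<dots> = comb (to_ac d) c identity_point Z 0"
      unfolding ev_to_ac_fix_left O by (rule c[OF identity_point_in_curve Z])
    also have "\<dots> = Z 0 * (c 0 * Z 2 + (c 1 * Z 3 + (c 2 * Z 0 + c 3 * Z 1)))"
      unfolding comb_4 val_identity[OF e four] quad_simps by (simp add: algebra_simps)
    finally show ?thesis .
  qed
  have "(g 1 1 + g 3 3) + (g 0 1 + g 1 0 - c 3) * t + (g 0 0 + g 1 3 + g 3 1 - c 2) * t\<^sup>2 + (g 0 3 + g 3 0 - c 1) * t ^ 3 = 0"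
    if t: "t ^ 4 = 1" for t
  proof -
    have O: "tw t identity_point = quad t 1 0 (t\<^sup>2)"
      unfolding eq_4_iff identity_point_def by simp
    show ?thesis using q[OF curve_tw[OF identity_point_in_curve t]] t
      unfolding O UNIV_4 by (simp add: sum.insert) Groebner_Basis.algebra
  qed
  note c123 = cubic_eq_0[OF two one_neq_zero this]
  have "(g 0 0 * to_ac d + g 2 2 - c 2 * to_ac d) + (2 * (g 1 2 + g 2 1)) * w + (g 0 2 + g 2 0 + 4 * g 1 1 - c 0) * w\<^sup>2
      + (2 * (g 0 1 + g 1 0) - 2 * c 3) * w ^ 3 = 0" if w: "w ^ 4 = to_ac d" for w
  proof -
    have "(w\<^sup>2)\<^sup>2 = to_ac d" using w by (simp flip: power_mult)
    hence "quad (w\<^sup>2) (2 * w) 1 0 \<in> curve (to_ac d)"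
      by (auto simp: curve_iff cone_iff eq_4_iff power_mult_distrib)
    from q[OF this] w show ?thesis
      unfolding UNIV_4 by (simp add: sum.insert) Groebner_Basis.algebra
  qed
  note c0 = cubic_eq_0(2)[OF two d0 this]
  have "c 0 = to_ac (a 0 2 + a 2 0 + 4 * a 1 1)" "c 1 = to_ac (a 0 3 + a 3 0)"
    "c 2 = to_ac (a 0 0 + a 1 3 + a 3 1)" "c 3 = to_ac (a 0 1 + a 1 0)"
    using c123 c0 by (simp_all add: g_def)
  hence "\<forall>j. c j \<in> range to_ac" unfolding all_4 by blast
  thus ?thesis by blast
qed

section \<open>The space of addition laws\<close>

definition law_comb :: "'a::field \<Rightarrow> (4 \<Rightarrow> 'a) \<Rightarrow> 4 \<Rightarrow> 'a bipoly" where
  "law_comb d c i = (\<Sum>j\<in>UNIV. Const (c j) * laws d j i)"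

lemma bihomogeneous_law_comb: "bihomogeneous 2 2 (law_comb d c i)"
  unfolding law_comb_def by (intro bihomogeneous_sum bihomogeneous_Const_mult bihomogeneous_laws)

lemma bi_eval_law_comb: "bi_eval P Q (law_comb d c i) = comb (to_ac d) (\<lambda>j. to_ac (c j)) P Q i"
  unfolding law_comb_def comb_def UNIV_4 by (simp add: bi_eval_laws)

lemma span_laws: "Modules.module.span tuple_scale {law0, law1 d, law2 d, law3 d} = range (law_comb d)"
proof -
  interpret vector_space tuple_scale by (rule vector_space_tuple_scale)
  have "{law0, law1 d, law2 d, law3 d} = range (laws d)"
    unfolding UNIV_4 laws_def by simp
  moreover have "span (range (laws d)) = range (law_comb d)"
  proof
    show "span (range (laws d)) \<subseteq> range (law_comb d)"
    proof (rule span_minimal)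
      show "range (laws d) \<subseteq> range (law_comb d)"
      proof clarify
        fix j
        have e: "laws d j = law_comb d (\<lambda>m. of_bool (m = j))"
        proof
          fix i
          have "law_comb d (\<lambda>m. of_bool (m = j)) i = (\<Sum>m\<in>{j}. laws d m i)"
            unfolding law_comb_def by (rule sum.mono_neutral_cong_right) (auto simp: Const_1)
          thus "laws d j i = law_comb d (\<lambda>m. of_bool (m = j)) i" by simp
        qed
        show "laws d j \<in> range (law_comb d)" unfolding e by (rule rangeI)
      qed
      show "subspace (range (law_comb d))"
        unfolding subspace_def
      proof (intro conjI ballI allI)
        show "0 \<in> range (law_comb d)"
          by (rule image_eqI[of _ _ "\<lambda>_. 0"]) (simp_all add: law_comb_def fun_eq_iff)
        fix x y c assume "x \<in> range (law_comb d)" 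
        then obtain a where x: "x = law_comb d a" by blast
        have e: "tuple_scale c x = law_comb d (\<lambda>j. c * a j)"
          by (simp add: x tuple_scale_def law_comb_def fun_eq_iff Const_mult sum_distrib_left mult.assoc)
        show "tuple_scale c x \<in> range (law_comb d)" unfolding e by (rule rangeI)
        assume "y \<in> range (law_comb d)" 
        then obtain b where y: "y = law_comb d b" by blast
        have e: "x + y = law_comb d (\<lambda>j. a j + b j)"
          by (simp add: x y law_comb_def fun_eq_iff Const_add distrib_right sum.distrib)
        show "x + y \<in> range (law_comb d)" unfolding e by (rule rangeI)
      qed
    qed
    show "range (law_comb d) \<subseteq> span (range (laws d))"
    proof clarify
      fix c
      have "law_comb d c = (\<Sum>j\<in>UNIV. tuple_scale (c j) (laws d j))"
        unfolding fun_eq_iff law_comb_def UNIV_4 tuple_scale_def by simp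
      also have "\<dots> \<in> span (range (laws d))"
        by (intro span_sum span_scale span_base) auto
      finally show "law_comb d c \<in> span (range (laws d))" .
    qed
  qed
  ultimately show ?thesis by simp
qed

lemma product_ideal_diff: "f \<in> product_ideal d \<Longrightarrow> g \<in> product_ideal d \<Longrightarrow> f - g \<in> product_ideal d"
  by (simp add: product_ideal_def)

lemma product_ideal_add: "f \<in> product_ideal d \<Longrightarrow> g \<in> product_ideal d \<Longrightarrow> f + g \<in> product_ideal d"
  by (simp add: product_ideal_def)

lemma law_class_eq:
  assumes "\<And>j. s j - s' j \<in> product_ideal d"
  shows "law_class d s = law_class d s'"
proof -
  have "t - s j \<in> product_ideal d \<longleftrightarrow> t - s' j \<in> product_ideal d" for t j
    using product_ideal_add[OF _ assms[of j], of "t - s j"] product_ideal_diff[OF _ assms[of j], of "t - s' j"] by auto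
  thus ?thesis unfolding law_class_def by simp
qed

lemma smooth_curve_to_ac:
  fixes d :: "'k::field"
  assumes "CHAR('k) \<noteq> 2" "nonsingular (to_ac d)"
  shows "smooth_curve (to_ac d)"
proof -
  have "(2 :: 'k) \<noteq> 0"
  proof
    assume "(2 :: 'k) = 0"
    hence "of_nat 2 = (0 :: 'k)" by simp
    hence dvd: "CHAR('k) dvd 2" by (simp only: of_nat_eq_0_iff_char_dvd)
    have "CHAR('k) \<le> 2" using dvd by (rule dvd_imp_le) simp
    moreover have "CHAR('k) \<noteq> 0" using dvd by (metis dvd_0_left_iff zero_neq_numeral)
    moreover have "CHAR('k) \<noteq> 1" by simp
    ultimately show False using assms(1) by linarith
  qed
  hence "to_ac (2 :: 'k) \<noteq> 0" by (simp only: to_ac_eq_0_iff not_False_eq_True)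
  hence two: "(2 :: 'k alg_closure) \<noteq> 0" by simp
  show ?thesis by unfold_locales (use two nonsingular_imp[OF two assms(2)] in simp_all)
qed

lemma addition_law_congruent_comb:
  fixes d :: "'k::field"
  assumes C: "smooth_curve (to_ac d)" and s: "is_addition_law22 d s"
  obtains c where "\<And>i. s i - law_comb d c i \<in> product_ideal d"
proof -
  interpret smooth_curve "to_ac d" by fact
  have bi: "bihomogeneous 2 2 (s i)" for i using s by (simp add: is_addition_law22_def)
  define S where "S i = Poly_Mapping.map to_ac (s i)" for i
  have S: "mp_eval (case_sum P Q) (S i) = bi_eval P Q (s i)" for P Q i by (simp add: S_def bi_eval_def)
  have bS: "bihomogeneous 2 2 (S i)" for i
  proof -
    have "Poly_Mapping.keys (S i) \<subseteq> Poly_Mapping.keys (s i)"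
      by (auto simp: S_def in_keys_iff map.rep_eq when_def)
    with bi[of i] show ?thesis unfolding bihomogeneous_def by blast
  qed
  have sum: "is_sum (to_ac d) P Q (\<lambda>i. mp_eval (case_sum P Q) (S i))"
    if "P \<in> curve (to_ac d)" "Q \<in> curve (to_ac d)" "(\<lambda>i. mp_eval (case_sum P Q) (S i)) \<noteq> (\<lambda>_. 0)" for P Q
    using s that unfolding S is_addition_law22_def by blast
  obtain c where c: "\<And>P Q i. P \<in> curve (to_ac d) \<Longrightarrow> Q \<in> curve (to_ac d) \<Longrightarrow> bi_eval P Q (s i) = comb (to_ac d) c P Q i"
    using law_eq_comb[of S, OF bS sum] unfolding S by blast
  \<comment> \<open>The constants were found in the algebraic closure; as they lie in the image of
    the base field, their preimages define a combination there.\<close>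
  have "c j = to_ac (of_ac (c j))" for j
    using comb_coefficients_descend[OF C bi c] by (simp add: to_ac_of_ac)
  hence e: "c = (\<lambda>j. to_ac (of_ac (c j)))" by blast
  have "s i - law_comb d (\<lambda>j. of_ac (c j)) i \<in> product_ideal d" for i
    using c unfolding product_ideal_def by (simp add: bi_eval_law_comb e[symmetric])
  thus ?thesis by (rule that)
qed

lemma law_comb_is_addition_law:
  fixes d :: "'k::field"
  assumes C: "smooth_curve (to_ac d)" and nz: "law_comb d c j \<notin> product_ideal d"
  shows "is_addition_law22 d (law_comb d c)"
proof -
  interpret smooth_curve "to_ac d" by fact
  have "is_sum (to_ac d) P Q (\<lambda>j. bi_eval P Q (law_comb d c j))"
    if "P \<in> curve (to_ac d)" "Q \<in> curve (to_ac d)" "\<exists>j. bi_eval P Q (law_comb d c j) \<noteq> 0" for P Q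
    using is_sum_comb[OF that(1,2), of "\<lambda>j. to_ac (c j)"] that(3) unfolding bi_eval_law_comb by metis
  thus ?thesis using nz unfolding is_addition_law22_def by (blast intro: bihomogeneous_law_comb)
qed

theorem theorem15:
  fixes d :: "'k::field"
  assumes "CHAR('k) \<noteq> 2"
    and "nonsingular (to_ac d)"
  shows "addition_law_space22 d =
           law_class d ` Modules.module.span tuple_scale {law0, law1 d, law2 d, law3 d}"
proof -
  have C: "smooth_curve (to_ac d)" by (rule smooth_curve_to_ac[OF assms])
  have zero: "law_comb d (\<lambda>_. 0) = (\<lambda>_. 0)" by (simp add: law_comb_def fun_eq_iff)
  show ?thesis unfolding span_laws addition_law_space22_def
  proof (intro equalityI image_subsetI)
    fix s assume "s \<in> {s. is_addition_law22 d s} \<union> {\<lambda>_. 0}"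
    then consider "is_addition_law22 d s" | "s = (\<lambda>_. 0)" by blast
    thus "law_class d s \<in> law_class d ` range (law_comb d)"
    proof cases
      case 1
      then obtain c where "\<And>i. s i - law_comb d c i \<in> product_ideal d"
        using addition_law_congruent_comb[OF C] by blast
      hence "law_class d s = law_class d (law_comb d c)" by (rule law_class_eq)
      thus ?thesis by blast
    next
      case 2
      thus ?thesis using zero by (metis rangeI image_eqI)
    qed
  next
    fix x assume "x \<in> range (law_comb d)"
    then obtain c where x: "x = law_comb d c" by blast
    show "law_class d x \<in> law_class d ` ({s. is_addition_law22 d s} \<union> {\<lambda>_. 0})"
    proof (cases "\<exists>j. x j \<notin> product_ideal d")
      case True
      hence "is_addition_law22 d x" using law_comb_is_addition_law[OF C] unfolding x by blast
      thus ?thesis by blast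
    next
      case False
      \<comment> \<open>A combination inside the product ideal is no addition law; its class is the
        one of the zero tuple.\<close>
      hence "law_class d x = law_class d (\<lambda>_. 0)" by (intro law_class_eq) simp
      thus ?thesis by blast
    qed
  qed
qed

end
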